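(* Let $\mathcal{D}$ be a $k$-linear, Hom-finite triangulated category with a cluster-tilting object $T$ and a Serre functor, and let $\Lambda=\mathrm{End}^{op}_{\mathcal{D}}(T)$. Let $M_\Lambda=X_\Lambda\oplus U_\Lambda$ be a basic $\tau$-tilting $\Lambda$-module which is the Bongartz completion of $U_\Lambda$, where $X_\Lambda$ is indecomposable, and let $$X_\Lambda\xrightarrow{g_\Lambda}U'_\Lambda\xrightarrow{f_\Lambda}Y_\Lambda\to 0 \qquad (1)$$ be an exact sequence in which $g_\Lambda$ is a minimal left $(\mathrm{add}\,U_\Lambda)$-approximation. Let $M=X\oplus U$ be the basic $T[1]$-cluster tilting object in $\mathcal{D}$ with $\mathrm{Hom}_{\mathcal{D}}(T,X)=X_\Lambda$ and $\mathrm{Hom}_{\mathcal{D}}(T,U)=U_\Lambda$, and let $$X\xrightarrow{g}U_2\xrightarrow{f}Y\xrightarrow{h}X[1] \qquad (2)$$ be a triangle in which $g$ is a minimal left $(\mathrm{add}\,U)$-approximation. Then the exact sequence (1) in $\mathrm{mod}\,\Lambda$ is induced from the triangle (2) in $\mathcal{D}$; that is, applying $\mathrm{Hom}_{\mathcal{D}}(T,-)$ to (2) yields an exact sequence $$\mathrm{Hom}_{\mathcal{D}}(T,X)\to\mathrm{Hom}_{\mathcal{D}}(T,U_2)\to\mathrm{Hom}_{\mathcal{D}}(T,Y)\to 0$$ which coincides (up to isomorphism) with (1).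
   Context: Conventions: $k$ is an algebraically closed field; triangulated categories are Krull-Schmidt, with shift $[1]$. A Serre functor is a $k$-linear equivalence $\mathbb{S}:\mathcal{D}\to\mathcal{D}$ with bifunctorial isomorphisms $\mathrm{Hom}_{\mathcal{D}}(A,B)\simeq \mathrm{Hom}_k(\mathrm{Hom}_{\mathcal{D}}(B,\mathbb{S}A),k)$. For an object $M$, $\mathrm{add}\,M$ is the full subcategory of direct summands of finite direct sums of copies of $M$; $[M](X,Y)$ is the subgroup of $\mathrm{Hom}_{\mathcal{D}}(X,Y)$ of morphisms factoring through $\mathrm{add}\,M$; $|X|$ is the number of non-isomorphic indecomposable direct summands of $X$; basic means that the indecomposable summands are pairwise non-isomorphic. An object $T$ is cluster-tilting if $\mathrm{add}\,T=\{X\mid \mathrm{Hom}_{\mathcal{D}}(T,X[1])=0\}=\{X\mid \mathrm{Hom}_{\mathcal{D}}(X,T[1])=0\}$. An object $X$ is $T[1]$-rigid if $[T[1]](X,X[1])=0$, and $T[1]$-cluster tilting if it is $T[1]$-rigid and $|X|=|T|$. The functor $\mathrm{Hom}_{\mathcal{D}}(T,-)$ induces a bijection between isomorphism classes of basic $T[1]$-cluster tilting objects without non-zero direct summands in $\mathrm{add}\,T[1]$ and isomorphism classes of basic $\tau$-tilting $\Lambda$-modules, so the object $M$ in the claim exists and is unique up to isomorphism. Modules are finitely generated left modules and $\tau$ is the Auslander-Reiten translation of $\mathrm{mod}\,\Lambda$. A module $X$ is $\tau$-rigid if $\mathrm{Hom}_\Lambda(X,\tau X)=0$, and $\tau$-tilting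 if also $|X|=|\Lambda|$. For a functorially finite torsion class $\mathcal{T}$ in $\mathrm{mod}\,\Lambda$, $P(\mathcal{T})$ is the direct sum of one copy of each indecomposable $X\in\mathcal{T}$ with $\mathrm{Ext}^1_\Lambda(X,\mathcal{T})=0$, up to isomorphism. For a basic $\tau$-rigid module $U$, the Bongartz completion of $U$ is $P({}^{\perp}(\tau U))$, where ${}^{\perp}(\tau U)=\{N\in\mathrm{mod}\,\Lambda\mid\mathrm{Hom}_\Lambda(N,\tau U)=0\}$. A left $(\mathrm{add}\,U)$-approximation of $X$ is a morphism $g:X\to U'$ with $U'\in\mathrm{add}\,U$ through which every morphism from $X$ to an object of $\mathrm{add}\,U$ factors; it is minimal if every endomorphism $\varphi$ of $U'$ with $\varphi g=g$ is an isomorphism. *)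

theory Defs
  imports "HOL-Algebra.Module" "HOL-Algebra.AbelCoset" "HOL-Algebra.Algebraic_Closure"
begin

no_notation var (\<open>X\<index>\<close>)  (* X is used as a variable below *)

section \<open>Linear categories\<close>

text \<open>
  Composition and the action of functors on morphisms are not indexed by objects; a category with
  object-indexed operations is turned into one of this form by tagging every morphism with its
  source and target.  Only the additive structure and the scalar multiplication of the records
  \<open>Hom C A B\<close> are meaningful, their fields \<open>mult\<close> and \<open>one\<close> are junk.
\<close>

record ('o, 'm, 'k) lincat =
  Obj :: "'o set"
  Hom :: "'o \<Rightarrow> 'o \<Rightarrow> ('k, 'm) module"
  Cmp :: "'m \<Rightarrow> 'm \<Rightarrow> 'm" (infixr \<open>\<cdot>\<index>\<close> 70)
  Idn :: "'o \<Rightarrow> 'm"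

definition zero_object :: "('o, 'm, 'k, 'z) lincat_scheme \<Rightarrow> 'o \<Rightarrow> bool" where
  "zero_object C X \<longleftrightarrow> X \<in> Obj C \<and> Idn C X = \<zero>\<^bsub>Hom C X X\<^esub>"

definition iso_arrow :: "('o, 'm, 'k, 'z) lincat_scheme \<Rightarrow> 'o \<Rightarrow> 'o \<Rightarrow> 'm \<Rightarrow> bool" where
  "iso_arrow C X Y f \<longleftrightarrow> f \<in> carrier (Hom C X Y) \<and>
     (\<exists>g \<in> carrier (Hom C Y X). g \<cdot>\<^bsub>C\<^esub> f = Idn C X \<and> f \<cdot>\<^bsub>C\<^esub> g = Idn C Y)"

definition isomorphic :: "('o, 'm, 'k, 'z) lincat_scheme \<Rightarrow> 'o \<Rightarrow> 'o \<Rightarrow> bool" where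
  "isomorphic C X Y \<longleftrightarrow> X \<in> Obj C \<and> Y \<in> Obj C \<and> (\<exists>f. iso_arrow C X Y f)"

text \<open>\<open>S\<close> is a direct sum of the objects in the list \<open>Xs\<close>; for \<open>Xs = []\<close> it is a zero object.\<close>

definition direct_sum :: "('o, 'm, 'k, 'z) lincat_scheme \<Rightarrow> 'o \<Rightarrow> 'o list \<Rightarrow> bool" where
  "direct_sum C S Xs \<longleftrightarrow> S \<in> Obj C \<and> set Xs \<subseteq> Obj C \<and>
     (\<exists>inc prj.
        (\<forall>i < length Xs. inc i \<in> carrier (Hom C (Xs ! i) S) \<and> prj i \<in> carrier (Hom C S (Xs ! i))) \<and>
        (\<forall>i < length Xs. \<forall>j < length Xs.
           prj j \<cdot>\<^bsub>C\<^esub> inc i = (if i = j then Idn C (Xs ! i) else \<zero>\<^bsub>Hom C (Xs ! i) (Xs ! j)\<^esub>)) \<and>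
        finsum (Hom C S S) (\<lambda>i. inc i \<cdot>\<^bsub>C\<^esub> prj i) {..<length Xs} = Idn C S)"

definition summand :: "('o, 'm, 'k, 'z) lincat_scheme \<Rightarrow> 'o \<Rightarrow> 'o \<Rightarrow> bool" where
  "summand C Z X \<longleftrightarrow> (\<exists>Z'. direct_sum C X [Z, Z'])"

definition add_closure :: "('o, 'm, 'k, 'z) lincat_scheme \<Rightarrow> 'o \<Rightarrow> 'o set" where
  "add_closure C M = {Z. \<exists>n S. direct_sum C S (replicate n M) \<and> summand C Z S}"

definition indecomposable :: "('o, 'm, 'k, 'z) lincat_scheme \<Rightarrow> 'o \<Rightarrow> bool" where
  "indecomposable C X \<longleftrightarrow> X \<in> Obj C \<and> \<not> zero_object C X \<and>
     (\<forall>A B. direct_sum C X [A, B] \<longrightarrow> zero_object C A \<or> zero_object C B)"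

definition basic :: "('o, 'm, 'k, 'z) lincat_scheme \<Rightarrow> 'o \<Rightarrow> bool" where
  "basic C X \<longleftrightarrow> (\<exists>Xs. direct_sum C X Xs \<and> (\<forall>Y \<in> set Xs. indecomposable C Y) \<and>
     (\<forall>i < length Xs. \<forall>j < length Xs. i \<noteq> j \<longrightarrow> \<not> isomorphic C (Xs ! i) (Xs ! j)))"

text \<open>The number \<open>|X|\<close> of isomorphism classes of indecomposable direct summands of \<open>X\<close>.\<close>

definition num_indec :: "('o, 'm, 'k, 'z) lincat_scheme \<Rightarrow> 'o \<Rightarrow> nat" where
  "num_indec C X =
     card ((\<lambda>Y. {Z. isomorphic C Y Z}) ` {Y. indecomposable C Y \<and> summand C Y X})"

definition left_approx :: "('o, 'm, 'k, 'z) lincat_scheme \<Rightarrow> 'o \<Rightarrow> 'o \<Rightarrow> 'o \<Rightarrow> 'm \<Rightarrow> bool" where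
  "left_approx C U X U' g \<longleftrightarrow> X \<in> Obj C \<and> U' \<in> add_closure C U \<and> g \<in> carrier (Hom C X U') \<and>
     (\<forall>V \<in> add_closure C U. \<forall>t \<in> carrier (Hom C X V). \<exists>s \<in> carrier (Hom C U' V). t = s \<cdot>\<^bsub>C\<^esub> g)"

definition minimal_left_approx ::
    "('o, 'm, 'k, 'z) lincat_scheme \<Rightarrow> 'o \<Rightarrow> 'o \<Rightarrow> 'o \<Rightarrow> 'm \<Rightarrow> bool" where
  "minimal_left_approx C U X U' g \<longleftrightarrow> left_approx C U X U' g \<and>
     (\<forall>\<phi> \<in> carrier (Hom C U' U'). \<phi> \<cdot>\<^bsub>C\<^esub> g = g \<longrightarrow> iso_arrow C U' U' \<phi>)"

definition factor_ideal :: "('o, 'm, 'k, 'z) lincat_scheme \<Rightarrow> 'o \<Rightarrow> 'o \<Rightarrow> 'o \<Rightarrow> 'm set" where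
  "factor_ideal C M X Y =
     {b \<cdot>\<^bsub>C\<^esub> a | a b. \<exists>Z \<in> add_closure C M. a \<in> carrier (Hom C X Z) \<and> b \<in> carrier (Hom C Z Y)}"

definition linear_functor ::
    "('o, 'm, 'k, 'z) lincat_scheme \<Rightarrow> ('p, 'n, 'k, 'y) lincat_scheme \<Rightarrow>
     'k set \<Rightarrow> ('o \<Rightarrow> 'p) \<Rightarrow> ('m \<Rightarrow> 'n) \<Rightarrow> bool" where
  "linear_functor C C' k F Fm \<longleftrightarrow>
     (\<forall>A \<in> Obj C. F A \<in> Obj C' \<and> Fm (Idn C A) = Idn C' (F A)) \<and>
     (\<forall>A \<in> Obj C. \<forall>B \<in> Obj C. \<forall>f \<in> carrier (Hom C A B).
        Fm f \<in> carrier (Hom C' (F A) (F B)) \<and>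
        (\<forall>g \<in> carrier (Hom C A B).
           Fm (f \<oplus>\<^bsub>Hom C A B\<^esub> g) = Fm f \<oplus>\<^bsub>Hom C' (F A) (F B)\<^esub> Fm g) \<and>
        (\<forall>c \<in> k. Fm (c \<odot>\<^bsub>Hom C A B\<^esub> f) = c \<odot>\<^bsub>Hom C' (F A) (F B)\<^esub> Fm f)) \<and>
     (\<forall>A \<in> Obj C. \<forall>B \<in> Obj C. \<forall>E \<in> Obj C.
        \<forall>f \<in> carrier (Hom C A B). \<forall>g \<in> carrier (Hom C B E). Fm (g \<cdot>\<^bsub>C\<^esub> f) = Fm g \<cdot>\<^bsub>C'\<^esub> Fm f)"

definition linear_equivalence ::
    "('o, 'm, 'k, 'z) lincat_scheme \<Rightarrow> ('p, 'n, 'k, 'y) lincat_scheme \<Rightarrow>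
     'k set \<Rightarrow> ('o \<Rightarrow> 'p) \<Rightarrow> ('m \<Rightarrow> 'n) \<Rightarrow> bool" where
  "linear_equivalence C C' k F Fm \<longleftrightarrow> linear_functor C C' k F Fm \<and>
     (\<forall>A \<in> Obj C. \<forall>B \<in> Obj C.
        bij_betw Fm (carrier (Hom C A B)) (carrier (Hom C' (F A) (F B)))) \<and>
     (\<forall>B \<in> Obj C'. \<exists>A \<in> Obj C. isomorphic C' (F A) B)"

locale linear_category =
  fixes K :: "('k, 'r) ring_scheme"
    and C :: "('o, 'm, 'k, 'z) lincat_scheme" (structure)
  assumes field_K: "field K"
    and hom_module: "\<lbrakk>A \<in> Obj C; B \<in> Obj C\<rbrakk> \<Longrightarrow> module K (Hom C A B)"
    and cmp_closed: "\<lbrakk>A \<in> Obj C; B \<in> Obj C; E \<in> Obj C;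
          f \<in> carrier (Hom C A B); g \<in> carrier (Hom C B E)\<rbrakk> \<Longrightarrow> g \<cdot> f \<in> carrier (Hom C A E)"
    and cmp_assoc: "\<lbrakk>A \<in> Obj C; B \<in> Obj C; E \<in> Obj C; F \<in> Obj C;
          f \<in> carrier (Hom C A B); g \<in> carrier (Hom C B E); h \<in> carrier (Hom C E F)\<rbrakk>
          \<Longrightarrow> h \<cdot> (g \<cdot> f) = (h \<cdot> g) \<cdot> f"
    and idn_closed: "A \<in> Obj C \<Longrightarrow> Idn C A \<in> carrier (Hom C A A)"
    and cmp_idn_right: "\<lbrakk>A \<in> Obj C; B \<in> Obj C; f \<in> carrier (Hom C A B)\<rbrakk> \<Longrightarrow> f \<cdot> Idn C A = f"
    and cmp_idn_left: "\<lbrakk>A \<in> Obj C; B \<in> Obj C; f \<in> carrier (Hom C A B)\<rbrakk> \<Longrightarrow> Idn C B \<cdot> f = f"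
    and cmp_add_right: "\<lbrakk>A \<in> Obj C; B \<in> Obj C; E \<in> Obj C;
          f \<in> carrier (Hom C A B); f' \<in> carrier (Hom C A B); g \<in> carrier (Hom C B E)\<rbrakk>
          \<Longrightarrow> g \<cdot> (f \<oplus>\<^bsub>Hom C A B\<^esub> f') = (g \<cdot> f) \<oplus>\<^bsub>Hom C A E\<^esub> (g \<cdot> f')"
    and cmp_add_left: "\<lbrakk>A \<in> Obj C; B \<in> Obj C; E \<in> Obj C;
          f \<in> carrier (Hom C A B); g \<in> carrier (Hom C B E); g' \<in> carrier (Hom C B E)\<rbrakk>
          \<Longrightarrow> (g \<oplus>\<^bsub>Hom C B E\<^esub> g') \<cdot> f = (g \<cdot> f) \<oplus>\<^bsub>Hom C A E\<^esub> (g' \<cdot> f)"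
    and cmp_smult_right: "\<lbrakk>A \<in> Obj C; B \<in> Obj C; E \<in> Obj C; c \<in> carrier K;
          f \<in> carrier (Hom C A B); g \<in> carrier (Hom C B E)\<rbrakk>
          \<Longrightarrow> g \<cdot> (c \<odot>\<^bsub>Hom C A B\<^esub> f) = c \<odot>\<^bsub>Hom C A E\<^esub> (g \<cdot> f)"
    and cmp_smult_left: "\<lbrakk>A \<in> Obj C; B \<in> Obj C; E \<in> Obj C; c \<in> carrier K;
          f \<in> carrier (Hom C A B); g \<in> carrier (Hom C B E)\<rbrakk>
          \<Longrightarrow> (c \<odot>\<^bsub>Hom C B E\<^esub> g) \<cdot> f = c \<odot>\<^bsub>Hom C A E\<^esub> (g \<cdot> f)"

locale additive_category = linear_category +
  assumes ex_zero_object: "\<exists>Z. zero_object C Z"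
    and ex_direct_sum: "\<lbrakk>A \<in> Obj C; B \<in> Obj C\<rbrakk> \<Longrightarrow> \<exists>S. direct_sum C S [A, B]"

definition local_ring :: "('a, 'b) ring_scheme \<Rightarrow> bool" where
  "local_ring R \<longleftrightarrow> ring R \<and> \<one>\<^bsub>R\<^esub> \<noteq> \<zero>\<^bsub>R\<^esub> \<and>
     (\<forall>a \<in> carrier R - Units R. \<forall>b \<in> carrier R - Units R. a \<oplus>\<^bsub>R\<^esub> b \<notin> Units R)"

definition endo_ring :: "('o, 'm, 'k, 'z) lincat_scheme \<Rightarrow> 'o \<Rightarrow> ('k, 'm) module" where
  "endo_ring C X = (Hom C X X)\<lparr>monoid.mult := (\<lambda>a b. a \<cdot>\<^bsub>C\<^esub> b), one := Idn C X\<rparr>"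

definition krull_schmidt :: "('o, 'm, 'k, 'z) lincat_scheme \<Rightarrow> bool" where
  "krull_schmidt C \<longleftrightarrow>
     (\<forall>X \<in> Obj C. \<exists>Xs. direct_sum C X Xs \<and> (\<forall>Y \<in> set Xs. local_ring (endo_ring C Y)))"


section \<open>Triangulated categories\<close>

text \<open>
  The shift is an autoequivalence \<open>(Sh, ShM)\<close>, not necessarily an automorphism;
  \<open>Tri D X Y Z f g h\<close> says that \<open>X \<rightarrow> Y \<rightarrow> Z \<rightarrow> X[1]\<close> with maps \<open>f\<close>, \<open>g\<close>, \<open>h\<close> is a triangle.
\<close>

record ('o, 'm, 'k) tricat = "('o, 'm, 'k) lincat" +
  Sh :: "'o \<Rightarrow> 'o"
  ShM :: "'m \<Rightarrow> 'm"
  Tri :: "'o \<Rightarrow> 'o \<Rightarrow> 'o \<Rightarrow> 'm \<Rightarrow> 'm \<Rightarrow> 'm \<Rightarrow> bool"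

definition pre_triangle ::
    "('o, 'm, 'k, 'z) tricat_scheme \<Rightarrow> 'o \<Rightarrow> 'o \<Rightarrow> 'o \<Rightarrow> 'm \<Rightarrow> 'm \<Rightarrow> 'm \<Rightarrow> bool" where
  "pre_triangle D X Y Z f g h \<longleftrightarrow> X \<in> Obj D \<and> Y \<in> Obj D \<and> Z \<in> Obj D \<and>
     f \<in> carrier (Hom D X Y) \<and> g \<in> carrier (Hom D Y Z) \<and> h \<in> carrier (Hom D Z (Sh D X))"

locale triangulated_category = additive_category K D
  for K :: "('k, 'r) ring_scheme"
    and D :: "('o, 'm, 'k, 'z) tricat_scheme" (structure) +
  assumes shift: "linear_equivalence D D (carrier K) (Sh D) (ShM D)"
    and tri_typed: "Tri D X Y Z f g h \<Longrightarrow> pre_triangle D X Y Z f g h"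
    and TR1_iso: "\<lbrakk>Tri D X Y Z f g h; pre_triangle D X' Y' Z' f' g' h';
          iso_arrow D X X' a; iso_arrow D Y Y' b; iso_arrow D Z Z' c;
          b \<cdot> f = f' \<cdot> a; c \<cdot> g = g' \<cdot> b; ShM D a \<cdot> h = h' \<cdot> c\<rbrakk>
          \<Longrightarrow> Tri D X' Y' Z' f' g' h'"
    and TR1_idn: "\<lbrakk>X \<in> Obj D; zero_object D Z\<rbrakk>
          \<Longrightarrow> Tri D X X Z (Idn D X) \<zero>\<^bsub>Hom D X Z\<^esub> \<zero>\<^bsub>Hom D Z (Sh D X)\<^esub>"
    and TR1_cone: "\<lbrakk>X \<in> Obj D; Y \<in> Obj D; f \<in> carrier (Hom D X Y)\<rbrakk>
          \<Longrightarrow> \<exists>Z g h. Tri D X Y Z f g h"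
    and TR2: "pre_triangle D X Y Z f g h
          \<Longrightarrow> Tri D X Y Z f g h \<longleftrightarrow>
              Tri D Y Z (Sh D X) g h (\<ominus>\<^bsub>Hom D (Sh D X) (Sh D Y)\<^esub> ShM D f)"
    and TR3: "\<lbrakk>Tri D X Y Z f g h; Tri D X' Y' Z' f' g' h';
          a \<in> carrier (Hom D X X'); b \<in> carrier (Hom D Y Y'); b \<cdot> f = f' \<cdot> a\<rbrakk>
          \<Longrightarrow> \<exists>c \<in> carrier (Hom D Z Z'). c \<cdot> g = g' \<cdot> b \<and> ShM D a \<cdot> h = h' \<cdot> c"
    and TR4: "\<lbrakk>Tri D X Y Z' f i j; Tri D Y Z X' g p q; Tri D X Z Y' (g \<cdot> f) m n\<rbrakk>
          \<Longrightarrow> \<exists>u v. Tri D Z' Y' X' u v (ShM D i \<cdot> q) \<and>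
                u \<cdot> i = m \<cdot> g \<and> n \<cdot> u = j \<and> v \<cdot> m = p \<and> q \<cdot> v = ShM D f \<cdot> n"


section \<open>Modules\<close>

text \<open>
  The library locale \<^locale>\<open>module\<close> is for commutative rings only.  Right modules are also
  represented by records of type \<open>module\<close>, where \<open>a \<odot> x\<close> stands for \<open>x a\<close>.
\<close>

locale left_module = R?: ring R + M?: abelian_group M
  for R :: "('a, 'r) ring_scheme" (structure) and M :: "('a, 'v, 's) module_scheme" (structure) +
  assumes smult_closed: "\<lbrakk>a \<in> carrier R; x \<in> carrier M\<rbrakk> \<Longrightarrow> a \<odot>\<^bsub>M\<^esub> x \<in> carrier M"
    and smult_l_distr: "\<lbrakk>a \<in> carrier R; b \<in> carrier R; x \<in> carrier M\<rbrakk>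
          \<Longrightarrow> (a \<oplus>\<^bsub>R\<^esub> b) \<odot>\<^bsub>M\<^esub> x = (a \<odot>\<^bsub>M\<^esub> x) \<oplus>\<^bsub>M\<^esub> (b \<odot>\<^bsub>M\<^esub> x)"
    and smult_r_distr: "\<lbrakk>a \<in> carrier R; x \<in> carrier M; y \<in> carrier M\<rbrakk>
          \<Longrightarrow> a \<odot>\<^bsub>M\<^esub> (x \<oplus>\<^bsub>M\<^esub> y) = (a \<odot>\<^bsub>M\<^esub> x) \<oplus>\<^bsub>M\<^esub> (a \<odot>\<^bsub>M\<^esub> y)"
    and smult_assoc: "\<lbrakk>a \<in> carrier R; b \<in> carrier R; x \<in> carrier M\<rbrakk>
          \<Longrightarrow> (a \<otimes>\<^bsub>R\<^esub> b) \<odot>\<^bsub>M\<^esub> x = a \<odot>\<^bsub>M\<^esub> (b \<odot>\<^bsub>M\<^esub> x)"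
    and smult_one: "x \<in> carrier M \<Longrightarrow> \<one>\<^bsub>R\<^esub> \<odot>\<^bsub>M\<^esub> x = x"

definition fin_gen :: "('a, 'r) ring_scheme \<Rightarrow> ('a, 'v) module \<Rightarrow> bool" where
  "fin_gen R M \<longleftrightarrow> (\<exists>S. finite S \<and> S \<subseteq> carrier M \<and>
     (\<forall>L. submodule L R M \<and> S \<subseteq> L \<longrightarrow> L = carrier M))"

text \<open>
  Linear maps are normalised to be zero outside the source.  Unlike \<^const>\<open>extensional\<close>
  functions, these are closed under plain composition and pointwise operations.
\<close>

definition lin_maps ::
    "('a, 'r) ring_scheme \<Rightarrow> ('a, 'v) module \<Rightarrow> ('a, 'w) module \<Rightarrow> ('v \<Rightarrow> 'w) set" where
  "lin_maps R M N = {f.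
     (\<forall>x \<in> carrier M. f x \<in> carrier N) \<and>
     (\<forall>x \<in> carrier M. \<forall>y \<in> carrier M. f (x \<oplus>\<^bsub>M\<^esub> y) = f x \<oplus>\<^bsub>N\<^esub> f y) \<and>
     (\<forall>a \<in> carrier R. \<forall>x \<in> carrier M. f (a \<odot>\<^bsub>M\<^esub> x) = a \<odot>\<^bsub>N\<^esub> f x) \<and>
     (\<forall>x. x \<notin> carrier M \<longrightarrow> f x = \<zero>\<^bsub>N\<^esub>)}"

definition map_module ::
    "('a, 'r) ring_scheme \<Rightarrow> ('a, 'v) module \<Rightarrow> ('a, 'w) module \<Rightarrow>
     ('b \<Rightarrow> ('v \<Rightarrow> 'w) \<Rightarrow> 'v \<Rightarrow> 'w) \<Rightarrow> ('b, 'v \<Rightarrow> 'w) module" where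
  "map_module R M N s = \<lparr>carrier = lin_maps R M N, monoid.mult = undefined, one = undefined,
     zero = (\<lambda>_. \<zero>\<^bsub>N\<^esub>), add = (\<lambda>f g x. f x \<oplus>\<^bsub>N\<^esub> g x), smult = s\<rparr>"

definition regular_module :: "('a, 'r) ring_scheme \<Rightarrow> ('a, 'a) module" where
  "regular_module R = \<lparr>carrier = carrier R, monoid.mult = monoid.mult R, one = \<one>\<^bsub>R\<^esub>,
     zero = \<zero>\<^bsub>R\<^esub>, add = add R, smult = monoid.mult R\<rparr>"

text \<open>
  The category of finitely generated left modules over a \<open>k\<close>-algebra \<open>L\<close>, whose scalar
  multiplication is that of \<open>k\<close>; \<open>k\<close> acts on an \<open>L\<close>-module through \<open>c \<mapsto> c 1\<close>.
  The elements of the modules are drawn from a fixed type \<open>'v\<close>.  In the theorem, \<open>'v\<close> is the type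
  of morphisms of the triangulated category; this loses no modules up to isomorphism, because there
  every finitely generated module is isomorphic to some \<open>Hom(T,Z)\<close>, whose carrier is a subset
  of that type.
\<close>

definition mod_cat :: "('k, 'a) module \<Rightarrow> (('a, 'v) module, 'v \<Rightarrow> 'v, 'k) lincat" where
  "mod_cat L = \<lparr>
     Obj = {M. left_module L M \<and> fin_gen L M},
     Hom = (\<lambda>M N. map_module L M N (\<lambda>c f x. (c \<odot>\<^bsub>L\<^esub> \<one>\<^bsub>L\<^esub>) \<odot>\<^bsub>N\<^esub> f x)),
     Cmp = (\<lambda>g f. g \<circ> f),
     Idn = (\<lambda>M x. if x \<in> carrier M then x else \<zero>\<^bsub>M\<^esub>)\<rparr>"

definition right_exact ::
    "('a, 'r) ring_scheme \<Rightarrow> ('a, 'v) module \<Rightarrow> ('a, 'w) module \<Rightarrow> ('a, 'x) module \<Rightarrow>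
     ('v \<Rightarrow> 'w) \<Rightarrow> ('w \<Rightarrow> 'x) \<Rightarrow> bool" where
  "right_exact R M N P f g \<longleftrightarrow> f \<in> lin_maps R M N \<and> g \<in> lin_maps R N P \<and>
     f ` carrier M = a_kernel N P g \<and> g ` carrier N = carrier P"


subsection \<open>The Auslander-Reiten translation\<close>

definition projective :: "('k, 'a) module \<Rightarrow> ('a, 'v) module \<Rightarrow> bool" where
  "projective L P \<longleftrightarrow> P \<in> Obj (mod_cat L) \<and>
     (\<forall>(M :: ('a, 'v) module) \<in> Obj (mod_cat L). \<forall>(N :: ('a, 'v) module) \<in> Obj (mod_cat L).
        \<forall>p \<in> lin_maps L M N. \<forall>f \<in> lin_maps L P N.
          p ` carrier M = carrier N \<longrightarrow> (\<exists>h \<in> lin_maps L P M. p \<circ> h = f))"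

text \<open>
  \<open>P1 \<rightarrow> P0 \<rightarrow> X \<rightarrow> 0\<close> is exact, and \<open>P0 \<rightarrow> X\<close> and \<open>P1 \<rightarrow> ker p0\<close> are projective covers
  (no proper submodule of the source has the same image).
\<close>

definition minimal_presentation ::
    "('k, 'a) module \<Rightarrow> ('a, 'v) module \<Rightarrow> ('a, 'v) module \<Rightarrow> ('a, 'v) module \<Rightarrow>
     ('v \<Rightarrow> 'v) \<Rightarrow> ('v \<Rightarrow> 'v) \<Rightarrow> bool" where
  "minimal_presentation L X P1 P0 p1 p0 \<longleftrightarrow>
     projective L P1 \<and> projective L P0 \<and> right_exact L P1 P0 X p1 p0 \<and>
     (\<forall>S. submodule S L P0 \<and> p0 ` S = p0 ` carrier P0 \<longrightarrow> S = carrier P0) \<and>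
     (\<forall>S. submodule S L P1 \<and> p1 ` S = p1 ` carrier P1 \<longrightarrow> S = carrier P1)"

text \<open>The right \<open>L\<close>-module \<open>Hom\<^sub>L(P, L)\<close>.\<close>

definition star_module :: "('k, 'a) module \<Rightarrow> ('a, 'v) module \<Rightarrow> ('a, 'v \<Rightarrow> 'a) module" where
  "star_module L P = map_module L P (regular_module L) (\<lambda>a f x. f x \<otimes>\<^bsub>L\<^esub> a)"

definition quotient_module :: "('a, 'v) module \<Rightarrow> 'v set \<Rightarrow> ('a, 'v set) module" where
  "quotient_module M I = \<lparr>carrier = a_rcosets\<^bsub>M\<^esub> I, monoid.mult = undefined, one = undefined,
     zero = I, add = set_add M, smult = (\<lambda>a A. \<Union>x \<in> A. I +>\<^bsub>M\<^esub> (a \<odot>\<^bsub>M\<^esub> x))\<rparr>"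

text \<open>The transpose \<open>Tr X = coker (Hom(p1, L) : Hom(P0, L) \<rightarrow> Hom(P1, L))\<close>, a right module.\<close>

definition transpose_module ::
    "('k, 'a) module \<Rightarrow> ('a, 'v) module \<Rightarrow> ('a, ('v \<Rightarrow> 'a) set) module" where
  "transpose_module L X =
     (let (P1, P0, p1, p0) =
        (SOME (P1 :: ('a, 'v) module, P0 :: ('a, 'v) module, p1, p0).
           minimal_presentation L X P1 P0 p1 p0)
      in quotient_module (star_module L P1) ((\<lambda>\<phi>. \<phi> \<circ> p1) ` carrier (star_module L P0)))"

text \<open>The left \<open>L\<close>-module \<open>Hom\<^sub>k(M, k)\<close> for a right \<open>L\<close>-module \<open>M\<close>: \<open>(a \<phi>)(x) = \<phi>(x a)\<close>.\<close>

definition dual_module ::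
    "('k, 'r) ring_scheme \<Rightarrow> ('k, 'a) module \<Rightarrow> ('a, 'v) module \<Rightarrow> ('a, 'v \<Rightarrow> 'k) module" where
  "dual_module K L M =
     map_module K
       \<lparr>carrier = carrier M, monoid.mult = monoid.mult M, one = one M, zero = zero M, add = add M,
        smult = (\<lambda>c x. (c \<odot>\<^bsub>L\<^esub> \<one>\<^bsub>L\<^esub>) \<odot>\<^bsub>M\<^esub> x)\<rparr>
       (regular_module K)
       (\<lambda>a \<phi> x. if x \<in> carrier M then \<phi> (a \<odot>\<^bsub>M\<^esub> x) else \<zero>\<^bsub>K\<^esub>)"

definition AR_translate ::
    "('k, 'r) ring_scheme \<Rightarrow> ('k, 'a) module \<Rightarrow> ('a, 'v) module \<Rightarrow>
     ('a, ('v \<Rightarrow> 'a) set \<Rightarrow> 'k) module" where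
  "AR_translate K L X = dual_module K L (transpose_module L X)"


subsection \<open>\<open>\<tau>\<close>-tilting modules and Bongartz completions\<close>

definition tau_perp ::
    "('k, 'r) ring_scheme \<Rightarrow> ('k, 'a) module \<Rightarrow> ('a, 'v) module \<Rightarrow> ('a, 'v) module set" where
  "tau_perp K L U = {N \<in> Obj (mod_cat L).
     lin_maps L N (AR_translate K L U) = {\<lambda>_. \<zero>\<^bsub>AR_translate K L U\<^esub>}}"

definition tau_rigid ::
    "('k, 'r) ring_scheme \<Rightarrow> ('k, 'a) module \<Rightarrow> ('a, 'v) module \<Rightarrow> bool" where
  "tau_rigid K L X \<longleftrightarrow> X \<in> tau_perp K L X"

definition tau_tilting ::
    "('k, 'r) ring_scheme \<Rightarrow> ('k, 'a) module \<Rightarrow> ('a, 'a) module \<Rightarrow> bool" where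
  "tau_tilting K L X \<longleftrightarrow> tau_rigid K L X \<and>
     num_indec (mod_cat L) X = num_indec (mod_cat L) (regular_module L)"

text \<open>
  \<open>Ext\<^sup>1(X, N) = 0\<close> in the sense of Yoneda: every extension \<open>0 \<rightarrow> N \<rightarrow> E \<rightarrow> X \<rightarrow> 0\<close> is equivalent to
  the split one.
\<close>

definition Ext1_vanishes :: "('k, 'a) module \<Rightarrow> ('a, 'v) module \<Rightarrow> ('a, 'v) module \<Rightarrow> bool" where
  "Ext1_vanishes L X N \<longleftrightarrow>
     (\<forall>(E :: ('a, 'v) module) \<in> Obj (mod_cat L). \<forall>i p.
        inj_on i (carrier N) \<and> right_exact L N E X i p \<longrightarrow>
        (\<exists>s \<in> lin_maps L X E. \<forall>x \<in> carrier X. p (s x) = x))"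

definition indec_ext_projective ::
    "('k, 'a) module \<Rightarrow> ('a, 'v) module set \<Rightarrow> ('a, 'v) module \<Rightarrow> bool" where
  "indec_ext_projective L TT X \<longleftrightarrow>
     indecomposable (mod_cat L) X \<and> X \<in> TT \<and> (\<forall>N \<in> TT. Ext1_vanishes L X N)"

text \<open>\<open>is_P L TT M\<close> says \<open>M \<cong> P(TT)\<close>.\<close>

definition is_P :: "('k, 'a) module \<Rightarrow> ('a, 'v) module set \<Rightarrow> ('a, 'v) module \<Rightarrow> bool" where
  "is_P L TT M \<longleftrightarrow> (\<exists>Xs. direct_sum (mod_cat L) M Xs \<and>
     (\<forall>X \<in> set Xs. indec_ext_projective L TT X) \<and>
     (\<forall>Z. indec_ext_projective L TT Z \<longrightarrow>
        (\<exists>!i. i < length Xs \<and> isomorphic (mod_cat L) Z (Xs ! i))))"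

definition bongartz_completion ::
    "('k, 'r) ring_scheme \<Rightarrow> ('k, 'a) module \<Rightarrow> ('a, 'v) module \<Rightarrow> ('a, 'v) module \<Rightarrow> bool" where
  "bongartz_completion K L U M \<longleftrightarrow>
     basic (mod_cat L) U \<and> tau_rigid K L U \<and> is_P L (tau_perp K L U) M"


section \<open>Serre functors and relative cluster tilting\<close>

definition hom_finite ::
    "('k, 'r) ring_scheme \<Rightarrow> ('o, 'm, 'k, 'z) lincat_scheme \<Rightarrow> bool" where
  "hom_finite K C \<longleftrightarrow> (\<forall>A \<in> Obj C. \<forall>B \<in> Obj C. fin_gen K (Hom C A B))"

definition dual_space :: "('k, 'r) ring_scheme \<Rightarrow> ('k, 'v) module \<Rightarrow> ('k, 'v \<Rightarrow> 'k) module" where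
  "dual_space K V = map_module K V (regular_module K) (\<lambda>c \<phi> x. c \<otimes>\<^bsub>K\<^esub> \<phi> x)"

definition serre_functor ::
    "('k, 'r) ring_scheme \<Rightarrow> ('o, 'm, 'k, 'z) lincat_scheme \<Rightarrow> ('o \<Rightarrow> 'o) \<Rightarrow> ('m \<Rightarrow> 'm) \<Rightarrow> bool"
  where
  "serre_functor K C S Sm \<longleftrightarrow> linear_equivalence C C (carrier K) S Sm \<and>
     (\<exists>\<eta>.
       (\<forall>A \<in> Obj C. \<forall>B \<in> Obj C.
          \<eta> A B \<in> lin_maps K (Hom C A B) (dual_space K (Hom C B (S A))) \<and>
          bij_betw (\<eta> A B) (carrier (Hom C A B)) (carrier (dual_space K (Hom C B (S A))))) \<and>
       (\<forall>A \<in> Obj C. \<forall>A' \<in> Obj C. \<forall>B \<in> Obj C. \<forall>B' \<in> Obj C.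
          \<forall>a \<in> carrier (Hom C A' A). \<forall>f \<in> carrier (Hom C A B). \<forall>b \<in> carrier (Hom C B B').
          \<forall>u \<in> carrier (Hom C B' (S A')).
            \<eta> A' B' (b \<cdot>\<^bsub>C\<^esub> f \<cdot>\<^bsub>C\<^esub> a) u = \<eta> A B f (Sm a \<cdot>\<^bsub>C\<^esub> u \<cdot>\<^bsub>C\<^esub> b)))"

definition cluster_tilting :: "('o, 'm, 'k, 'z) tricat_scheme \<Rightarrow> 'o \<Rightarrow> bool" where
  "cluster_tilting D T \<longleftrightarrow> T \<in> Obj D \<and>
     add_closure D T =
       {X \<in> Obj D. carrier (Hom D T (Sh D X)) = {\<zero>\<^bsub>Hom D T (Sh D X)\<^esub>}} \<and>
     add_closure D T =
       {X \<in> Obj D. carrier (Hom D X (Sh D T)) = {\<zero>\<^bsub>Hom D X (Sh D T)\<^esub>}}"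

definition rel_rigid :: "('o, 'm, 'k, 'z) tricat_scheme \<Rightarrow> 'o \<Rightarrow> 'o \<Rightarrow> bool" where
  "rel_rigid D T X \<longleftrightarrow> X \<in> Obj D \<and>
     factor_ideal D (Sh D T) X (Sh D X) = {\<zero>\<^bsub>Hom D X (Sh D X)\<^esub>}"

definition rel_cluster_tilting :: "('o, 'm, 'k, 'z) tricat_scheme \<Rightarrow> 'o \<Rightarrow> 'o \<Rightarrow> bool" where
  "rel_cluster_tilting D T X \<longleftrightarrow> rel_rigid D T X \<and> num_indec D X = num_indec D T"

text \<open>The algebra \<open>End\<^sup>o\<^sup>p(T)\<close> and the functor \<open>Hom(T, -)\<close> to its left modules.\<close>

definition endo_op_algebra :: "('o, 'm, 'k, 'z) lincat_scheme \<Rightarrow> 'o \<Rightarrow> ('k, 'm) module" where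
  "endo_op_algebra C T = (Hom C T T)\<lparr>monoid.mult := (\<lambda>a b. b \<cdot>\<^bsub>C\<^esub> a), one := Idn C T\<rparr>"

definition hom_functor :: "('o, 'm, 'k, 'z) lincat_scheme \<Rightarrow> 'o \<Rightarrow> 'o \<Rightarrow> ('m, 'm) module" where
  "hom_functor C T X = \<lparr>carrier = carrier (Hom C T X), monoid.mult = undefined, one = undefined,
     zero = \<zero>\<^bsub>Hom C T X\<^esub>, add = add (Hom C T X), smult = (\<lambda>a x. x \<cdot>\<^bsub>C\<^esub> a)\<rparr>"

definition hom_functor_map ::
    "('o, 'm, 'k, 'z) lincat_scheme \<Rightarrow> 'o \<Rightarrow> 'o \<Rightarrow> 'o \<Rightarrow> 'm \<Rightarrow> 'm \<Rightarrow> 'm" where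
  "hom_functor_map C T X Y f =
     (\<lambda>x. if x \<in> carrier (Hom C T X) then f \<cdot>\<^bsub>C\<^esub> x else \<zero>\<^bsub>Hom C T Y\<^esub>)"

end

theory Submission
  imports Defs
begin

text \<open>
  Write \<open>F = Hom(T, -)\<close>; it is full and kills exactly the morphisms factoring through \<open>add T[1]\<close>
  (the ghosts).  Everything follows from one claim: every morphism \<open>X \<rightarrow> V[1]\<close> with \<open>V \<in> add T\<close> factors
  through \<open>g\<close>.  By Serre duality the claim says that \<open>F h = 0\<close>, which makes \<open>F\<close> of the triangle right
  exact; it also allows an endomorphism of \<open>U\<^sub>2\<close> fixing \<open>g\<close> up to ghosts to be corrected to one fixing
  \<open>g\<close>, so \<open>F g\<close> is again a minimal left approximation, and these are unique up to isomorphism.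

  For the claim, let \<open>B\<close> be the cocone of a right \<open>(add U)\<close>-approximation \<open>S \<rightarrow> T[1]\<close>.  Rigidity of \<open>U\<close>
  puts \<open>F B\<close> into the torsion class of \<open>\<tau> U\<^sub>\<Lambda>\<close>.  A morphism \<open>X \<rightarrow> T[1]\<close> composed with \<open>T[1] \<rightarrow> B[1]\<close>
  gives an extension of \<open>X\<close> by \<open>B\<close>; its image under \<open>F\<close> splits because \<open>X\<^sub>\<Lambda>\<close> is a summand of the
  Bongartz completion and hence Ext-projective.  As \<open>End X\<close> is local, the extension itself splits, so
  \<open>X \<rightarrow> T[1]\<close> factors through \<open>S \<in> add U\<close> and therefore through \<open>g\<close>.
\<close>

section \<open>Linear categories\<close>

text \<open>Three obstacles shape the argument. First, \<open>AR_translate\<close> is computed from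
  a presentation picked by \<open>SOME\<close>, of which only minimality is known. Membership in the
  torsion class is therefore reduced to a lifting property that can be tested on any projective
  presentation, in particular on the one that F produces from a triangle V -> S -> U -> V[1] with V
  and S in add T. Second, F is only half exact: on the extension B -> E -> X the map F B -> F E need
  not be injective, so its image takes the place of F B; it stays in the torsion class because
  quotients do. Third, F forgets ghosts: a section of F E -> F X lifts to a morphism that is a
  section only up to a ghost. Since X has no nonzero summand in add T[1] and F X is indecomposable,
  a Krull-Schmidt decomposition shows that End X is local, and a ghost endomorphism of X is never
  invertible, so the error can be inverted away. The choice of B is dictated by the lifting
  property: rigidity of U pushes a morphism U -> B[1] through add T[1] back to a morphism U -> T[1],
  and this one lifts to S, where it dies.\<close>

definition arr :: "('o, 'm, 'k, 'z) lincat_scheme \<Rightarrow> 'm \<Rightarrow> 'o \<Rightarrow> 'o \<Rightarrow> bool" where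
  "arr C f A B \<longleftrightarrow> A \<in> Obj C \<and> B \<in> Obj C \<and> f \<in> carrier (Hom C A B)"

lemma arrD:
  assumes "arr C f A B"
  shows "A \<in> Obj C" "B \<in> Obj C" "f \<in> carrier (Hom C A B)"
  using assms by (auto simp: arr_def)

text \<open>\<open>lessThan_Suc\<close> splits off the last index, whereas a direct sum over
  \<open>X # Xs\<close> puts the new summand at index 0.\<close>

lemma (in abelian_monoid) finsum_lessThan_Suc_shift:
  assumes "\<And>i. i < Suc n \<Longrightarrow> f i \<in> carrier G"
  shows "finsum G f {..<Suc n} = f 0 \<oplus> finsum G (\<lambda>i. f (Suc i)) {..<n}"
  using assms
proof (induction n)
  case 0
  then show ?case by (simp add: lessThan_Suc)
next
  case (Suc n)
  have c: "f \<in> {..<Suc n} \<rightarrow> carrier G" "f (Suc n) \<in> carrier G" "f 0 \<in> carrier G"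
    "(\<lambda>i. f (Suc i)) \<in> {..<n} \<rightarrow> carrier G" "finsum G (\<lambda>i. f (Suc i)) {..<n} \<in> carrier G"
    using Suc.prems by (auto intro!: finsum_closed)
  have "finsum G f {..<Suc (Suc n)} = f (Suc n) \<oplus> finsum G f {..<Suc n}"
    using c by (subst lessThan_Suc) (auto intro!: finsum_insert)
  also have "\<dots> = f 0 \<oplus> (f (Suc n) \<oplus> finsum G (\<lambda>i. f (Suc i)) {..<n})"
    using Suc c by (simp add: a_lcomm)
  also have "f (Suc n) \<oplus> finsum G (\<lambda>i. f (Suc i)) {..<n} = finsum G (\<lambda>i. f (Suc i)) {..<Suc n}"
    using c Suc.prems by (subst lessThan_Suc) (auto intro!: finsum_insert[symmetric])
  finally show ?case .
qed

lemma (in abelian_group) neg_zero: "\<ominus> \<zero> = \<zero>"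
  by (metis l_zero zero_closed minus_equality)

lemma (in abelian_group) minus_eq_zero_iff:
  assumes "x \<in> carrier G" "y \<in> carrier G"
  shows "x \<ominus> y = \<zero> \<longleftrightarrow> x = y"
proof
  assume "x \<ominus> y = \<zero>"
  then have "\<ominus> (\<ominus> y) = x" using assms by (intro minus_equality) (auto simp: a_minus_def)
  then show "x = y" using assms by simp
qed (use assms in \<open>simp add: a_minus_def r_neg\<close>)

context linear_category
begin

section \<open>Arrows and bilinear composition\<close>

lemma hom_ab: "\<lbrakk>A \<in> Obj C; B \<in> Obj C\<rbrakk> \<Longrightarrow> abelian_group (Hom C A B)"
  using hom_module module.axioms(2) by blast

lemma arr_ab: "arr C f A B \<Longrightarrow> abelian_group (Hom C A B)"
  by (simp add: arr_def hom_ab)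

lemma arr_cmp: "\<lbrakk>arr C f A B; arr C g B E\<rbrakk> \<Longrightarrow> arr C (g \<cdot> f) A E"
  by (auto simp: arr_def intro: cmp_closed)

lemma arr_idn: "A \<in> Obj C \<Longrightarrow> arr C (Idn C A) A A"
  by (simp add: arr_def idn_closed)

lemma arr_zero: "\<lbrakk>A \<in> Obj C; B \<in> Obj C\<rbrakk> \<Longrightarrow> arr C \<zero>\<^bsub>Hom C A B\<^esub> A B"
  by (simp add: arr_def hom_ab abelian_group.axioms abelian_monoid.zero_closed)

lemma arr_add: "\<lbrakk>arr C f A B; arr C g A B\<rbrakk> \<Longrightarrow> arr C (f \<oplus>\<^bsub>Hom C A B\<^esub> g) A B"
  by (simp add: arr_def hom_ab abelian_group.axioms abelian_monoid.a_closed)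

lemma arr_neg: "arr C f A B \<Longrightarrow> arr C (\<ominus>\<^bsub>Hom C A B\<^esub> f) A B"
  by (simp add: arr_def hom_ab abelian_group.a_inv_closed)

lemma arr_minus: "\<lbrakk>arr C f A B; arr C g A B\<rbrakk> \<Longrightarrow> arr C (f \<ominus>\<^bsub>Hom C A B\<^esub> g) A B"
  by (simp add: arr_def hom_ab abelian_group.minus_closed)

lemma arr_finsum:
  "\<lbrakk>\<And>i. i \<in> I \<Longrightarrow> arr C (f i) A B; A \<in> Obj C; B \<in> Obj C\<rbrakk>
    \<Longrightarrow> arr C (finsum (Hom C A B) f I) A B"
  by (auto simp: arr_def hom_ab abelian_group.axioms intro!: abelian_monoid.finsum_closed)

lemma assoc: "\<lbrakk>arr C f A B; arr C g B E; arr C h E G\<rbrakk> \<Longrightarrow> h \<cdot> (g \<cdot> f) = (h \<cdot> g) \<cdot> f"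
  by (auto simp: arr_def intro: cmp_assoc)

text \<open>Brings the middle pair \<open>c\<close>, \<open>b\<close> together, which is how a
  section cancels against its retraction inside a longer composite.\<close>

lemma assoc4: assumes "arr C a A B" "arr C b B E" "arr C c E G" "arr C d G H"
  shows "(d \<cdot> c) \<cdot> (b \<cdot> a) = d \<cdot> ((c \<cdot> b) \<cdot> a)"
  using assoc[OF arr_cmp[OF assms(1,2)] assms(3,4)] assoc[OF assms(1-3)] by simp

lemma idr: "arr C f A B \<Longrightarrow> f \<cdot> Idn C A = f"
  by (auto simp: arr_def intro: cmp_idn_right)

lemma idl: "arr C f A B \<Longrightarrow> Idn C B \<cdot> f = f"
  by (auto simp: arr_def intro: cmp_idn_left)

lemma cmp_addr: "\<lbrakk>arr C f A B; arr C f' A B; arr C g B E\<rbrakk>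
    \<Longrightarrow> g \<cdot> (f \<oplus>\<^bsub>Hom C A B\<^esub> f') = (g \<cdot> f) \<oplus>\<^bsub>Hom C A E\<^esub> (g \<cdot> f')"
  by (auto simp: arr_def intro: cmp_add_right)

lemma cmp_addl: "\<lbrakk>arr C f A B; arr C g B E; arr C g' B E\<rbrakk>
    \<Longrightarrow> (g \<oplus>\<^bsub>Hom C B E\<^esub> g') \<cdot> f = (g \<cdot> f) \<oplus>\<^bsub>Hom C A E\<^esub> (g' \<cdot> f)"
  by (auto simp: arr_def intro: cmp_add_left)

lemma cmp_zeror: assumes "arr C g B E" "A \<in> Obj C"
  shows "g \<cdot> \<zero>\<^bsub>Hom C A B\<^esub> = \<zero>\<^bsub>Hom C A E\<^esub>"
proof -
  have z: "arr C \<zero>\<^bsub>Hom C A B\<^esub> A B" using assms by (auto intro: arr_zero dest: arrD)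
  interpret AB: abelian_group "Hom C A B" using arr_ab[OF z] .
  have gz: "arr C (g \<cdot> \<zero>\<^bsub>Hom C A B\<^esub>) A E" using arr_cmp[OF z assms(1)] .
  interpret AE: abelian_group "Hom C A E" using arr_ab[OF gz] .
  show ?thesis using cmp_addr[OF z z assms(1)] gz
    by (metis AB.l_zero AB.zero_closed AE.add.l_cancel_one' arrD(3))
qed

lemma cmp_zerol: assumes "arr C f A B" "E \<in> Obj C"
  shows "\<zero>\<^bsub>Hom C B E\<^esub> \<cdot> f = \<zero>\<^bsub>Hom C A E\<^esub>"
proof -
  have z: "arr C \<zero>\<^bsub>Hom C B E\<^esub> B E" using assms by (auto intro: arr_zero dest: arrD)
  interpret AB: abelian_group "Hom C B E" using arr_ab[OF z] .
  have gz: "arr C (\<zero>\<^bsub>Hom C B E\<^esub> \<cdot> f) A E" using arr_cmp[OF assms(1) z] .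
  interpret AE: abelian_group "Hom C A E" using arr_ab[OF gz] .
  show ?thesis using cmp_addl[OF assms(1) z z] gz
    by (metis AB.l_zero AB.zero_closed AE.add.l_cancel_one' arrD(3))
qed

lemma cmp_negr: assumes "arr C f A B" "arr C g B E"
  shows "g \<cdot> (\<ominus>\<^bsub>Hom C A B\<^esub> f) = \<ominus>\<^bsub>Hom C A E\<^esub> (g \<cdot> f)"
proof -
  interpret AB: abelian_group "Hom C A B" using arr_ab[OF assms(1)] .
  interpret AE: abelian_group "Hom C A E" using arr_ab[OF arr_cmp[OF assms]] .
  have "g \<cdot> (\<ominus>\<^bsub>Hom C A B\<^esub> f) \<oplus>\<^bsub>Hom C A E\<^esub> (g \<cdot> f) = \<zero>\<^bsub>Hom C A E\<^esub>"
    using cmp_addr[OF arr_neg[OF assms(1)] assms] cmp_zeror[OF assms(2), of A] assms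
    by (metis AB.l_neg arrD(1,3))
  then show ?thesis
    using arrD(3)[OF arr_cmp[OF arr_neg[OF assms(1)] assms(2)]] arrD(3)[OF arr_cmp[OF assms]]
    by (metis AE.minus_equality)
qed

lemma cmp_negl: assumes "arr C f A B" "arr C g B E"
  shows "(\<ominus>\<^bsub>Hom C B E\<^esub> g) \<cdot> f = \<ominus>\<^bsub>Hom C A E\<^esub> (g \<cdot> f)"
proof -
  interpret BE: abelian_group "Hom C B E" using arr_ab[OF assms(2)] .
  interpret AE: abelian_group "Hom C A E" using arr_ab[OF arr_cmp[OF assms]] .
  have "(\<ominus>\<^bsub>Hom C B E\<^esub> g) \<cdot> f \<oplus>\<^bsub>Hom C A E\<^esub> (g \<cdot> f) = \<zero>\<^bsub>Hom C A E\<^esub>"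
    using cmp_addl[OF assms(1) arr_neg[OF assms(2)] assms(2)] cmp_zerol[OF assms(1), of E] assms
    by (metis BE.l_neg arrD(2,3))
  then show ?thesis
    using arrD(3)[OF arr_cmp[OF assms(1) arr_neg[OF assms(2)]]] arrD(3)[OF arr_cmp[OF assms]]
    by (metis AE.minus_equality)
qed

lemma cmp_minusr: assumes "arr C f A B" "arr C f' A B" "arr C g B E"
  shows "g \<cdot> (f \<ominus>\<^bsub>Hom C A B\<^esub> f') = (g \<cdot> f) \<ominus>\<^bsub>Hom C A E\<^esub> (g \<cdot> f')"
  unfolding a_minus_def using assms by (simp add: cmp_addr[OF _ arr_neg] cmp_negr)

lemma cmp_minusl: assumes "arr C f A B" "arr C g B E" "arr C g' B E"
  shows "(g \<ominus>\<^bsub>Hom C B E\<^esub> g') \<cdot> f = (g \<cdot> f) \<ominus>\<^bsub>Hom C A E\<^esub> (g' \<cdot> f)"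
  unfolding a_minus_def using assms by (simp add: cmp_addl[OF _ _ arr_neg] cmp_negl)

lemma minus_eq_zero_iff: assumes "arr C f A B" "arr C g A B"
  shows "f \<ominus>\<^bsub>Hom C A B\<^esub> g = \<zero>\<^bsub>Hom C A B\<^esub> \<longleftrightarrow> f = g"
proof -
  interpret AB: abelian_group "Hom C A B" using arr_ab[OF assms(1)] .
  show ?thesis using AB.minus_eq_zero_iff[OF arrD(3)[OF assms(1)] arrD(3)[OF assms(2)]] .
qed

lemma neg_eq_zero_iff: assumes "arr C f A B"
  shows "\<ominus>\<^bsub>Hom C A B\<^esub> f = \<zero>\<^bsub>Hom C A B\<^esub> \<longleftrightarrow> f = \<zero>\<^bsub>Hom C A B\<^esub>"
proof -
  interpret AB: abelian_group "Hom C A B" using arr_ab[OF assms(1)] .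
  show ?thesis using arrD(3)[OF assms] by (metis AB.minus_minus AB.neg_zero)
qed

lemma neg_neg: assumes "arr C f A B"
  shows "\<ominus>\<^bsub>Hom C A B\<^esub> (\<ominus>\<^bsub>Hom C A B\<^esub> f) = f"
  using abelian_group.minus_minus[OF arr_ab[OF assms] arrD(3)[OF assms]] .

lemma cmp_finsumr:
  assumes "finite I" "\<And>i. i \<in> I \<Longrightarrow> arr C (f i) A B" "arr C g B E" "A \<in> Obj C"
  shows "g \<cdot> finsum (Hom C A B) f I = finsum (Hom C A E) (\<lambda>i. g \<cdot> f i) I"
  using assms(1,2)
proof (induction I rule: finite_induct)
  case empty
  then show ?case using assms abelian_group.axioms(1)[OF hom_ab] arrD
    by (metis abelian_monoid.finsum_empty cmp_zeror)
next
  case (insert x I)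
  have fx: "arr C (f x) A B" using insert.prems by simp
  interpret AB: abelian_group "Hom C A B" using arr_ab[OF fx] .
  interpret AE: abelian_group "Hom C A E" using arr_ab[OF arr_cmp[OF fx assms(3)]] .
  have 1: "f \<in> I \<rightarrow> carrier (Hom C A B)" "f x \<in> carrier (Hom C A B)"
    using arrD(3)[OF insert.prems] by auto
  have 2: "(\<lambda>i. g \<cdot> f i) \<in> I \<rightarrow> carrier (Hom C A E)" "g \<cdot> f x \<in> carrier (Hom C A E)"
    using arrD(3)[OF arr_cmp[OF insert.prems assms(3)]] by auto
  have 3: "arr C (finsum (Hom C A B) f I) A B"
    using insert.prems arrD(1,2)[OF fx] by (intro arr_finsum) auto
  have IH: "g \<cdot> finsum (Hom C A B) f I = finsum (Hom C A E) (\<lambda>i. g \<cdot> f i) I"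
    using insert by blast
  have "g \<cdot> finsum (Hom C A B) f (insert x I) = g \<cdot> (f x \<oplus>\<^bsub>Hom C A B\<^esub> finsum (Hom C A B) f I)"
    using AB.finsum_insert[OF insert.hyps 1] by simp
  also have "\<dots> = g \<cdot> f x \<oplus>\<^bsub>Hom C A E\<^esub> g \<cdot> finsum (Hom C A B) f I"
    using insert.prems 3 assms(3) by (intro cmp_addr) auto
  also have "\<dots> = finsum (Hom C A E) (\<lambda>i. g \<cdot> f i) (insert x I)"
    unfolding IH using AE.finsum_insert[OF insert.hyps 2] by simp
  finally show ?case .
qed

lemma cmp_finsuml:
  assumes "finite I" "\<And>i. i \<in> I \<Longrightarrow> arr C (f i) B E" "arr C g A B" "E \<in> Obj C"
  shows "finsum (Hom C B E) f I \<cdot> g = finsum (Hom C A E) (\<lambda>i. f i \<cdot> g) I"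
  using assms(1,2)
proof (induction I rule: finite_induct)
  case empty
  then show ?case using assms abelian_group.axioms(1)[OF hom_ab] arrD
    by (metis abelian_monoid.finsum_empty cmp_zerol)
next
  case (insert x I)
  have fx: "arr C (f x) B E" using insert.prems by simp
  interpret AB: abelian_group "Hom C B E" using arr_ab[OF fx] .
  interpret AE: abelian_group "Hom C A E" using arr_ab[OF arr_cmp[OF assms(3) fx]] .
  have 1: "f \<in> I \<rightarrow> carrier (Hom C B E)" "f x \<in> carrier (Hom C B E)"
    using arrD(3)[OF insert.prems] by auto
  have 2: "(\<lambda>i. f i \<cdot> g) \<in> I \<rightarrow> carrier (Hom C A E)" "f x \<cdot> g \<in> carrier (Hom C A E)"
    using arrD(3)[OF arr_cmp[OF assms(3) insert.prems]] by auto
  have 3: "arr C (finsum (Hom C B E) f I) B E"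
    using insert.prems arrD(1,2)[OF fx] by (intro arr_finsum) auto
  have IH: "finsum (Hom C B E) f I \<cdot> g = finsum (Hom C A E) (\<lambda>i. f i \<cdot> g) I"
    using insert by blast
  have "finsum (Hom C B E) f (insert x I) \<cdot> g = (f x \<oplus>\<^bsub>Hom C B E\<^esub> finsum (Hom C B E) f I) \<cdot> g"
    using AB.finsum_insert[OF insert.hyps 1] by simp
  also have "\<dots> = f x \<cdot> g \<oplus>\<^bsub>Hom C A E\<^esub> finsum (Hom C B E) f I \<cdot> g"
    using insert.prems 3 assms(3) by (intro cmp_addl) auto
  also have "\<dots> = finsum (Hom C A E) (\<lambda>i. f i \<cdot> g) (insert x I)"
    unfolding IH using AE.finsum_insert[OF insert.hyps 2] by simp
  finally show ?case .
qed

lemma finsum_arr_cong: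
  assumes "\<And>i. i \<in> I \<Longrightarrow> f i = g i" "\<And>i. i \<in> I \<Longrightarrow> arr C (g i) A B" "A \<in> Obj C" "B \<in> Obj C"
  shows "finsum (Hom C A B) f I = finsum (Hom C A B) g I"
proof -
  interpret AB: abelian_group "Hom C A B" using hom_ab assms(3,4) .
  show ?thesis using assms(1) arrD(3)[OF assms(2)] by (intro AB.finsum_cong') auto
qed

lemma finsum_arr_zero:
  assumes "\<And>i. i \<in> I \<Longrightarrow> f i = \<zero>\<^bsub>Hom C A B\<^esub>" "A \<in> Obj C" "B \<in> Obj C"
  shows "finsum (Hom C A B) f I = \<zero>\<^bsub>Hom C A B\<^esub>"
proof -
  interpret AB: abelian_group "Hom C A B" using assms hom_ab by blast
  show ?thesis using assms(1) AB.add.finprod_one_eqI[of I f] by (simp add: finsum_def)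
qed

section \<open>Isomorphisms, zero objects and direct sums\<close>

lemma iso_arrowD:
  assumes "iso_arrow C X Y f" "X \<in> Obj C" "Y \<in> Obj C"
  obtains g where "arr C f X Y" "arr C g Y X" "g \<cdot> f = Idn C X" "f \<cdot> g = Idn C Y"
  using assms by (auto simp: iso_arrow_def arr_def)

lemma iso_arrowI:
  "\<lbrakk>arr C f X Y; arr C g Y X; g \<cdot> f = Idn C X; f \<cdot> g = Idn C Y\<rbrakk> \<Longrightarrow> iso_arrow C X Y f"
  by (auto simp: iso_arrow_def arr_def)

lemma zero_object_arr: assumes "zero_object C Z" "arr C f Z A" shows "f = \<zero>\<^bsub>Hom C Z A\<^esub>"
  using assms by (metis arrD cmp_zeror idr zero_object_def)

lemma zero_object_iso:
  assumes "zero_object C Z" "arr C f Z A" "arr C g A Z" "f \<cdot> g = Idn C A"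
  shows "zero_object C A"
  using assms zero_object_arr[OF assms(1,2)] cmp_zerol[OF assms(3)] arrD
  by (metis zero_object_def)

lemma direct_sumE:
  assumes "direct_sum C S Xs"
  obtains inc prj where "S \<in> Obj C" "set Xs \<subseteq> Obj C"
    "\<And>i. i < length Xs \<Longrightarrow> arr C (inc i) (Xs ! i) S"
    "\<And>i. i < length Xs \<Longrightarrow> arr C (prj i) S (Xs ! i)"
    "\<And>i j. \<lbrakk>i < length Xs; j < length Xs\<rbrakk> \<Longrightarrow>
       prj j \<cdot> inc i = (if i = j then Idn C (Xs ! i) else \<zero>\<^bsub>Hom C (Xs ! i) (Xs ! j)\<^esub>)"
    "finsum (Hom C S S) (\<lambda>i. inc i \<cdot> prj i) {..<length Xs} = Idn C S"
proof -
  from assms obtain inc prj where a: "S \<in> Obj C" "set Xs \<subseteq> Obj C"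
    "\<forall>i < length Xs. inc i \<in> carrier (Hom C (Xs ! i) S) \<and> prj i \<in> carrier (Hom C S (Xs ! i))"
    "\<forall>i < length Xs. \<forall>j < length Xs.
           prj j \<cdot> inc i = (if i = j then Idn C (Xs ! i) else \<zero>\<^bsub>Hom C (Xs ! i) (Xs ! j)\<^esub>)"
    "finsum (Hom C S S) (\<lambda>i. inc i \<cdot> prj i) {..<length Xs} = Idn C S"
    unfolding direct_sum_def by blast
  have "Xs ! i \<in> Obj C" if "i < length Xs" for i using a(2) that by auto
  then show ?thesis using that[of inc prj] a by (auto simp: arr_def)
qed

lemma direct_sumI:
  assumes "S \<in> Obj C" "set Xs \<subseteq> Obj C"
    "\<And>i. i < length Xs \<Longrightarrow> arr C (inc i) (Xs ! i) S"
    "\<And>i. i < length Xs \<Longrightarrow> arr C (prj i) S (Xs ! i)"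
    "\<And>i j. \<lbrakk>i < length Xs; j < length Xs\<rbrakk> \<Longrightarrow>
       prj j \<cdot> inc i = (if i = j then Idn C (Xs ! i) else \<zero>\<^bsub>Hom C (Xs ! i) (Xs ! j)\<^esub>)"
    "finsum (Hom C S S) (\<lambda>i. inc i \<cdot> prj i) {..<length Xs} = Idn C S"
  shows "direct_sum C S Xs"
  unfolding direct_sum_def
  by (intro conjI exI[of _ inc] exI[of _ prj]) (use assms in \<open>auto dest: arrD\<close>)

lemma direct_sum2E:
  assumes "direct_sum C S [A, B]"
  obtains i p j q where "arr C i A S" "arr C p S A" "arr C j B S" "arr C q S B"
    "p \<cdot> i = Idn C A" "q \<cdot> j = Idn C B" "q \<cdot> i = \<zero>\<^bsub>Hom C A B\<^esub>" "p \<cdot> j = \<zero>\<^bsub>Hom C B A\<^esub>"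
    "(i \<cdot> p) \<oplus>\<^bsub>Hom C S S\<^esub> (j \<cdot> q) = Idn C S"
proof -
  obtain inc prj where a: "S \<in> Obj C" "set [A, B] \<subseteq> Obj C"
    "\<And>i. i < length [A, B] \<Longrightarrow> arr C (inc i) ([A, B] ! i) S"
    "\<And>i. i < length [A, B] \<Longrightarrow> arr C (prj i) S ([A, B] ! i)"
    "\<And>i j. \<lbrakk>i < length [A, B]; j < length [A, B]\<rbrakk> \<Longrightarrow>
       prj j \<cdot> inc i = (if i = j then Idn C ([A, B] ! i) else \<zero>\<^bsub>Hom C ([A, B] ! i) ([A, B] ! j)\<^esub>)"
    "finsum (Hom C S S) (\<lambda>i. inc i \<cdot> prj i) {..<length [A, B]} = Idn C S"
    by (rule direct_sumE[OF assms]) (rule that)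
  have b: "arr C (inc 0) A S" "arr C (prj 0) S A" "arr C (inc 1) B S" "arr C (prj 1) S B"
    using a(3)[of 0] a(4)[of 0] a(3)[of 1] a(4)[of 1] by simp_all
  interpret S: abelian_group "Hom C S S" using hom_ab a by blast
  have c: "inc 0 \<cdot> prj 0 \<in> carrier (Hom C S S)" "inc 1 \<cdot> prj 1 \<in> carrier (Hom C S S)"
    using arrD(3)[OF arr_cmp[OF b(2,1)]] arrD(3)[OF arr_cmp[OF b(4,3)]] by auto
  have "{..<length [A, B]} = {0, 1}" by auto
  then have "(inc 0 \<cdot> prj 0) \<oplus>\<^bsub>Hom C S S\<^esub> (inc 1 \<cdot> prj 1) = Idn C S"
    using a(6) c by simp
  then show ?thesis
    using that[of "inc 0" "prj 0" "inc 1" "prj 1"] b a(5)[of 0 0] a(5)[of 0 1] a(5)[of 1 0] a(5)[of 1 1]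
    by simp
qed

lemma direct_sum2I:
  assumes "arr C i A S" "arr C p S A" "arr C j B S" "arr C q S B"
    "p \<cdot> i = Idn C A" "q \<cdot> j = Idn C B" "q \<cdot> i = \<zero>\<^bsub>Hom C A B\<^esub>" "p \<cdot> j = \<zero>\<^bsub>Hom C B A\<^esub>"
    "(i \<cdot> p) \<oplus>\<^bsub>Hom C S S\<^esub> (j \<cdot> q) = Idn C S"
  shows "direct_sum C S [A, B]"
proof (rule direct_sumI[where inc = "\<lambda>n. if n = 0 then i else j" and prj = "\<lambda>n. if n = 0 then p else q"])
  interpret S: abelian_group "Hom C S S" using arr_ab[OF arr_cmp[OF assms(2,1)]] .
  have c: "i \<cdot> p \<in> carrier (Hom C S S)" "j \<cdot> q \<in> carrier (Hom C S S)"
    using arrD(3)[OF arr_cmp[OF assms(2,1)]] arrD(3)[OF arr_cmp[OF assms(4,3)]] by auto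
  have "{..<length [A, B]} = {0, 1}" by auto
  then show "finsum (Hom C S S) (\<lambda>n. (if n = 0 then i else j) \<cdot> (if n = 0 then p else q)) {..<length [A, B]} = Idn C S"
    using c assms(9) by simp
qed (use assms in \<open>auto dest: arrD simp: less_Suc_eq\<close>)

lemma direct_sum_iso:
  assumes "direct_sum C S Xs" "arr C f S S'" "arr C g S' S" "g \<cdot> f = Idn C S" "f \<cdot> g = Idn C S'"
  shows "direct_sum C S' Xs"
proof -
  obtain inc prj where a: "S \<in> Obj C" "set Xs \<subseteq> Obj C"
    "\<And>i. i < length Xs \<Longrightarrow> arr C (inc i) (Xs ! i) S"
    "\<And>i. i < length Xs \<Longrightarrow> arr C (prj i) S (Xs ! i)"
    "\<And>i j. \<lbrakk>i < length Xs; j < length Xs\<rbrakk> \<Longrightarrow>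
       prj j \<cdot> inc i = (if i = j then Idn C (Xs ! i) else \<zero>\<^bsub>Hom C (Xs ! i) (Xs ! j)\<^esub>)"
    "finsum (Hom C S S) (\<lambda>i. inc i \<cdot> prj i) {..<length Xs} = Idn C S"
    by (rule direct_sumE[OF assms(1)]) (rule that)
  have S': "S' \<in> Obj C" using arrD(2)[OF assms(2)] .
  note ip = arr_cmp[OF a(4) a(3)]
  show ?thesis
  proof (rule direct_sumI[where inc = "\<lambda>i. f \<cdot> inc i" and prj = "\<lambda>i. prj i \<cdot> g"])
    fix i j assume l: "i < length Xs" "j < length Xs"
    have "(prj j \<cdot> g) \<cdot> (f \<cdot> inc i) = prj j \<cdot> ((g \<cdot> f) \<cdot> inc i)"
      using assoc4[OF a(3)[OF l(1)] assms(2,3) a(4)[OF l(2)]] .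
    then show "(prj j \<cdot> g) \<cdot> (f \<cdot> inc i) = (if i = j then Idn C (Xs ! i) else \<zero>\<^bsub>Hom C (Xs ! i) (Xs ! j)\<^esub>)"
      using a(3)[OF l(1)] a(5)[OF l] assms(4) by (simp add: idl)
  next
    have "finsum (Hom C S' S') (\<lambda>i. (f \<cdot> inc i) \<cdot> prj i \<cdot> g) {..<length Xs}
        = finsum (Hom C S' S') (\<lambda>i. f \<cdot> ((inc i \<cdot> prj i) \<cdot> g)) {..<length Xs}"
      using assoc4[OF assms(3) a(4) a(3) assms(2)] S' arr_cmp[OF arr_cmp[OF assms(3) ip] assms(2)]
      by (intro finsum_arr_cong) auto
    also have "\<dots> = f \<cdot> (finsum (Hom C S S) (\<lambda>i. inc i \<cdot> prj i) {..<length Xs} \<cdot> g)"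
      using ip a(1) S' assms(2,3)
      by (subst cmp_finsuml[OF _ _ assms(3)])
        (auto intro!: cmp_finsumr[symmetric] arr_cmp[OF assms(3)])
    also have "\<dots> = Idn C S'" using a(6) assms by (simp add: idl)
    finally show "finsum (Hom C S' S') (\<lambda>i. (f \<cdot> inc i) \<cdot> prj i \<cdot> g) {..<length Xs} = Idn C S'" .
  qed (use a(2) S' arr_cmp[OF a(3) assms(2)] arr_cmp[OF assms(3) a(4)] in auto)
qed

section \<open>Summands, additive closures and approximations\<close>

lemma summandE:
  assumes "summand C Z X"
  obtains i p where "arr C i Z X" "arr C p X Z" "p \<cdot> i = Idn C Z"
  using assms direct_sum2E unfolding summand_def by metis

lemma summand_iso:
  assumes "summand C Z S" "arr C f Z Z'" "arr C g Z' Z" "g \<cdot> f = Idn C Z" "f \<cdot> g = Idn C Z'"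
  shows "summand C Z' S"
proof -
  obtain W where "direct_sum C S [Z, W]" using assms unfolding summand_def by blast
  then obtain i p j q where a: "arr C i Z S" "arr C p S Z" "arr C j W S" "arr C q S W"
    "p \<cdot> i = Idn C Z" "q \<cdot> j = Idn C W" "q \<cdot> i = \<zero>\<^bsub>Hom C Z W\<^esub>" "p \<cdot> j = \<zero>\<^bsub>Hom C W Z\<^esub>"
    "(i \<cdot> p) \<oplus>\<^bsub>Hom C S S\<^esub> (j \<cdot> q) = Idn C S"
    by (elim direct_sum2E)
  have "direct_sum C S [Z', W]"
  proof (rule direct_sum2I[of "i \<cdot> g" _ _ "f \<cdot> p" j _ q])
    have "(f \<cdot> p) \<cdot> i \<cdot> g = f \<cdot> ((p \<cdot> i) \<cdot> g)" using assoc4[OF assms(3) a(1,2) assms(2)] .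
    then show "(f \<cdot> p) \<cdot> i \<cdot> g = Idn C Z'" using a(5) assms by (simp add: idl)
    have "q \<cdot> i \<cdot> g = (q \<cdot> i) \<cdot> g" using assoc[OF assms(3) a(1,4)] .
    then show "q \<cdot> i \<cdot> g = \<zero>\<^bsub>Hom C Z' W\<^esub>" using a assms(3) by (simp add: cmp_zerol arrD)
    have "(f \<cdot> p) \<cdot> j = f \<cdot> (p \<cdot> j)" using assoc[OF a(3,2) assms(2)] by simp
    then show "(f \<cdot> p) \<cdot> j = \<zero>\<^bsub>Hom C W Z'\<^esub>" using a(3,8) cmp_zeror[OF assms(2) arrD(1)[OF a(3)]] by simp
    have "(i \<cdot> g) \<cdot> f \<cdot> p = i \<cdot> ((g \<cdot> f) \<cdot> p)" using assoc4[OF a(2) assms(2,3) a(1)] .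
    then have "(i \<cdot> g) \<cdot> f \<cdot> p = i \<cdot> p" using a(2) assms(4) by (simp add: idl)
    then show "((i \<cdot> g) \<cdot> f \<cdot> p) \<oplus>\<^bsub>Hom C S S\<^esub> (j \<cdot> q) = Idn C S" using a(9) by simp
  qed (use a arr_cmp[OF assms(3) a(1)] arr_cmp[OF a(2) assms(2)] in auto)
  then show ?thesis unfolding summand_def by blast
qed

lemma add_closure_iso:
  assumes "Z \<in> add_closure C M" "arr C f Z Z'" "arr C g Z' Z" "g \<cdot> f = Idn C Z" "f \<cdot> g = Idn C Z'"
  shows "Z' \<in> add_closure C M"
  using assms summand_iso[OF _ assms(2-)] unfolding add_closure_def by blast

text \<open>Composing a retraction from \<open>M^n\<close> to \<open>V\<close> with the injections
  and projections of \<open>M^n\<close> factors the identity of \<open>V\<close> through copies of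
  \<open>M\<close>. The orthogonality relations are lost, but this expansion is all that the
  arguments about add M use.\<close>

lemma add_closure_coords:
  assumes "V \<in> add_closure C M"
  obtains n a b where "V \<in> Obj C" "\<And>i. i < (n::nat) \<Longrightarrow> arr C (a i) M V" "\<And>i. i < n \<Longrightarrow> arr C (b i) V M"
    "finsum (Hom C V V) (\<lambda>i. a i \<cdot> b i) {..<n} = Idn C V"
proof -
  obtain n S where "direct_sum C S (replicate n M)" and s: "summand C V S"
    using assms unfolding add_closure_def by blast
  then obtain inc prj where d: "S \<in> Obj C"
    "\<And>i. i < n \<Longrightarrow> arr C (inc i) M S" "\<And>i. i < n \<Longrightarrow> arr C (prj i) S M"
    "finsum (Hom C S S) (\<lambda>i. inc i \<cdot> prj i) {..<n} = Idn C S"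
    by (elim direct_sumE) auto
  obtain i p where i: "arr C i V S" "arr C p S V" "p \<cdot> i = Idn C V" using s by (rule summandE)
  note ip = arr_cmp[OF d(3) d(2)]
  have "finsum (Hom C V V) (\<lambda>k. (p \<cdot> inc k) \<cdot> (prj k \<cdot> i)) {..<n}
      = finsum (Hom C V V) (\<lambda>k. p \<cdot> ((inc k \<cdot> prj k) \<cdot> i)) {..<n}"
    using assoc4[OF i(1) d(3) d(2) i(2)] arr_cmp[OF arr_cmp[OF i(1) ip] i(2)] arrD[OF i(1)]
    by (intro finsum_arr_cong) auto
  also have "\<dots> = p \<cdot> (finsum (Hom C S S) (\<lambda>i. inc i \<cdot> prj i) {..<n} \<cdot> i)"
    using ip i arrD[OF i(1)]
    by (subst cmp_finsuml[OF _ _ i(1)]) (auto intro!: cmp_finsumr[symmetric] arr_cmp[OF i(1)])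
  also have "\<dots> = Idn C V" using d(4) i by (simp add: idl)
  finally show ?thesis
    using that[of n "\<lambda>k. p \<cdot> inc k" "\<lambda>k. prj k \<cdot> i"] arrD(1)[OF i(1)]
      arr_cmp[OF d(2) i(2)] arr_cmp[OF i(1) d(3)] by simp
qed

lemma summand_refl:
  assumes "X \<in> Obj C" "zero_object C Z"
  shows "summand C X X"
proof -
  have Z: "Z \<in> Obj C" "Idn C Z = \<zero>\<^bsub>Hom C Z Z\<^esub>" using assms by (auto simp: zero_object_def)
  note z = arr_zero[OF assms(1) Z(1)] arr_zero[OF Z(1) assms(1)]
  have "direct_sum C X [X, Z]"
  proof (rule direct_sum2I[OF arr_idn[OF assms(1)] arr_idn[OF assms(1)] z(2) z(1)])
    interpret S: abelian_group "Hom C X X" using hom_ab assms by blast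
    show "Idn C X \<cdot> Idn C X \<oplus>\<^bsub>Hom C X X\<^esub> \<zero>\<^bsub>Hom C Z X\<^esub> \<cdot> \<zero>\<^bsub>Hom C X Z\<^esub> = Idn C X"
      using assms Z z idl[OF arr_idn[OF assms(1)]] cmp_zeror[OF z(2) assms(1)] idn_closed by simp
  qed (use assms Z z idl[OF arr_idn] idr[OF z(1)] idl[OF z(2)] idl[OF z(1)] idr[OF z(2)] cmp_zeror[OF z(1)] in \<open>auto\<close>)
  then show ?thesis unfolding summand_def by blast
qed

lemma direct_sum_single: assumes "Y \<in> Obj C" shows "direct_sum C Y [Y]"
proof (rule direct_sumI[where inc = "\<lambda>_. Idn C Y" and prj = "\<lambda>_. Idn C Y"])
  interpret S: abelian_group "Hom C Y Y" using hom_ab assms by blast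
  show "finsum (Hom C Y Y) (\<lambda>i. Idn C Y \<cdot> Idn C Y) {..<length [Y]} = Idn C Y"
    using assms idl[OF arr_idn[OF assms]] idn_closed by (simp add: lessThan_Suc)
qed (use assms arr_idn idl in auto)

lemma add_closure_refl:
  assumes "X \<in> Obj C" "zero_object C Z"
  shows "X \<in> add_closure C X"
  using direct_sum_single[OF assms(1)] summand_refl[OF assms]
  unfolding add_closure_def by (auto intro!: exI[of _ 1])

text \<open>\<open>f\<close> is the sum of the \<open>(f \<cdot> a i) \<cdot> b i\<close>, so it is
  determined by its composites with morphisms from \<open>M\<close>.\<close>

lemma add_closure_zero:
  assumes "V \<in> add_closure C M" "arr C f V Z" "\<And>t. arr C t M V \<Longrightarrow> f \<cdot> t = \<zero>\<^bsub>Hom C M Z\<^esub>"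
  shows "f = \<zero>\<^bsub>Hom C V Z\<^esub>"
proof -
  obtain n a b where ab: "V \<in> Obj C" "\<And>i. i < (n::nat) \<Longrightarrow> arr C (a i) M V" "\<And>i. i < n \<Longrightarrow> arr C (b i) V M"
    "finsum (Hom C V V) (\<lambda>i. a i \<cdot> b i) {..<n} = Idn C V"
    by (rule add_closure_coords[OF assms(1)]) (rule that)
  have Z: "Z \<in> Obj C" using arrD(2)[OF assms(2)] .
  have "f = f \<cdot> finsum (Hom C V V) (\<lambda>i. a i \<cdot> b i) {..<n}" using ab(4) idr[OF assms(2)] by simp
  also have "\<dots> = finsum (Hom C V Z) (\<lambda>i. f \<cdot> (a i \<cdot> b i)) {..<n}"
    using arr_cmp[OF ab(3) ab(2)] ab(1) assms(2) by (intro cmp_finsumr) auto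
  also have "\<dots> = \<zero>\<^bsub>Hom C V Z\<^esub>"
    using assoc[OF ab(3) ab(2) assms(2)] assms(3)[OF ab(2)] cmp_zerol[OF ab(3) Z] ab(1) Z
    by (intro finsum_arr_zero) auto
  finally show ?thesis .
qed

lemma direct_sum_copiesE:
  assumes "direct_sum C S (replicate n M)"
  obtains inc prj where "S \<in> Obj C" "\<And>i. i < n \<Longrightarrow> arr C (inc i) M S" "\<And>i. i < n \<Longrightarrow> arr C (prj i) S M"
    "\<And>i j. \<lbrakk>i < n; j < n\<rbrakk> \<Longrightarrow> prj j \<cdot> inc i = (if i = j then Idn C M else \<zero>\<^bsub>Hom C M M\<^esub>)"
    "finsum (Hom C S S) (\<lambda>i. inc i \<cdot> prj i) {..<n} = Idn C S"
proof -
  obtain inc prj where a: "S \<in> Obj C"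
    "\<And>i. i < n \<Longrightarrow> arr C (inc i) (replicate n M ! i) S"
    "\<And>i. i < n \<Longrightarrow> arr C (prj i) S (replicate n M ! i)"
    "\<And>i j. \<lbrakk>i < n; j < n\<rbrakk> \<Longrightarrow>
       prj j \<cdot> inc i = (if i = j then Idn C (replicate n M ! i) else \<zero>\<^bsub>Hom C (replicate n M ! i) (replicate n M ! j)\<^esub>)"
    "finsum (Hom C S S) (\<lambda>i. inc i \<cdot> prj i) {..<n} = Idn C S"
    by (rule direct_sumE[OF assms], unfold length_replicate) (rule that)
  show ?thesis by (rule that[of inc prj]) (use a in auto)
qed

text \<open>The universal property of \<open>M^n\<close> as a coproduct. The formula for
  \<open>p\<close> is kept explicit because \<open>F_full\<close> has to evaluate it.\<close>

lemma direct_sum_copies_lift: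
  assumes "direct_sum C S (replicate n M)" "\<And>i. i < n \<Longrightarrow> arr C (u i) M Z" "Z \<in> Obj C"
    "S \<in> Obj C" "\<And>i. i < n \<Longrightarrow> arr C (inc i) M S" "\<And>i. i < n \<Longrightarrow> arr C (prj i) S M"
    "\<And>i j. \<lbrakk>i < n; j < n\<rbrakk> \<Longrightarrow> prj j \<cdot> inc i = (if i = j then Idn C M else \<zero>\<^bsub>Hom C M M\<^esub>)"
  defines "p \<equiv> finsum (Hom C S Z) (\<lambda>i. u i \<cdot> prj i) {..<n}"
  shows "arr C p S Z" "\<And>i. i < n \<Longrightarrow> p \<cdot> inc i = u i"
proof -
  show "arr C p S Z" unfolding p_def using arr_cmp[OF assms(6) assms(2)] assms(3,4)
    by (intro arr_finsum) auto
  fix j assume j: "j < n"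
  have M: "M \<in> Obj C" using arrD(1)[OF assms(5)[OF j]] .
  interpret MZ: abelian_group "Hom C M Z" using hom_ab[OF M assms(3)] .
  have "p \<cdot> inc j = finsum (Hom C M Z) (\<lambda>i. (u i \<cdot> prj i) \<cdot> inc j) {..<n}"
    unfolding p_def using arr_cmp[OF assms(6) assms(2)] assms(3)
    by (intro cmp_finsuml assms(5)[OF j]) auto
  also have "\<dots> = finsum (Hom C M Z) (\<lambda>i. if j = i then u i else \<zero>\<^bsub>Hom C M Z\<^esub>) {..<n}"
  proof (rule finsum_arr_cong)
    fix i assume "i \<in> {..<n}"
    then have i: "i < n" by simp
    show "(u i \<cdot> prj i) \<cdot> inc j = (if j = i then u i else \<zero>\<^bsub>Hom C M Z\<^esub>)"
      using assoc[OF assms(5)[OF j] assms(6)[OF i] assms(2)[OF i]] assms(7)[OF j i]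
        cmp_zeror[OF assms(2)[OF i] M] idr[OF assms(2)[OF i]] by (auto split: if_splits)
    show "arr C (if j = i then u i else \<zero>\<^bsub>Hom C M Z\<^esub>) M Z" using assms(2)[OF i] arr_zero[OF M assms(3)]
      by auto
  qed (use M assms(3) in auto)
  also have "\<dots> = u j" using MZ.finsum_singleton[of j "{..<n}" u] j arrD(3)[OF assms(2)] by auto
  finally show "p \<cdot> inc j = u j" .
qed

lemma add_closure_zero':
  assumes "V \<in> add_closure C M" "arr C f Z V" "\<And>t. arr C t V M \<Longrightarrow> t \<cdot> f = \<zero>\<^bsub>Hom C Z M\<^esub>"
  shows "f = \<zero>\<^bsub>Hom C Z V\<^esub>"
proof -
  obtain n a b where ab: "V \<in> Obj C" "\<And>i. i < (n::nat) \<Longrightarrow> arr C (a i) M V" "\<And>i. i < n \<Longrightarrow> arr C (b i) V M"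
    "finsum (Hom C V V) (\<lambda>i. a i \<cdot> b i) {..<n} = Idn C V"
    by (rule add_closure_coords[OF assms(1)]) (rule that)
  have Z: "Z \<in> Obj C" using arrD(1)[OF assms(2)] .
  have "f = finsum (Hom C V V) (\<lambda>i. a i \<cdot> b i) {..<n} \<cdot> f" using ab(4) idl[OF assms(2)] by simp
  also have "\<dots> = finsum (Hom C Z V) (\<lambda>i. (a i \<cdot> b i) \<cdot> f) {..<n}"
    using arr_cmp[OF ab(3) ab(2)] ab(1) assms(2) by (intro cmp_finsuml) auto
  also have "\<dots> = \<zero>\<^bsub>Hom C Z V\<^esub>"
    using assoc[OF assms(2) ab(3) ab(2)] assms(3)[OF ab(3)] cmp_zeror[OF ab(2) Z] ab(1) Z
    by (intro finsum_arr_zero) auto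
  finally show ?thesis .
qed

text \<open>For \<open>Z\<close> equal to \<open>T\<close> this expands an element of Hom(T,V) over
  the generators \<open>a i\<close>, with the ring elements \<open>b i \<cdot> x\<close> as
  coefficients.\<close>

lemma coords_expand:
  assumes "\<And>i. i < (n::nat) \<Longrightarrow> arr C (a i) M V" "\<And>i. i < n \<Longrightarrow> arr C (b i) V M"
    "finsum (Hom C V V) (\<lambda>i. a i \<cdot> b i) {..<n} = Idn C V" "arr C x Z V"
  shows "finsum (Hom C Z V) (\<lambda>i. a i \<cdot> (b i \<cdot> x)) {..<n} = x"
proof -
  note o = arrD(1,2)[OF assms(4)]
  have "finsum (Hom C Z V) (\<lambda>i. a i \<cdot> (b i \<cdot> x)) {..<n} = finsum (Hom C Z V) (\<lambda>i. (a i \<cdot> b i) \<cdot> x) {..<n}"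
    using assoc[OF assms(4) assms(2) assms(1)] arr_cmp[OF assms(4) arr_cmp[OF assms(2) assms(1)]] o
    by (intro finsum_arr_cong) auto
  also have "\<dots> = finsum (Hom C V V) (\<lambda>i. a i \<cdot> b i) {..<n} \<cdot> x"
    using arr_cmp[OF assms(2) assms(1)] o by (intro cmp_finsuml[OF _ _ assms(4), symmetric]) auto
  finally show ?thesis using assms(3) idl[OF assms(4)] by simp
qed

text \<open>The approximation property has to be tested on \<open>U\<close> only: lift each
  coordinate \<open>b i \<cdot> x\<close> and recombine the lifts with the
  \<open>a i\<close>.\<close>

lemma approx_lift:
  assumes "W \<in> add_closure C U" "arr C g X Y" "\<And>t. arr C t X U \<Longrightarrow> \<exists>s. arr C s Y U \<and> s \<cdot> g = t" "arr C x X W"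
  obtains y where "arr C y Y W" "y \<cdot> g = x"
proof -
  obtain n a b where ab: "W \<in> Obj C" "\<And>i. i < (n::nat) \<Longrightarrow> arr C (a i) U W" "\<And>i. i < n \<Longrightarrow> arr C (b i) W U"
    "finsum (Hom C W W) (\<lambda>i. a i \<cdot> b i) {..<n} = Idn C W"
    by (rule add_closure_coords[OF assms(1)]) (rule that)
  have "\<exists>s. arr C s Y U \<and> s \<cdot> g = b i \<cdot> x" if "i < n" for i
    using assms(3)[OF arr_cmp[OF assms(4) ab(3)[OF that]]] .
  then obtain s where s: "\<And>i. i < n \<Longrightarrow> arr C (s i) Y U" "\<And>i. i < n \<Longrightarrow> s i \<cdot> g = b i \<cdot> x" by metis
  note o = arrD(1,2)[OF assms(2)]
  define y where "y = finsum (Hom C Y W) (\<lambda>i. a i \<cdot> s i) {..<n}"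
  have y: "arr C y Y W" unfolding y_def using arr_cmp[OF s(1) ab(2)] o ab(1) by (intro arr_finsum) auto
  have "y \<cdot> g = finsum (Hom C X W) (\<lambda>i. (a i \<cdot> s i) \<cdot> g) {..<n}"
    unfolding y_def using arr_cmp[OF s(1) ab(2)] ab(1) by (intro cmp_finsuml[OF _ _ assms(2)]) auto
  also have "\<dots> = finsum (Hom C X W) (\<lambda>i. a i \<cdot> (b i \<cdot> x)) {..<n}"
    using assoc[OF assms(2) s(1) ab(2)] s(2) arr_cmp[OF arr_cmp[OF assms(4) ab(3)] ab(2)] o ab(1)
    by (intro finsum_arr_cong) auto
  also have "\<dots> = x" using coords_expand[OF ab(2) ab(3) ab(4) assms(4)] by simp
  finally show ?thesis using that y by blast
qed

text \<open>The hypotheses give \<open>b\<close> a left and a right inverse, which must agree. This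
  is the form in which minimal approximations turn out to be unique.\<close>

lemma iso_arrow_two_sided:
  assumes "arr C b X Y" "arr C b' Y X" "iso_arrow C X X (b' \<cdot> b)" "iso_arrow C Y Y (b \<cdot> b')"
  shows "iso_arrow C X Y b"
proof -
  note o = arrD(1,2)[OF assms(1)]
  obtain k where k: "arr C k X X" "k \<cdot> (b' \<cdot> b) = Idn C X"
    by (rule iso_arrowD[OF assms(3) o(1) o(1)]) (rule that)
  obtain l where l: "arr C l Y Y" "(b \<cdot> b') \<cdot> l = Idn C Y"
    by (rule iso_arrowD[OF assms(4) o(2) o(2)]) (rule that)
  have kb: "arr C (k \<cdot> b') Y X" and bl: "arr C (b' \<cdot> l) Y X" using arr_cmp assms(2) k(1) l(1) by blast+
  have 1: "(k \<cdot> b') \<cdot> b = Idn C X" using assoc[OF assms(1,2) k(1)] k(2) by simp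
  have 2: "b \<cdot> (b' \<cdot> l) = Idn C Y" using assoc[OF l(1) assms(2,1)] l(2) by simp
  have "k \<cdot> b' = b' \<cdot> l" using assoc[OF bl assms(1) kb] 1 2 idr[OF kb] idl[OF bl] by simp
  then show ?thesis using iso_arrowI[OF assms(1) kb] 1 2 by simp
qed

end

lemma (in additive_category) ex_direct_sum_list:
  "set Xs \<subseteq> Obj C \<Longrightarrow> \<exists>S. direct_sum C S Xs"
proof (induction Xs)
  case Nil
  obtain Z where Z: "zero_object C Z" using ex_zero_object by blast
  have "Z \<in> Obj C" using Z by (simp add: zero_object_def)
  interpret S: abelian_group "Hom C Z Z" using hom_ab \<open>Z \<in> Obj C\<close> by blast
  have "direct_sum C Z []"
    using Z by (intro direct_sumI) (auto simp: zero_object_def)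
  then show ?case by blast
next
  case (Cons X Xs)
  then obtain S where S: "direct_sum C S Xs" by auto
  obtain inc prj where a: "S \<in> Obj C" "set Xs \<subseteq> Obj C"
    "\<And>i. i < length Xs \<Longrightarrow> arr C (inc i) (Xs ! i) S"
    "\<And>i. i < length Xs \<Longrightarrow> arr C (prj i) S (Xs ! i)"
    "\<And>i j. \<lbrakk>i < length Xs; j < length Xs\<rbrakk> \<Longrightarrow>
       prj j \<cdot> inc i = (if i = j then Idn C (Xs ! i) else \<zero>\<^bsub>Hom C (Xs ! i) (Xs ! j)\<^esub>)"
    "finsum (Hom C S S) (\<lambda>i. inc i \<cdot> prj i) {..<length Xs} = Idn C S"
    by (rule direct_sumE[OF S]) (rule that)
  obtain R where "direct_sum C R [X, S]" using ex_direct_sum[of X S] Cons a by auto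
  then obtain i p j q where b: "arr C i X R" "arr C p R X" "arr C j S R" "arr C q R S"
    "p \<cdot> i = Idn C X" "q \<cdot> j = Idn C S" "q \<cdot> i = \<zero>\<^bsub>Hom C X S\<^esub>" "p \<cdot> j = \<zero>\<^bsub>Hom C S X\<^esub>"
    "(i \<cdot> p) \<oplus>\<^bsub>Hom C R R\<^esub> (j \<cdot> q) = Idn C R"
    by (elim direct_sum2E)
  have R: "R \<in> Obj C" using arrD(2)[OF b(1)] .
  interpret R: abelian_group "Hom C R R" using hom_ab R by blast
  define inc' where "inc' = (\<lambda>n. case n of 0 \<Rightarrow> i | Suc n \<Rightarrow> j \<cdot> inc n)"
  define prj' where "prj' = (\<lambda>n. case n of 0 \<Rightarrow> p | Suc n \<Rightarrow> prj n \<cdot> q)"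
  have i': "inc' 0 = i" "\<And>n. inc' (Suc n) = j \<cdot> inc n" "prj' 0 = p" "\<And>n. prj' (Suc n) = prj n \<cdot> q"
    by (auto simp: inc'_def prj'_def)
  note ji = arr_cmp[OF a(3) b(3)] and pq = arr_cmp[OF b(4) a(4)]
  note ip = arr_cmp[OF a(4) a(3)]
  have I: "arr C (inc' n) ((X # Xs) ! n) R" "arr C (prj' n) R ((X # Xs) ! n)"
    if "n < length (X # Xs)" for n
    using that b ji pq by (cases n; auto simp: i')+
  have "direct_sum C R (X # Xs)"
  proof (rule direct_sumI[where inc = inc' and prj = prj'])
    fix n m assume nm: "n < length (X # Xs)" "m < length (X # Xs)"
    show "prj' m \<cdot> inc' n = (if n = m then Idn C ((X # Xs) ! n) else \<zero>\<^bsub>Hom C ((X # Xs) ! n) ((X # Xs) ! m)\<^esub>)"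
    proof (cases n)
      case 0
      show ?thesis
      proof (cases m)
        case (Suc m')
        then have m: "m' < length Xs" using nm by simp
        have "(prj m' \<cdot> q) \<cdot> i = prj m' \<cdot> (q \<cdot> i)" using assoc[OF b(1,4) a(4)[OF m]] by simp
        then show ?thesis using Suc 0 b(7) cmp_zeror[OF a(4)[OF m]] arrD(1)[OF b(1)] by (simp add: i')
      qed (use 0 b in \<open>simp add: i'\<close>)
    next
      case (Suc n')
      then have n: "n' < length Xs" using nm by simp
      show ?thesis
      proof (cases m)
        case 0
        have "p \<cdot> (j \<cdot> inc n') = (p \<cdot> j) \<cdot> inc n'" using assoc[OF a(3)[OF n] b(3,2)] .
        then show ?thesis using Suc 0 b(8) cmp_zerol[OF a(3)[OF n]] arrD(1)[OF b(1)] by (simp add: i')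
      next
        case (Suc m')
        then have m: "m' < length Xs" using nm by simp
        have "(prj m' \<cdot> q) \<cdot> (j \<cdot> inc n') = prj m' \<cdot> ((q \<cdot> j) \<cdot> inc n')"
          using assoc4[OF a(3)[OF n] b(3,4) a(4)[OF m]] .
        then show ?thesis using Suc \<open>n = Suc n'\<close> b(6) a(5)[OF n m] idl[OF a(3)[OF n]] by (simp add: i')
      qed
    qed
  next
    have "finsum (Hom C R R) (\<lambda>n. inc' n \<cdot> prj' n) {..<length (X # Xs)}
       = (i \<cdot> p) \<oplus>\<^bsub>Hom C R R\<^esub> finsum (Hom C R R) (\<lambda>n. (j \<cdot> inc n) \<cdot> prj n \<cdot> q) {..<length Xs}"
      using arrD(3)[OF arr_cmp[OF I(2) I(1)]]
      by (simp del: lessThan_Suc add: R.finsum_lessThan_Suc_shift i')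
    also have "finsum (Hom C R R) (\<lambda>n. (j \<cdot> inc n) \<cdot> prj n \<cdot> q) {..<length Xs}
       = finsum (Hom C R R) (\<lambda>n. j \<cdot> ((inc n \<cdot> prj n) \<cdot> q)) {..<length Xs}"
      using assoc4[OF b(4) a(4) a(3) b(3)] arr_cmp[OF arr_cmp[OF b(4) ip] b(3)] R
      by (intro finsum_arr_cong) auto
    also have "\<dots> = j \<cdot> (finsum (Hom C S S) (\<lambda>i. inc i \<cdot> prj i) {..<length Xs} \<cdot> q)"
      using ip b R a(1)
      by (subst cmp_finsuml[OF _ _ b(4)]) (auto intro!: cmp_finsumr[symmetric] arr_cmp[OF b(4)])
    also have "\<dots> = j \<cdot> q" using a(6) b by (simp add: idl)
    finally show "finsum (Hom C R R) (\<lambda>n. inc' n \<cdot> prj' n) {..<length (X # Xs)} = Idn C R"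
      using b(9) by simp
  qed (use I R Cons in auto)
  then show ?case by blast
qed

section \<open>Additive functors\<close>

text \<open>\<open>Fm\<close> receives source and target because Hom(T,-) needs them: its maps are
  zero off the source, so they depend on more than the morphism. The shift ignores these two
  arguments.\<close>

locale additive_functor = C: linear_category K C + C': linear_category K' C'
  for K :: "('k, 'r) ring_scheme" and C :: "('o, 'm, 'k, 'z) lincat_scheme"
    and K' :: "('l, 's) ring_scheme" and C' :: "('p, 'n, 'l, 'y) lincat_scheme" +
  fixes F :: "'o \<Rightarrow> 'p" and Fm :: "'o \<Rightarrow> 'o \<Rightarrow> 'm \<Rightarrow> 'n"
  assumes F_obj: "A \<in> Obj C \<Longrightarrow> F A \<in> Obj C'"
    and F_arr: "arr C f A B \<Longrightarrow> arr C' (Fm A B f) (F A) (F B)"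
    and F_idn: "A \<in> Obj C \<Longrightarrow> Fm A A (Idn C A) = Idn C' (F A)"
    and F_add: "\<lbrakk>arr C f A B; arr C g A B\<rbrakk>
        \<Longrightarrow> Fm A B (f \<oplus>\<^bsub>Hom C A B\<^esub> g) = Fm A B f \<oplus>\<^bsub>Hom C' (F A) (F B)\<^esub> Fm A B g"
    and F_cmp: "\<lbrakk>arr C f A B; arr C g B E\<rbrakk> \<Longrightarrow> Fm A E (g \<cdot>\<^bsub>C\<^esub> f) = Fm B E g \<cdot>\<^bsub>C'\<^esub> Fm A B f"
begin

lemma F_zero: assumes "A \<in> Obj C" "B \<in> Obj C"
  shows "Fm A B \<zero>\<^bsub>Hom C A B\<^esub> = \<zero>\<^bsub>Hom C' (F A) (F B)\<^esub>"
proof -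
  have z: "arr C \<zero>\<^bsub>Hom C A B\<^esub> A B" using C.arr_zero assms .
  interpret AB: abelian_group "Hom C A B" using C.arr_ab[OF z] .
  interpret FAB: abelian_group "Hom C' (F A) (F B)" using C'.arr_ab[OF F_arr[OF z]] .
  show ?thesis using F_add[OF z z] arrD(3)[OF F_arr[OF z]]
    by (metis AB.l_zero AB.zero_closed FAB.add.l_cancel_one')
qed

lemma F_finsum:
  assumes "finite I" "\<And>i. i \<in> I \<Longrightarrow> arr C (f i) A B" "A \<in> Obj C" "B \<in> Obj C"
  shows "Fm A B (finsum (Hom C A B) f I) = finsum (Hom C' (F A) (F B)) (\<lambda>i. Fm A B (f i)) I"
  using assms(1,2)
proof (induction I rule: finite_induct)
  case empty
  then show ?case using assms abelian_group.axioms(1)[OF C.hom_ab] abelian_group.axioms(1)[OF C'.hom_ab]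
    by (metis abelian_monoid.finsum_empty F_zero F_obj)
next
  case (insert x I)
  interpret AB: abelian_group "Hom C A B" using assms C.hom_ab by blast
  interpret AE: abelian_group "Hom C' (F A) (F B)" using assms C'.hom_ab F_obj by blast
  have 1: "f \<in> I \<rightarrow> carrier (Hom C A B)" "f x \<in> carrier (Hom C A B)"
    using arrD(3)[OF insert.prems] by auto
  have 2: "(\<lambda>i. Fm A B (f i)) \<in> I \<rightarrow> carrier (Hom C' (F A) (F B))" "Fm A B (f x) \<in> carrier (Hom C' (F A) (F B))"
    using arrD(3)[OF F_arr[OF insert.prems]] by auto
  have 3: "arr C (finsum (Hom C A B) f I) A B"
    using insert.prems assms by (intro C.arr_finsum) auto
  have IH: "Fm A B (finsum (Hom C A B) f I) = finsum (Hom C' (F A) (F B)) (\<lambda>i. Fm A B (f i)) I"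
    using insert by blast
  have "Fm A B (finsum (Hom C A B) f (insert x I)) = Fm A B (f x \<oplus>\<^bsub>Hom C A B\<^esub> finsum (Hom C A B) f I)"
    using AB.finsum_insert[OF insert.hyps 1] by simp
  also have "\<dots> = Fm A B (f x) \<oplus>\<^bsub>Hom C' (F A) (F B)\<^esub> Fm A B (finsum (Hom C A B) f I)"
    using insert.prems 3 by (intro F_add) auto
  also have "\<dots> = finsum (Hom C' (F A) (F B)) (\<lambda>i. Fm A B (f i)) (insert x I)"
    unfolding IH using AE.finsum_insert[OF insert.hyps 2] by simp
  finally show ?case .
qed

lemma F_direct_sum:
  assumes "direct_sum C S Xs"
  shows "direct_sum C' (F S) (map F Xs)"
proof -
  obtain inc prj where a: "S \<in> Obj C" "set Xs \<subseteq> Obj C"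
    "\<And>i. i < length Xs \<Longrightarrow> arr C (inc i) (Xs ! i) S"
    "\<And>i. i < length Xs \<Longrightarrow> arr C (prj i) S (Xs ! i)"
    "\<And>i j. \<lbrakk>i < length Xs; j < length Xs\<rbrakk> \<Longrightarrow>
       prj j \<cdot>\<^bsub>C\<^esub> inc i = (if i = j then Idn C (Xs ! i) else \<zero>\<^bsub>Hom C (Xs ! i) (Xs ! j)\<^esub>)"
    "finsum (Hom C S S) (\<lambda>i. inc i \<cdot>\<^bsub>C\<^esub> prj i) {..<length Xs} = Idn C S"
    by (rule C.direct_sumE[OF assms(1)]) (rule that)
  have o: "Xs ! i \<in> Obj C" if "i < length Xs" for i using a(2) that by auto
  show ?thesis
  proof (rule C'.direct_sumI[where inc = "\<lambda>i. Fm (Xs ! i) S (inc i)" and prj = "\<lambda>i. Fm S (Xs ! i) (prj i)"])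
    fix i j assume "i < length (map F Xs)" "j < length (map F Xs)"
    then have l: "i < length Xs" "j < length Xs" by auto
    show "Fm S (Xs ! j) (prj j) \<cdot>\<^bsub>C'\<^esub> Fm (Xs ! i) S (inc i) =
           (if i = j then Idn C' (map F Xs ! i) else \<zero>\<^bsub>Hom C' (map F Xs ! i) (map F Xs ! j)\<^esub>)"
      using F_cmp[OF a(3)[OF l(1)] a(4)[OF l(2)]] a(5)[OF l] o l by (auto simp: F_idn F_zero)
  next
    have "finsum (Hom C' (F S) (F S)) (\<lambda>i. Fm (Xs ! i) S (inc i) \<cdot>\<^bsub>C'\<^esub> Fm S (Xs ! i) (prj i)) {..<length Xs}
      = finsum (Hom C' (F S) (F S)) (\<lambda>i. Fm S S (inc i \<cdot>\<^bsub>C\<^esub> prj i)) {..<length Xs}"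
      using a F_obj
      by (intro C'.finsum_arr_cong) (auto simp: F_cmp[OF a(4) a(3)] intro!: C'.arr_cmp[OF F_arr[OF a(4)] F_arr[OF a(3)]])
    also have "\<dots> = Idn C' (F S)"
      using a(1,6) C.arr_cmp[OF a(4) a(3)] by (subst F_finsum[symmetric]) (auto simp: F_idn)
    finally show "finsum (Hom C' (F S) (F S)) (\<lambda>i. Fm (Xs ! i) S (inc i) \<cdot>\<^bsub>C'\<^esub> Fm S (Xs ! i) (prj i)) {..<length (map F Xs)}
      = Idn C' (F S)" by simp
  qed (use a F_obj in \<open>auto intro: F_arr\<close>)
qed

lemma F_summand: "summand C Z X \<Longrightarrow> summand C' (F Z) (F X)"
  unfolding summand_def using F_direct_sum by fastforce

lemma F_add_closure: "Z \<in> add_closure C M \<Longrightarrow> F Z \<in> add_closure C' (F M)"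
  unfolding add_closure_def using F_direct_sum F_summand by fastforce

end

section \<open>Triangulated categories\<close>

context triangulated_category
begin

sublocale shift: additive_functor K D K D "Sh D" "\<lambda>A B. ShM D"
proof
  have f: "linear_functor D D (carrier K) (Sh D) (ShM D)"
    using shift by (simp add: linear_equivalence_def)
  show "A \<in> Obj D \<Longrightarrow> Sh D A \<in> Obj D" for A using f by (simp add: linear_functor_def)
  show "A \<in> Obj D \<Longrightarrow> ShM D (Idn D A) = Idn D (Sh D A)" for A using f by (simp add: linear_functor_def)
  show "arr D f A B \<Longrightarrow> arr D (ShM D f) (Sh D A) (Sh D B)" for f A B
    using f by (simp add: linear_functor_def arr_def)
  show "\<lbrakk>arr D f A B; arr D g A B\<rbrakk>
    \<Longrightarrow> ShM D (f \<oplus>\<^bsub>Hom D A B\<^esub> g) = ShM D f \<oplus>\<^bsub>Hom D (Sh D A) (Sh D B)\<^esub> ShM D g" for f g A B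
    using f by (simp add: linear_functor_def arr_def)
  show "\<lbrakk>arr D f A B; arr D g B E\<rbrakk> \<Longrightarrow> ShM D (g \<cdot> f) = ShM D g \<cdot> ShM D f" for f g A B E
    using f unfolding linear_functor_def arr_def by blast
qed

lemmas Sh_obj = shift.F_obj and Sh_arr = shift.F_arr and Sh_idn = shift.F_idn
  and Sh_cmp = shift.F_cmp and Sh_zero = shift.F_zero

lemma Sh_bij: "\<lbrakk>A \<in> Obj D; B \<in> Obj D\<rbrakk> \<Longrightarrow>
    bij_betw (ShM D) (carrier (Hom D A B)) (carrier (Hom D (Sh D A) (Sh D B)))"
  using shift by (simp add: linear_equivalence_def)

lemma Sh_full: assumes "arr D u (Sh D A) (Sh D B)" "A \<in> Obj D" "B \<in> Obj D"
  obtains f where "arr D f A B" "ShM D f = u"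
proof -
  have "u \<in> ShM D ` carrier (Hom D A B)"
    using Sh_bij[OF assms(2,3)] arrD(3)[OF assms(1)] by (simp add: bij_betw_def)
  then show ?thesis using that assms(2,3) by (auto simp: arr_def)
qed

lemma Sh_inj: assumes "arr D f A B" "arr D g A B" "ShM D f = ShM D g"
  shows "f = g"
  using Sh_bij[OF arrD(1,2)[OF assms(1)]] arrD(3)[OF assms(1)] arrD(3)[OF assms(2)] assms(3)
  by (auto simp: bij_betw_def inj_on_def)

lemma Sh_ess: assumes "B \<in> Obj D"
  obtains A e e' where "A \<in> Obj D" "arr D e (Sh D A) B" "arr D e' B (Sh D A)"
    "e' \<cdot> e = Idn D (Sh D A)" "e \<cdot> e' = Idn D B"
proof -
  from shift assms obtain A where A: "A \<in> Obj D" "isomorphic D (Sh D A) B"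
    by (auto simp: linear_equivalence_def)
  then obtain e where "iso_arrow D (Sh D A) B e" by (auto simp: isomorphic_def)
  then show ?thesis by (rule iso_arrowD) (use A assms Sh_obj that in auto)
qed

section \<open>Exact sequences obtained from a triangle\<close>

lemma triD: assumes "Tri D X Y Z f g h"
  shows "arr D f X Y" "arr D g Y Z" "arr D h Z (Sh D X)"
  using tri_typed[OF assms] Sh_obj by (auto simp: pre_triangle_def arr_def)

lemma pre_triangleI: "\<lbrakk>arr D f X Y; arr D g Y Z; arr D h Z (Sh D X)\<rbrakk> \<Longrightarrow> pre_triangle D X Y Z f g h"
  by (auto simp: pre_triangle_def arr_def)

lemma rotate: assumes "Tri D X Y Z f g h"
  shows "Tri D Y Z (Sh D X) g h (\<ominus>\<^bsub>Hom D (Sh D X) (Sh D Y)\<^esub> ShM D f)"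
  using assms TR2 tri_typed by blast

text \<open>TR3 only fills in the third morphism. Both the trivial triangle on \<open>A\<close> and
  the given one are therefore rotated once, so that the missing morphism A -> X appears, shifted, in
  the third place. The signs of the two rotations cancel.\<close>

lemma tri_exact_cov:
  assumes "Tri D X Y Z f g h" "arr D u A Y" "g \<cdot> u = \<zero>\<^bsub>Hom D A Z\<^esub>"
  obtains u' where "arr D u' A X" "f \<cdot> u' = u"
proof -
  obtain N where N: "zero_object D N" using ex_zero_object by blast
  have A: "A \<in> Obj D" and N': "N \<in> Obj D" and Z: "Z \<in> Obj D"
    using arrD[OF assms(2)] N arrD[OF triD(2)[OF assms(1)]] by (auto simp: zero_object_def)
  note t = triD[OF assms(1)]
  have r: "Tri D A N (Sh D A) \<zero>\<^bsub>Hom D A N\<^esub> \<zero>\<^bsub>Hom D N (Sh D A)\<^esub> (\<ominus>\<^bsub>Hom D (Sh D A) (Sh D A)\<^esub> ShM D (Idn D A))"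
    using rotate[OF TR1_idn[OF A N]] .
  have "\<zero>\<^bsub>Hom D N Z\<^esub> \<cdot> \<zero>\<^bsub>Hom D A N\<^esub> = g \<cdot> u"
    using assms(3) cmp_zeror[OF arr_zero[OF N' Z] A] by simp
  then obtain c where c: "arr D c (Sh D A) (Sh D X)"
      "ShM D u \<cdot> (\<ominus>\<^bsub>Hom D (Sh D A) (Sh D A)\<^esub> ShM D (Idn D A)) = (\<ominus>\<^bsub>Hom D (Sh D X) (Sh D Y)\<^esub> ShM D f) \<cdot> c"
    using TR3[OF r rotate[OF assms(1)] arrD(3)[OF assms(2)] arrD(3)[OF arr_zero[OF N' Z]]]
      Sh_obj A arrD(1)[OF t(1)] by (auto simp: arr_def)
  obtain v where v: "arr D v A X" "ShM D v = c" using Sh_full[OF c(1) A arrD(1)[OF t(1)]] .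
  have Sf: "arr D (ShM D f) (Sh D X) (Sh D Y)" and Su: "arr D (ShM D u) (Sh D A) (Sh D Y)"
    using Sh_arr t assms by blast+
  have "ShM D u \<cdot> (\<ominus>\<^bsub>Hom D (Sh D A) (Sh D A)\<^esub> ShM D (Idn D A)) = \<ominus>\<^bsub>Hom D (Sh D A) (Sh D Y)\<^esub> ShM D u"
    using cmp_negr[OF arr_idn[OF Sh_obj[OF A]] Su] Su by (simp add: Sh_idn A idr)
  moreover have "(\<ominus>\<^bsub>Hom D (Sh D X) (Sh D Y)\<^esub> ShM D f) \<cdot> c = \<ominus>\<^bsub>Hom D (Sh D A) (Sh D Y)\<^esub> ShM D (f \<cdot> v)"
    using cmp_negl[OF c(1) Sf] Sh_cmp[OF v(1) t(1)] v(2) by simp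
  ultimately have "ShM D u = ShM D (f \<cdot> v)"
    using c(2) neg_neg[OF Su] neg_neg[OF Sh_arr[OF arr_cmp[OF v(1) t(1)]]] by metis
  then have "u = f \<cdot> v" using Sh_inj[OF assms(2) arr_cmp[OF v(1) t(1)]] by simp
  then show ?thesis using that v by simp
qed

lemma zero_object_Sh: assumes "zero_object D N" shows "zero_object D (Sh D N)"
  using assms Sh_idn[of N] Sh_zero[of N N] Sh_obj by (auto simp: zero_object_def)

lemma tri_exact_con:
  assumes "Tri D X Y Z f g h" "arr D u Y A" "u \<cdot> f = \<zero>\<^bsub>Hom D X A\<^esub>"
  obtains u' where "arr D u' Z A" "u' \<cdot> g = u"
proof -
  obtain N where N: "zero_object D N" using ex_zero_object by blast
  note t = triD[OF assms(1)]
  have A: "A \<in> Obj D" and N': "N \<in> Obj D" and X: "X \<in> Obj D" and Z: "Z \<in> Obj D"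
    using arrD[OF assms(2)] N arrD[OF t(1)] arrD[OF t(2)] by (auto simp: zero_object_def)
  \<comment> \<open>TR2 is read backwards to move the zero vertex of the trivial triangle on
    \<open>A\<close> to the front; the sign is harmless on a zero morphism.\<close>
  have "\<ominus>\<^bsub>Hom D (Sh D N) (Sh D A)\<^esub> ShM D \<zero>\<^bsub>Hom D N A\<^esub> = \<zero>\<^bsub>Hom D (Sh D N) (Sh D A)\<^esub>"
    using Sh_zero[OF N' A] abelian_group.neg_zero[OF hom_ab[OF Sh_obj[OF N'] Sh_obj[OF A]]] by simp
  then have "Tri D N A A \<zero>\<^bsub>Hom D N A\<^esub> (Idn D A) \<zero>\<^bsub>Hom D A (Sh D N)\<^esub>"
    using TR2[OF pre_triangleI[OF arr_zero[OF N' A] arr_idn[OF A] arr_zero[OF A Sh_obj[OF N']]]]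
      TR1_idn[OF A zero_object_Sh[OF N]] by simp
  note T = TR3[OF assms(1) this arrD(3)[OF arr_zero[OF X N']] arrD(3)[OF assms(2)]]
  have "u \<cdot> f = \<zero>\<^bsub>Hom D N A\<^esub> \<cdot> \<zero>\<^bsub>Hom D X N\<^esub>"
    using assms(3) cmp_zeror[OF arr_zero[OF N' A] X] by simp
  then obtain c where "c \<in> carrier (Hom D Z A)" "c \<cdot> g = Idn D A \<cdot> u" using T by blast
  then show ?thesis using that[of c] assms(2) A Z by (simp add: idl arr_def)
qed

text \<open>TR3 maps the trivial triangle on \<open>X\<close>, whose third vertex is zero, to the
  given triangle; hence the composite passes through zero.\<close>

lemma tri_comp1: assumes "Tri D X Y Z f g h" shows "g \<cdot> f = \<zero>\<^bsub>Hom D X Z\<^esub>"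
proof -
  obtain N where N: "zero_object D N" using ex_zero_object by blast
  note t = triD[OF assms(1)]
  have N': "N \<in> Obj D" and X: "X \<in> Obj D" and Z: "Z \<in> Obj D"
    using N arrD[OF t(1)] arrD[OF t(2)] by (auto simp: zero_object_def)
  have "f \<cdot> Idn D X = f \<cdot> Idn D X" ..
  then obtain c where "c \<in> carrier (Hom D N Z)" "c \<cdot> \<zero>\<^bsub>Hom D X N\<^esub> = g \<cdot> f"
    using TR3[OF TR1_idn[OF X N] assms arrD(3)[OF arr_idn[OF X]] arrD(3)[OF t(1)]] by blast
  then show ?thesis using cmp_zeror[of c N Z X] N' X Z by (simp add: arr_def)
qed

lemma tri_comp2: "Tri D X Y Z f g h \<Longrightarrow> h \<cdot> g = \<zero>\<^bsub>Hom D Y (Sh D X)\<^esub>"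
  using tri_comp1[OF rotate] .

lemma tri_comp3: assumes "Tri D X Y Z f g h" shows "ShM D f \<cdot> h = \<zero>\<^bsub>Hom D Z (Sh D Y)\<^esub>"
proof -
  note t = triD[OF assms]
  have "\<ominus>\<^bsub>Hom D Z (Sh D Y)\<^esub> (ShM D f \<cdot> h) = \<zero>\<^bsub>Hom D Z (Sh D Y)\<^esub>"
    using tri_comp2[OF rotate[OF assms]] cmp_negl[OF t(3) Sh_arr[OF t(1)]] by simp
  then show ?thesis using neg_eq_zero_iff[OF arr_cmp[OF t(3) Sh_arr[OF t(1)]]] by simp
qed

text \<open>This and the next lemmas rotate the two exactness statements. The sign that a rotation
  puts on a morphism does not change what it kills, and elsewhere it is passed on to the
  lift.\<close>

lemma tri_exact_cov1:
  assumes "Tri D X Y Z f g h" "arr D u A Z" "h \<cdot> u = \<zero>\<^bsub>Hom D A (Sh D X)\<^esub>"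
  obtains u' where "arr D u' A Y" "g \<cdot> u' = u"
  using tri_exact_cov[OF rotate[OF assms(1)] assms(2,3)] .

lemma tri_exact_cov2:
  assumes "Tri D X Y Z f g h" "arr D u A (Sh D X)" "ShM D f \<cdot> u = \<zero>\<^bsub>Hom D A (Sh D Y)\<^esub>"
  obtains u' where "arr D u' A Z" "h \<cdot> u' = u"
proof -
  have Sf: "arr D (ShM D f) (Sh D X) (Sh D Y)" using Sh_arr[OF triD(1)[OF assms(1)]] .
  have "(\<ominus>\<^bsub>Hom D (Sh D X) (Sh D Y)\<^esub> ShM D f) \<cdot> u = \<zero>\<^bsub>Hom D A (Sh D Y)\<^esub>"
    using cmp_negl[OF assms(2) Sf] assms(3) neg_eq_zero_iff[OF arr_cmp[OF assms(2) Sf]] by simp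
  then show ?thesis using tri_exact_cov[OF rotate[OF rotate[OF assms(1)]] assms(2)] that by blast
qed

lemma tri_exact_cov3:
  assumes "Tri D X Y Z f g h" "arr D u A (Sh D Y)" "ShM D g \<cdot> u = \<zero>\<^bsub>Hom D A (Sh D Z)\<^esub>"
  obtains u' where "arr D u' A (Sh D X)" "ShM D f \<cdot> u' = u"
proof -
  have Sf: "arr D (ShM D f) (Sh D X) (Sh D Y)" using Sh_arr[OF triD(1)[OF assms(1)]] .
  obtain v where v: "arr D v A (Sh D X)" "(\<ominus>\<^bsub>Hom D (Sh D X) (Sh D Y)\<^esub> ShM D f) \<cdot> v = u"
    using tri_exact_cov2[OF rotate[OF assms(1)] assms(2,3)] .
  have "ShM D f \<cdot> (\<ominus>\<^bsub>Hom D A (Sh D X)\<^esub> v) = u"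
    using v cmp_negl[OF v(1) Sf] cmp_negr[OF v(1) Sf] by simp
  then show ?thesis using that arr_neg[OF v(1)] by blast
qed

lemma tri_exact_con1:
  assumes "Tri D X Y Z f g h" "arr D u Z A" "u \<cdot> g = \<zero>\<^bsub>Hom D Y A\<^esub>"
  obtains u' where "arr D u' (Sh D X) A" "u' \<cdot> h = u"
  using tri_exact_con[OF rotate[OF assms(1)] assms(2,3)] .

lemma tri_exact_con2:
  assumes "Tri D X Y Z f g h" "arr D u (Sh D X) A" "u \<cdot> h = \<zero>\<^bsub>Hom D Z A\<^esub>"
  obtains u' where "arr D u' (Sh D Y) A" "u' \<cdot> ShM D f = u"
proof -
  have Sf: "arr D (ShM D f) (Sh D X) (Sh D Y)" using Sh_arr[OF triD(1)[OF assms(1)]] .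
  obtain v where v: "arr D v (Sh D Y) A" "v \<cdot> (\<ominus>\<^bsub>Hom D (Sh D X) (Sh D Y)\<^esub> ShM D f) = u"
    using tri_exact_con1[OF rotate[OF assms(1)] assms(2,3)] .
  have "(\<ominus>\<^bsub>Hom D (Sh D Y) A\<^esub> v) \<cdot> ShM D f = u"
    using v cmp_negl[OF Sf v(1)] cmp_negr[OF Sf v(1)] by simp
  then show ?thesis using that arr_neg[OF v(1)] by blast
qed

text \<open>TR1 provides cones only. The cone of \<open>f\<close> is of the form W[1] merely up to
  isomorphism, the shift being an autoequivalence; after replacing it by W[1] the triangle is
  rotated back, and the sign in the choice of \<open>k\<close> cancels that of TR2.\<close>

lemma cocone:
  assumes "arr D f Y Z"
  obtains W k c where "Tri D W Y Z k f c"
proof -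
  obtain E c d where t: "Tri D Y Z E f c d" using TR1_cone arrD[OF assms] by blast
  note a = triD[OF t]
  note Y = arrD(1)[OF assms] and Z = arrD(2)[OF assms]
  obtain W e e' where W: "W \<in> Obj D" "arr D e (Sh D W) E" "arr D e' E (Sh D W)"
    "e' \<cdot> e = Idn D (Sh D W)" "e \<cdot> e' = Idn D E" using Sh_ess[OF arrD(2)[OF a(2)]] .
  have ec: "arr D (e' \<cdot> c) Z (Sh D W)" and de: "arr D (d \<cdot> e) (Sh D W) (Sh D Y)"
    using arr_cmp W a by blast+
  have "ShM D (Idn D Y) \<cdot> d = (d \<cdot> e) \<cdot> e'"
    using assoc[OF W(3,2) a(3)] W(5) a(3) Y by (simp add: Sh_idn idl idr)
  then have t': "Tri D Y Z (Sh D W) f (e' \<cdot> c) (d \<cdot> e)"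
    using TR1_iso[OF t pre_triangleI[OF assms ec de], of "Idn D Y" "Idn D Z" e'] Y Z W
      iso_arrowI[OF arr_idn arr_idn] iso_arrowI[OF W(3,2,5,4)] idl[OF arr_idn] idl[OF assms] idr[OF assms] idr[OF ec]
    by simp
  obtain k where k: "arr D k W Y" "ShM D k = \<ominus>\<^bsub>Hom D (Sh D W) (Sh D Y)\<^esub> (d \<cdot> e)"
    using Sh_full[OF arr_neg[OF de] W(1) Y] .
  have "\<ominus>\<^bsub>Hom D (Sh D W) (Sh D Y)\<^esub> ShM D k = d \<cdot> e" using k neg_neg[OF de] by simp
  then have "Tri D W Y Z k f (e' \<cdot> c)"
    using TR2[OF pre_triangleI[OF k(1) assms ec]] t' by simp
  then show ?thesis using that by blast
qed

text \<open>\<open>v\<close> is regarded as the class of an extension of \<open>Z\<close> by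
  \<open>X\<close>, and \<open>B\<close> is its middle term.\<close>

lemma extension_triangle:
  assumes "arr D v Z (Sh D X)" "X \<in> Obj D"
  obtains B s b where "Tri D X B Z s b v"
proof -
  obtain B b c where t: "Tri D B Z (Sh D X) b v c" using cocone[OF assms(1)] .
  note a = triD[OF t]
  have B: "B \<in> Obj D" using arrD(1)[OF a(1)] .
  obtain s where s: "arr D s X B" "ShM D s = \<ominus>\<^bsub>Hom D (Sh D X) (Sh D B)\<^esub> c"
    using Sh_full[OF arr_neg[OF a(3)] assms(2) B] .
  have "\<ominus>\<^bsub>Hom D (Sh D X) (Sh D B)\<^esub> ShM D s = c" using s neg_neg[OF a(3)] by simp
  then have "Tri D X B Z s b v" using TR2[OF pre_triangleI[OF s(1) a(1) assms(1)]] t by simp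
  then show ?thesis using that by blast
qed

text \<open>A split monomorphism has a zero connecting morphism, so its cone is a complement.\<close>

lemma retract_direct_sum:
  assumes "arr D i Y M" "arr D p M Y" "p \<cdot> i = Idn D Y"
  obtains Z where "direct_sum D M [Y, Z]"
proof -
  obtain Z q h where t: "Tri D Y M Z i q h" using TR1_cone arrD[OF assms(1)] by blast
  note a = triD[OF t]
  have Y: "Y \<in> Obj D" and M: "M \<in> Obj D" and Z: "Z \<in> Obj D" using arrD(1,2)[OF a(1)] arrD(2)[OF a(2)]
    by auto
  have "ShM D p \<cdot> ShM D i = Idn D (Sh D Y)" using Sh_cmp[OF assms(1,2)] assms(3) Sh_idn[OF Y] by simp
  then have "h = ShM D p \<cdot> (ShM D i \<cdot> h)"
    using assoc[OF a(3) Sh_arr[OF a(1)] Sh_arr[OF assms(2)]] idl[OF a(3)] by simp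
  then have h: "h = \<zero>\<^bsub>Hom D Z (Sh D Y)\<^esub>"
    using tri_comp3[OF t] cmp_zeror[OF Sh_arr[OF assms(2)] Z] by simp
  obtain k where k: "arr D k Z M" "q \<cdot> k = Idn D Z"
    using tri_exact_cov1[OF t arr_idn[OF Z]] h cmp_zerol[OF arr_idn[OF Z] Sh_obj[OF Y]] by blast
  note ipk = arr_cmp[OF arr_cmp[OF k(1) assms(2)] assms(1)]
  \<comment> \<open>The section \<open>k\<close> of \<open>q\<close>, corrected so that
    \<open>p\<close> kills it; the correction does not disturb \<open>q \<cdot> k\<close> because
    \<open>q \<cdot> i\<close> is zero.\<close>
  define j where "j = k \<ominus>\<^bsub>Hom D Z M\<^esub> (i \<cdot> (p \<cdot> k))"
  have j: "arr D j Z M" unfolding j_def using arr_minus[OF k(1) ipk] .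
  interpret ZZ: abelian_group "Hom D Z Z" using hom_ab[OF Z Z] .
  interpret MM: abelian_group "Hom D M M" using hom_ab[OF M M] .
  interpret ZM: abelian_group "Hom D Z M" using hom_ab[OF Z M] .
  have "q \<cdot> (i \<cdot> (p \<cdot> k)) = \<zero>\<^bsub>Hom D Z Z\<^esub>"
    using assoc[OF arr_cmp[OF k(1) assms(2)] a(1,2)] tri_comp1[OF t] cmp_zerol[OF arr_cmp[OF k(1) assms(2)] Z]
    by simp
  then have qj: "q \<cdot> j = Idn D Z"
    unfolding j_def using cmp_minusr[OF k(1) ipk a(2)] k(2) arrD(3)[OF arr_idn[OF Z]]
    by (simp add: a_minus_def ZZ.neg_zero)
  have "p \<cdot> (i \<cdot> (p \<cdot> k)) = p \<cdot> k"
    using assoc[OF arr_cmp[OF k(1) assms(2)] assms(1,2)] assms(3) idl[OF arr_cmp[OF k(1) assms(2)]]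
    by simp
  then have pj: "p \<cdot> j = \<zero>\<^bsub>Hom D Z Y\<^esub>"
    unfolding j_def
    using cmp_minusr[OF k(1) ipk assms(2)] minus_eq_zero_iff[OF arr_cmp[OF k(1) assms(2)] arr_cmp[OF k(1) assms(2)]]
    by simp
  note ip = arr_cmp[OF assms(2,1)]
  have e: "arr D (Idn D M \<ominus>\<^bsub>Hom D M M\<^esub> (i \<cdot> p)) M M" using arr_minus[OF arr_idn[OF M] ip] .
  have "(i \<cdot> p) \<cdot> i = i" using assoc[OF assms(1,2,1)] assms(3) idr[OF assms(1)] by simp
  then have "(Idn D M \<ominus>\<^bsub>Hom D M M\<^esub> (i \<cdot> p)) \<cdot> i = \<zero>\<^bsub>Hom D Y M\<^esub>"
    using cmp_minusl[OF assms(1) arr_idn[OF M] ip] idl[OF assms(1)] minus_eq_zero_iff[OF assms(1,1)]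
    by simp
  \<comment> \<open>The idempotent complementary to \<open>i \<cdot> p\<close> kills
    \<open>i\<close> and so factors through \<open>q\<close>. Evaluating on \<open>j\<close> shows
    that the factor \<open>r\<close> is \<open>j\<close> itself.\<close>
  then obtain r where r: "arr D r Z M" "r \<cdot> q = Idn D M \<ominus>\<^bsub>Hom D M M\<^esub> (i \<cdot> p)"
    using tri_exact_con[OF t e] by blast
  have "(i \<cdot> p) \<cdot> j = \<zero>\<^bsub>Hom D Z M\<^esub>" using assoc[OF j assms(2,1)] pj cmp_zeror[OF assms(1) Z] by simp
  then have "(r \<cdot> q) \<cdot> j = j"
    unfolding r(2) using cmp_minusl[OF j arr_idn[OF M] ip] idl[OF j] arrD(3)[OF j]
    by (simp add: a_minus_def ZM.neg_zero)
  then have "r = j" using assoc[OF j a(2) r(1)] qj idr[OF r(1)] by simp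
  then have jq: "j \<cdot> q = Idn D M \<ominus>\<^bsub>Hom D M M\<^esub> (i \<cdot> p)" using r by simp
  have "(i \<cdot> p) \<oplus>\<^bsub>Hom D M M\<^esub> (j \<cdot> q) = Idn D M"
    unfolding jq using arrD(3)[OF ip] arrD(3)[OF arr_idn[OF M]]
    by (simp add: a_minus_def MM.a_lcomm MM.r_neg)
  then have "direct_sum D M [Y, Z]"
    using direct_sum2I[OF assms(1,2) j a(2) assms(3) qj tri_comp1[OF t] pj] by simp
  then show ?thesis using that by blast
qed

end

section \<open>Left modules of finite length\<close>

lemma (in abelian_group) add_minus_cancel:
  assumes "x \<in> carrier G" "y \<in> carrier G" shows "x \<oplus> (y \<oplus> \<ominus> x) = y"
  using a_lcomm[of x y "\<ominus> x"] assms by (simp add: r_neg)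

lemma module_left_module: assumes "module R M" shows "left_module R M"
proof -
  interpret module R M by fact
  show ?thesis
    by (intro left_module.intro left_module_axioms.intro R.ring_axioms M.abelian_group_axioms)
      (auto simp: smult_l_distr smult_r_distr smult_assoc1)
qed

context left_module
begin

lemma smult_zero_right [simp]: assumes "a \<in> carrier R" shows "a \<odot>\<^bsub>M\<^esub> \<zero>\<^bsub>M\<^esub> = \<zero>\<^bsub>M\<^esub>"
  using smult_r_distr[OF assms M.zero_closed M.zero_closed] smult_closed[OF assms M.zero_closed]
  by (metis M.add.l_cancel_one' M.l_zero M.zero_closed)

lemma smult_zero_left [simp]: assumes "x \<in> carrier M" shows "\<zero>\<^bsub>R\<^esub> \<odot>\<^bsub>M\<^esub> x = \<zero>\<^bsub>M\<^esub>"
  using smult_l_distr[OF R.zero_closed R.zero_closed assms] smult_closed[OF R.zero_closed assms]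
  by (metis M.add.l_cancel_one' R.l_zero R.zero_closed)

lemma smult_neg_right: assumes "a \<in> carrier R" "x \<in> carrier M"
  shows "a \<odot>\<^bsub>M\<^esub> (\<ominus>\<^bsub>M\<^esub> x) = \<ominus>\<^bsub>M\<^esub> (a \<odot>\<^bsub>M\<^esub> x)"
  using smult_r_distr[OF assms(1) M.a_inv_closed[OF assms(2)] assms(2)] assms
    smult_closed[OF assms] smult_closed[OF assms(1) M.a_inv_closed[OF assms(2)]]
  by (metis M.l_neg M.minus_equality smult_zero_right)

lemma smult_neg_left: assumes "a \<in> carrier R" "x \<in> carrier M"
  shows "(\<ominus>\<^bsub>R\<^esub> a) \<odot>\<^bsub>M\<^esub> x = \<ominus>\<^bsub>M\<^esub> (a \<odot>\<^bsub>M\<^esub> x)"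
  using smult_l_distr[OF R.a_inv_closed[OF assms(1)] assms] assms
    smult_closed[OF assms] smult_closed[OF R.a_inv_closed[OF assms(1)] assms(2)]
  by (metis R.l_neg M.minus_equality smult_zero_left)

lemma smult_finsum_right:
  assumes "finite I" "a \<in> carrier R" "f \<in> I \<rightarrow> carrier M"
  shows "a \<odot>\<^bsub>M\<^esub> finsum M f I = finsum M (\<lambda>i. a \<odot>\<^bsub>M\<^esub> f i) I"
  using assms
proof (induction I rule: finite_induct)
  case (insert x F)
  then have "f x \<in> carrier M" "f \<in> F \<rightarrow> carrier M" "(\<lambda>i. a \<odot>\<^bsub>M\<^esub> f i) \<in> F \<rightarrow> carrier M" "a \<odot>\<^bsub>M\<^esub> f x \<in> carrier M"
    by (auto intro: smult_closed)
  with insert show ?case by (simp add: M.finsum_insert smult_r_distr)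
qed simp

text \<open>\<open>submodule\<close> also asks for negatives; these come from the scalar -1.\<close>

lemma submodI:
  assumes "H \<subseteq> carrier M" "\<zero>\<^bsub>M\<^esub> \<in> H"
    and "\<And>a b. \<lbrakk>a \<in> H; b \<in> H\<rbrakk> \<Longrightarrow> a \<oplus>\<^bsub>M\<^esub> b \<in> H"
    and sm: "\<And>a x. \<lbrakk>a \<in> carrier R; x \<in> H\<rbrakk> \<Longrightarrow> a \<odot>\<^bsub>M\<^esub> x \<in> H"
  shows "submodule H R M"
proof -
  have "\<ominus>\<^bsub>M\<^esub> x \<in> H" if "x \<in> H" for x
    using sm[OF R.a_inv_closed[OF R.one_closed] that] smult_neg_left[OF R.one_closed, of x] that assms(1)
    by (auto simp: smult_one)
  then show ?thesis
    using assms by (auto intro!: submodule.intro subgroup.intro simp: submodule_axioms_def a_inv_def)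
qed

lemma submodD:
  assumes "submodule H R M"
  shows "H \<subseteq> carrier M" "\<zero>\<^bsub>M\<^esub> \<in> H" "\<And>x. x \<in> H \<Longrightarrow> \<ominus>\<^bsub>M\<^esub> x \<in> H"
    "\<And>a b. \<lbrakk>a \<in> H; b \<in> H\<rbrakk> \<Longrightarrow> a \<oplus>\<^bsub>M\<^esub> b \<in> H"
    "\<And>a x. \<lbrakk>a \<in> carrier R; x \<in> H\<rbrakk> \<Longrightarrow> a \<odot>\<^bsub>M\<^esub> x \<in> H"
proof -
  have s: "subgroup H (add_monoid M)" using assms by (simp add: submodule_def)
  show "H \<subseteq> carrier M" "\<zero>\<^bsub>M\<^esub> \<in> H" "\<And>a b. \<lbrakk>a \<in> H; b \<in> H\<rbrakk> \<Longrightarrow> a \<oplus>\<^bsub>M\<^esub> b \<in> H"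
    using subgroup.subset[OF s] subgroup.one_closed[OF s] subgroup.m_closed[OF s] by auto
  show "\<And>x. x \<in> H \<Longrightarrow> \<ominus>\<^bsub>M\<^esub> x \<in> H"
    using subgroup.m_inv_closed[OF s] by (simp add: a_inv_def)
  show "\<And>a x. \<lbrakk>a \<in> carrier R; x \<in> H\<rbrakk> \<Longrightarrow> a \<odot>\<^bsub>M\<^esub> x \<in> H"
    using submodule.smult_closed[OF assms] .
qed

lemma submod_zero: "submodule {\<zero>\<^bsub>M\<^esub>} R M"
  by (rule submodI) auto

lemma submod_carrier: "submodule (carrier M) R M"
  by (rule submodI) (auto intro: smult_closed)

lemma submod_minus: "\<lbrakk>submodule H R M; a \<in> H; b \<in> H\<rbrakk> \<Longrightarrow> a \<ominus>\<^bsub>M\<^esub> b \<in> H"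
  unfolding a_minus_def using submodD by blast

lemma submod_Inter:
  assumes "\<And>H. H \<in> A \<Longrightarrow> submodule H R M" "A \<noteq> {}"
  shows "submodule (\<Inter> A) R M"
proof (rule submodI)
  show "\<Inter> A \<subseteq> carrier M" using assms submodD(1) by (metis Inf_lower2 all_not_in_conv)
qed (use submodD[OF assms(1)] in auto)

end

lemma submodule_left_module:
  assumes "left_module R M" "submodule H R M"
  shows "left_module R (M\<lparr>carrier := H\<rparr>)"
proof -
  interpret left_module R M by fact
  note s = submodD[OF assms(2)]
  have "abelian_group (M\<lparr>carrier := H\<rparr>)"
  proof (rule abelian_groupI)
    fix x assume "x \<in> carrier (M\<lparr>carrier := H\<rparr>)"
    then show "\<exists>y\<in>carrier (M\<lparr>carrier := H\<rparr>). y \<oplus>\<^bsub>M\<lparr>carrier := H\<rparr>\<^esub> x = \<zero>\<^bsub>M\<lparr>carrier := H\<rparr>\<^esub>"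
      using s M.l_neg by (auto intro!: bexI[of _ "\<ominus>\<^bsub>M\<^esub> x"])
  qed (use s(1,2,4) in \<open>auto simp: subset_iff intro: M.a_assoc M.a_comm\<close>)
  then show ?thesis
    using R.ring_axioms s(1,5) smult_l_distr smult_r_distr smult_assoc smult_one
    by (auto simp: left_module_def left_module_axioms_def subset_iff)
qed

lemma submodule_of_submodule:
  assumes "left_module R M" "submodule H R M" "submodule H' R (M\<lparr>carrier := H\<rparr>)"
  shows "submodule H' R M" "H' \<subseteq> H"
proof -
  interpret left_module R M by fact
  interpret S: left_module R "M\<lparr>carrier := H\<rparr>" using submodule_left_module assms by blast
  note s = S.submodD[OF assms(3)]
  show "H' \<subseteq> H" using s(1) by simp
  then show "submodule H' R M" using s submodD(1)[OF assms(2)] by (intro submodI) auto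
qed

lemma lin_mapsD:
  assumes "f \<in> lin_maps R M N"
  shows "\<And>x. x \<in> carrier M \<Longrightarrow> f x \<in> carrier N"
    "\<And>x y. \<lbrakk>x \<in> carrier M; y \<in> carrier M\<rbrakk> \<Longrightarrow> f (x \<oplus>\<^bsub>M\<^esub> y) = f x \<oplus>\<^bsub>N\<^esub> f y"
    "\<And>a x. \<lbrakk>a \<in> carrier R; x \<in> carrier M\<rbrakk> \<Longrightarrow> f (a \<odot>\<^bsub>M\<^esub> x) = a \<odot>\<^bsub>N\<^esub> f x"
    "\<And>x. x \<notin> carrier M \<Longrightarrow> f x = \<zero>\<^bsub>N\<^esub>"
  using assms by (auto simp: lin_maps_def)

lemma lin_mapsI:
  assumes "\<And>x. x \<in> carrier M \<Longrightarrow> f x \<in> carrier N"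
    "\<And>x y. \<lbrakk>x \<in> carrier M; y \<in> carrier M\<rbrakk> \<Longrightarrow> f (x \<oplus>\<^bsub>M\<^esub> y) = f x \<oplus>\<^bsub>N\<^esub> f y"
    "\<And>a x. \<lbrakk>a \<in> carrier R; x \<in> carrier M\<rbrakk> \<Longrightarrow> f (a \<odot>\<^bsub>M\<^esub> x) = a \<odot>\<^bsub>N\<^esub> f x"
    "\<And>x. x \<notin> carrier M \<Longrightarrow> f x = \<zero>\<^bsub>N\<^esub>"
  shows "f \<in> lin_maps R M N"
  using assms by (auto simp: lin_maps_def)

lemma lin_maps_eqI:
  assumes "f \<in> lin_maps R M N" "g \<in> lin_maps R M N" "\<And>x. x \<in> carrier M \<Longrightarrow> f x = g x"
  shows "f = g"
  using assms lin_mapsD(4) by (metis ext)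

locale lin_map = M: left_module R M + N: left_module R N
  for R :: "('a, 'r) ring_scheme" and M :: "('a, 'v) module" and N :: "('a, 'w) module" +
  fixes f :: "'v \<Rightarrow> 'w"
  assumes f_lin: "f \<in> lin_maps R M N"
begin

lemmas f_closed = lin_mapsD(1)[OF f_lin] and f_add = lin_mapsD(2)[OF f_lin]
  and f_smult = lin_mapsD(3)[OF f_lin] and f_out = lin_mapsD(4)[OF f_lin]

lemma f_zero: "f \<zero>\<^bsub>M\<^esub> = \<zero>\<^bsub>N\<^esub>"
  using f_add[of "\<zero>\<^bsub>M\<^esub>" "\<zero>\<^bsub>M\<^esub>"] f_closed[of "\<zero>\<^bsub>M\<^esub>"] by simp

lemma f_neg: assumes "x \<in> carrier M" shows "f (\<ominus>\<^bsub>M\<^esub> x) = \<ominus>\<^bsub>N\<^esub> f x"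
  using f_add[of "\<ominus>\<^bsub>M\<^esub> x" x] assms f_closed M.M.l_neg f_zero
  by (metis M.M.a_inv_closed N.M.minus_equality)

lemma f_minus: "\<lbrakk>x \<in> carrier M; y \<in> carrier M\<rbrakk> \<Longrightarrow> f (x \<ominus>\<^bsub>M\<^esub> y) = f x \<ominus>\<^bsub>N\<^esub> f y"
  by (simp add: a_minus_def f_add f_neg)

lemma f_finsum:
  assumes "finite I" "g \<in> I \<rightarrow> carrier M"
  shows "f (finsum M g I) = finsum N (\<lambda>i. f (g i)) I"
  using assms
proof (induction I rule: finite_induct)
  case empty then show ?case by (simp add: f_zero)
next
  case (insert x F)
  then have "g x \<in> carrier M" "g \<in> F \<rightarrow> carrier M" "(\<lambda>i. f (g i)) \<in> F \<rightarrow> carrier N" "f (g x) \<in> carrier N"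
    using f_closed by auto
  with insert show ?case by (simp add: f_add)
qed

lemma kernel_submod: "submodule {x \<in> carrier M. f x = \<zero>\<^bsub>N\<^esub>} R M"
  by (rule M.submodI) (auto simp: f_zero f_add f_smult intro: M.smult_closed)

lemma image_submod: assumes "submodule H R M" shows "submodule (f ` H) R N"
proof (rule N.submodI)
  note s = M.submodD[OF assms]
  show "f ` H \<subseteq> carrier N" using s(1) f_closed by blast
  show "\<zero>\<^bsub>N\<^esub> \<in> f ` H" using s(2) f_zero by (metis image_eqI)
  show "a \<oplus>\<^bsub>N\<^esub> b \<in> f ` H" if ab: "a \<in> f ` H" "b \<in> f ` H" for a b
  proof -
    obtain x y where "x \<in> H" "y \<in> H" "a = f x" "b = f y" using ab by blast
    then have "a \<oplus>\<^bsub>N\<^esub> b = f (x \<oplus>\<^bsub>M\<^esub> y)" "x \<oplus>\<^bsub>M\<^esub> y \<in> H" using f_add[of x y] s(1,4)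
      by (auto simp: subset_iff)
    then show ?thesis by blast
  qed
  show "a \<odot>\<^bsub>N\<^esub> x \<in> f ` H" if ax: "a \<in> carrier R" "x \<in> f ` H" for a x
  proof -
    obtain y where "y \<in> H" "x = f y" using ax by blast
    then have "a \<odot>\<^bsub>N\<^esub> x = f (a \<odot>\<^bsub>M\<^esub> y)" "a \<odot>\<^bsub>M\<^esub> y \<in> H" using f_smult[of a y] s(1,5) ax(1)
      by (auto simp: subset_iff)
    then show ?thesis by blast
  qed
qed

lemma preimage_submod: assumes "submodule H R N" shows "submodule {x \<in> carrier M. f x \<in> H} R M"
  by (rule M.submodI) (use N.submodD[OF assms] in \<open>auto simp: f_zero f_add f_smult intro: M.smult_closed\<close>)

lemma inj_iff: "inj_on f (carrier M) \<longleftrightarrow> (\<forall>x \<in> carrier M. f x = \<zero>\<^bsub>N\<^esub> \<longrightarrow> x = \<zero>\<^bsub>M\<^esub>)"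
proof
  assume "inj_on f (carrier M)"
  then show "\<forall>x \<in> carrier M. f x = \<zero>\<^bsub>N\<^esub> \<longrightarrow> x = \<zero>\<^bsub>M\<^esub>"
    using f_zero by (auto simp: inj_on_def)
next
  assume a: "\<forall>x \<in> carrier M. f x = \<zero>\<^bsub>N\<^esub> \<longrightarrow> x = \<zero>\<^bsub>M\<^esub>"
  show "inj_on f (carrier M)"
  proof (rule inj_onI)
    fix x y assume xy: "x \<in> carrier M" "y \<in> carrier M" "f x = f y"
    then have "f (x \<ominus>\<^bsub>M\<^esub> y) = \<zero>\<^bsub>N\<^esub>" using f_closed N.M.minus_eq_zero_iff by (simp add: f_minus)
    then have "x \<ominus>\<^bsub>M\<^esub> y = \<zero>\<^bsub>M\<^esub>" using a xy by simp
    then show "x = y" using xy M.M.minus_eq_zero_iff[of x y] by simp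
  qed
qed

lemma inv_lin_map:
  assumes "bij_betw f (carrier M) (carrier N)"
  obtains g
    where "g \<in> lin_maps R N M" "\<And>x. x \<in> carrier M \<Longrightarrow> g (f x) = x" "\<And>y. y \<in> carrier N \<Longrightarrow> f (g y) = y"
proof -
  define g where "g y = (if y \<in> carrier N then the_inv_into (carrier M) f y else \<zero>\<^bsub>M\<^esub>)" for y
  have inj: "inj_on f (carrier M)" and im: "f ` carrier M = carrier N" using assms
    by (auto simp: bij_betw_def)
  have gf: "g (f x) = x" if "x \<in> carrier M" for x
    using that inj f_closed by (simp add: g_def the_inv_into_f_f)
  have fg: "f (g y) = y" "g y \<in> carrier M" if "y \<in> carrier N" for y
    using that inj im by (auto simp: g_def f_the_inv_into_f intro!: the_inv_into_into)
  have "g \<in> lin_maps R N M"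
  proof (rule lin_mapsI)
    show "g (x \<oplus>\<^bsub>N\<^esub> y) = g x \<oplus>\<^bsub>M\<^esub> g y" if "x \<in> carrier N" "y \<in> carrier N" for x y
      using gf[of "g x \<oplus>\<^bsub>M\<^esub> g y"] fg that by (simp add: f_add)
    show "g (a \<odot>\<^bsub>N\<^esub> x) = a \<odot>\<^bsub>M\<^esub> g x" if "a \<in> carrier R" "x \<in> carrier N" for a x
      using gf[of "a \<odot>\<^bsub>M\<^esub> g x"] fg that by (simp add: f_smult M.smult_closed)
  qed (use fg in \<open>auto simp: g_def\<close>)
  then show ?thesis using that gf fg by blast
qed

end

lemma lin_mapI: "\<lbrakk>left_module R M; left_module R N; f \<in> lin_maps R M N\<rbrakk> \<Longrightarrow> lin_map R M N f"
  by (simp add: lin_map_def lin_map_axioms_def)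

lemma lin_maps_comp:
  assumes "f \<in> lin_maps R M N" "g \<in> lin_maps R N P" "left_module R N" "left_module R P"
  shows "g \<circ> f \<in> lin_maps R M P"
proof -
  interpret g: lin_map R N P g using assms by (simp add: lin_mapI)
  show ?thesis
    using lin_mapsD[OF assms(1)] g.f_closed g.f_add g.f_smult g.f_zero by (intro lin_mapsI) auto
qed

definition id_map :: "('a, 'v, 's) module_scheme \<Rightarrow> 'v \<Rightarrow> 'v" where
  "id_map M x = (if x \<in> carrier M then x else \<zero>\<^bsub>M\<^esub>)"

text \<open>Linear maps have to vanish off their source, so the inclusion of a submodule is not the
  identity function.\<close>

definition inclusion :: "('a, 'v, 's) module_scheme \<Rightarrow> 'v set \<Rightarrow> 'v \<Rightarrow> 'v" where
  "inclusion M H x = (if x \<in> H then x else \<zero>\<^bsub>M\<^esub>)"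

lemma inclusion_lin:
  assumes "left_module R M" "submodule H R M"
  shows "inclusion M H \<in> lin_maps R (M\<lparr>carrier := H\<rparr>) M"
proof -
  interpret left_module R M by fact
  show ?thesis using submodD[OF assms(2)] by (auto intro!: lin_mapsI simp: inclusion_def)
qed

lemma lin_maps_restrict_codomain:
  assumes "f \<in> lin_maps R M N" "\<And>x. x \<in> carrier M \<Longrightarrow> f x \<in> H"
  shows "f \<in> lin_maps R M (N\<lparr>carrier := H\<rparr>)"
  using lin_mapsD[OF assms(1)] assms(2) by (auto intro!: lin_mapsI)

text \<open>Finite length is encoded by a bounded, strictly monotone numerical function on
  submodules. Both chain conditions follow at once, and the dimension over the ground field will
  provide such a function without any composition series.\<close>

definition fin_len :: "('a, 'r) ring_scheme \<Rightarrow> ('a, 'v) module \<Rightarrow> bool" where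
  "fin_len R M \<longleftrightarrow> (\<exists>(d :: 'v set \<Rightarrow> nat) n. (\<forall>S. submodule S R M \<longrightarrow> d S \<le> n) \<and>
     (\<forall>S S'. submodule S R M \<and> submodule S' R M \<and> S \<subset> S' \<longrightarrow> d S < d S'))"

lemma fin_lenE:
  fixes M :: "('a, 'v) module"
  assumes "fin_len R M"
  obtains d :: "'v set \<Rightarrow> nat" and n where "\<And>S. submodule S R M \<Longrightarrow> d S \<le> n"
    "\<And>S S'. \<lbrakk>submodule S R M; submodule S' R M; S \<subset> S'\<rbrakk> \<Longrightarrow> d S < d S'"
proof -
  obtain d :: "'v set \<Rightarrow> nat" and n where "\<forall>S. submodule S R M \<longrightarrow> d S \<le> n"
     "\<forall>S S'. submodule S R M \<and> submodule S' R M \<and> S \<subset> S' \<longrightarrow> d S < d S'"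
    using assms unfolding fin_len_def by blast
  then show ?thesis using that[of d n] by blast
qed

lemma fin_len_minimal:
  fixes M :: "('a, 'v) module"
  assumes "fin_len R M" "P S0" "\<And>S. P S \<Longrightarrow> submodule S R M"
  obtains S where "P S" "\<And>S'. \<lbrakk>P S'; S' \<subseteq> S\<rbrakk> \<Longrightarrow> S' = S"
proof -
  obtain d :: "'v set \<Rightarrow> nat" and n where d: "\<And>S. submodule S R M \<Longrightarrow> d S \<le> n"
    "\<And>S S'. \<lbrakk>submodule S R M; submodule S' R M; S \<subset> S'\<rbrakk> \<Longrightarrow> d S < d S'"
    by (rule fin_lenE[OF assms(1)]) (rule that)
  obtain S where "P S" "\<And>S'. P S' \<Longrightarrow> d S \<le> d S'"
    using assms(2) exists_least_lemma[of "\<lambda>n. \<exists>S. P S \<and> d S = n"] ex_has_least_nat[of P S0 d] by blast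
  then show ?thesis using that[of S] d(2) assms(3) by (metis leD psubsetI)
qed

lemma fin_len_maximal:
  fixes M :: "('a, 'v) module"
  assumes "fin_len R M" "P S0" "\<And>S. P S \<Longrightarrow> submodule S R M"
  obtains S where "P S" "\<And>S'. \<lbrakk>P S'; S \<subseteq> S'\<rbrakk> \<Longrightarrow> S' = S"
proof -
  obtain d :: "'v set \<Rightarrow> nat" and n where d: "\<And>S. submodule S R M \<Longrightarrow> d S \<le> n"
    "\<And>S S'. \<lbrakk>submodule S R M; submodule S' R M; S \<subset> S'\<rbrakk> \<Longrightarrow> d S < d S'"
    by (rule fin_lenE[OF assms(1)]) (rule that)
  obtain S where "P S" "\<And>S'. P S' \<Longrightarrow> d S' \<le> d S"
    using ex_has_greatest_nat[of P S0 d "Suc n"] assms(2,3) d(1) by (metis less_Suc_eq_le)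
  then show ?thesis using that[of S] d(2) assms(3) by (metis leD psubsetI)
qed

text \<open>The Noetherian argument: among the submodules generated by finite subsets of
  \<open>H\<close>, a maximal one already absorbs every further element of \<open>H\<close>.\<close>

lemma fin_len_fin_gen:
  fixes M :: "('a, 'v) module"
  assumes "left_module R M" "fin_len R M" "submodule H R M"
  shows "fin_gen R (M\<lparr>carrier := H\<rparr>)"
proof -
  interpret left_module R M by fact
  define gen where "gen F = \<Inter> {S. submodule S R M \<and> F \<subseteq> S}" for F
  have g: "submodule (gen F) R M" if "F \<subseteq> H" for F
    unfolding gen_def using that assms(3) by (intro submod_Inter) auto
  have gH: "gen F \<subseteq> H" if "F \<subseteq> H" for F unfolding gen_def using that assms(3) by blast
  define P where "P S \<longleftrightarrow> (\<exists>F. finite F \<and> F \<subseteq> H \<and> S = gen F)" for S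
  have "P (gen {})" by (auto simp: P_def)
  moreover have Ps: "P S \<Longrightarrow> submodule S R M" for S unfolding P_def using g by blast
  ultimately obtain S where S: "P S" "\<And>S'. \<lbrakk>P S'; S \<subseteq> S'\<rbrakk> \<Longrightarrow> S' = S"
    using fin_len_maximal[of R M P, OF assms(2) _ Ps] by metis
  obtain F where F: "finite F" "F \<subseteq> H" "S = gen F" using S(1) by (auto simp: P_def)
  have "x \<in> S" if "x \<in> H" for x
  proof -
    have "P (gen (insert x F))" unfolding P_def using F that by blast
    moreover have "S \<subseteq> gen (insert x F)" using F by (auto simp: gen_def)
    ultimately have "gen (insert x F) = S" by (rule S(2))
    then show ?thesis by (auto simp: gen_def)
  qed
  then have SH: "gen F = H" using F gH by blast
  show ?thesis unfolding fin_gen_def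
  proof (intro exI[of _ F] conjI allI impI)
    fix L assume L: "submodule L R (M\<lparr>carrier := H\<rparr>) \<and> F \<subseteq> L"
    then have "submodule L R M" "L \<subseteq> H" using submodule_of_submodule[OF assms(1,3)] by blast+
    then have "L = H" using SH L unfolding gen_def by blast
    then show "L = carrier (M\<lparr>carrier := H\<rparr>)" by simp
  qed (use F in auto)
qed

text \<open>The kernels of the powers of \<open>f\<close> form an ascending chain.\<close>

lemma fin_len_surj_inj:
  fixes M :: "('a, 'v) module"
  assumes "left_module R M" "fin_len R M" "f \<in> lin_maps R M M" "f ` carrier M = carrier M"
  shows "bij_betw f (carrier M) (carrier M)"
proof -
  interpret lin_map R M M f using assms by (simp add: lin_mapI)
  obtain d :: "'v set \<Rightarrow> nat" and n where d: "\<And>S. submodule S R M \<Longrightarrow> d S \<le> n"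
    "\<And>S S'. \<lbrakk>submodule S R M; submodule S' R M; S \<subset> S'\<rbrakk> \<Longrightarrow> d S < d S'"
    by (rule fin_lenE[OF assms(2)]) (rule that)
  define N where "N k = {x \<in> carrier M. (f ^^ k) x = \<zero>\<^bsub>M\<^esub>}" for k
  have c: "x \<in> carrier M \<Longrightarrow> (f ^^ k) x \<in> carrier M" for x k
    by (induction k) (auto intro: f_closed)
  have s: "submodule (N k) R M" for k
  proof (induction k)
    case 0
    have "N 0 = {\<zero>\<^bsub>M\<^esub>}" by (auto simp: N_def)
    then show ?case using M.submod_zero by simp
  next
    case (Suc k)
    have "N (Suc k) = {x \<in> carrier M. f x \<in> N k}"
      by (auto simp: N_def funpow_swap1 intro: f_closed)
    then show ?case using preimage_submod[OF Suc] by simp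
  qed
  have m: "N k \<subseteq> N (Suc k)" for k by (auto simp: N_def f_zero)
  have "\<exists>k. N k = N (Suc k)"
  proof (rule ccontr)
    assume "\<not> ?thesis"
    then have lt: "d (N k) < d (N (Suc k))" for k using d(2)[OF s s] m by blast
    have "k \<le> d (N k)" for k
    proof (induction k)
      case (Suc k) then show ?case using lt[of k] by linarith
    qed simp
    from this[of "Suc n"] show False using d(1)[OF s, of "Suc n"] by linarith
  qed
  then obtain k where k: "N k = N (Suc k)" by blast
  have sj: "\<exists>y \<in> carrier M. (f ^^ j) y = x" if "x \<in> carrier M" for x j
    using that
  proof (induction j arbitrary: x)
    case (Suc j)
    have "x \<in> f ` carrier M" using Suc.prems assms(4) by simp
    then obtain z where z: "z \<in> carrier M" "f z = x" by blast
    obtain y where y: "y \<in> carrier M" "(f ^^ j) y = z" using Suc.IH[OF z(1)] by blast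
    have "(f ^^ Suc j) y = x" using y(2) z(2) by simp
    then show ?case using y(1) by blast
  qed simp
  \<comment> \<open>If x = f^k y, then f x = 0 puts \<open>y\<close> into \<open>N (Suc k)\<close>,
    which equals \<open>N k\<close>, and that means x = 0.\<close>
  have "x = \<zero>\<^bsub>M\<^esub>" if "x \<in> carrier M" "f x = \<zero>\<^bsub>M\<^esub>" for x
  proof -
    obtain y where y: "y \<in> carrier M" "(f ^^ k) y = x" using sj[OF \<open>x \<in> carrier M\<close>] by blast
    then have "y \<in> N (Suc k)" using that by (simp add: N_def)
    then show ?thesis using k y by (auto simp: N_def)
  qed
  then show ?thesis using assms(4) inj_iff by (auto simp: bij_betw_def)
qed

section \<open>Finite-dimensional vector spaces\<close>

fun lspan :: "('a, 'r) ring_scheme \<Rightarrow> ('a, 'v) module \<Rightarrow> 'v list \<Rightarrow> 'v set" where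
  "lspan K V [] = {\<zero>\<^bsub>V\<^esub>}"
| "lspan K V (x # xs) = {(c \<odot>\<^bsub>V\<^esub> x) \<oplus>\<^bsub>V\<^esub> v | c v. c \<in> carrier K \<and> v \<in> lspan K V xs}"

text \<open>The number of pivots of \<open>W\<close> with respect to the spanning sequence \<open>xs\<close>; this stands in
  for the dimension.\<close>

fun pivots :: "('a, 'r) ring_scheme \<Rightarrow> ('a, 'v) module \<Rightarrow> 'v list \<Rightarrow> 'v set \<Rightarrow> nat" where
  "pivots K V [] W = 0"
| "pivots K V (x # xs) W = (if \<exists>v \<in> lspan K V xs. x \<oplus>\<^bsub>V\<^esub> v \<in> W then 1 else 0) + pivots K V xs W"

lemma pivots_le: "pivots K V xs W \<le> length xs"
  by (induction xs) auto

lemma pivots_mono: "W \<subseteq> W' \<Longrightarrow> pivots K V xs W \<le> pivots K V xs W'"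
  by (induction xs) (auto intro: add_mono)

lemma lspan_submod:
  assumes "left_module K V" "set xs \<subseteq> carrier V"
  shows "submodule (lspan K V xs) K V"
proof -
  interpret left_module K V by fact
  show "submodule (lspan K V xs) K V"
    using assms(2)
  proof (induction xs)
    case Nil
    then show ?case using submod_zero by simp
  next
    case (Cons x xs)
    then have s: "submodule (lspan K V xs) K V" and x: "x \<in> carrier V" by auto
    note S = submodD[OF s]
    show ?case
    proof (rule submodI)
      show "lspan K V (x # xs) \<subseteq> carrier V" using S(1) x smult_closed by auto
      have "\<zero>\<^bsub>V\<^esub> = (\<zero>\<^bsub>K\<^esub> \<odot>\<^bsub>V\<^esub> x) \<oplus>\<^bsub>V\<^esub> \<zero>\<^bsub>V\<^esub>" using x by simp
      then show "\<zero>\<^bsub>V\<^esub> \<in> lspan K V (x # xs)" using S(2) R.zero_closed unfolding lspan.simps by blast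
    next
      fix a b assume "a \<in> lspan K V (x # xs)" "b \<in> lspan K V (x # xs)"
      then obtain c v c' v' where cv: "c \<in> carrier K" "v \<in> lspan K V xs" "a = (c \<odot>\<^bsub>V\<^esub> x) \<oplus>\<^bsub>V\<^esub> v"
        "c' \<in> carrier K" "v' \<in> lspan K V xs" "b = (c' \<odot>\<^bsub>V\<^esub> x) \<oplus>\<^bsub>V\<^esub> v'" by auto
      have vc: "v \<in> carrier V" "v' \<in> carrier V" using cv S(1) by auto
      have "a \<oplus>\<^bsub>V\<^esub> b = ((c \<oplus>\<^bsub>K\<^esub> c') \<odot>\<^bsub>V\<^esub> x) \<oplus>\<^bsub>V\<^esub> (v \<oplus>\<^bsub>V\<^esub> v')"
        using cv vc x smult_closed by (simp add: smult_l_distr M.a_ac)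
      then show "a \<oplus>\<^bsub>V\<^esub> b \<in> lspan K V (x # xs)"
        using R.a_closed[OF cv(1,4)] S(4)[OF cv(2,5)] unfolding lspan.simps by blast
    next
      fix a b assume a: "a \<in> carrier K" and "b \<in> lspan K V (x # xs)"
      then obtain c v where cv: "c \<in> carrier K" "v \<in> lspan K V xs" "b = (c \<odot>\<^bsub>V\<^esub> x) \<oplus>\<^bsub>V\<^esub> v" by auto
      have vc: "v \<in> carrier V" using cv S(1) by auto
      have "a \<odot>\<^bsub>V\<^esub> b = ((a \<otimes>\<^bsub>K\<^esub> c) \<odot>\<^bsub>V\<^esub> x) \<oplus>\<^bsub>V\<^esub> (a \<odot>\<^bsub>V\<^esub> v)"
        using cv vc x a smult_closed by (simp add: smult_r_distr smult_assoc)
      then show "a \<odot>\<^bsub>V\<^esub> b \<in> lspan K V (x # xs)"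
        using R.m_closed[OF a cv(1)] S(5)[OF a cv(2)] unfolding lspan.simps by blast
    qed
  qed
qed

lemma lspan_superset:
  assumes "left_module K V" "set xs \<subseteq> carrier V"
  shows "set xs \<subseteq> lspan K V xs"
  using assms(2)
proof (induction xs)
  case (Cons x xs)
  interpret left_module K V by fact
  have x: "x \<in> carrier V" and s: "submodule (lspan K V xs) K V"
    using Cons.prems lspan_submod[OF assms(1)] by auto
  note S = submodD[OF s]
  have "x = (\<one>\<^bsub>K\<^esub> \<odot>\<^bsub>V\<^esub> x) \<oplus>\<^bsub>V\<^esub> \<zero>\<^bsub>V\<^esub>" using x by (simp add: smult_one)
  then have "x \<in> lspan K V (x # xs)" using R.one_closed S(2) unfolding lspan.simps by blast
  moreover have "y \<in> lspan K V (x # xs)" if y: "y \<in> lspan K V xs" for y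
  proof -
    have "y = (\<zero>\<^bsub>K\<^esub> \<odot>\<^bsub>V\<^esub> x) \<oplus>\<^bsub>V\<^esub> y" using x y S(1) by auto
    then show ?thesis using R.zero_closed y unfolding lspan.simps by blast
  qed
  ultimately show ?case using Cons by auto
qed simp

text \<open>Each summand of \<open>pivots\<close> is monotone in the subspace, so equal totals force
  equality at every pivot. An element of \<open>W'\<close> can then be reduced by elements of
  \<open>W\<close>, one leading coefficient at a time.\<close>

lemma pivots_eq:
  assumes "field K" "left_module K V" "set xs \<subseteq> carrier V" "submodule W K V" "submodule W' K V" "W \<subseteq> W'"
    "pivots K V xs W = pivots K V xs W'"
  shows "W' \<inter> lspan K V xs \<subseteq> W"
  using assms(3,7)
proof (induction xs)
  case Nil
  interpret left_module K V by fact
  show ?case using submodD(2)[OF assms(4)] by auto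
next
  case (Cons x xs)
  interpret left_module K V by fact
  interpret K: field K by fact
  have x: "x \<in> carrier V" and s: "submodule (lspan K V xs) K V"
    using Cons.prems lspan_submod[OF assms(2)] by auto
  note S = submodD[OF s] and S1 = submodD[OF assms(4)] and S2 = submodD[OF assms(5)]
  have m: "pivots K V xs W \<le> pivots K V xs W'" using pivots_mono assms(6) by blast
  have e: "pivots K V xs W = pivots K V xs W'"
    and i: "(\<exists>v \<in> lspan K V xs. x \<oplus>\<^bsub>V\<^esub> v \<in> W') \<longrightarrow> (\<exists>v \<in> lspan K V xs. x \<oplus>\<^bsub>V\<^esub> v \<in> W)"
    using Cons.prems(2) m assms(6) by (auto split: if_splits)
  have IH: "W' \<inter> lspan K V xs \<subseteq> W" using Cons e by simp
  show ?case
  proof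
    fix w assume w: "w \<in> W' \<inter> lspan K V (x # xs)"
    then obtain c v where cv: "c \<in> carrier K" "v \<in> lspan K V xs" "w = (c \<odot>\<^bsub>V\<^esub> x) \<oplus>\<^bsub>V\<^esub> v" by auto
    have vc: "v \<in> carrier V" using cv S(1) by auto
    show "w \<in> W"
    proof (cases "c = \<zero>\<^bsub>K\<^esub>")
      case True
      then have "w = v" using cv vc x by simp
      then show ?thesis using w cv IH by blast
    next
      case False
      then have c: "inv\<^bsub>K\<^esub> c \<in> carrier K" "inv\<^bsub>K\<^esub> c \<otimes>\<^bsub>K\<^esub> c = \<one>\<^bsub>K\<^esub>"
        using cv(1) K.field_Units by (auto intro: R.Units_l_inv)
      have "inv\<^bsub>K\<^esub> c \<odot>\<^bsub>V\<^esub> w = x \<oplus>\<^bsub>V\<^esub> (inv\<^bsub>K\<^esub> c \<odot>\<^bsub>V\<^esub> v)"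
        using cv vc x c smult_closed by (simp add: smult_r_distr smult_assoc[symmetric] smult_one)
      then have "\<exists>v \<in> lspan K V xs. x \<oplus>\<^bsub>V\<^esub> v \<in> W'"
        using S2(5)[OF c(1), of w] w S(5)[OF c(1) cv(2)] by auto
      then obtain u where u: "u \<in> lspan K V xs" "x \<oplus>\<^bsub>V\<^esub> u \<in> W" using i by blast
      have uc: "u \<in> carrier V" using u S(1) by auto
      have cu: "c \<odot>\<^bsub>V\<^esub> (x \<oplus>\<^bsub>V\<^esub> u) \<in> W" using S1(5)[OF cv(1) u(2)] .
      have d: "v \<ominus>\<^bsub>V\<^esub> (c \<odot>\<^bsub>V\<^esub> u) \<in> lspan K V xs"
        using submod_minus[OF s cv(2) S(5)[OF cv(1) u(1)]] .
      \<comment> \<open>Clear the leading coefficient with an element of \<open>W\<close>. The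
        remainder lies in \<open>W'\<close> and in the span of the shorter sequence, where the
        induction hypothesis applies.\<close>
      have w': "w = (c \<odot>\<^bsub>V\<^esub> (x \<oplus>\<^bsub>V\<^esub> u)) \<oplus>\<^bsub>V\<^esub> (v \<ominus>\<^bsub>V\<^esub> (c \<odot>\<^bsub>V\<^esub> u))"
        using cv vc uc x smult_closed by (simp add: smult_r_distr a_minus_def M.a_ac M.add_minus_cancel)
      have "v \<ominus>\<^bsub>V\<^esub> (c \<odot>\<^bsub>V\<^esub> u) = w \<ominus>\<^bsub>V\<^esub> (c \<odot>\<^bsub>V\<^esub> (x \<oplus>\<^bsub>V\<^esub> u))"
        using cv vc uc x smult_closed
        by (simp add: smult_r_distr a_minus_def M.minus_add M.a_ac M.r_neg M.r_neg1 M.r_neg2)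
      then have "v \<ominus>\<^bsub>V\<^esub> (c \<odot>\<^bsub>V\<^esub> u) \<in> W'"
        using submod_minus[OF assms(5)] w cu assms(6) by auto
      then show ?thesis using IH d cu w' S1(4) by auto
    qed
  qed
qed

lemma fin_gen_lspan:
  assumes "left_module K V" "fin_gen K V"
  obtains xs where "set xs \<subseteq> carrier V" "lspan K V xs = carrier V"
proof -
  obtain S where S: "finite S" "S \<subseteq> carrier V" "\<And>L. \<lbrakk>submodule L K V; S \<subseteq> L\<rbrakk> \<Longrightarrow> L = carrier V"
    using assms(2) unfolding fin_gen_def by blast
  obtain xs where "set xs = S" using finite_list[OF S(1)] by blast
  then have "lspan K V xs = carrier V"
    using S(2) lspan_submod[OF assms(1)] lspan_superset[OF assms(1)] by (intro S(3)) auto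
  then show ?thesis using that[of xs] S(2) \<open>set xs = S\<close> by simp
qed

text \<open>Counting pivots along a spanning sequence of the whole space is strictly monotone by
  \<open>pivots_eq\<close> and bounded by the length of the sequence.\<close>

lemma fin_len_vector_space:
  assumes "field K" "module K V" "fin_gen K V"
  shows "fin_len K V"
proof -
  have l: "left_module K V" using module_left_module assms by blast
  interpret left_module K V by fact
  obtain xs where xs: "set xs \<subseteq> carrier V" "lspan K V xs = carrier V"
    using fin_gen_lspan[OF l assms(3)] .
  have "pivots K V xs S < pivots K V xs S'" if "submodule S K V" "submodule S' K V" "S \<subset> S'" for S S'
  proof -
    have "pivots K V xs S \<noteq> pivots K V xs S'"
      using pivots_eq[OF assms(1) l xs(1) that(1,2)] that(3) xs(2) submodD(1)[OF that(2)] by blast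
    then show ?thesis using pivots_mono[of S S' K V xs] that(3) by auto
  qed
  then show ?thesis unfolding fin_len_def
    by (intro exI[of _ "pivots K V xs"] exI[of _ "length xs"]) (auto simp: pivots_le)
qed

text \<open>The functional reads off the coefficient of \<open>v\<close> modulo a maximal subspace avoiding \<open>v\<close>.\<close>

lemma separating_functional:
  assumes "field K" "module K V" "fin_gen K V" "v \<in> carrier V" "v \<noteq> \<zero>\<^bsub>V\<^esub>"
  obtains \<phi> where "\<phi> \<in> lin_maps K V (regular_module K)" "\<phi> v \<noteq> \<zero>\<^bsub>K\<^esub>"
proof -
  have l: "left_module K V" using module_left_module assms by blast
  interpret left_module K V by fact
  interpret K: field K by fact
  have "submodule {\<zero>\<^bsub>V\<^esub>} K V \<and> v \<notin> {\<zero>\<^bsub>V\<^esub>}" using submod_zero assms by simp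
  then obtain W where W: "submodule W K V \<and> v \<notin> W"
    "\<And>S'. \<lbrakk>submodule S' K V \<and> v \<notin> S'; W \<subseteq> S'\<rbrakk> \<Longrightarrow> S' = W"
    using fin_len_maximal[OF fin_len_vector_space[OF assms(1-3)], of "\<lambda>S. submodule S K V \<and> v \<notin> S"]
    by blast
  have s: "submodule W K V" using W by blast
  note S = submodD[OF s]
  have ex: "\<exists>c \<in> carrier K. x \<ominus>\<^bsub>V\<^esub> (c \<odot>\<^bsub>V\<^esub> v) \<in> W" if x: "x \<in> carrier V" for x
  proof (cases "x \<in> W")
    case True
    then show ?thesis using assms(4) x by (intro bexI[of _ "\<zero>\<^bsub>K\<^esub>"]) (auto simp: a_minus_def M.neg_zero)
  next
    case False
    \<comment> \<open>The subspace W + K x is strictly larger than \<open>W\<close>, so by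
      maximality it contains \<open>v\<close>. The coefficient of \<open>x\<close> in the resulting
      equation is nonzero because \<open>v\<close> is not in \<open>W\<close>, and the equation can
      be solved for \<open>x\<close>.\<close>
    define W' where "W' = {w \<oplus>\<^bsub>V\<^esub> (c \<odot>\<^bsub>V\<^esub> x) | w c. w \<in> W \<and> c \<in> carrier K}"
    have in_W': "w \<oplus>\<^bsub>V\<^esub> (c \<odot>\<^bsub>V\<^esub> x) \<in> W'" if "w \<in> W" "c \<in> carrier K" for w c
      using that unfolding W'_def by blast
    have s': "submodule W' K V"
    proof (rule submodI)
      show "W' \<subseteq> carrier V" using S(1) x smult_closed unfolding W'_def by auto
      show "\<zero>\<^bsub>V\<^esub> \<in> W'" using in_W'[OF S(2) R.zero_closed] x by simp
    next
      fix a b assume "a \<in> W'" "b \<in> W'"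
      then obtain w c w' c' where cv: "w \<in> W" "c \<in> carrier K" "a = w \<oplus>\<^bsub>V\<^esub> (c \<odot>\<^bsub>V\<^esub> x)"
        "w' \<in> W" "c' \<in> carrier K" "b = w' \<oplus>\<^bsub>V\<^esub> (c' \<odot>\<^bsub>V\<^esub> x)" unfolding W'_def by blast
      have wc: "w \<in> carrier V" "w' \<in> carrier V" using cv S(1) by auto
      have "a \<oplus>\<^bsub>V\<^esub> b = (w \<oplus>\<^bsub>V\<^esub> w') \<oplus>\<^bsub>V\<^esub> ((c \<oplus>\<^bsub>K\<^esub> c') \<odot>\<^bsub>V\<^esub> x)"
        using cv wc x smult_closed by (simp add: smult_l_distr M.a_ac)
      then show "a \<oplus>\<^bsub>V\<^esub> b \<in> W'" using in_W'[OF S(4)[OF cv(1,4)] R.a_closed[OF cv(2,5)]] by simp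
    next
      fix a b assume a: "a \<in> carrier K" and "b \<in> W'"
      then obtain w c where cv: "w \<in> W" "c \<in> carrier K" "b = w \<oplus>\<^bsub>V\<^esub> (c \<odot>\<^bsub>V\<^esub> x)" unfolding W'_def by blast
      have wc: "w \<in> carrier V" using cv S(1) by auto
      have "a \<odot>\<^bsub>V\<^esub> b = (a \<odot>\<^bsub>V\<^esub> w) \<oplus>\<^bsub>V\<^esub> ((a \<otimes>\<^bsub>K\<^esub> c) \<odot>\<^bsub>V\<^esub> x)"
        using cv wc x a smult_closed by (simp add: smult_r_distr smult_assoc)
      then show "a \<odot>\<^bsub>V\<^esub> b \<in> W'" using in_W'[OF S(5)[OF a cv(1)] R.m_closed[OF a cv(2)]] by simp
    qed
    have WW': "W \<subseteq> W'"
    proof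
      fix w assume w: "w \<in> W"
      then have "w = w \<oplus>\<^bsub>V\<^esub> (\<zero>\<^bsub>K\<^esub> \<odot>\<^bsub>V\<^esub> x)" using S(1) x by auto
      then show "w \<in> W'" using in_W'[OF w R.zero_closed] by simp
    qed
    have "x \<in> W'" using in_W'[OF S(2) R.one_closed] x by (simp add: smult_one)
    then have "W' \<noteq> W" using False by blast
    then have "v \<in> W'" using W(2) s' WW' by blast
    then obtain w c where wc: "w \<in> W" "c \<in> carrier K" "v = w \<oplus>\<^bsub>V\<^esub> (c \<odot>\<^bsub>V\<^esub> x)" unfolding W'_def by blast
    have w: "w \<in> carrier V" using wc S(1) by auto
    have "c \<noteq> \<zero>\<^bsub>K\<^esub>" using wc w x W(1) by auto
    then have c: "inv\<^bsub>K\<^esub> c \<in> carrier K" "inv\<^bsub>K\<^esub> c \<otimes>\<^bsub>K\<^esub> c = \<one>\<^bsub>K\<^esub>"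
      using wc(2) K.field_Units by (auto intro: R.Units_l_inv)
    have "inv\<^bsub>K\<^esub> c \<odot>\<^bsub>V\<^esub> v = (inv\<^bsub>K\<^esub> c \<odot>\<^bsub>V\<^esub> w) \<oplus>\<^bsub>V\<^esub> x"
      using wc w x c smult_closed by (simp add: smult_r_distr smult_assoc[symmetric] smult_one)
    then have "x \<ominus>\<^bsub>V\<^esub> (inv\<^bsub>K\<^esub> c \<odot>\<^bsub>V\<^esub> v) = \<ominus>\<^bsub>V\<^esub> (inv\<^bsub>K\<^esub> c \<odot>\<^bsub>V\<^esub> w)"
      using x w c smult_closed by (simp add: a_minus_def M.minus_add M.a_ac M.r_neg1 M.r_neg2 M.r_neg)
    then have "x \<ominus>\<^bsub>V\<^esub> (inv\<^bsub>K\<^esub> c \<odot>\<^bsub>V\<^esub> v) \<in> W" using S(3)[OF S(5)[OF c(1) wc(1)]] by simp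
    then show ?thesis using c(1) by blast
  qed
  \<comment> \<open>Two different coefficients would put a nonzero multiple of \<open>v\<close> into
    \<open>W\<close>.\<close>
  have un: "c = c'" if "x \<in> carrier V" "c \<in> carrier K" "c' \<in> carrier K"
    "x \<ominus>\<^bsub>V\<^esub> (c \<odot>\<^bsub>V\<^esub> v) \<in> W" "x \<ominus>\<^bsub>V\<^esub> (c' \<odot>\<^bsub>V\<^esub> v) \<in> W" for x c c'
  proof (rule ccontr)
    assume ne: "c \<noteq> c'"
    define e where "e = c' \<ominus>\<^bsub>K\<^esub> c"
    have e: "e \<in> carrier K" "e \<noteq> \<zero>\<^bsub>K\<^esub>" using that ne R.minus_eq_zero_iff by (auto simp: e_def)
    have "(x \<ominus>\<^bsub>V\<^esub> (c \<odot>\<^bsub>V\<^esub> v)) \<ominus>\<^bsub>V\<^esub> (x \<ominus>\<^bsub>V\<^esub> (c' \<odot>\<^bsub>V\<^esub> v)) = e \<odot>\<^bsub>V\<^esub> v"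
      using that assms(4) smult_closed
      by (simp add: e_def a_minus_def smult_l_distr smult_neg_left M.minus_add M.a_ac M.r_neg1 M.r_neg2 M.r_neg)
    then have ev: "e \<odot>\<^bsub>V\<^esub> v \<in> W" using submod_minus[OF s that(4,5)] by simp
    have i: "inv\<^bsub>K\<^esub> e \<in> carrier K" "inv\<^bsub>K\<^esub> e \<otimes>\<^bsub>K\<^esub> e = \<one>\<^bsub>K\<^esub>"
      using e K.field_Units by (auto intro: R.Units_l_inv)
    have "inv\<^bsub>K\<^esub> e \<odot>\<^bsub>V\<^esub> (e \<odot>\<^bsub>V\<^esub> v) = v" using i e assms(4)
      by (simp add: smult_assoc[symmetric] smult_one)
    then show False using S(5)[OF i(1) ev] W(1) by simp
  qed
  define \<phi> where "\<phi> x = (if x \<in> carrier V then (THE c. c \<in> carrier K \<and> x \<ominus>\<^bsub>V\<^esub> (c \<odot>\<^bsub>V\<^esub> v) \<in> W) else \<zero>\<^bsub>K\<^esub>)"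
    for x
  have \<phi>: "\<phi> x = c" if "x \<in> carrier V" "c \<in> carrier K" "x \<ominus>\<^bsub>V\<^esub> (c \<odot>\<^bsub>V\<^esub> v) \<in> W" for x c
    unfolding \<phi>_def using that un[OF that(1)] by (auto intro!: the_equality)
  have \<phi>c: "\<phi> x \<in> carrier K" "x \<ominus>\<^bsub>V\<^esub> (\<phi> x \<odot>\<^bsub>V\<^esub> v) \<in> W" if "x \<in> carrier V" for x
    using ex[OF that] \<phi>[OF that] by auto
  have "\<phi> \<in> lin_maps K V (regular_module K)"
  proof (rule lin_mapsI)
    fix x y assume xy: "x \<in> carrier V" "y \<in> carrier V"
    have "(x \<oplus>\<^bsub>V\<^esub> y) \<ominus>\<^bsub>V\<^esub> ((\<phi> x \<oplus>\<^bsub>K\<^esub> \<phi> y) \<odot>\<^bsub>V\<^esub> v)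
       = (x \<ominus>\<^bsub>V\<^esub> (\<phi> x \<odot>\<^bsub>V\<^esub> v)) \<oplus>\<^bsub>V\<^esub> (y \<ominus>\<^bsub>V\<^esub> (\<phi> y \<odot>\<^bsub>V\<^esub> v))"
      using xy \<phi>c(1) assms(4) smult_closed by (simp add: a_minus_def smult_l_distr M.minus_add M.a_ac)
    then show "\<phi> (x \<oplus>\<^bsub>V\<^esub> y) = \<phi> x \<oplus>\<^bsub>regular_module K\<^esub> \<phi> y"
      using xy \<phi>c S(4) by (auto simp: regular_module_def intro!: \<phi>)
  next
    fix a x assume ax: "a \<in> carrier K" "x \<in> carrier V"
    have "(a \<odot>\<^bsub>V\<^esub> x) \<ominus>\<^bsub>V\<^esub> ((a \<otimes>\<^bsub>K\<^esub> \<phi> x) \<odot>\<^bsub>V\<^esub> v) = a \<odot>\<^bsub>V\<^esub> (x \<ominus>\<^bsub>V\<^esub> (\<phi> x \<odot>\<^bsub>V\<^esub> v))"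
      using ax \<phi>c(1) assms(4) smult_closed
      by (simp add: a_minus_def smult_r_distr smult_assoc smult_neg_right)
    then show "\<phi> (a \<odot>\<^bsub>V\<^esub> x) = a \<odot>\<^bsub>regular_module K\<^esub> \<phi> x"
      using ax \<phi>c S(5) smult_closed by (auto simp: regular_module_def intro!: \<phi>)
  qed (use \<phi>c in \<open>auto simp: regular_module_def \<phi>_def\<close>)
  moreover have "\<phi> v = \<one>\<^bsub>K\<^esub>"
    using assms(4) S(2) M.minus_eq_zero_iff[of v v] by (intro \<phi>) (auto simp: smult_one)
  ultimately show ?thesis using that by simp
qed

section \<open>Modules over a finite-dimensional algebra\<close>

text \<open>Stated for additive maps between groups, since it is applied to evaluation maps and to
  pairings with values in the ground field, which are not linear maps of left modules.\<close>

lemma additive_finsum: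
  assumes "abelian_group G" "abelian_group H" "finite I" "f \<in> I \<rightarrow> carrier G"
    "\<And>x. x \<in> carrier G \<Longrightarrow> h x \<in> carrier H"
    "\<And>x y. \<lbrakk>x \<in> carrier G; y \<in> carrier G\<rbrakk> \<Longrightarrow> h (x \<oplus>\<^bsub>G\<^esub> y) = h x \<oplus>\<^bsub>H\<^esub> h y"
  shows "h (finsum G f I) = finsum H (\<lambda>i. h (f i)) I"
proof -
  interpret G: abelian_group G by fact
  interpret H: abelian_group H by fact
  have z: "h \<zero>\<^bsub>G\<^esub> = \<zero>\<^bsub>H\<^esub>"
    using assms(5)[OF G.zero_closed] assms(6)[OF G.zero_closed G.zero_closed] by simp
  show ?thesis using assms(3,4)
  proof (induction I rule: finite_induct)
    case (insert x F)
    then have c: "f \<in> F \<rightarrow> carrier G" "f x \<in> carrier G" "(\<lambda>i. h (f i)) \<in> F \<rightarrow> carrier H" "h (f x) \<in> carrier H"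
      using assms(5) by auto
    have "h (finsum G f (insert x F)) = h (f x) \<oplus>\<^bsub>H\<^esub> h (finsum G f F)"
      using insert.hyps c by (simp add: assms(6))
    also have "\<dots> = finsum H (\<lambda>i. h (f i)) (insert x F)"
      using insert.hyps insert.IH c by simp
    finally show ?case .
  qed (simp add: z)
qed

lemma map_module_simps [simp]:
  "carrier (map_module R M N s) = lin_maps R M N"
  "\<zero>\<^bsub>map_module R M N s\<^esub> = (\<lambda>_. \<zero>\<^bsub>N\<^esub>)"
  "f \<oplus>\<^bsub>map_module R M N s\<^esub> g = (\<lambda>x. f x \<oplus>\<^bsub>N\<^esub> g x)"
  "c \<odot>\<^bsub>map_module R M N s\<^esub> f = s c f"
  by (simp_all add: map_module_def)

lemma regular_module_simps [simp]:
  "carrier (regular_module R) = carrier R" "\<zero>\<^bsub>regular_module R\<^esub> = \<zero>\<^bsub>R\<^esub>"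
  "a \<oplus>\<^bsub>regular_module R\<^esub> b = a \<oplus>\<^bsub>R\<^esub> b" "a \<odot>\<^bsub>regular_module R\<^esub> b = a \<otimes>\<^bsub>R\<^esub> b"
  by (simp_all add: regular_module_def)

lemma regular_left_module:
  assumes "ring R" shows "left_module R (regular_module R)"
proof -
  interpret ring R by fact
  have "abelian_group (regular_module R)"
  proof (rule abelian_groupI)
    fix x assume "x \<in> carrier (regular_module R)"
    then show "\<exists>y\<in>carrier (regular_module R). y \<oplus>\<^bsub>regular_module R\<^esub> x = \<zero>\<^bsub>regular_module R\<^esub>"
      using l_neg[of x] a_inv_closed[of x] by auto
  qed (auto simp: a_ac)
  then show ?thesis
    using assms by (auto simp: left_module_def left_module_axioms_def l_distr r_distr m_assoc)
qed

text \<open>Stated for every scalar action \<open>s\<close>, so that it serves Hom spaces over the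
  ground field, the right modules Hom(P,L) and auxiliary groups of maps alike.\<close>

lemma map_module_abelian:
  assumes "left_module R N"
  shows "abelian_group (map_module R M N s)"
proof -
  interpret N: left_module R N by fact
  show ?thesis
  proof (rule abelian_groupI)
    fix f g assume "f \<in> carrier (map_module R M N s)" "g \<in> carrier (map_module R M N s)"
    then have fg: "f \<in> lin_maps R M N" "g \<in> lin_maps R M N" by auto
    show "f \<oplus>\<^bsub>map_module R M N s\<^esub> g \<in> carrier (map_module R M N s)"
      using lin_mapsD[OF fg(1)] lin_mapsD[OF fg(2)]
      by (auto intro!: lin_mapsI simp: N.M.a_ac N.smult_r_distr)
    have c: "f x \<in> carrier N" "g x \<in> carrier N" for x
      using lin_mapsD(1,4)[OF fg(1)] lin_mapsD(1,4)[OF fg(2)] N.M.zero_closed by metis+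
    show "f \<oplus>\<^bsub>map_module R M N s\<^esub> g = g \<oplus>\<^bsub>map_module R M N s\<^esub> f" using c by (auto simp: N.M.a_comm)
    show "\<zero>\<^bsub>map_module R M N s\<^esub> \<oplus>\<^bsub>map_module R M N s\<^esub> f = f" using c by auto
    have "(\<lambda>x. \<ominus>\<^bsub>N\<^esub> f x) \<in> lin_maps R M N"
      using lin_mapsD[OF fg(1)]
      by (auto intro!: lin_mapsI simp: N.M.minus_add N.M.neg_zero N.smult_neg_right)
    then show "\<exists>h\<in>carrier (map_module R M N s). h \<oplus>\<^bsub>map_module R M N s\<^esub> f = \<zero>\<^bsub>map_module R M N s\<^esub>"
      using c by (intro bexI[of _ "\<lambda>x. \<ominus>\<^bsub>N\<^esub> f x"]) (auto simp: N.M.l_neg)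
    fix h assume "h \<in> carrier (map_module R M N s)"
    then have "h x \<in> carrier N" for x using lin_mapsD(1,4)[of h R M N] N.M.zero_closed
      by (metis map_module_simps(1))
    then show "f \<oplus>\<^bsub>map_module R M N s\<^esub> g \<oplus>\<^bsub>map_module R M N s\<^esub> h
        = f \<oplus>\<^bsub>map_module R M N s\<^esub> (g \<oplus>\<^bsub>map_module R M N s\<^esub> h)"
      using c by (auto simp: N.M.a_assoc)
  qed (auto intro!: lin_mapsI)
qed

lemma lin_maps_range:
  assumes "f \<in> lin_maps R M N" "left_module R N"
  shows "f x \<in> carrier N"
proof -
  interpret N: left_module R N by fact
  show ?thesis using lin_mapsD(1,4)[OF assms(1)] N.M.zero_closed by metis
qed

lemma map_module_finsum:
  assumes "left_module R N" "finite I" "\<And>i. i \<in> I \<Longrightarrow> f i \<in> lin_maps R M N"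
  shows "finsum (map_module R M N s) f I x = finsum N (\<lambda>i. f i x) I"
proof -
  interpret N: left_module R N by fact
  show ?thesis
    using additive_finsum[OF map_module_abelian[OF assms(1), of M s] N.M.abelian_group_axioms assms(2), of f "\<lambda>g. g x"]
      assms(3) lin_maps_range[OF _ assms(1), of _ M x] by (simp add: Pi_def)
qed

locale fd_algebra =
  fixes K :: "('k, 'r) ring_scheme" and L :: "('k, 'a) module"
  assumes field_K: "field K" and ring_L: "ring L" and module_L: "module K L" and fin_gen_L: "fin_gen K L"
    and smult_mult_left: "\<lbrakk>c \<in> carrier K; a \<in> carrier L; b \<in> carrier L\<rbrakk>
          \<Longrightarrow> (c \<odot>\<^bsub>L\<^esub> a) \<otimes>\<^bsub>L\<^esub> b = c \<odot>\<^bsub>L\<^esub> (a \<otimes>\<^bsub>L\<^esub> b)"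
    and smult_mult_right: "\<lbrakk>c \<in> carrier K; a \<in> carrier L; b \<in> carrier L\<rbrakk>
          \<Longrightarrow> a \<otimes>\<^bsub>L\<^esub> (c \<odot>\<^bsub>L\<^esub> b) = c \<odot>\<^bsub>L\<^esub> (a \<otimes>\<^bsub>L\<^esub> b)"
begin

sublocale K: field K by (rule field_K)
sublocale L: ring L by (rule ring_L)

lemma left_module_L: "left_module K L"
  by (rule module_left_module[OF module_L])

abbreviation scal :: "'k \<Rightarrow> 'a" where "scal c \<equiv> c \<odot>\<^bsub>L\<^esub> \<one>\<^bsub>L\<^esub>"

lemma scal_closed: "c \<in> carrier K \<Longrightarrow> scal c \<in> carrier L"
  using left_module.smult_closed[OF left_module_L _ L.one_closed] .

lemma scal_mult: assumes "c \<in> carrier K" "a \<in> carrier L"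
  shows "scal c \<otimes>\<^bsub>L\<^esub> a = c \<odot>\<^bsub>L\<^esub> a" "a \<otimes>\<^bsub>L\<^esub> scal c = c \<odot>\<^bsub>L\<^esub> a"
  using smult_mult_left[OF assms(1) L.one_closed assms(2)] smult_mult_right[OF assms(1,2) L.one_closed] assms
  by auto

lemma scal_add: "\<lbrakk>c \<in> carrier K; d \<in> carrier K\<rbrakk> \<Longrightarrow> scal (c \<oplus>\<^bsub>K\<^esub> d) = scal c \<oplus>\<^bsub>L\<^esub> scal d"
  using left_module.smult_l_distr[OF left_module_L] L.one_closed by blast

lemma scal_mul: "\<lbrakk>c \<in> carrier K; d \<in> carrier K\<rbrakk> \<Longrightarrow> scal (c \<otimes>\<^bsub>K\<^esub> d) = scal c \<otimes>\<^bsub>L\<^esub> scal d"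
  using left_module.smult_assoc[OF left_module_L, of c d "\<one>\<^bsub>L\<^esub>"] scal_mult(1)[of c "scal d"] scal_closed
  by simp

lemma scal_one: "scal \<one>\<^bsub>K\<^esub> = \<one>\<^bsub>L\<^esub>"
  using left_module.smult_one[OF left_module_L] by simp

section \<open>The category of finitely generated modules\<close>

lemma mod_obj: "M \<in> Obj (mod_cat L) \<longleftrightarrow> left_module L M \<and> fin_gen L M"
  by (simp add: mod_cat_def)

lemma mod_cat_simps [simp]:
  "Hom (mod_cat L) M N = map_module L M N (\<lambda>c f x. scal c \<odot>\<^bsub>N\<^esub> f x)"
  "g \<cdot>\<^bsub>mod_cat L\<^esub> f = g \<circ> f" "Idn (mod_cat L) M = id_map M"
  by (auto simp: mod_cat_def id_map_def)

lemma id_map_lin: "left_module L M \<Longrightarrow> id_map M \<in> lin_maps L M M"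
  by (rule lin_mapsI)
    (auto simp: id_map_def left_module.smult_closed left_module_def abelian_group_def abelian_monoid.a_closed)

lemma hom_module_mod:
  assumes "left_module L M" "left_module L N"
  shows "module K (map_module L M N (\<lambda>c f x. scal c \<odot>\<^bsub>N\<^esub> f x))"
proof -
  interpret N: left_module L N by fact
  have c: "f x \<in> carrier N" if "f \<in> lin_maps L M N" for f x using lin_maps_range[OF that assms(2)] .
  show ?thesis
  proof (rule moduleI)
    show "cring K" by unfold_locales
    show "abelian_group (map_module L M N (\<lambda>c f x. scal c \<odot>\<^bsub>N\<^esub> f x))"
      using map_module_abelian[OF assms(2)] .
    fix a f assume a: "a \<in> carrier K" and "f \<in> carrier (map_module L M N (\<lambda>c f x. scal c \<odot>\<^bsub>N\<^esub> f x))"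
    then have f: "f \<in> lin_maps L M N" by simp
    \<comment> \<open>The ground field acts through central elements of \<open>L\<close>; this keeps
      a scaled linear map linear.\<close>
    have "scal a \<odot>\<^bsub>N\<^esub> (b \<odot>\<^bsub>N\<^esub> f x) = b \<odot>\<^bsub>N\<^esub> (scal a \<odot>\<^bsub>N\<^esub> f x)" if "b \<in> carrier L" for b x
      using N.smult_assoc[OF scal_closed[OF a] that c[OF f]] N.smult_assoc[OF that scal_closed[OF a] c[OF f]]
        scal_mult[OF a that] by simp
    then have "(\<lambda>x. scal a \<odot>\<^bsub>N\<^esub> f x) \<in> lin_maps L M N"
      using lin_mapsD[OF f] scal_closed[OF a]
      by (auto intro!: lin_mapsI N.smult_closed simp: N.smult_r_distr)
    then show "a \<odot>\<^bsub>map_module L M N (\<lambda>c f x. scal c \<odot>\<^bsub>N\<^esub> f x)\<^esub> f \<in> carrier (map_module L M N (\<lambda>c f x. scal c \<odot>\<^bsub>N\<^esub> f x))"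
      by simp
  qed (auto simp: c N.smult_l_distr N.smult_r_distr scal_closed N.smult_assoc[symmetric] scal_add scal_mul scal_one[simplified] N.smult_one)
qed

lemma mod_linear_category: "linear_category K (mod_cat L :: (('a, 'v) module, 'v \<Rightarrow> 'v, 'k) lincat)"
proof -
  let ?C = "mod_cat L :: (('a, 'v) module, 'v \<Rightarrow> 'v, 'k) lincat"
  have lm: "left_module L A" if "A \<in> Obj ?C" for A using that mod_obj by blast
  have car: "f \<in> carrier (Hom ?C A B) \<longleftrightarrow> f \<in> lin_maps L A B" for f A B by simp
  have lin: "lin_map L A B f" if "A \<in> Obj ?C" "B \<in> Obj ?C" "f \<in> carrier (Hom ?C A B)" for A B f
    using lin_mapI[OF lm[OF that(1)] lm[OF that(2)] that(3)[unfolded car]] .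
  have rg: "f x \<in> carrier B" if "B \<in> Obj ?C" "f \<in> carrier (Hom ?C A B)" for A B f x
    using lin_maps_range[OF that(2)[unfolded car] lm[OF that(1)]] .
  show ?thesis
  proof (rule linear_category.intro)
    show "module K (Hom ?C A B)" if "A \<in> Obj ?C" "B \<in> Obj ?C" for A B
      using hom_module_mod[OF lm[OF that(1)] lm[OF that(2)]] by simp
    show "g \<cdot>\<^bsub>?C\<^esub> f \<in> carrier (Hom ?C A E)"
      if "A \<in> Obj ?C" "B \<in> Obj ?C" "E \<in> Obj ?C" "f \<in> carrier (Hom ?C A B)" "g \<in> carrier (Hom ?C B E)"
      for A B E f g
      using lin_maps_comp[OF that(4,5)[unfolded car] lm[OF that(2)] lm[OF that(3)]] by simp
    show "Idn ?C A \<in> carrier (Hom ?C A A)" if "A \<in> Obj ?C" for A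
      using id_map_lin[OF lm[OF that]] by simp
    show "f \<cdot>\<^bsub>?C\<^esub> Idn ?C A = f" if "A \<in> Obj ?C" "B \<in> Obj ?C" "f \<in> carrier (Hom ?C A B)" for A B f
      using lin_map.f_zero[OF lin[OF that]] lin_map.f_out[OF lin[OF that]] by (auto simp: id_map_def)
    show "Idn ?C B \<cdot>\<^bsub>?C\<^esub> f = f" if "A \<in> Obj ?C" "B \<in> Obj ?C" "f \<in> carrier (Hom ?C A B)" for A B f
      using rg[OF that(2,3)] by (auto simp: id_map_def)
    show "g \<cdot>\<^bsub>?C\<^esub> (f \<oplus>\<^bsub>Hom ?C A B\<^esub> f') = g \<cdot>\<^bsub>?C\<^esub> f \<oplus>\<^bsub>Hom ?C A E\<^esub> g \<cdot>\<^bsub>?C\<^esub> f'"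
      if "A \<in> Obj ?C" "B \<in> Obj ?C" "E \<in> Obj ?C" "f \<in> carrier (Hom ?C A B)" "f' \<in> carrier (Hom ?C A B)"
        "g \<in> carrier (Hom ?C B E)" for A B E f f' g
      using lin_map.f_add[OF lin[OF that(2,3,6)]] rg[OF that(2,4)] rg[OF that(2,5)] by auto
    show "g \<cdot>\<^bsub>?C\<^esub> (c \<odot>\<^bsub>Hom ?C A B\<^esub> f) = c \<odot>\<^bsub>Hom ?C A E\<^esub> (g \<cdot>\<^bsub>?C\<^esub> f)"
      if "A \<in> Obj ?C" "B \<in> Obj ?C" "E \<in> Obj ?C" "c \<in> carrier K" "f \<in> carrier (Hom ?C A B)"
        "g \<in> carrier (Hom ?C B E)" for A B E f g c
      using lin_map.f_smult[OF lin[OF that(2,3,6)] scal_closed[OF that(4)]] rg[OF that(2,5)] by auto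
  qed (auto simp: field_K)
qed

lemma arr_mod: "arr (mod_cat L) f M N \<longleftrightarrow> M \<in> Obj (mod_cat L) \<and> N \<in> Obj (mod_cat L) \<and> f \<in> lin_maps L M N"
  by (simp add: arr_def)

lemma arr_mod_lin_map: "arr (mod_cat L) f M N \<Longrightarrow> lin_map L M N f"
  by (simp add: arr_mod mod_obj lin_mapI)

text \<open>Submodules over \<open>L\<close> are subspaces, so it suffices that the underlying
  vector space \<open>MK\<close> is finitely generated. It is, by the products of generators of
  \<open>L\<close> over the field with generators of \<open>M\<close> over \<open>L\<close>.\<close>

lemma mod_fin_len:
  fixes M :: "('a, 'v) module"
  assumes "M \<in> Obj (mod_cat L)"
  shows "fin_len L M"
proof -
  interpret M: left_module L M using assms mod_obj by blast
  define MK :: "('k, 'v) module" where "MK = \<lparr>carrier = carrier M, monoid.mult = undefined, one = undefined,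
     zero = \<zero>\<^bsub>M\<^esub>, add = add M, smult = (\<lambda>c x. scal c \<odot>\<^bsub>M\<^esub> x)\<rparr>"
  have MK: "carrier MK = carrier M" "\<zero>\<^bsub>MK\<^esub> = \<zero>\<^bsub>M\<^esub>" "x \<oplus>\<^bsub>MK\<^esub> y = x \<oplus>\<^bsub>M\<^esub> y" "c \<odot>\<^bsub>MK\<^esub> x = scal c \<odot>\<^bsub>M\<^esub> x"
    for x y c
    by (auto simp: MK_def)
  have ab: "abelian_group MK"
  proof (rule abelian_groupI)
    fix x assume "x \<in> carrier MK"
    then show "\<exists>y\<in>carrier MK. y \<oplus>\<^bsub>MK\<^esub> x = \<zero>\<^bsub>MK\<^esub>"
      using M.M.l_neg[of x] M.M.a_inv_closed[of x] by (auto simp: MK)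
  qed (auto simp: MK M.M.a_ac)
  have m: "module K MK"
  proof (rule moduleI)
    show "cring K" by unfold_locales
  qed (use ab in \<open>auto simp: MK M.smult_closed M.smult_l_distr M.smult_r_distr scal_closed scal_add scal_mul M.smult_assoc
      scal_one M.smult_one\<close>)
  interpret MK: left_module K MK using module_left_module[OF m] .
  have sub: "submodule S K MK" if "submodule S L M" for S
    using M.submodD[OF that] by (intro MK.submodI) (auto simp: MK scal_closed)
  obtain X where X: "finite X" "X \<subseteq> carrier M" "\<And>S. \<lbrakk>submodule S L M; X \<subseteq> S\<rbrakk> \<Longrightarrow> S = carrier M"
    using assms[unfolded mod_obj] unfolding fin_gen_def by blast
  obtain Y where Y: "finite Y" "Y \<subseteq> carrier L" "\<And>S. \<lbrakk>submodule S K L; Y \<subseteq> S\<rbrakk> \<Longrightarrow> S = carrier L"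
    using fin_gen_L unfolding fin_gen_def by blast
  interpret LK: left_module K L by (rule left_module_L)
  have "fin_gen K MK" unfolding fin_gen_def
  proof (intro exI[of _ "(\<lambda>(l, x). l \<odot>\<^bsub>M\<^esub> x) ` (Y \<times> X)"] conjI allI impI)
    show "finite ((\<lambda>(l, x). l \<odot>\<^bsub>M\<^esub> x) ` (Y \<times> X))" using X Y by simp
    show "(\<lambda>(l, x). l \<odot>\<^bsub>M\<^esub> x) ` (Y \<times> X) \<subseteq> carrier MK" using X(2) Y(2)
      by (auto simp: MK intro!: M.smult_closed)
    fix W assume W: "submodule W K MK \<and> (\<lambda>(l, x). l \<odot>\<^bsub>M\<^esub> x) ` (Y \<times> X) \<subseteq> W"
    then have "submodule W K MK" by blast
    note w = MK.submodD[OF this, unfolded MK]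
    have lx: "l \<odot>\<^bsub>M\<^esub> x \<in> W" if l: "l \<in> carrier L" and x: "x \<in> X" for l x
    proof -
      have xc: "x \<in> carrier M" using x X by blast
      have sm: "(c \<odot>\<^bsub>L\<^esub> a) \<odot>\<^bsub>M\<^esub> x = scal c \<odot>\<^bsub>M\<^esub> (a \<odot>\<^bsub>M\<^esub> x)" if "c \<in> carrier K" "a \<in> carrier L" for c a
        using M.smult_assoc[OF scal_closed[OF that(1)] that(2) xc] scal_mult[OF that] by simp
      have "submodule {l \<in> carrier L. l \<odot>\<^bsub>M\<^esub> x \<in> W} K L"
        using w xc by (intro LK.submodI) (auto simp: M.smult_l_distr sm intro: LK.smult_closed)
      moreover have "Y \<subseteq> {l \<in> carrier L. l \<odot>\<^bsub>M\<^esub> x \<in> W}" using W x Y(2) by auto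
      ultimately show ?thesis using Y(3) l by blast
    qed
    \<comment> \<open>The largest \<open>L\<close>-submodule inside the subspace \<open>W\<close>.
      It contains the generators \<open>X\<close> of \<open>M\<close>, hence is everything, and so
      is \<open>W\<close>.\<close>
    define W' where "W' = {m \<in> carrier M. \<forall>l \<in> carrier L. l \<odot>\<^bsub>M\<^esub> m \<in> W}"
    have "submodule W' L M" unfolding W'_def
      using w by (intro M.submodI) (auto simp: M.smult_r_distr M.smult_assoc[symmetric] intro: M.smult_closed)
    moreover have "X \<subseteq> W'" using lx X(2) by (auto simp: W'_def)
    ultimately have "W' = carrier M" by (rule X(3))
    moreover have "W' \<subseteq> W"
    proof
      fix m assume "m \<in> W'"
      then have "\<one>\<^bsub>L\<^esub> \<odot>\<^bsub>M\<^esub> m \<in> W" "m \<in> carrier M" by (auto simp: W'_def)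
      then show "m \<in> W" by (simp add: M.smult_one)
    qed
    ultimately show "W = carrier MK" using w(1) by (simp add: MK)
  qed
  then have "fin_len K MK" using fin_len_vector_space[OF field_K m] by blast
  then obtain d :: "'v set \<Rightarrow> nat" and n where d: "\<And>S. submodule S K MK \<Longrightarrow> d S \<le> n"
    "\<And>S S'. \<lbrakk>submodule S K MK; submodule S' K MK; S \<subset> S'\<rbrakk> \<Longrightarrow> d S < d S'"
    by (rule fin_lenE) (rule that)
  then show ?thesis unfolding fin_len_def using sub by blast
qed

text \<open>That a submodule is again finitely generated is not formal; it comes from finite
  length.\<close>

lemma submod_obj:
  assumes "M \<in> Obj (mod_cat L)" "submodule H L M"
  shows "M\<lparr>carrier := H\<rparr> \<in> Obj (mod_cat L)"
  using assms mod_fin_len[OF assms(1)] submodule_left_module fin_len_fin_gen mod_obj by metis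

section \<open>Projective covers and presentations\<close>

lemma a_kernel_eq: "a_kernel M N f = {x \<in> carrier M. f x = \<zero>\<^bsub>N\<^esub>}"
  by (simp add: a_kernel_def kernel_def)

definition restr :: "('a, 'v) module \<Rightarrow> 'v set \<Rightarrow> ('v \<Rightarrow> 'v) \<Rightarrow> 'v \<Rightarrow> 'v" where
  "restr N S f x = (if x \<in> S then f x else \<zero>\<^bsub>N\<^esub>)"

lemma restr_lin:
  assumes "left_module L M" "f \<in> lin_maps L M N" "submodule S L M"
  shows "restr N S f \<in> lin_maps L (M\<lparr>carrier := S\<rparr>) N"
proof -
  interpret M: left_module L M by fact
  note s = M.submodD[OF assms(3)]
  show ?thesis using lin_mapsD[OF assms(2)] s by (auto intro!: lin_mapsI simp: restr_def subset_iff)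
qed

lemma restr_image: "restr N S f ` S' = f ` S'" if "S' \<subseteq> S"
  using that by (force simp: restr_def image_iff)

lemma projective_retract:
  fixes P P' :: "('a, 'v) module"
  assumes "projective L P" "P' \<in> Obj (mod_cat L)" "i \<in> lin_maps L P' P" "r \<in> lin_maps L P P'"
    "\<And>x. x \<in> carrier P' \<Longrightarrow> r (i x) = x"
  shows "projective L P'"
  unfolding projective_def
proof (intro conjI ballI impI)
  fix M N :: "('a, 'v) module" and p f
  assume M: "M \<in> Obj (mod_cat L)" and N: "N \<in> Obj (mod_cat L)"
    and p: "p \<in> lin_maps L M N" "p ` carrier M = carrier N" and f: "f \<in> lin_maps L P' N"
  have l: "left_module L M" "left_module L N" "left_module L P" "left_module L P'"
    using M N assms mod_obj unfolding projective_def by blast+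
  have "f \<circ> r \<in> lin_maps L P N" using lin_maps_comp[OF assms(4) f] l by blast
  then obtain h where h: "h \<in> lin_maps L P M" "p \<circ> h = f \<circ> r"
    using assms(1) M N p unfolding projective_def by blast
  have hi: "h \<circ> i \<in> lin_maps L P' M" using lin_maps_comp[OF assms(3) h(1)] l by blast
  have "p \<circ> (h \<circ> i) = f"
  proof (rule lin_maps_eqI)
    show "p \<circ> (h \<circ> i) \<in> lin_maps L P' N" using lin_maps_comp[OF hi p(1)] l by blast
    fix x assume "x \<in> carrier P'"
    then show "(p \<circ> (h \<circ> i)) x = f x" using h(2) assms(5) by (metis comp_apply)
  qed (rule f)
  then show "\<exists>h \<in> lin_maps L P' M. p \<circ> h = f" using hi by blast
qed (rule assms)

text \<open>A minimal submodule \<open>S\<close> still mapping onto \<open>X\<close> is a retract of \<open>P\<close>: lift \<open>P \<rightarrow> X\<close> to \<open>\<alpha> : P \<rightarrow> S\<close>;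
  by minimality \<open>\<alpha>\<close> restricts to an automorphism of \<open>S\<close>.\<close>

lemma projective_cover:
  fixes P X :: "('a, 'v) module"
  assumes "projective L P" "X \<in> Obj (mod_cat L)" "p \<in> lin_maps L P X" "p ` carrier P = carrier X"
  obtains S where "submodule S L P" "projective L (P\<lparr>carrier := S\<rparr>)" "p ` S = carrier X"
    "\<And>S'. \<lbrakk>submodule S' L (P\<lparr>carrier := S\<rparr>); p ` S' = carrier X\<rbrakk> \<Longrightarrow> S' = S"
proof -
  have P: "P \<in> Obj (mod_cat L)" using assms by (simp add: projective_def)
  have l: "left_module L P" "left_module L X" using P assms mod_obj by blast+
  interpret P: left_module L P by fact
  interpret p: lin_map L P X p using lin_mapI l assms by blast
  have "submodule (carrier P) L P \<and> p ` carrier P = carrier X" using assms P.submod_carrier by blast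
  then obtain S where S0: "submodule S L P \<and> p ` S = carrier X"
    "\<And>S'. \<lbrakk>submodule S' L P \<and> p ` S' = carrier X; S' \<subseteq> S\<rbrakk> \<Longrightarrow> S' = S"
    using fin_len_minimal[OF mod_fin_len[OF P], of "\<lambda>S. submodule S L P \<and> p ` S = carrier X" "carrier P"]
    by blast
  then have S: "submodule S L P" "p ` S = carrier X" by blast+
  have Sc: "S \<subseteq> carrier P" using P.submodD(1)[OF S(1)] .
  define PS where "PS = P\<lparr>carrier := S\<rparr>"
  have PS: "PS \<in> Obj (mod_cat L)" "carrier PS = S" using submod_obj[OF P S(1)] by (auto simp: PS_def)
  have lS: "left_module L PS" using PS mod_obj by blast
  have min: "S' = S" if "submodule S' L PS" "p ` S' = carrier X" for S'
    using submodule_of_submodule[OF l(1) S(1) that(1)[unfolded PS_def]] S0(2) that by blast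
  have pS: "restr X S p \<in> lin_maps L PS X" using restr_lin[OF l(1) assms(3) S(1)] by (simp add: PS_def)
  have "restr X S p ` carrier PS = carrier X" using S restr_image[of S S X p] by (simp add: PS)
  then obtain \<alpha> where \<alpha>: "\<alpha> \<in> lin_maps L P PS" "restr X S p \<circ> \<alpha> = p"
    using assms(1) PS(1) assms(2,3) pS unfolding projective_def by blast
  interpret \<alpha>: lin_map L P PS \<alpha> using lin_mapI l lS \<alpha> by blast
  have \<alpha>S: "\<alpha> x \<in> S" "p (\<alpha> x) = p x" if "x \<in> carrier P" for x
  proof -
    show s: "\<alpha> x \<in> S" using \<alpha>.f_closed[OF that] PS by simp
    have "restr X S p (\<alpha> x) = p x" using \<alpha>(2) by (metis comp_apply)
    then show "p (\<alpha> x) = p x" using s by (simp add: restr_def)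
  qed
  define \<beta> where "\<beta> = restr PS S \<alpha>"
  have \<beta>: "\<beta> \<in> lin_maps L PS PS" using restr_lin[OF l(1) \<alpha>(1) S(1)] by (simp add: \<beta>_def PS_def)
  interpret \<beta>: lin_map L PS PS \<beta> using lin_mapI lS \<beta> by blast
  have im: "\<beta> ` S = \<alpha> ` S" using restr_image[of S S PS \<alpha>] by (simp add: \<beta>_def)
  have "p ` (\<alpha> ` S) = p ` S" unfolding image_image using \<alpha>S(2) Sc by (intro image_cong) auto
  then have "\<beta> ` S = S"
    using \<beta>.image_submod[OF \<alpha>.N.submod_carrier] S(2) im by (intro min) (auto simp: PS)
  then have "bij_betw \<beta> (carrier PS) (carrier PS)"
    using fin_len_surj_inj[OF lS mod_fin_len[OF PS(1)] \<beta>] PS by simp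
  then obtain \<gamma> where \<gamma>: "\<gamma> \<in> lin_maps L PS PS" "\<And>x. x \<in> carrier PS \<Longrightarrow> \<gamma> (\<beta> x) = x"
    by (rule \<beta>.inv_lin_map) (rule that)
  \<comment> \<open>\<open>\<gamma> \<circ> \<alpha>\<close> retracts the inclusion of
    \<open>S\<close>, because \<open>\<alpha>\<close> restricts to \<open>\<beta>\<close> there and
    \<open>\<gamma>\<close> inverts \<open>\<beta>\<close>.\<close>
  have "projective L PS"
  proof (rule projective_retract[OF assms(1) PS(1)])
    show "inclusion P S \<in> lin_maps L PS P" using inclusion_lin[OF l(1) S(1)] by (simp add: PS_def)
    show "\<gamma> \<circ> \<alpha> \<in> lin_maps L P PS" using lin_maps_comp[OF \<alpha>(1) \<gamma>(1) lS lS] .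
    fix x assume "x \<in> carrier PS"
    then show "(\<gamma> \<circ> \<alpha>) (inclusion P S x) = x"
      using \<gamma>(2)[of x] by (simp add: inclusion_def \<beta>_def restr_def PS)
  qed
  then show ?thesis using that[OF S(1) _ S(2)] min by (auto simp: PS_def)
qed

text \<open>A projective cover of \<open>X\<close> followed by one of its kernel. Enough projectives
  are assumed because modules have their elements in one fixed type, in which powers of
  \<open>L\<close> have to be found first; Hom(T,-) will supply them.\<close>

lemma minimal_presentation_exists:
  fixes X :: "('a, 'v) module"
  assumes enough: "\<And>X :: ('a, 'v) module. X \<in> Obj (mod_cat L) \<Longrightarrow>
      \<exists>(P :: ('a, 'v) module) p. projective L P \<and> p \<in> lin_maps L P X \<and> p ` carrier P = carrier X"
    and X: "X \<in> Obj (mod_cat L)"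
  obtains P1 P0 p1 p0 where "minimal_presentation L X P1 P0 p1 p0"
proof -
  obtain P :: "('a, 'v) module" and p
    where P: "projective L P" "p \<in> lin_maps L P X" "p ` carrier P = carrier X" using enough[OF X]
      by blast
  obtain S where S: "submodule S L P" "projective L (P\<lparr>carrier := S\<rparr>)" "p ` S = carrier X"
    "\<And>S'. \<lbrakk>submodule S' L (P\<lparr>carrier := S\<rparr>); p ` S' = carrier X\<rbrakk> \<Longrightarrow> S' = S"
    by (rule projective_cover[OF P(1) X P(2,3)]) (rule that)
  define P0 where "P0 = P\<lparr>carrier := S\<rparr>"
  define p0 where "p0 = restr X S p"
  have P0: "P0 \<in> Obj (mod_cat L)" "carrier P0 = S" "projective L P0" using S
    by (auto simp: P0_def projective_def)
  have l: "left_module L P" "left_module L P0" "left_module L X" using P(1) X P0 mod_obj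
    unfolding projective_def by blast+
  have p0: "p0 \<in> lin_maps L P0 X" using restr_lin[OF l(1) P(2) S(1)] by (simp add: p0_def P0_def)
  interpret p0: lin_map L P0 X p0 using lin_mapI l p0 by blast
  have p0i: "p0 ` S' = p ` S'" if "S' \<subseteq> S" for S' using restr_image[OF that] by (simp add: p0_def)
  define N where "N = {x \<in> carrier P0. p0 x = \<zero>\<^bsub>X\<^esub>}"
  have N: "submodule N L P0" using p0.kernel_submod by (simp add: N_def)
  define K0 where "K0 = P0\<lparr>carrier := N\<rparr>"
  have K0: "K0 \<in> Obj (mod_cat L)" "carrier K0 = N" using submod_obj[OF P0(1) N] by (auto simp: K0_def)
  obtain Q :: "('a, 'v) module" and q
    where Q: "projective L Q" "q \<in> lin_maps L Q K0" "q ` carrier Q = carrier K0" using enough[OF K0(1)]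
      by blast
  obtain S1 where S1: "submodule S1 L Q" "projective L (Q\<lparr>carrier := S1\<rparr>)" "q ` S1 = carrier K0"
    "\<And>S'. \<lbrakk>submodule S' L (Q\<lparr>carrier := S1\<rparr>); q ` S' = carrier K0\<rbrakk> \<Longrightarrow> S' = S1"
    by (rule projective_cover[OF Q(1) K0(1) Q(2,3)]) (rule that)
  define P1 where "P1 = Q\<lparr>carrier := S1\<rparr>"
  define p1 where "p1 = restr K0 S1 q"
  have lQ: "left_module L Q" "left_module L P1" using Q(1) S1(2) mod_obj unfolding projective_def P1_def
    by blast+
  have P1: "carrier P1 = S1" "projective L P1" using S1(2) by (auto simp: P1_def)
  have p1: "p1 \<in> lin_maps L P1 K0" using restr_lin[OF lQ(1) Q(2) S1(1)] by (simp add: p1_def P1_def)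
  have p1': "p1 \<in> lin_maps L P1 P0"
    using lin_mapsD[OF p1] p0.M.submodD(1)[OF N] by (auto intro!: lin_mapsI simp: K0_def)
  have p1i: "p1 ` S' = q ` S'" if "S' \<subseteq> S1" for S' using restr_image[OF that] by (simp add: p1_def)
  interpret P1: left_module L P1 by fact
  have "minimal_presentation L X P1 P0 p1 p0"
    unfolding minimal_presentation_def right_exact_def a_kernel_eq
  proof (intro conjI allI impI)
    show "p1 ` carrier P1 = {x \<in> carrier P0. p0 x = \<zero>\<^bsub>X\<^esub>}" using p1i[of S1] P1 S1(3) K0
      by (simp add: N_def)
    show "p0 ` carrier P0 = carrier X" using p0i[of S] P0 S(3) by simp
  next
    fix S' assume s: "submodule S' L P0 \<and> p0 ` S' = p0 ` carrier P0"
    then have "S' \<subseteq> S" using p0.M.submodD(1)[of S'] P0 by auto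
    then show "S' = carrier P0" using s p0i[of S'] p0i[of S] P0(2) S(3) S(4)[of S'] by (simp add: P0_def)
  next
    fix S' assume s: "submodule S' L P1 \<and> p1 ` S' = p1 ` carrier P1"
    then have "S' \<subseteq> S1" using P1.submodD(1)[of S'] P1 by auto
    then show "S' = carrier P1" using s p1i[of S'] p1i[of S1] P1(1) S1(3) S1(4)[of S']
      by (simp add: P1_def)
  qed (use P1 P0 p1' p0 in auto)
  then show ?thesis using that by blast
qed

text \<open>\<open>projective\<close> speaks of surjections between modules, so \<open>f\<close> and
  \<open>u\<close> are first corestricted to the kernel of \<open>g\<close>, which \<open>f\<close>
  maps onto.\<close>

lemma projective_lift:
  fixes P A B :: "('a, 'v) module"
  assumes "projective L P" "right_exact L A B E f g" "A \<in> Obj (mod_cat L)" "B \<in> Obj (mod_cat L)" "E \<in> Obj (mod_cat L)"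
    "u \<in> lin_maps L P B" "\<And>x. x \<in> carrier P \<Longrightarrow> g (u x) = \<zero>\<^bsub>E\<^esub>"
  obtains v where "v \<in> lin_maps L P A" "f \<circ> v = u"
proof -
  have l: "left_module L B" "left_module L E" using assms mod_obj by blast+
  have e: "f \<in> lin_maps L A B" "g \<in> lin_maps L B E" "f ` carrier A = {x \<in> carrier B. g x = \<zero>\<^bsub>E\<^esub>}"
    using assms(2) by (auto simp: right_exact_def a_kernel_eq)
  interpret g: lin_map L B E g using lin_mapI l e by blast
  define N where "N = {x \<in> carrier B. g x = \<zero>\<^bsub>E\<^esub>}"
  have N: "B\<lparr>carrier := N\<rparr> \<in> Obj (mod_cat L)" using submod_obj[OF assms(4) g.kernel_submod]
    by (simp add: N_def)
  have fN: "f \<in> lin_maps L A (B\<lparr>carrier := N\<rparr>)" using e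
    by (intro lin_maps_restrict_codomain) (auto simp: N_def)
  have uN: "u \<in> lin_maps L P (B\<lparr>carrier := N\<rparr>)"
    using assms(6,7) lin_mapsD(1)[OF assms(6)] by (intro lin_maps_restrict_codomain) (auto simp: N_def)
  have "f ` carrier A = carrier (B\<lparr>carrier := N\<rparr>)" using e by (simp add: N_def)
  then show ?thesis using assms(1,3) N fN uN that unfolding projective_def by blast
qed

lemma projective_lift_surj:
  fixes P A B :: "('a, 'v) module"
  assumes "projective L P" "A \<in> Obj (mod_cat L)" "B \<in> Obj (mod_cat L)"
    "f \<in> lin_maps L A B" "f ` carrier A = carrier B" "u \<in> lin_maps L P B"
  obtains v where "v \<in> lin_maps L P A" "f \<circ> v = u"
  using assms unfolding projective_def by blast

text \<open>The minimal presentation is a retract of every projective presentation.\<close>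

lemma minimal_presentation_extension:
  fixes U N Q1 Q0 P1 P0 :: "('a, 'v) module"
  assumes mp: "minimal_presentation L U P1 P0 p1 p0" and U: "U \<in> Obj (mod_cat L)"
    and N: "N \<in> Obj (mod_cat L)"
    and Q: "projective L Q1" "projective L Q0" "right_exact L Q1 Q0 U q1 q0"
    and ext: "\<And>\<psi>. \<psi> \<in> lin_maps L Q1 N \<Longrightarrow> \<exists>\<chi> \<in> lin_maps L Q0 N. \<psi> = \<chi> \<circ> q1"
    and \<psi>: "\<psi> \<in> lin_maps L P1 N"
  obtains \<chi> where "\<chi> \<in> lin_maps L P0 N" "\<psi> = \<chi> \<circ> p1"
proof -
  have P: "projective L P1" "projective L P0" "right_exact L P1 P0 U p1 p0"
    and m0: "\<And>S. \<lbrakk>submodule S L P0; p0 ` S = p0 ` carrier P0\<rbrakk> \<Longrightarrow> S = carrier P0"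
    and m1: "\<And>S. \<lbrakk>submodule S L P1; p1 ` S = p1 ` carrier P1\<rbrakk> \<Longrightarrow> S = carrier P1"
    using mp unfolding minimal_presentation_def by blast+
  have O: "P1 \<in> Obj (mod_cat L)" "P0 \<in> Obj (mod_cat L)" "Q1 \<in> Obj (mod_cat L)" "Q0 \<in> Obj (mod_cat L)"
    using P Q by (auto simp: projective_def)
  have l: "left_module L P1" "left_module L P0" "left_module L Q1" "left_module L Q0" "left_module L U" "left_module L N"
    using O U N mod_obj by blast+
  have pe: "p1 \<in> lin_maps L P1 P0" "p0 \<in> lin_maps L P0 U" "p1 ` carrier P1 = {x \<in> carrier P0. p0 x = \<zero>\<^bsub>U\<^esub>}" "p0 ` carrier P0 = carrier U"
    and qe: "q1 \<in> lin_maps L Q1 Q0" "q0 \<in> lin_maps L Q0 U" "q1 ` carrier Q1 = {x \<in> carrier Q0. q0 x = \<zero>\<^bsub>U\<^esub>}" "q0 ` carrier Q0 = carrier U"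
    using P(3) Q(3) by (auto simp: right_exact_def a_kernel_eq)
  obtain i0 where i0: "i0 \<in> lin_maps L P0 Q0" "q0 \<circ> i0 = p0"
    using projective_lift_surj[OF P(2) O(4) U qe(2,4) pe(2)] .
  obtain r0 where r0: "r0 \<in> lin_maps L Q0 P0" "p0 \<circ> r0 = q0"
    using projective_lift_surj[OF Q(2) O(2) U pe(2,4) qe(2)] .
  have "q0 ((i0 \<circ> p1) x) = \<zero>\<^bsub>U\<^esub>" if "x \<in> carrier P1" for x
    using i0(2) pe(3) that by (metis (mono_tags, lifting) comp_apply image_eqI mem_Collect_eq)
  then obtain i1 where i1: "i1 \<in> lin_maps L P1 Q1" "q1 \<circ> i1 = i0 \<circ> p1"
    using projective_lift[OF P(1) Q(3) O(3,4) U lin_maps_comp[OF pe(1) i0(1) l(2,4)]] by blast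
  have "p0 ((r0 \<circ> q1) x) = \<zero>\<^bsub>U\<^esub>" if "x \<in> carrier Q1" for x
    using r0(2) qe(3) that by (metis (mono_tags, lifting) comp_apply image_eqI mem_Collect_eq)
  then obtain r1 where r1: "r1 \<in> lin_maps L Q1 P1" "p1 \<circ> r1 = r0 \<circ> q1"
    using projective_lift[OF Q(1) P(3) O(1,2) U lin_maps_comp[OF qe(1) r0(1) l(4,2)]] by blast
  \<comment> \<open>The comparison maps between the two presentations need not compose to
    identities. Their composites commute with the maps of the minimal presentation, so minimality
    makes them surjective, first \<open>\<phi>0\<close> and then \<open>\<phi>1\<close>; finite
    length makes \<open>\<phi>1\<close> bijective.\<close>
  define \<phi>0 where "\<phi>0 = r0 \<circ> i0"
  define \<phi>1 where "\<phi>1 = r1 \<circ> i1"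
  interpret f0: lin_map L P0 P0 \<phi>0 unfolding \<phi>0_def using lin_mapI l lin_maps_comp[OF i0(1) r0(1)]
    by blast
  interpret f1: lin_map L P1 P1 \<phi>1 unfolding \<phi>1_def using lin_mapI l lin_maps_comp[OF i1(1) r1(1)]
    by blast
  have e0: "p0 (\<phi>0 x) = p0 x" for x using i0(2) r0(2) by (metis \<phi>0_def comp_apply)
  have e1: "p1 (\<phi>1 x) = \<phi>0 (p1 x)" for x using i1(2) r1(2) by (metis \<phi>0_def \<phi>1_def comp_apply)
  have s0: "\<phi>0 ` carrier P0 = carrier P0"
    using f0.image_submod[OF f0.M.submod_carrier] e0 by (intro m0) (simp_all add: image_image)
  have "p1 ` (\<phi>1 ` carrier P1) = \<phi>0 ` (p1 ` carrier P1)" by (simp add: image_image e1)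
  also have "\<dots> = p1 ` carrier P1"
  proof
    show "\<phi>0 ` (p1 ` carrier P1) \<subseteq> p1 ` carrier P1" unfolding pe(3) using f0.f_closed e0 by auto
    show "p1 ` carrier P1 \<subseteq> \<phi>0 ` (p1 ` carrier P1)"
    proof
      fix x assume "x \<in> p1 ` carrier P1"
      then have x: "x \<in> carrier P0" "p0 x = \<zero>\<^bsub>U\<^esub>" unfolding pe(3) by auto
      then obtain y where y: "y \<in> carrier P0" "x = \<phi>0 y" using s0 by blast
      then show "x \<in> \<phi>0 ` (p1 ` carrier P1)" unfolding pe(3) using x e0 by auto
    qed
  qed
  finally have s1: "\<phi>1 ` carrier P1 = carrier P1"
    using f1.image_submod[OF f1.M.submod_carrier] by (intro m1)
  obtain \<gamma> where \<gamma>: "\<gamma> \<in> lin_maps L P1 P1" "\<And>x. x \<in> carrier P1 \<Longrightarrow> \<gamma> (\<phi>1 x) = x"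
    by (rule f1.inv_lin_map[OF fin_len_surj_inj[OF l(1) mod_fin_len[OF O(1)] f1.f_lin s1]]) (rule that)
  \<comment> \<open>\<open>\<gamma> \<circ> r1\<close> is a retraction of \<open>i1\<close>.
    Transport \<open>\<psi>\<close> along it to \<open>Q1\<close>, extend it over \<open>Q0\<close>
    there, and pull the extension back along \<open>i0\<close>.\<close>
  have "\<psi> \<circ> (\<gamma> \<circ> r1) \<in> lin_maps L Q1 N"
    using lin_maps_comp[OF lin_maps_comp[OF r1(1) \<gamma>(1)] \<psi>] l by blast
  then obtain \<chi> where \<chi>: "\<chi> \<in> lin_maps L Q0 N" "\<psi> \<circ> (\<gamma> \<circ> r1) = \<chi> \<circ> q1" using ext by blast
  have c: "\<chi> \<circ> i0 \<in> lin_maps L P0 N" using lin_maps_comp[OF i0(1) \<chi>(1) l(4,6)] .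
  have "\<psi> = (\<chi> \<circ> i0) \<circ> p1"
  proof (rule lin_maps_eqI[OF \<psi> lin_maps_comp[OF pe(1) c l(2,6)]])
    fix x assume x: "x \<in> carrier P1"
    have "\<psi> x = (\<psi> \<circ> (\<gamma> \<circ> r1)) (i1 x)" using \<gamma>(2)[OF x] by (simp add: \<phi>1_def)
    also have "\<dots> = \<chi> ((q1 \<circ> i1) x)" unfolding \<chi>(2) by simp
    also have "\<dots> = ((\<chi> \<circ> i0) \<circ> p1) x" unfolding i1(2) by simp
    finally show "\<psi> x = ((\<chi> \<circ> i0) \<circ> p1) x" .
  qed
  then show ?thesis using that c by blast
qed

section \<open>Isomorphisms, retracts and cokernels of modules\<close>

lemma mod_iso_arrowE:
  fixes M N :: "('a, 'v) module"
  assumes "iso_arrow (mod_cat L) M N f" "M \<in> Obj (mod_cat L)" "N \<in> Obj (mod_cat L)"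
  obtains g where "arr (mod_cat L) f M N" "arr (mod_cat L) g N M"
    "\<And>x. x \<in> carrier M \<Longrightarrow> g (f x) = x" "\<And>y. y \<in> carrier N \<Longrightarrow> f (g y) = y"
proof -
  interpret M: linear_category K "mod_cat L :: (('a, 'v) module, 'v \<Rightarrow> 'v, 'k) lincat"
    by (rule mod_linear_category)
  obtain g where g: "arr (mod_cat L) f M N" "arr (mod_cat L) g N M"
    "g \<cdot>\<^bsub>mod_cat L\<^esub> f = Idn (mod_cat L) M" "f \<cdot>\<^bsub>mod_cat L\<^esub> g = Idn (mod_cat L) N"
    by (rule M.iso_arrowD[OF assms]) (rule that)
  have "g (f x) = x" if "x \<in> carrier M" for x using fun_cong[OF g(3), of x] that
    by (simp add: id_map_def)
  moreover have "f (g y) = y" if "y \<in> carrier N" for y using fun_cong[OF g(4), of y] that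
    by (simp add: id_map_def)
  ultimately show ?thesis using that g(1,2) by blast
qed

lemma mod_iso_arrowI:
  fixes M N :: "('a, 'v) module"
  assumes "arr (mod_cat L) f M N" "arr (mod_cat L) g N M"
    "\<And>x. x \<in> carrier M \<Longrightarrow> g (f x) = x" "\<And>y. y \<in> carrier N \<Longrightarrow> f (g y) = y"
  shows "iso_arrow (mod_cat L) M N f"
proof -
  interpret M: linear_category K "mod_cat L :: (('a, 'v) module, 'v \<Rightarrow> 'v, 'k) lincat"
    by (rule mod_linear_category)
  have fg: "f \<in> lin_maps L M N" "g \<in> lin_maps L N M" and l: "left_module L M" "left_module L N"
    using assms by (auto simp: arr_mod mod_obj)
  have "g \<circ> f = id_map M"
    by (rule lin_maps_eqI[OF lin_maps_comp[OF fg l(2,1)] id_map_lin[OF l(1)]]) (simp add: id_map_def assms)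
  moreover have "f \<circ> g = id_map N"
    by (rule lin_maps_eqI[OF lin_maps_comp[OF fg(2,1) l] id_map_lin[OF l(2)]]) (simp add: id_map_def assms)
  ultimately show ?thesis using M.iso_arrowI[OF assms(1,2)] by simp
qed

lemma zero_object_mod: "M \<in> Obj (mod_cat L) \<Longrightarrow> zero_object (mod_cat L) M \<longleftrightarrow> (\<forall>x \<in> carrier M. x = \<zero>\<^bsub>M\<^esub>)"
  by (auto simp: zero_object_def id_map_def fun_eq_iff)

text \<open>The complement is the kernel of \<open>p\<close>, with projection \<open>q\<close>,
  which is the identity minus \<open>i \<circ> p\<close>. The second conclusion serves retracts of
  indecomposable modules: once the complement vanishes, \<open>i\<close> and \<open>p\<close> are
  inverse to each other.\<close>

lemma mod_retract:
  fixes A M :: "('a, 'v) module"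
  assumes i: "arr (mod_cat L) i A M" and p: "arr (mod_cat L) p M A"
    and pi: "\<And>x. x \<in> carrier A \<Longrightarrow> p (i x) = x"
  obtains Z where "direct_sum (mod_cat L) M [A, Z]"
    "\<And>x. \<lbrakk>zero_object (mod_cat L) Z; x \<in> carrier M\<rbrakk> \<Longrightarrow> i (p x) = x"
proof -
  interpret C: linear_category K "mod_cat L :: (('a, 'v) module, 'v \<Rightarrow> 'v, 'k) lincat"
    by (rule mod_linear_category)
  interpret i: lin_map L A M i using arr_mod_lin_map[OF i] .
  interpret p: lin_map L M A p using arr_mod_lin_map[OF p] .
  have O: "A \<in> Obj (mod_cat L)" "M \<in> Obj (mod_cat L)" using i by (auto simp: arr_mod)
  define H where "H = {x \<in> carrier M. p x = \<zero>\<^bsub>A\<^esub>}"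
  define Z where "Z = M\<lparr>carrier := H\<rparr>"
  have H: "submodule H L M" unfolding H_def by (rule p.kernel_submod)
  have ZO: "Z \<in> Obj (mod_cat L)" unfolding Z_def using submod_obj[OF O(2) H] .
  have lZ: "left_module L Z" using ZO mod_obj by blast
  define q where "q = (\<lambda>x. id_map M x \<ominus>\<^bsub>M\<^esub> i (p x))"
  have ip: "i \<circ> p \<in> lin_maps L M M"
    using lin_maps_comp[OF p.f_lin i.f_lin i.M.left_module_axioms i.N.left_module_axioms] .
  have ipa: "arr (mod_cat L) (i \<circ> p) M M" using ip O by (simp add: arr_mod)
  have ipc: "i (p x) \<in> carrier M" for x using lin_maps_range[OF ip i.N.left_module_axioms, of x] by simp
  have qM: "q \<in> lin_maps L M M"
  proof (rule lin_mapsI)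
    show "q (x \<oplus>\<^bsub>M\<^esub> y) = q x \<oplus>\<^bsub>M\<^esub> q y" if "x \<in> carrier M" "y \<in> carrier M" for x y
      using that ipc p.f_closed
      by (simp add: q_def id_map_def a_minus_def p.f_add i.f_add i.N.M.minus_add i.N.M.a_ac)
    show "q (a \<odot>\<^bsub>M\<^esub> x) = a \<odot>\<^bsub>M\<^esub> q x" if "a \<in> carrier L" "x \<in> carrier M" for a x
      using that ipc p.f_closed i.N.smult_closed[OF that]
      by (simp add: q_def id_map_def a_minus_def p.f_smult i.f_smult i.N.smult_r_distr i.N.smult_neg_right)
    show "q x = \<zero>\<^bsub>M\<^esub>" if "x \<notin> carrier M" for x
      using that by (simp add: q_def id_map_def p.f_out i.f_zero a_minus_def i.N.M.neg_zero)
  qed (simp add: q_def id_map_def ipc)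
  have qH: "q x \<in> H" if "x \<in> carrier M" for x
  proof -
    have "p (q x) = \<zero>\<^bsub>A\<^esub>"
      using p.f_minus[OF that ipc] pi[OF p.f_closed[OF that]] that p.f_closed[OF that] i.M.M.minus_eq_zero_iff
      by (simp add: q_def id_map_def)
    then show ?thesis using lin_mapsD(1)[OF qM that] by (simp add: H_def)
  qed
  have qZ: "q \<in> lin_maps L M Z" unfolding Z_def by (rule lin_maps_restrict_codomain[OF qM qH])
  have jl: "inclusion M H \<in> lin_maps L Z M" unfolding Z_def
    using inclusion_lin[OF i.N.left_module_axioms H] .
  have "direct_sum (mod_cat L) M [A, Z]"
  proof (rule C.direct_sum2I)
    show "arr (mod_cat L) i A M" "arr (mod_cat L) p M A" by fact+
    show ja: "arr (mod_cat L) (inclusion M H) Z M" using jl ZO O by (simp add: arr_mod)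
    show qa: "arr (mod_cat L) q M Z" using qZ ZO O by (simp add: arr_mod)
    show "p \<cdot>\<^bsub>mod_cat L\<^esub> i = Idn (mod_cat L) A"
      using pi by (auto simp: fun_eq_iff id_map_def i.f_out p.f_zero)
    have "q (inclusion M H x) = id_map Z x" for x
      using i.N.submodD(1)[OF H]
      by (auto simp: q_def inclusion_def id_map_def Z_def H_def i.f_zero p.f_zero a_minus_def i.N.M.neg_zero)
    then show "q \<cdot>\<^bsub>mod_cat L\<^esub> inclusion M H = Idn (mod_cat L) Z" by auto
    have "q (i x) = \<zero>\<^bsub>Z\<^esub>" for x
      using pi[of x] i.f_closed[of x] i.f_out[of x] i.N.M.minus_eq_zero_iff[of "i x" "i x"]
      by (cases "x \<in> carrier A") (auto simp: q_def id_map_def Z_def i.f_zero p.f_zero a_minus_def i.N.M.neg_zero)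
    then show "q \<cdot>\<^bsub>mod_cat L\<^esub> i = \<zero>\<^bsub>Hom (mod_cat L) A Z\<^esub>" by auto
    show "p \<cdot>\<^bsub>mod_cat L\<^esub> inclusion M H = \<zero>\<^bsub>Hom (mod_cat L) Z A\<^esub>"
      by (auto simp: fun_eq_iff inclusion_def H_def p.f_zero)
    have "i (p x) \<oplus>\<^bsub>M\<^esub> inclusion M H (q x) = id_map M x" for x
    proof (cases "x \<in> carrier M")
      case True
      then have "inclusion M H (q x) = x \<ominus>\<^bsub>M\<^esub> i (p x)" using qH[OF True]
        by (simp add: inclusion_def q_def id_map_def)
      then show ?thesis using True ipc i.N.M.add_minus_cancel[of "i (p x)" x]
        by (simp add: id_map_def a_minus_def)
    next
      case False
      then have "q x = \<zero>\<^bsub>M\<^esub>" using lin_mapsD(4)[OF qM] by simp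
      then show ?thesis using False i.N.submodD(2)[OF H]
        by (simp add: id_map_def p.f_out i.f_zero inclusion_def)
    qed
    then show "(i \<cdot>\<^bsub>mod_cat L\<^esub> p) \<oplus>\<^bsub>Hom (mod_cat L) M M\<^esub> (inclusion M H \<cdot>\<^bsub>mod_cat L\<^esub> q) = Idn (mod_cat L) M"
      by auto
  qed
  moreover have "i (p x) = x" if "zero_object (mod_cat L) Z" "x \<in> carrier M" for x
  proof -
    have "q x = \<zero>\<^bsub>M\<^esub>" using that(1)[unfolded zero_object_mod[OF ZO]] qH[OF that(2)] by (auto simp: Z_def)
    then show ?thesis using i.N.M.minus_eq_zero_iff[OF that(2) ipc] that(2)
      by (simp add: q_def id_map_def)
  qed
  ultimately show ?thesis using that by blast
qed

text \<open>Functoriality of cokernels, with the induced map \<open>c\<close> computed on chosen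
  preimages \<open>s\<close>.\<close>

lemma cokernel_map:
  assumes l: "left_module L N" "left_module L P" "left_module L N'" "left_module L P'"
    and re: "right_exact L M N P f g" and re': "right_exact L M' N' P' f' g'"
    and b: "b \<in> lin_maps L N N'" "\<And>m. m \<in> carrier M \<Longrightarrow> b (f m) \<in> f' ` carrier M'"
  obtains c where "c \<in> lin_maps L P P'" "c \<circ> g = g' \<circ> b"
proof -
  have e: "g \<in> lin_maps L N P" "f ` carrier M = {x \<in> carrier N. g x = \<zero>\<^bsub>P\<^esub>}" "g ` carrier N = carrier P"
    "g' \<in> lin_maps L N' P'" "f' ` carrier M' = {x \<in> carrier N'. g' x = \<zero>\<^bsub>P'\<^esub>}"
    using re re' by (auto simp: right_exact_def a_kernel_eq)
  interpret g: lin_map L N P g using lin_mapI l e by blast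
  interpret g': lin_map L N' P' g' using lin_mapI l e by blast
  interpret b: lin_map L N N' b using lin_mapI l b by blast
  define s where "s y = (SOME x. x \<in> carrier N \<and> g x = y)" for y
  have s: "s y \<in> carrier N" "g (s y) = y" if "y \<in> carrier P" for y
  proof -
    have "y \<in> g ` carrier N" using that e(3) by simp
    then have "\<exists>x. x \<in> carrier N \<and> g x = y" by blast
    then show "s y \<in> carrier N" "g (s y) = y" unfolding s_def by (metis (mono_tags, lifting) someI_ex)+
  qed
  define c where "c y = (if y \<in> carrier P then g' (b (s y)) else \<zero>\<^bsub>P'\<^esub>)" for y
  have cg: "c (g x) = g' (b x)" if x: "x \<in> carrier N" for x
  proof -
    have gx: "g x \<in> carrier P" using g.f_closed[OF x] .
    \<comment> \<open>The difference of two preimages lies in the image of \<open>f\<close>;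
      \<open>b\<close> sends it into the image of \<open>f'\<close>, which \<open>g'\<close> kills.
      Hence \<open>c\<close> does not depend on the choice of \<open>s\<close>.\<close>
    define d where "d = s (g x) \<ominus>\<^bsub>N\<^esub> x"
    have d: "d \<in> carrier N" "g d = \<zero>\<^bsub>P\<^esub>"
      using s[OF gx] x g.f_minus[OF s(1)[OF gx] x] g.N.M.minus_eq_zero_iff[OF gx gx]
      by (auto simp: d_def)
    then have "d \<in> f ` carrier M" using e(2) by simp
    then have "b d \<in> f' ` carrier M'" using b(2) by blast
    then have "g' (b d) = \<zero>\<^bsub>P'\<^esub>" using e(5) by auto
    then have "g' (b (s (g x))) \<ominus>\<^bsub>P'\<^esub> g' (b x) = \<zero>\<^bsub>P'\<^esub>"
      using s[OF gx] x by (simp add: d_def b.f_minus g'.f_minus b.f_closed)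
    then show ?thesis
      using g'.N.M.minus_eq_zero_iff[OF g'.f_closed[OF b.f_closed[OF s(1)[OF gx]]] g'.f_closed[OF b.f_closed[OF x]]] gx
      by (simp add: c_def)
  qed
  have "c \<in> lin_maps L P P'"
  proof (rule lin_mapsI)
    fix x assume x: "x \<in> carrier P"
    show "c x \<in> carrier P'" using s[OF x] x by (simp add: c_def g'.f_closed b.f_closed)
    show "c (x \<oplus>\<^bsub>P\<^esub> y) = c x \<oplus>\<^bsub>P'\<^esub> c y" if y: "y \<in> carrier P" for y
      using cg[of "s x \<oplus>\<^bsub>N\<^esub> s y"] cg[OF s(1)[OF x]] cg[OF s(1)[OF y]] s[OF x] s[OF y]
      by (simp add: g.f_add b.f_add g'.f_add b.f_closed)
    show "c (a \<odot>\<^bsub>P\<^esub> x) = a \<odot>\<^bsub>P'\<^esub> c x" if a: "a \<in> carrier L" for a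
      using cg[of "a \<odot>\<^bsub>N\<^esub> s x"] cg[OF s(1)[OF x]] s[OF x] a
      by (simp add: g.f_smult b.f_smult g'.f_smult b.f_closed g.M.smult_closed)
  qed (simp add: c_def)
  moreover have "c \<circ> g = g' \<circ> b"
  proof
    fix x show "(c \<circ> g) x = (g' \<circ> b) x"
    proof (cases "x \<in> carrier N")
      case False
      then have "g x = g \<zero>\<^bsub>N\<^esub>" "b x = b \<zero>\<^bsub>N\<^esub>" using g.f_out g.f_zero b.f_out b.f_zero by simp_all
      then show ?thesis using cg[of "\<zero>\<^bsub>N\<^esub>"] by simp
    qed (simp add: cg)
  qed
  ultimately show ?thesis using that by blast
qed

end

section \<open>A criterion for vanishing of \<open>Hom(N, \<tau> U)\<close>\<close>

text \<open>The data of the dual basis lemma for a projective module. The \<open>x i\<close>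
  generate but need not be independent; the data is what identifies the tensor product of Hom(P,L)
  and N with Hom(P,N).\<close>

definition dual_basis :: "('k, 'a) module \<Rightarrow> ('a, 'v) module \<Rightarrow> nat \<Rightarrow> (nat \<Rightarrow> 'v) \<Rightarrow> (nat \<Rightarrow> 'v \<Rightarrow> 'a) \<Rightarrow> bool" where
  "dual_basis L P n x \<xi> \<longleftrightarrow> (\<forall>i<n. x i \<in> carrier P \<and> \<xi> i \<in> lin_maps L P (regular_module L)) \<and>
     (\<forall>y \<in> carrier P. finsum P (\<lambda>i. \<xi> i y \<odot>\<^bsub>P\<^esub> x i) {..<n} = y)"

context fd_algebra
begin

text \<open>\<open>transpose_module\<close> picks its presentation by \<open>SOME\<close>, so the
  translate is known to come from some minimal presentation, not from the given one; the latter only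
  shows that there is a choice to make.\<close>

lemma AR_translate_eq:
  fixes U P1 P0 :: "('a, 'v) module"
  assumes "minimal_presentation L U P1 P0 p1 p0"
  obtains P1' P0' :: "('a, 'v) module" and p1' p0' where "minimal_presentation L U P1' P0' p1' p0'"
    "AR_translate K L U = dual_module K L
       (quotient_module (star_module L P1') ((\<lambda>\<phi>. \<phi> \<circ> p1') ` lin_maps L P0' (regular_module L)))"
proof -
  let ?t = "SOME (P1 :: ('a, 'v) module, P0 :: ('a, 'v) module, p1, p0). minimal_presentation L U P1 P0 p1 p0"
  have "case ?t of (P1, P0, p1, p0) \<Rightarrow> minimal_presentation L U P1 P0 p1 p0"
    by (rule someI_ex) (use assms in auto)
  moreover obtain P1' P0' p1' p0' where t: "?t = (P1', P0', p1', p0')" by (cases ?t)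
  ultimately have "minimal_presentation L U P1' P0' p1' p0'" by simp
  moreover have "AR_translate K L U = dual_module K L
       (quotient_module (star_module L P1') ((\<lambda>\<phi>. \<phi> \<circ> p1') ` lin_maps L P0' (regular_module L)))"
    unfolding AR_translate_def transpose_module_def t by (simp add: star_module_def)
  ultimately show ?thesis using that by blast
qed

lemma mult_right_lin:
  assumes "f \<in> lin_maps L P (regular_module L)" "a \<in> carrier L"
  shows "(\<lambda>x. f x \<otimes>\<^bsub>L\<^esub> a) \<in> lin_maps L P (regular_module L)"
  using lin_mapsD[OF assms(1)] assms(2) by (auto intro!: lin_mapsI simp: L.l_distr L.m_assoc)

text \<open>The map is the elementary tensor of \<open>f\<close> and \<open>m\<close>, seen in
  Hom(P,N).\<close>

lemma smult_vector_lin: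
  assumes "f \<in> lin_maps L P (regular_module L)" "left_module L N" "m \<in> carrier N"
  shows "(\<lambda>x. f x \<odot>\<^bsub>N\<^esub> m) \<in> lin_maps L P N"
proof -
  interpret N: left_module L N by fact
  show ?thesis using lin_mapsD[OF assms(1)] assms(3)
    by (auto intro!: lin_mapsI N.smult_closed simp: N.smult_l_distr N.smult_assoc)
qed

text \<open>By Hom-tensor adjunction, Hom(N, D Tr U) is dual to the tensor product of Tr U and N,
  which is the cokernel of Hom(P0,N) -> Hom(P1,N); \<open>ext\<close> says that this cokernel is
  zero. Tensor products are avoided: \<open>\<phi>\<close> gives a balanced pairing
  \<open>\<theta>\<close> of N with Hom(P1,L), the dual basis turns it into a functional
  \<open>\<Phi>\<close> on Hom(P1,N), and \<open>\<Phi>\<close> vanishes on everything that factors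
  through \<open>p1\<close>.\<close>

lemma Hom_dual_transpose_zero:
  fixes P1 P0 N :: "('a, 'v) module"
  assumes l: "left_module L P1" "left_module L P0" "left_module L N"
    and p1: "p1 \<in> lin_maps L P1 P0"
    and b1: "dual_basis L P1 n x \<xi>" and b0: "dual_basis L P0 k y \<eta>"
    and ext: "\<And>\<psi>. \<psi> \<in> lin_maps L P1 N \<Longrightarrow> \<exists>\<chi> \<in> lin_maps L P0 N. \<psi> = \<chi> \<circ> p1"
    and AR: "AR = dual_module K L
       (quotient_module (star_module L P1) ((\<lambda>\<phi>. \<phi> \<circ> p1) ` lin_maps L P0 (regular_module L)))"
    and \<phi>: "\<phi> \<in> lin_maps L N AR"
  shows "\<phi> = (\<lambda>_. \<zero>\<^bsub>AR\<^esub>)"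
proof -
  define Q where "Q = star_module L P1"
  define I where "I = (\<lambda>\<phi>. \<phi> \<circ> p1) ` lin_maps L P0 (regular_module L)"
  define Tr where "Tr = quotient_module Q I"
  interpret N: left_module L N by fact
  interpret P1: left_module L P1 by fact
  interpret P0: left_module L P0 by fact
  interpret p1: lin_map L P1 P0 p1 using l p1 by (simp add: lin_mapI)
  have lL: "left_module L (regular_module L)" using regular_left_module[OF ring_L] .
  interpret LL: left_module L "regular_module L" by (rule lL)
  have Q: "carrier Q = lin_maps L P1 (regular_module L)" "\<zero>\<^bsub>Q\<^esub> = (\<lambda>_. \<zero>\<^bsub>L\<^esub>)"
    "f \<oplus>\<^bsub>Q\<^esub> g = (\<lambda>x. f x \<oplus>\<^bsub>L\<^esub> g x)" "a \<odot>\<^bsub>Q\<^esub> f = (\<lambda>x. f x \<otimes>\<^bsub>L\<^esub> a)" for f g a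
    by (simp_all add: Q_def star_module_def)
  interpret Q: abelian_group Q unfolding Q_def star_module_def by (rule map_module_abelian[OF lL])
  have rL: "f z \<in> carrier L" if "f \<in> lin_maps L P (regular_module L)" for f z and P :: "('a, 'v) module"
    using lin_maps_range[OF that lL] by simp
  have Isub: "I \<subseteq> carrier Q" unfolding I_def Q using lin_maps_comp[OF p1 _ l(2) lL] by blast
  have Iadd: "f \<oplus>\<^bsub>Q\<^esub> g \<in> I" if fg: "f \<in> I" "g \<in> I" for f g
  proof -
    obtain f' g' where f': "f' \<in> lin_maps L P0 (regular_module L)" "f = f' \<circ> p1"
      "g' \<in> lin_maps L P0 (regular_module L)" "g = g' \<circ> p1" using fg unfolding I_def by blast
    have "f' \<oplus>\<^bsub>map_module L P0 (regular_module L) undefined\<^esub> g' \<in> lin_maps L P0 (regular_module L)"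
      using abelian_monoid.a_closed[OF abelian_group.axioms(1)[OF map_module_abelian[OF lL, of P0 undefined]]] f'
      by (metis map_module_simps(1))
    then have "(\<lambda>z. f' z \<oplus>\<^bsub>L\<^esub> g' z) \<in> lin_maps L P0 (regular_module L)" by simp
    moreover have "f \<oplus>\<^bsub>Q\<^esub> g = (\<lambda>z. f' z \<oplus>\<^bsub>L\<^esub> g' z) \<circ> p1" using f' by (auto simp: Q)
    ultimately show ?thesis unfolding I_def by blast
  qed
  have Imul: "(\<lambda>z. f z \<otimes>\<^bsub>L\<^esub> a) \<in> I" if fa: "f \<in> I" "a \<in> carrier L" for f a
  proof -
    obtain f' where f': "f' \<in> lin_maps L P0 (regular_module L)" "f = f' \<circ> p1" using fa unfolding I_def
      by blast
    have "(\<lambda>z. f z \<otimes>\<^bsub>L\<^esub> a) = (\<lambda>z. f' z \<otimes>\<^bsub>L\<^esub> a) \<circ> p1" using f' by auto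
    then show ?thesis unfolding I_def using mult_right_lin[OF f'(1) fa(2)] by blast
  qed
  have Ineg: "\<ominus>\<^bsub>Q\<^esub> f \<in> I" if f: "f \<in> I" for f
  proof -
    have fq: "f \<in> carrier Q" using f Isub by blast
    have "(\<lambda>z. f z \<otimes>\<^bsub>L\<^esub> (\<ominus>\<^bsub>L\<^esub> \<one>\<^bsub>L\<^esub>)) \<in> carrier Q" using Imul[OF f] Isub by auto
    moreover have "(\<lambda>z. f z \<otimes>\<^bsub>L\<^esub> (\<ominus>\<^bsub>L\<^esub> \<one>\<^bsub>L\<^esub>)) \<oplus>\<^bsub>Q\<^esub> f = \<zero>\<^bsub>Q\<^esub>"
      using rL fq by (auto simp: Q L.r_minus L.l_neg)
    ultimately have "\<ominus>\<^bsub>Q\<^esub> f = (\<lambda>z. f z \<otimes>\<^bsub>L\<^esub> (\<ominus>\<^bsub>L\<^esub> \<one>\<^bsub>L\<^esub>))" using Q.minus_equality fq by blast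
    then show ?thesis using Imul[OF f] by simp
  qed
  have Izero: "\<zero>\<^bsub>Q\<^esub> \<in> I"
  proof -
    have "(\<lambda>_. \<zero>\<^bsub>L\<^esub>) \<in> lin_maps L P0 (regular_module L)" by (auto intro!: lin_mapsI)
    then show ?thesis unfolding I_def Q by (force intro!: image_eqI)
  qed
  have Isg: "subgroup I (add_monoid Q)"
    using Isub Iadd Ineg Izero by (auto intro!: subgroup.intro simp: a_inv_def)
  interpret I: abelian_subgroup I Q
    using Isg Q.abelian_group_axioms by (intro abelian_subgroupI3 additive_subgroup.intro)
  have coset0: "I +>\<^bsub>Q\<^esub> f = I" if "f \<in> I" for f
    using Q.a_coset_join2[OF _ Isg that] Isub that by blast
  have cosetc: "I +>\<^bsub>Q\<^esub> f \<in> a_rcosets\<^bsub>Q\<^esub> I" if "f \<in> carrier Q" for f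
    using Q.a_rcosetsI[OF Isub that] .
  have cosets: "I +>\<^bsub>Q\<^esub> (h \<oplus>\<^bsub>Q\<^esub> f) = I +>\<^bsub>Q\<^esub> f" if "h \<in> I" "f \<in> carrier Q" for h f
  proof -
    have h: "h \<in> carrier Q" using that Isub by blast
    have "I +>\<^bsub>Q\<^esub> (h \<oplus>\<^bsub>Q\<^esub> f) = (I +>\<^bsub>Q\<^esub> h) <+>\<^bsub>Q\<^esub> (I +>\<^bsub>Q\<^esub> f)" using I.a_rcos_sum[OF h that(2)] by simp
    also have "\<dots> = (I +>\<^bsub>Q\<^esub> \<zero>\<^bsub>Q\<^esub>) <+>\<^bsub>Q\<^esub> (I +>\<^bsub>Q\<^esub> f)" using coset0 that(1) Izero by simp
    also have "\<dots> = I +>\<^bsub>Q\<^esub> (\<zero>\<^bsub>Q\<^esub> \<oplus>\<^bsub>Q\<^esub> f)" using I.a_rcos_sum[OF Q.zero_closed that(2)] .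
    also have "\<zero>\<^bsub>Q\<^esub> \<oplus>\<^bsub>Q\<^esub> f = f" using that(2) by (rule Q.l_zero)
    finally show ?thesis .
  qed
  have Tr: "carrier Tr = a_rcosets\<^bsub>Q\<^esub> I" "A \<oplus>\<^bsub>Tr\<^esub> B = A <+>\<^bsub>Q\<^esub> B" "\<zero>\<^bsub>Tr\<^esub> = I" for A B
    by (simp_all add: Tr_def quotient_module_def)
  \<comment> \<open>\<open>quotient_module\<close> defines scaling by a union over the members of a
    coset; all of them yield the same coset because \<open>I\<close> is stable under the right
    action.\<close>
  have Trs: "a \<odot>\<^bsub>Tr\<^esub> (I +>\<^bsub>Q\<^esub> f) = I +>\<^bsub>Q\<^esub> (\<lambda>z. f z \<otimes>\<^bsub>L\<^esub> a)"
    if a: "a \<in> carrier L" and f: "f \<in> carrier Q" for a f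
  proof -
    have fa: "(\<lambda>z. f z \<otimes>\<^bsub>L\<^esub> a) \<in> carrier Q" using mult_right_lin f a by (simp add: Q)
    have "I +>\<^bsub>Q\<^esub> (a \<odot>\<^bsub>Q\<^esub> g) = I +>\<^bsub>Q\<^esub> (\<lambda>z. f z \<otimes>\<^bsub>L\<^esub> a)" if g: "g \<in> I +>\<^bsub>Q\<^esub> f" for g
    proof -
      obtain h where h: "h \<in> I" "g = h \<oplus>\<^bsub>Q\<^esub> f" using g by (auto simp: a_r_coset_def')
      have hq: "h \<in> carrier Q" using h Isub by blast
      have "a \<odot>\<^bsub>Q\<^esub> g = (\<lambda>z. h z \<otimes>\<^bsub>L\<^esub> a) \<oplus>\<^bsub>Q\<^esub> (\<lambda>z. f z \<otimes>\<^bsub>L\<^esub> a)"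
        using rL hq f a by (auto simp: Q h L.l_distr)
      then show ?thesis using cosets[OF Imul[OF h(1) a] fa] by simp
    qed
    moreover have "f \<in> I +>\<^bsub>Q\<^esub> f" using Izero f Q.l_zero[OF f] by (force simp: a_r_coset_def')
    ultimately show ?thesis by (auto simp: Tr_def quotient_module_def)
  qed
  define V where "V = \<lparr>carrier = carrier Tr, monoid.mult = monoid.mult Tr, one = one Tr, zero = zero Tr, add = add Tr,
        smult = (\<lambda>c x. (c \<odot>\<^bsub>L\<^esub> \<one>\<^bsub>L\<^esub>) \<odot>\<^bsub>Tr\<^esub> x)\<rparr>"
  have ARV: "AR = map_module K V (regular_module K) (\<lambda>a \<phi> x. if x \<in> carrier Tr then \<phi> (a \<odot>\<^bsub>Tr\<^esub> x) else \<zero>\<^bsub>K\<^esub>)"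
    unfolding AR dual_module_def V_def Tr_def Q_def I_def by simp
  have V: "carrier V = a_rcosets\<^bsub>Q\<^esub> I" "A \<oplus>\<^bsub>V\<^esub> B = A <+>\<^bsub>Q\<^esub> B" for A B
    by (simp_all add: V_def Tr)
  have \<phi>m: "\<phi> m \<in> lin_maps K V (regular_module K)" if "m \<in> carrier N" for m
    using lin_mapsD(1)[OF \<phi> that] by (simp add: ARV)
  \<comment> \<open>The pairing of N with Hom(P1,L) that belongs to \<open>\<phi>\<close>. It is
    biadditive by \<open>\<theta>1\<close> and \<open>\<theta>2\<close>, balanced over
    \<open>L\<close> by \<open>\<theta>3\<close>, and zero on \<open>I\<close> by
    \<open>\<theta>0\<close>.\<close>
  define \<theta> where "\<theta> m f = \<phi> m (I +>\<^bsub>Q\<^esub> f)" for m f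
  have \<theta>c: "\<theta> m f \<in> carrier K" if "m \<in> carrier N" "f \<in> carrier Q" for m f
    using lin_mapsD(1)[OF \<phi>m[OF that(1)], of "I +>\<^bsub>Q\<^esub> f"] cosetc[OF that(2)] by (simp add: \<theta>_def V)
  have \<theta>1: "\<theta> m (f \<oplus>\<^bsub>Q\<^esub> g) = \<theta> m f \<oplus>\<^bsub>K\<^esub> \<theta> m g"
    if "m \<in> carrier N" "f \<in> carrier Q" "g \<in> carrier Q" for m f g
    using lin_mapsD(2)[OF \<phi>m[OF that(1)], of "I +>\<^bsub>Q\<^esub> f" "I +>\<^bsub>Q\<^esub> g"] cosetc that I.a_rcos_sum[OF that(2,3)]
    by (simp add: \<theta>_def V)
  have \<theta>2: "\<theta> (m \<oplus>\<^bsub>N\<^esub> m') f = \<theta> m f \<oplus>\<^bsub>K\<^esub> \<theta> m' f" if "m \<in> carrier N" "m' \<in> carrier N" for m m' f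
    using lin_mapsD(2)[OF \<phi> that] by (simp add: \<theta>_def ARV)
  have \<theta>3: "\<theta> (a \<odot>\<^bsub>N\<^esub> m) f = \<theta> m (\<lambda>z. f z \<otimes>\<^bsub>L\<^esub> a)"
    if "m \<in> carrier N" "a \<in> carrier L" "f \<in> carrier Q" for a m f
    using lin_mapsD(3)[OF \<phi> that(2,1)] cosetc[OF that(3)] Trs[OF that(2,3)] by (simp add: \<theta>_def ARV Tr)
  have \<theta>0: "\<theta> m f = \<zero>\<^bsub>K\<^esub>" if m: "m \<in> carrier N" and f: "f \<in> I" for m f
  proof -
    have "\<theta> m \<zero>\<^bsub>Q\<^esub> = \<theta> m \<zero>\<^bsub>Q\<^esub> \<oplus>\<^bsub>K\<^esub> \<theta> m \<zero>\<^bsub>Q\<^esub>" using \<theta>1[OF m Q.zero_closed Q.zero_closed] by simp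
    then have "\<theta> m \<zero>\<^bsub>Q\<^esub> = \<zero>\<^bsub>K\<^esub>" using \<theta>c[OF m Q.zero_closed] by simp
    then show ?thesis using coset0[OF f] coset0[OF Izero] by (simp add: \<theta>_def)
  qed
  have B1: "x i \<in> carrier P1" "\<xi> i \<in> carrier Q" if "i < n" for i
    using b1 that by (auto simp: dual_basis_def Q)
  have B1s: "finsum P1 (\<lambda>i. \<xi> i z \<odot>\<^bsub>P1\<^esub> x i) {..<n} = z" if "z \<in> carrier P1" for z
    using b1 that by (simp add: dual_basis_def)
  have B0: "y i \<in> carrier P0" "\<eta> i \<in> lin_maps L P0 (regular_module L)" if "i < k" for i
    using b0 that by (auto simp: dual_basis_def)
  have B0s: "finsum P0 (\<lambda>i. \<eta> i z \<odot>\<^bsub>P0\<^esub> y i) {..<k} = z" if "z \<in> carrier P0" for z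
    using b0 that by (simp add: dual_basis_def)
  define H where "H = map_module L P1 N undefined"
  interpret H: abelian_group H unfolding H_def by (rule map_module_abelian[OF l(3)])
  have H: "carrier H = lin_maps L P1 N" "f \<oplus>\<^bsub>H\<^esub> g = (\<lambda>x. f x \<oplus>\<^bsub>N\<^esub> g x)" for f g by (simp_all add: H_def)
  \<comment> \<open>By the dual basis, \<open>\<psi>\<close> is the sum of the elementary tensors of
    \<open>\<xi> i\<close> and \<open>\<psi> (x i)\<close>; \<open>\<Phi>\<close> applies the
    pairing to each of them.\<close>
  define \<Phi> where "\<Phi> \<psi> = finsum K (\<lambda>i. \<theta> (\<psi> (x i)) (\<xi> i)) {..<n}" for \<psi>
  have rN: "f z \<in> carrier N" if "f \<in> lin_maps L P1 N" for f z using lin_maps_range[OF that l(3)] .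
  have \<Phi>c: "\<Phi> \<psi> \<in> carrier K" if "\<psi> \<in> carrier H" for \<psi>
    unfolding \<Phi>_def using \<theta>c rN that B1 by (intro K.finsum_closed) (auto simp: H)
  have \<Phi>add: "\<Phi> (f \<oplus>\<^bsub>H\<^esub> g) = \<Phi> f \<oplus>\<^bsub>K\<^esub> \<Phi> g" if "f \<in> carrier H" "g \<in> carrier H" for f g
  proof -
    have "\<Phi> (f \<oplus>\<^bsub>H\<^esub> g) = finsum K (\<lambda>i. \<theta> (f (x i)) (\<xi> i) \<oplus>\<^bsub>K\<^esub> \<theta> (g (x i)) (\<xi> i)) {..<n}"
      unfolding \<Phi>_def H using \<theta>2 \<theta>c rN that B1 by (intro K.finsum_cong') (auto simp: H)
    also have "\<dots> = \<Phi> f \<oplus>\<^bsub>K\<^esub> \<Phi> g"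
      unfolding \<Phi>_def using \<theta>c rN that B1 by (intro K.finsum_addf) (auto simp: H)
    finally show ?thesis .
  qed
  \<comment> \<open>Balancedness moves the scalars \<open>f (x i)\<close> to the other side, where
    the dual basis reassembles \<open>f\<close>.\<close>
  have \<Phi>elem: "\<Phi> (\<lambda>z. f z \<odot>\<^bsub>N\<^esub> m) = \<theta> m f" if f: "f \<in> carrier Q" and m: "m \<in> carrier N" for f m
  proof -
    have fx: "f (x i) \<in> carrier L" for i using rL f by (simp add: Q)
    have q: "(\<lambda>z. \<xi> i z \<otimes>\<^bsub>L\<^esub> f (x i)) \<in> carrier Q" if "i < n" for i
      using mult_right_lin[OF _ fx] B1[OF that] by (simp add: Q)
    have "\<Phi> (\<lambda>z. f z \<odot>\<^bsub>N\<^esub> m) = finsum K (\<lambda>i. \<theta> m (\<lambda>z. \<xi> i z \<otimes>\<^bsub>L\<^esub> f (x i))) {..<n}"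
      unfolding \<Phi>_def using \<theta>3[OF m fx] B1 \<theta>c[OF m q] by (intro K.finsum_cong') auto
    also have "\<dots> = \<theta> m (finsum Q (\<lambda>i. (\<lambda>z. \<xi> i z \<otimes>\<^bsub>L\<^esub> f (x i))) {..<n})"
      using additive_finsum[OF Q.abelian_group_axioms K.abelian_group_axioms, of "{..<n}" "\<lambda>i z. \<xi> i z \<otimes>\<^bsub>L\<^esub> f (x i)" "\<theta> m"]
        q \<theta>c[OF m] \<theta>1[OF m] by auto
    also have "finsum Q (\<lambda>i. (\<lambda>z. \<xi> i z \<otimes>\<^bsub>L\<^esub> f (x i))) {..<n} = f"
    proof (rule lin_maps_eqI)
      show "finsum Q (\<lambda>i. (\<lambda>z. \<xi> i z \<otimes>\<^bsub>L\<^esub> f (x i))) {..<n} \<in> lin_maps L P1 (regular_module L)"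
        using Q.finsum_closed[of "\<lambda>i z. \<xi> i z \<otimes>\<^bsub>L\<^esub> f (x i)" "{..<n}"] q by (auto simp: Q)
      show "f \<in> lin_maps L P1 (regular_module L)" using f by (simp add: Q)
      then interpret f: lin_map L P1 "regular_module L" f using l lL by (simp add: lin_mapI)
      fix z assume z: "z \<in> carrier P1"
      have c: "\<xi> i z \<in> carrier L" if "i < n" for i using rL B1[OF that] by (simp add: Q)
      have "finsum Q (\<lambda>i. (\<lambda>z. \<xi> i z \<otimes>\<^bsub>L\<^esub> f (x i))) {..<n} z
          = finsum (regular_module L) (\<lambda>i. \<xi> i z \<otimes>\<^bsub>L\<^esub> f (x i)) {..<n}"
        unfolding Q_def star_module_def using q by (intro map_module_finsum[OF lL]) (auto simp: Q)
      also have "\<dots> = finsum (regular_module L) (\<lambda>i. f (\<xi> i z \<odot>\<^bsub>P1\<^esub> x i)) {..<n}"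
        using f.f_smult[OF c B1(1)] c fx by (intro LL.M.finsum_cong') (auto simp: Pi_def)
      also have "\<dots> = f (finsum P1 (\<lambda>i. \<xi> i z \<odot>\<^bsub>P1\<^esub> x i) {..<n})"
        using c B1 by (intro f.f_finsum[symmetric]) (auto intro: P1.smult_closed)
      also have "\<dots> = f z" using B1s[OF z] by simp
      finally show "finsum Q (\<lambda>i. (\<lambda>z. \<xi> i z \<otimes>\<^bsub>L\<^esub> f (x i))) {..<n} z = f z" .
    qed
    finally show ?thesis .
  qed
  have \<Phi>0: "\<Phi> \<psi> = \<zero>\<^bsub>K\<^esub>" if \<psi>: "\<psi> \<in> lin_maps L P1 N" for \<psi>
  proof -
    obtain \<chi> where \<chi>: "\<chi> \<in> lin_maps L P0 N" "\<psi> = \<chi> \<circ> p1" using ext[OF \<psi>] by blast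
    interpret \<chi>: lin_map L P0 N \<chi> using l \<chi> by (simp add: lin_mapI)
    \<comment> \<open>Expanding \<open>\<chi>\<close> along the dual basis of \<open>P0\<close>
      writes \<open>\<chi> \<circ> p1\<close> as a sum of elementary tensors whose first factors
      \<open>\<eta> j \<circ> p1\<close> lie in \<open>I\<close>.\<close>
    define e where "e j = (\<lambda>z. (\<eta> j \<circ> p1) z \<odot>\<^bsub>N\<^esub> \<chi> (y j))" for j
    have ep: "\<eta> j \<circ> p1 \<in> I" if "j < k" for j unfolding I_def using B0(2)[OF that] by blast
    have ec: "e j \<in> carrier H" if "j < k" for j
      unfolding e_def H
      using smult_vector_lin[OF subsetD[OF Isub[unfolded Q] ep[OF that]] l(3) \<chi>.f_closed[OF B0(1)[OF that]]] .
    have "\<psi> = finsum H e {..<k}"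
    proof (rule lin_maps_eqI[OF \<psi>])
      show "finsum H e {..<k} \<in> lin_maps L P1 N" using H.finsum_closed[of e "{..<k}"] ec
        by (auto simp: H)
      fix z assume z: "z \<in> carrier P1"
      have pz: "p1 z \<in> carrier P0" using p1.f_closed[OF z] .
      have c: "\<eta> j (p1 z) \<in> carrier L" if "j < k" for j using rL B0[OF that] by blast
      have "finsum H e {..<k} z = finsum N (\<lambda>j. e j z) {..<k}"
        unfolding H_def using ec by (intro map_module_finsum[OF l(3)]) (auto simp: H)
      also have "\<dots> = finsum N (\<lambda>j. \<chi> (\<eta> j (p1 z) \<odot>\<^bsub>P0\<^esub> y j)) {..<k}"
        using \<chi>.f_smult[OF c B0(1)] c \<chi>.f_closed[OF B0(1)]
          N.smult_closed[OF c \<chi>.f_closed[OF B0(1)]]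
        by (intro N.M.finsum_cong') (auto simp: e_def)
      also have "\<dots> = \<chi> (finsum P0 (\<lambda>j. \<eta> j (p1 z) \<odot>\<^bsub>P0\<^esub> y j) {..<k})"
        using P0.smult_closed[OF c B0(1)] by (intro \<chi>.f_finsum[symmetric]) auto
      also have "\<dots> = \<psi> z" using B0s[OF pz] \<chi>(2) by simp
      finally show "\<psi> z = finsum H e {..<k} z" by simp
    qed
    then have "\<Phi> \<psi> = finsum K (\<lambda>j. \<Phi> (e j)) {..<k}"
      using additive_finsum[OF H.abelian_group_axioms K.abelian_group_axioms, of "{..<k}" e \<Phi>] ec \<Phi>c \<Phi>add
      by auto
    moreover have "\<Phi> (e j) = \<zero>\<^bsub>K\<^esub>" if "j < k" for j
      unfolding e_def \<Phi>elem[OF subsetD[OF Isub ep[OF that]] \<chi>.f_closed[OF B0(1)[OF that]]]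
      using \<theta>0[OF \<chi>.f_closed[OF B0(1)[OF that]] ep[OF that]] .
    ultimately show ?thesis using K.add.finprod_one_eqI[of "{..<k}" "\<lambda>j. \<Phi> (e j)"]
      by (simp add: finsum_def)
  qed
  have "\<phi> m = (\<lambda>_. \<zero>\<^bsub>K\<^esub>)" for m
  proof (cases "m \<in> carrier N")
    case True
    show ?thesis
    proof
      fix A
      show "\<phi> m A = \<zero>\<^bsub>K\<^esub>"
      proof (cases "A \<in> carrier V")
        case A: True
        then obtain f where f: "f \<in> carrier Q" "A = I +>\<^bsub>Q\<^esub> f" by (auto simp: V A_RCOSETS_def')
        \<comment> \<open>The value of \<open>\<phi> m\<close> at the coset of \<open>f\<close> is
          \<open>\<theta> m f\<close>, which is \<open>\<Phi>\<close> of an elementary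
          tensor.\<close>
        have "(\<lambda>z. f z \<odot>\<^bsub>N\<^esub> m) \<in> lin_maps L P1 N" using smult_vector_lin[OF _ l(3) True] f
          by (simp add: Q)
        then have "\<theta> m f = \<zero>\<^bsub>K\<^esub>" using \<Phi>0 \<Phi>elem[OF f(1) True] by metis
        then show ?thesis by (simp add: \<theta>_def f)
      next
        case False
        then show ?thesis using lin_mapsD(4)[OF \<phi>m[OF True]] by simp
      qed
    qed
  next
    case False
    then show ?thesis using lin_mapsD(4)[OF \<phi>] by (simp add: ARV)
  qed
  then show ?thesis by (auto simp: ARV)
qed

lemma zero_lin_AR: "(\<lambda>_. \<zero>\<^bsub>AR_translate K L U\<^esub>) \<in> lin_maps L N (AR_translate K L U)"
  by (auto intro!: lin_mapsI simp: AR_translate_def dual_module_def)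

text \<open>The hypothesis \<open>ext\<close> is about an arbitrary projective presentation of
  \<open>U\<close>; \<open>minimal_presentation_extension\<close> carries it to the unknown minimal
  presentation behind \<open>AR_translate\<close>.\<close>

lemma tau_perpI:
  fixes U N Q1 Q0 :: "('a, 'v) module"
  assumes U: "U \<in> Obj (mod_cat L)" and N: "N \<in> Obj (mod_cat L)"
    and enough: "\<And>X :: ('a, 'v) module. X \<in> Obj (mod_cat L) \<Longrightarrow>
      \<exists>(P :: ('a, 'v) module) p. projective L P \<and> p \<in> lin_maps L P X \<and> p ` carrier P = carrier X"
    and dual: "\<And>P :: ('a, 'v) module. projective L P \<Longrightarrow> \<exists>n x \<xi>. dual_basis L P n x \<xi>"
    and Q: "projective L Q1" "projective L Q0" "right_exact L Q1 Q0 U q1 q0"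
    and ext: "\<And>\<psi>. \<psi> \<in> lin_maps L Q1 N \<Longrightarrow> \<exists>\<chi> \<in> lin_maps L Q0 N. \<psi> = \<chi> \<circ> q1"
  shows "N \<in> tau_perp K L U"
proof -
  obtain R1 R0 :: "('a, 'v) module" and r1 r0 where "minimal_presentation L U R1 R0 r1 r0"
    using minimal_presentation_exists[OF enough U] by blast
  then obtain P1 P0 :: "('a, 'v) module" and p1 p0 where mp: "minimal_presentation L U P1 P0 p1 p0"
    and AR: "AR_translate K L U = dual_module K L
       (quotient_module (star_module L P1) ((\<lambda>\<phi>. \<phi> \<circ> p1) ` lin_maps L P0 (regular_module L)))"
    by (rule AR_translate_eq) (rule that)
  have P: "projective L P1" "projective L P0" "p1 \<in> lin_maps L P1 P0"
    using mp unfolding minimal_presentation_def right_exact_def by blast+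
  have l: "left_module L P1" "left_module L P0" "left_module L N"
    using P N unfolding projective_def mod_obj by blast+
  obtain n x \<xi> where b1: "dual_basis L P1 n x \<xi>" using dual[OF P(1)] by blast
  obtain k y \<eta> where b0: "dual_basis L P0 k y \<eta>" using dual[OF P(2)] by blast
  have ext': "\<exists>\<chi> \<in> lin_maps L P0 N. \<psi> = \<chi> \<circ> p1" if "\<psi> \<in> lin_maps L P1 N" for \<psi>
    by (rule minimal_presentation_extension[OF mp U N Q ext that]) auto
  have "\<phi> = (\<lambda>_. \<zero>\<^bsub>AR_translate K L U\<^esub>)" if "\<phi> \<in> lin_maps L N (AR_translate K L U)" for \<phi>
    by (rule Hom_dual_transpose_zero[OF l P(3) b1 b0 ext' AR that])
  then show ?thesis unfolding tau_perp_def using N zero_lin_AR[of U N] by blast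
qed

text \<open>Torsion classes are closed under quotients, since composing with a surjection loses no
  morphism.\<close>

lemma tau_perp_image:
  fixes U N N' :: "('a, 'v) module"
  assumes "N \<in> tau_perp K L U" "N' \<in> Obj (mod_cat L)" "q \<in> lin_maps L N N'" "q ` carrier N = carrier N'"
  shows "N' \<in> tau_perp K L U"
proof -
  let ?A = "AR_translate K L U"
  have "f = (\<lambda>_. \<zero>\<^bsub>?A\<^esub>)" if f: "f \<in> lin_maps L N' ?A" for f
  proof -
    interpret N': left_module L N' using assms(2) mod_obj by blast
    have "f \<zero>\<^bsub>N'\<^esub> = f \<zero>\<^bsub>N'\<^esub> \<oplus>\<^bsub>?A\<^esub> f \<zero>\<^bsub>N'\<^esub>" "f \<zero>\<^bsub>N'\<^esub> \<in> carrier ?A"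
      using lin_mapsD(1,2)[OF f N'.M.zero_closed] by (metis N'.M.l_zero N'.M.zero_closed, blast)
    then have "f \<zero>\<^bsub>N'\<^esub> A = \<zero>\<^bsub>K\<^esub>" for A
      using lin_maps_range[of "f \<zero>\<^bsub>N'\<^esub>" K _ "regular_module K" A] regular_left_module[OF K.ring_axioms]
      by (auto simp: AR_translate_def dual_module_def dest!: fun_cong[of _ _ A])
    then have f0: "f \<zero>\<^bsub>N'\<^esub> = \<zero>\<^bsub>?A\<^esub>" by (auto simp: AR_translate_def dual_module_def)
    have "f \<circ> q \<in> lin_maps L N ?A"
      using lin_mapsD[OF f] lin_mapsD[OF assms(3)] f0 by (intro lin_mapsI) auto
    then have "f \<circ> q = (\<lambda>_. \<zero>\<^bsub>?A\<^esub>)" using assms(1) unfolding tau_perp_def by blast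
    then have "f z = \<zero>\<^bsub>?A\<^esub>" if "z \<in> carrier N'" for z
      using assms(4) that by (metis (no_types, lifting) comp_apply imageE)
    then show ?thesis using lin_mapsD(4)[OF f] by blast
  qed
  then show ?thesis unfolding tau_perp_def using assms(2) zero_lin_AR[of U N'] by blast
qed

end

section \<open>The functor \<open>Hom(T, -)\<close>\<close>

text \<open>Hom-finiteness provides finitely many generators of Hom(M,Z) over the field; take one
  copy of \<open>M\<close> for each of them.\<close>

lemma (in additive_category) right_approximation:
  assumes "hom_finite K C" "M \<in> Obj C" "Z \<in> Obj C"
  obtains n S p where "direct_sum C S (replicate n M)" "S \<in> add_closure C M" "arr C p S Z"
    "\<And>t. arr C t M Z \<Longrightarrow> \<exists>t'. arr C t' M S \<and> p \<cdot> t' = t"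
proof -
  interpret MZ: left_module K "Hom C M Z" using module_left_module[OF hom_module[OF assms(2,3)]] .
  have "fin_gen K (Hom C M Z)" using assms unfolding hom_finite_def by blast
  then obtain G where G: "finite G" "G \<subseteq> carrier (Hom C M Z)"
    "\<And>W. \<lbrakk>submodule W K (Hom C M Z); G \<subseteq> W\<rbrakk> \<Longrightarrow> W = carrier (Hom C M Z)"
    unfolding fin_gen_def by blast
  obtain us where us: "set us = G" using finite_list[OF G(1)] by blast
  define n where "n = length us"
  obtain S where S: "direct_sum C S (replicate n M)"
    using ex_direct_sum_list[of "replicate n M"] assms(2) by fastforce
  obtain inc prj where d: "S \<in> Obj C" "\<And>i. i < n \<Longrightarrow> arr C (inc i) M S" "\<And>i. i < n \<Longrightarrow> arr C (prj i) S M"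
    "\<And>i j. \<lbrakk>i < n; j < n\<rbrakk> \<Longrightarrow> prj j \<cdot> inc i = (if i = j then Idn C M else \<zero>\<^bsub>Hom C M M\<^esub>)"
    "finsum (Hom C S S) (\<lambda>i. inc i \<cdot> prj i) {..<n} = Idn C S"
    by (rule direct_sum_copiesE[OF S]) (rule that)
  have u: "arr C (us ! i) M Z" if "i < n" for i
    using that us G(2) assms nth_mem[of i us] by (auto simp: arr_def n_def)
  define p where "p = finsum (Hom C S Z) (\<lambda>i. us ! i \<cdot> prj i) {..<n}"
  have p: "arr C p S Z" "\<And>i. i < n \<Longrightarrow> p \<cdot> inc i = us ! i"
    unfolding p_def using direct_sum_copies_lift[of S n M "\<lambda>i. us ! i" Z inc prj] S u assms(3) d(1-4)
    by blast+
  \<comment> \<open>The morphisms that lift through \<open>p\<close> form a subspace containing the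
    generators, hence all of Hom(M,Z).\<close>
  define W where "W = {p \<cdot> t | t. arr C t M S}"
  interpret MS: left_module K "Hom C M S" using module_left_module[OF hom_module[OF assms(2) d(1)]] .
  have "submodule W K (Hom C M Z)"
  proof (rule MZ.submodI)
    show "W \<subseteq> carrier (Hom C M Z)" unfolding W_def using arrD(3)[OF arr_cmp[OF _ p(1)]] by blast
    show "\<zero>\<^bsub>Hom C M Z\<^esub> \<in> W" unfolding W_def using cmp_zeror[OF p(1) assms(2)] arr_zero[OF assms(2) d(1)]
      by (metis (mono_tags, lifting) mem_Collect_eq)
    show "a \<oplus>\<^bsub>Hom C M Z\<^esub> b \<in> W" if "a \<in> W" "b \<in> W" for a b
      using that cmp_addr[OF _ _ p(1)] arr_add unfolding W_def by (smt (verit) mem_Collect_eq)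
    show "c \<odot>\<^bsub>Hom C M Z\<^esub> a \<in> W" if ca: "c \<in> carrier K" "a \<in> W" for c a
    proof -
      obtain t where t: "arr C t M S" "a = p \<cdot> t" using ca unfolding W_def by blast
      have "p \<cdot> (c \<odot>\<^bsub>Hom C M S\<^esub> t) = c \<odot>\<^bsub>Hom C M Z\<^esub> a"
        using cmp_smult_right[OF assms(2) d(1) assms(3) ca(1) arrD(3)[OF t(1)] arrD(3)[OF p(1)]] t
        by simp
      moreover have "arr C (c \<odot>\<^bsub>Hom C M S\<^esub> t) M S"
        using MS.smult_closed[OF ca(1) arrD(3)[OF t(1)]] assms(2) d(1) by (simp add: arr_def)
      ultimately show ?thesis unfolding W_def by (smt (verit) mem_Collect_eq)
    qed
  qed
  moreover have "G \<subseteq> W"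
  proof
    fix g assume "g \<in> G"
    then obtain i where i: "i < n" "g = us ! i" using us by (auto simp: in_set_conv_nth n_def)
    have "g = p \<cdot> inc i" using p(2)[OF i(1)] i by simp
    then show "g \<in> W" unfolding W_def using d(2)[OF i(1)] by blast
  qed
  ultimately have "W = carrier (Hom C M Z)" by (rule G(3))
  then have "\<exists>t'. arr C t' M S \<and> p \<cdot> t' = t" if "arr C t M Z" for t
  proof -
    have "t \<in> W" using arrD(3)[OF that] \<open>W = carrier (Hom C M Z)\<close> by simp
    then show ?thesis unfolding W_def by blast
  qed
  moreover obtain N where "zero_object C N" using ex_zero_object by blast
  then have "S \<in> add_closure C M" using S summand_refl[OF d(1)] unfolding add_closure_def by blast
  ultimately show ?thesis using that S p(1) by blast
qed

section \<open>The endomorphism algebra of T and the functor Hom(T,-)\<close>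

locale cluster_tilted = triangulated_category K D
  for K :: "('k, 'r) ring_scheme" and D :: "('o, 'm, 'k, 'z) tricat_scheme" (structure) +
  fixes T :: 'o
  assumes hf: "hom_finite K D" and ct: "cluster_tilting D T"
begin

abbreviation L :: "('k, 'm) module" where "L \<equiv> endo_op_algebra D T"
abbreviation F :: "'o \<Rightarrow> ('m, 'm) module" where "F \<equiv> hom_functor D T"
abbreviation Fm :: "'o \<Rightarrow> 'o \<Rightarrow> 'm \<Rightarrow> 'm \<Rightarrow> 'm" where "Fm \<equiv> hom_functor_map D T"

lemma T_obj: "T \<in> Obj D" using ct by (simp add: cluster_tilting_def)

lemma L_simps [simp]:
  "carrier L = carrier (Hom D T T)" "a \<otimes>\<^bsub>L\<^esub> b = b \<cdot> a" "\<one>\<^bsub>L\<^esub> = Idn D T" "\<zero>\<^bsub>L\<^esub> = \<zero>\<^bsub>Hom D T T\<^esub>"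
  "a \<oplus>\<^bsub>L\<^esub> b = a \<oplus>\<^bsub>Hom D T T\<^esub> b" "c \<odot>\<^bsub>L\<^esub> a = c \<odot>\<^bsub>Hom D T T\<^esub> a"
  by (simp_all add: endo_op_algebra_def)

lemma F_simps [simp]:
  "carrier (F X) = carrier (Hom D T X)" "\<zero>\<^bsub>F X\<^esub> = \<zero>\<^bsub>Hom D T X\<^esub>" "x \<oplus>\<^bsub>F X\<^esub> y = x \<oplus>\<^bsub>Hom D T X\<^esub> y"
  "a \<odot>\<^bsub>F X\<^esub> x = x \<cdot> a"
  by (simp_all add: hom_functor_def)

lemma finsum_F: "finsum (F X) f I = finsum (Hom D T X) f I"
  by (simp add: finsum_def finprod_def hom_functor_def)

lemma Tarr: "X \<in> Obj D \<Longrightarrow> x \<in> carrier (Hom D T X) \<longleftrightarrow> arr D x T X"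
  by (simp add: arr_def T_obj)

sublocale A: fd_algebra K L
proof (rule fd_algebra.intro)
  show "field K" by (rule field_K)
  have m: "module K (Hom D T T)" using hom_module T_obj by blast
  interpret H: left_module K "Hom D T T" using module_left_module[OF m] .
  have ab: "abelian_group L"
  proof (rule abelian_groupI)
    fix x assume "x \<in> carrier L"
    then show "\<exists>y\<in>carrier L. y \<oplus>\<^bsub>L\<^esub> x = \<zero>\<^bsub>L\<^esub>"
      using H.M.l_neg[of x] H.M.a_inv_closed[of x] by auto
  qed (auto simp: H.M.a_ac)
  show "ring L"
  proof (rule ringI)
    show "abelian_group L" by (rule ab)
    show "Group.monoid L"
    proof (rule monoidI)
      show "a \<otimes>\<^bsub>L\<^esub> b \<otimes>\<^bsub>L\<^esub> c = a \<otimes>\<^bsub>L\<^esub> (b \<otimes>\<^bsub>L\<^esub> c)"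
        if "a \<in> carrier L" "b \<in> carrier L" "c \<in> carrier L" for a b c
        using that assoc[of a T T b T c T] by (simp add: Tarr[OF T_obj])
    qed (auto simp: Tarr[OF T_obj] idl idr intro: arr_cmp arr_idn T_obj)
  qed (auto simp: Tarr[OF T_obj] intro: cmp_addr cmp_addl)
  show "module K L"
    using m ab unfolding module_def module_axioms_def by simp
  show "fin_gen K L"
  proof -
    have fg: "fin_gen K (Hom D T T)" using hf T_obj by (simp add: hom_finite_def)
    obtain S where S: "finite S" "S \<subseteq> carrier (Hom D T T)"
      "\<And>W. \<lbrakk>submodule W K (Hom D T T); S \<subseteq> W\<rbrakk> \<Longrightarrow> W = carrier (Hom D T T)"
      using fg unfolding fin_gen_def by blast
    interpret LL: left_module K L using module_left_module[OF \<open>module K L\<close>] .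
    show ?thesis unfolding fin_gen_def
    proof (intro exI[of _ S] conjI allI impI)
      fix W assume W: "submodule W K L \<and> S \<subseteq> W"
      then have "submodule W K L" by blast
      note w = LL.submodD[OF this]
      have "submodule W K (Hom D T T)" using w by (intro H.submodI) auto
      then show "W = carrier L" using S(3) W by simp
    qed (use S in auto)
  qed
  show "(c \<odot>\<^bsub>L\<^esub> a) \<otimes>\<^bsub>L\<^esub> b = c \<odot>\<^bsub>L\<^esub> (a \<otimes>\<^bsub>L\<^esub> b)" "a \<otimes>\<^bsub>L\<^esub> (c \<odot>\<^bsub>L\<^esub> b) = c \<odot>\<^bsub>L\<^esub> (a \<otimes>\<^bsub>L\<^esub> b)"
    if "c \<in> carrier K" "a \<in> carrier L" "b \<in> carrier L" for a b c
    using that cmp_smult_right[OF T_obj T_obj T_obj] cmp_smult_left[OF T_obj T_obj T_obj] by auto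
qed

lemma F_left_module: assumes "X \<in> Obj D" shows "left_module L (F X)"
proof -
  interpret H: left_module K "Hom D T X" using module_left_module[OF hom_module[OF T_obj assms]] .
  have ab: "abelian_group (F X)"
  proof (rule abelian_groupI)
    fix x assume "x \<in> carrier (F X)"
    then show "\<exists>y\<in>carrier (F X). y \<oplus>\<^bsub>F X\<^esub> x = \<zero>\<^bsub>F X\<^esub>"
      using H.M.l_neg[of x] H.M.a_inv_closed[of x] by auto
  qed (auto simp: H.M.a_ac)
  show ?thesis
  proof (intro left_module.intro left_module_axioms.intro A.ring_L ab)
    fix a b x y assume a: "a \<in> carrier L" and x: "x \<in> carrier (F X)"
    have a': "arr D a T T" and x': "arr D x T X" using a x Tarr T_obj assms by simp_all
    show "a \<odot>\<^bsub>F X\<^esub> x \<in> carrier (F X)" using arrD(3)[OF arr_cmp[OF a' x']] by simp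
    {
      assume "b \<in> carrier L"
      then have b': "arr D b T T" using Tarr T_obj by simp
      show "(a \<oplus>\<^bsub>L\<^esub> b) \<odot>\<^bsub>F X\<^esub> x = a \<odot>\<^bsub>F X\<^esub> x \<oplus>\<^bsub>F X\<^esub> b \<odot>\<^bsub>F X\<^esub> x" using cmp_addr[OF a' b' x'] by simp
      show "(a \<otimes>\<^bsub>L\<^esub> b) \<odot>\<^bsub>F X\<^esub> x = a \<odot>\<^bsub>F X\<^esub> (b \<odot>\<^bsub>F X\<^esub> x)" using assoc[OF a' b' x'] by simp
    next
      assume "y \<in> carrier (F X)"
      then have y': "arr D y T X" using Tarr assms by simp
      show "a \<odot>\<^bsub>F X\<^esub> (x \<oplus>\<^bsub>F X\<^esub> y) = a \<odot>\<^bsub>F X\<^esub> x \<oplus>\<^bsub>F X\<^esub> a \<odot>\<^bsub>F X\<^esub> y" using cmp_addl[OF a' x' y'] by simp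
    }
  next
    show "\<one>\<^bsub>L\<^esub> \<odot>\<^bsub>F X\<^esub> x = x" if "x \<in> carrier (F X)" for x using that assms by (simp add: Tarr idr)
  qed
qed

text \<open>Generators over the field suffice: scalar multiples of the identity of \<open>T\<close>
  make every \<open>L\<close>-submodule a subspace.\<close>

lemma F_fin_gen: assumes X: "X \<in> Obj D" shows "fin_gen L (F X)"
proof -
  interpret H: left_module K "Hom D T X" using module_left_module[OF hom_module[OF T_obj X]] .
  interpret FX: left_module L "F X" using F_left_module[OF X] .
  have fg: "fin_gen K (Hom D T X)" using hf T_obj X by (simp add: hom_finite_def)
  obtain S where S: "finite S" "S \<subseteq> carrier (Hom D T X)"
    "\<And>W. \<lbrakk>submodule W K (Hom D T X); S \<subseteq> W\<rbrakk> \<Longrightarrow> W = carrier (Hom D T X)"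
    using fg unfolding fin_gen_def by blast
  show ?thesis unfolding fin_gen_def
  proof (intro exI[of _ S] conjI allI impI)
    fix W assume W: "submodule W L (F X) \<and> S \<subseteq> W"
    then have "submodule W L (F X)" by blast
    note w = FX.submodD[OF this]
    have "c \<odot>\<^bsub>Hom D T X\<^esub> x \<in> W" if "c \<in> carrier K" "x \<in> W" for c x
    proof -
      have x: "arr D x T X" using that w(1) Tarr[OF X] by auto
      have "x \<cdot> (c \<odot>\<^bsub>Hom D T T\<^esub> Idn D T) = c \<odot>\<^bsub>Hom D T X\<^esub> x"
        using cmp_smult_right[OF T_obj T_obj X that(1) idn_closed[OF T_obj] arrD(3)[OF x]] idr[OF x]
        by simp
      then show ?thesis using w(5)[OF A.scal_closed[OF that(1)] that(2)] by simp
    qed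
    then have "submodule W K (Hom D T X)" using w by (intro H.submodI) auto
    then show "W = carrier (F X)" using S(3) W by simp
  qed (use S in auto)
qed

lemma F_obj: "X \<in> Obj D \<Longrightarrow> F X \<in> Obj (mod_cat L)"
  using F_left_module F_fin_gen A.mod_obj by blast

lemma Fm_apply: "arr D x T A \<Longrightarrow> Fm A B f x = f \<cdot> x"
  by (simp add: hom_functor_map_def arr_def)

lemma Fm_out: "x \<notin> carrier (Hom D T A) \<Longrightarrow> Fm A B f x = \<zero>\<^bsub>Hom D T B\<^esub>"
  by (simp add: hom_functor_map_def)

lemma Fm_lin: assumes "arr D f A B" shows "Fm A B f \<in> lin_maps L (F A) (F B)"
proof -
  note o = arrD(1,2)[OF assms]
  show ?thesis
    using assms o
    by (intro lin_mapsI) (auto simp: Tarr T_obj Fm_apply Fm_out arr_add arr_cmp intro: cmp_addr assoc[symmetric] assoc)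
qed

sublocale F: additive_functor K D K "mod_cat L :: (('m, 'm) module, 'm \<Rightarrow> 'm, 'k) lincat" F Fm
proof -
  interpret M: linear_category K "mod_cat L :: (('m, 'm) module, 'm \<Rightarrow> 'm, 'k) lincat"
    by (rule A.mod_linear_category)
  show "additive_functor K D K (mod_cat L :: (('m, 'm) module, 'm \<Rightarrow> 'm, 'k) lincat) F Fm"
  proof
    show "Fm A A (Idn D A) = Idn (mod_cat L) (F A)" if "A \<in> Obj D" for A
      using that by (auto simp: hom_functor_map_def id_map_def Tarr idl)
    show "Fm A B (f \<oplus>\<^bsub>Hom D A B\<^esub> g) = Fm A B f \<oplus>\<^bsub>Hom (mod_cat L) (F A) (F B)\<^esub> Fm A B g"
      if "arr D f A B" "arr D g A B" for f g A B
    proof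
      note o = arrD(1,2)[OF that(1)]
      interpret TB: abelian_group "Hom D T B" using hom_ab[OF T_obj o(2)] .
      fix x
      show "Fm A B (f \<oplus>\<^bsub>Hom D A B\<^esub> g) x = (Fm A B f \<oplus>\<^bsub>Hom (mod_cat L) (F A) (F B)\<^esub> Fm A B g) x"
        by (cases "arr D x T A") (simp_all add: hom_functor_map_def Tarr[OF o(1)] cmp_addl[OF _ that])
    qed
    show "Fm A E (g \<cdot> f) = Fm B E g \<cdot>\<^bsub>mod_cat L\<^esub> Fm A B f" if "arr D f A B" "arr D g B E" for f g A B E
      using that arrD[OF that(1)] arrD[OF that(2)] cmp_zeror[OF that(2) T_obj]
      by (auto simp: hom_functor_map_def Tarr fun_eq_iff arr_cmp assoc T_obj)
  qed (auto simp: F_obj A.arr_mod Fm_lin dest: arrD)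
qed

section \<open>Approximation triangles, ghosts and fullness\<close>

lemma add_T_iff: "V \<in> add_closure D T \<longleftrightarrow> V \<in> Obj D \<and> (\<forall>f. arr D f T (Sh D V) \<longrightarrow> f = \<zero>\<^bsub>Hom D T (Sh D V)\<^esub>)"
proof -
  have "add_closure D T = {X \<in> Obj D. carrier (Hom D T (Sh D X)) = {\<zero>\<^bsub>Hom D T (Sh D X)\<^esub>}}"
    using ct by (simp add: cluster_tilting_def)
  then show ?thesis
    using arrD(3)[OF arr_zero[OF T_obj Sh_obj]] Tarr[OF Sh_obj] by (auto simp: set_eq_iff)
qed

lemma T_add: "T \<in> add_closure D T"
  using add_closure_refl[OF T_obj] ex_zero_object by blast

lemma add_T_obj: "V \<in> add_closure D T \<Longrightarrow> V \<in> Obj D"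
  by (simp add: add_T_iff)

lemma add_T_shift: "\<lbrakk>V \<in> add_closure D T; arr D f T (Sh D V)\<rbrakk> \<Longrightarrow> f = \<zero>\<^bsub>Hom D T (Sh D V)\<^esub>"
  by (simp add: add_T_iff)

text \<open>Why \<open>V\<close> lies in add T: a morphism T -> V[1] dies in S[1], so it comes from
  a morphism T -> Z; this lifts through \<open>p\<close>, and \<open>c \<cdot> p\<close> is zero.
  Hence every object is the cone of a morphism in add T.\<close>

lemma T_triangle:
  assumes Z: "Z \<in> Obj D"
  obtains n V S k p c where "Tri D V S Z k p c" "V \<in> add_closure D T" "S \<in> add_closure D T"
    "\<And>t. arr D t T Z \<Longrightarrow> \<exists>t'. arr D t' T S \<and> p \<cdot> t' = t" "direct_sum D S (replicate n T)"
proof -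
  obtain n S p where S: "direct_sum D S (replicate n T)" "S \<in> add_closure D T" "arr D p S Z"
    "\<And>t. arr D t T Z \<Longrightarrow> \<exists>t'. arr D t' T S \<and> p \<cdot> t' = t"
    by (rule right_approximation[OF hf T_obj Z]) (rule that)
  obtain V k c where t: "Tri D V S Z k p c" using cocone[OF S(3)] .
  note a = triD[OF t]
  have V: "V \<in> Obj D" using arrD(1)[OF a(1)] .
  have "u = \<zero>\<^bsub>Hom D T (Sh D V)\<^esub>" if u: "arr D u T (Sh D V)" for u
  proof -
    have "ShM D k \<cdot> u = \<zero>\<^bsub>Hom D T (Sh D S)\<^esub>" using add_T_shift[OF S(2) arr_cmp[OF u Sh_arr[OF a(1)]]] .
    then obtain u' where u': "arr D u' T Z" "c \<cdot> u' = u" using tri_exact_cov2[OF t u] by blast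
    obtain t' where t': "arr D t' T S" "p \<cdot> t' = u'" using S(4)[OF u'(1)] by blast
    have "u = (c \<cdot> p) \<cdot> t'" using assoc[OF t'(1) a(2,3)] u' t' by simp
    then show ?thesis using tri_comp2[OF t] cmp_zerol[OF t'(1) Sh_obj[OF V]] by simp
  qed
  then have "V \<in> add_closure D T" using V by (simp add: add_T_iff)
  then show ?thesis using that t S by blast
qed

text \<open>Defined by what F kills; \<open>ghost_factor\<close> and \<open>factor_ghost\<close>
  show that these are the morphisms through add T[1].\<close>

definition ghost :: "'m \<Rightarrow> 'o \<Rightarrow> 'o \<Rightarrow> bool" where
  "ghost f Z W \<longleftrightarrow> arr D f Z W \<and> (\<forall>t. arr D t T Z \<longrightarrow> f \<cdot> t = \<zero>\<^bsub>Hom D T W\<^esub>)"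

text \<open>A ghost vanishes on the add T approximation of its source, so it factors through the
  connecting morphism to V[1].\<close>

lemma ghost_factor:
  assumes "ghost f Z W"
  obtains V a b where "V \<in> add_closure D T" "arr D a Z (Sh D V)" "arr D b (Sh D V) W" "f = b \<cdot> a"
proof -
  have f: "arr D f Z W" using assms by (simp add: ghost_def)
  note o = arrD(1,2)[OF f]
  obtain n V S k p c where t: "Tri D V S Z k p c" "V \<in> add_closure D T" "S \<in> add_closure D T"
    "\<And>t. arr D t T Z \<Longrightarrow> \<exists>t'. arr D t' T S \<and> p \<cdot> t' = t" "direct_sum D S (replicate n T)"
    by (rule T_triangle[OF o(1)]) (rule that)
  note a = triD[OF t(1)]
  have "f \<cdot> p = \<zero>\<^bsub>Hom D S W\<^esub>"
  proof (rule add_closure_zero[OF t(3) arr_cmp[OF a(2) f]])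
    fix u assume u: "arr D u T S"
    show "(f \<cdot> p) \<cdot> u = \<zero>\<^bsub>Hom D T W\<^esub>"
      using assoc[OF u a(2) f] assms arr_cmp[OF u a(2)] by (simp add: ghost_def)
  qed
  then obtain b where "arr D b (Sh D V) W" "b \<cdot> c = f" using tri_exact_con1[OF t(1) f] by blast
  then show ?thesis using that t(2) a(3) by blast
qed

lemma factor_ghost:
  assumes "V \<in> add_closure D T" "arr D a Z (Sh D V)" "arr D b (Sh D V) W"
  shows "ghost (b \<cdot> a) Z W"
  unfolding ghost_def
proof (intro conjI allI impI)
  show "arr D (b \<cdot> a) Z W" using arr_cmp assms by blast
  fix t assume t: "arr D t T Z"
  have "a \<cdot> t = \<zero>\<^bsub>Hom D T (Sh D V)\<^esub>" using add_T_shift[OF assms(1) arr_cmp[OF t assms(2)]] .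
  then show "(b \<cdot> a) \<cdot> t = \<zero>\<^bsub>Hom D T W\<^esub>" using assoc[OF t assms(2,3)] cmp_zeror[OF assms(3) T_obj]
    by simp
qed

text \<open>\<open>\<phi>\<close> prescribes a morphism \<open>q\<close> on the approximation
  \<open>S\<close> of \<open>Z\<close>. Since \<open>\<phi>\<close> respects the relations,
  \<open>q\<close> kills \<open>V\<close> and descends along \<open>p\<close>.\<close>

lemma F_full:
  assumes Z: "Z \<in> Obj D" and W: "W \<in> Obj D" and \<phi>: "\<phi> \<in> lin_maps L (F Z) (F W)"
  obtains \<alpha> where "arr D \<alpha> Z W" "Fm Z W \<alpha> = \<phi>"
proof -
  obtain n V S k p c where t: "Tri D V S Z k p c" and VT: "V \<in> add_closure D T"
    and S: "S \<in> add_closure D T"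
    "\<And>t. arr D t T Z \<Longrightarrow> \<exists>t'. arr D t' T S \<and> p \<cdot> t' = t" "direct_sum D S (replicate n T)"
    by (rule T_triangle[OF Z]) (rule that)
  note a = triD[OF t]
  obtain inc prj where d: "S \<in> Obj D" "\<And>i. i < n \<Longrightarrow> arr D (inc i) T S" "\<And>i. i < n \<Longrightarrow> arr D (prj i) S T"
    "\<And>i j. \<lbrakk>i < n; j < n\<rbrakk> \<Longrightarrow> prj j \<cdot> inc i = (if i = j then Idn D T else \<zero>\<^bsub>Hom D T T\<^esub>)"
    "finsum (Hom D S S) (\<lambda>i. inc i \<cdot> prj i) {..<n} = Idn D S"
    by (rule direct_sum_copiesE[OF S(3)]) (rule that)
  interpret FZ: left_module L "F Z" using F_left_module[OF Z] .
  interpret \<phi>: lin_map L "F Z" "F W" \<phi> using lin_mapI[OF F_left_module[OF Z] F_left_module[OF W] \<phi>] .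
  have \<phi>a: "arr D (\<phi> x) T W" if "arr D x T Z" for x using \<phi>.f_closed[of x] that Tarr Z W by simp
  have u: "arr D (\<phi> (p \<cdot> inc i)) T W" if "i < n" for i using \<phi>a[OF arr_cmp[OF d(2)[OF that] a(2)]] .
  define q where "q = finsum (Hom D S W) (\<lambda>i. \<phi> (p \<cdot> inc i) \<cdot> prj i) {..<n}"
  have q: "arr D q S W" "\<And>i. i < n \<Longrightarrow> q \<cdot> inc i = \<phi> (p \<cdot> inc i)"
    unfolding q_def using direct_sum_copies_lift[of S n T "\<lambda>i. \<phi> (p \<cdot> inc i)" W inc prj] S(3) u W d(1-4)
    by blast+
  \<comment> \<open>Linearity of \<open>\<phi>\<close>: the composites
    \<open>prj i \<cdot> y\<close> are elements of \<open>L\<close>, the coefficients of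
    \<open>p \<cdot> y\<close> over the \<open>p \<cdot> inc i\<close>.\<close>
  have qy: "q \<cdot> y = \<phi> (p \<cdot> y)" if y: "arr D y T S" for y
  proof -
    note py = arr_cmp[OF y d(3)]
    have sp: "p \<cdot> (inc i \<cdot> (prj i \<cdot> y)) = (p \<cdot> inc i) \<cdot> (prj i \<cdot> y)" if "i < n" for i
      using assoc[OF py[OF that] d(2)[OF that] a(2)] .
    have "y = finsum (Hom D S S) (\<lambda>i. inc i \<cdot> prj i) {..<n} \<cdot> y" using d(5) idl[OF y] by simp
    also have "\<dots> = finsum (Hom D T S) (\<lambda>i. (inc i \<cdot> prj i) \<cdot> y) {..<n}"
      using arr_cmp[OF d(3) d(2)] d(1) by (intro cmp_finsuml[OF _ _ y]) auto
    also have "\<dots> = finsum (Hom D T S) (\<lambda>i. inc i \<cdot> (prj i \<cdot> y)) {..<n}"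
      using assoc[OF y d(3) d(2)] arr_cmp[OF py d(2)] d(1) T_obj by (intro finsum_arr_cong) auto
    finally have y': "y = finsum (Hom D T S) (\<lambda>i. inc i \<cdot> (prj i \<cdot> y)) {..<n}" .
    have "p \<cdot> y = finsum (Hom D T Z) (\<lambda>i. p \<cdot> (inc i \<cdot> (prj i \<cdot> y))) {..<n}"
      by (subst y', rule cmp_finsumr[OF _ _ a(2) T_obj]) (use arr_cmp[OF py d(2)] in auto)
    also have "\<dots> = finsum (F Z) (\<lambda>i. (prj i \<cdot> y) \<odot>\<^bsub>F Z\<^esub> (p \<cdot> inc i)) {..<n}"
      unfolding finsum_F using sp arr_cmp[OF py arr_cmp[OF d(2) a(2)]] T_obj Z
      by (intro finsum_arr_cong) auto
    finally have "\<phi> (p \<cdot> y) = finsum (F W) (\<lambda>i. \<phi> ((prj i \<cdot> y) \<odot>\<^bsub>F Z\<^esub> (p \<cdot> inc i))) {..<n}"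
      using arr_cmp[OF py arr_cmp[OF d(2) a(2)]] Tarr[OF Z]
      by (simp only:, intro \<phi>.f_finsum) auto
    also have "\<dots> = finsum (F W) (\<lambda>i. (\<phi> (p \<cdot> inc i) \<cdot> prj i) \<cdot> y) {..<n}"
      using \<phi>.f_smult[of "prj i \<cdot> y" "p \<cdot> inc i" for i] py arr_cmp[OF d(2) a(2)] Tarr[OF T_obj] Tarr[OF Z] Tarr[OF W]
        assoc[OF y d(3) u] arr_cmp[OF py u]
      by (intro \<phi>.N.M.finsum_cong') auto
    also have "\<dots> = finsum (Hom D T W) (\<lambda>i. (\<phi> (p \<cdot> inc i) \<cdot> prj i) \<cdot> y) {..<n}"
      by (rule finsum_F)
    also have "\<dots> = q \<cdot> y"
      unfolding q_def using arr_cmp[OF d(3) u] W by (intro cmp_finsuml[OF _ _ y, symmetric]) auto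
    finally show ?thesis by simp
  qed
  \<comment> \<open>\<open>V\<close> lies in add T, so it is enough to test on morphisms from
    \<open>T\<close>, where \<open>qy\<close> turns the composite into \<open>\<phi>\<close> of
    zero.\<close>
  have "q \<cdot> k = \<zero>\<^bsub>Hom D V W\<^esub>"
  proof (rule add_closure_zero[OF VT arr_cmp[OF a(1) q(1)]])
    fix x assume x: "arr D x T V"
    have "(q \<cdot> k) \<cdot> x = \<phi> ((p \<cdot> k) \<cdot> x)"
      using assoc[OF x a(1) q(1)] qy[OF arr_cmp[OF x a(1)]] assoc[OF x a(1) a(2)] by simp
    also have "\<dots> = \<zero>\<^bsub>Hom D T W\<^esub>" using tri_comp1[OF t] cmp_zerol[OF x Z] \<phi>.f_zero by simp
    finally show "(q \<cdot> k) \<cdot> x = \<zero>\<^bsub>Hom D T W\<^esub>" .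
  qed
  then obtain \<alpha> where \<alpha>: "arr D \<alpha> Z W" "\<alpha> \<cdot> p = q" using tri_exact_con[OF t q(1)] by blast
  have "Fm Z W \<alpha> = \<phi>"
  proof (rule lin_maps_eqI[OF Fm_lin[OF \<alpha>(1)] \<phi>])
    fix x assume "x \<in> carrier (F Z)"
    then have x: "arr D x T Z" using Tarr[OF Z] by simp
    obtain y where y: "arr D y T S" "p \<cdot> y = x" using S(2)[OF x] by blast
    show "Fm Z W \<alpha> x = \<phi> x"
      using qy[OF y(1)] y assoc[OF y(1) a(2) \<alpha>(1)] \<alpha>(2) Fm_apply[OF x] by simp
  qed
  then show ?thesis using that \<alpha>(1) by blast
qed

section \<open>Projective modules as images of add T\<close>

definition coord_map :: "('m, 'm) module \<Rightarrow> 'o \<Rightarrow> nat \<Rightarrow> (nat \<Rightarrow> 'm) \<Rightarrow> (nat \<Rightarrow> 'm) \<Rightarrow> 'm \<Rightarrow> 'm" where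
  "coord_map M V n b m x =
     (if x \<in> carrier (Hom D T V) then finsum M (\<lambda>i. (b i \<cdot> x) \<odot>\<^bsub>M\<^esub> m i) {..<n} else \<zero>\<^bsub>M\<^esub>)"

text \<open>\<open>coord_map\<close> takes the place of maps out of a free module: F T is the
  regular module, and the \<open>b i\<close> act as coordinate functions on F V.\<close>

lemma coord_map_lin:
  assumes "left_module L M" "V \<in> Obj D" "\<And>i. i < n \<Longrightarrow> arr D (b i) V T" "\<And>i. i < n \<Longrightarrow> m i \<in> carrier M"
  shows "coord_map M V n b m \<in> lin_maps L (F V) M"
proof -
  interpret M: left_module L M by fact
  have c: "(b i \<cdot> x) \<odot>\<^bsub>M\<^esub> m i \<in> carrier M" if "i < n" "arr D x T V" for i x
    using M.smult_closed[of "b i \<cdot> x" "m i"] arrD(3)[OF arr_cmp[OF that(2) assms(3)[OF that(1)]]] assms(4)[OF that(1)]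
    by simp
  have e: "coord_map M V n b m x = finsum M (\<lambda>i. (b i \<cdot> x) \<odot>\<^bsub>M\<^esub> m i) {..<n}" if "arr D x T V" for x
    using that by (simp add: coord_map_def Tarr[OF assms(2)])
  show ?thesis
  proof (rule lin_mapsI)
    fix x assume "x \<in> carrier (F V)"
    then have x: "arr D x T V" using Tarr[OF assms(2)] by simp
    show "coord_map M V n b m x \<in> carrier M" unfolding e[OF x] using c[OF _ x]
      by (intro M.M.finsum_closed) auto
    {
      fix y assume "y \<in> carrier (F V)"
      then have y: "arr D y T V" using Tarr[OF assms(2)] by simp
      have "coord_map M V n b m (x \<oplus>\<^bsub>Hom D T V\<^esub> y)
          = finsum M (\<lambda>i. (b i \<cdot> x) \<odot>\<^bsub>M\<^esub> m i \<oplus>\<^bsub>M\<^esub> (b i \<cdot> y) \<odot>\<^bsub>M\<^esub> m i) {..<n}"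
        unfolding e[OF arr_add[OF x y]]
      proof (rule M.M.finsum_cong')
        fix i assume "i \<in> {..<n}"
        then have i: "i < n" by simp
        show "(b i \<cdot> (x \<oplus>\<^bsub>Hom D T V\<^esub> y)) \<odot>\<^bsub>M\<^esub> m i = (b i \<cdot> x) \<odot>\<^bsub>M\<^esub> m i \<oplus>\<^bsub>M\<^esub> (b i \<cdot> y) \<odot>\<^bsub>M\<^esub> m i"
          using M.smult_l_distr[of "b i \<cdot> x" "b i \<cdot> y" "m i"] cmp_addr[OF x y assms(3)[OF i]] assms(4)[OF i]
            arrD(3)[OF arr_cmp[OF x assms(3)[OF i]]] arrD(3)[OF arr_cmp[OF y assms(3)[OF i]]] by simp
      qed (use c[OF _ x] c[OF _ y] in auto)
      also have "\<dots> = coord_map M V n b m x \<oplus>\<^bsub>M\<^esub> coord_map M V n b m y"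
        unfolding e[OF x] e[OF y] using c[OF _ x] c[OF _ y] by (intro M.M.finsum_addf) auto
      finally show "coord_map M V n b m (x \<oplus>\<^bsub>F V\<^esub> y) = coord_map M V n b m x \<oplus>\<^bsub>M\<^esub> coord_map M V n b m y"
        by simp
    next
      fix a assume "a \<in> carrier L"
      then have a: "a \<in> carrier L" "arr D a T T" using Tarr[OF T_obj] by auto
      have "coord_map M V n b m (x \<cdot> a) = finsum M (\<lambda>i. a \<odot>\<^bsub>M\<^esub> ((b i \<cdot> x) \<odot>\<^bsub>M\<^esub> m i)) {..<n}"
        unfolding e[OF arr_cmp[OF a(2) x]]
      proof (rule M.M.finsum_cong')
        fix i assume "i \<in> {..<n}"
        then have i: "i < n" by simp
        show "(b i \<cdot> (x \<cdot> a)) \<odot>\<^bsub>M\<^esub> m i = a \<odot>\<^bsub>M\<^esub> ((b i \<cdot> x) \<odot>\<^bsub>M\<^esub> m i)"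
          using M.smult_assoc[of a "b i \<cdot> x" "m i"] assoc[OF a(2) x assms(3)[OF i]] assms(4)[OF i] a
            arrD(3)[OF arr_cmp[OF x assms(3)[OF i]]] by simp
      qed (use c[OF _ x] M.smult_closed[OF a(1)] in auto)
      also have "\<dots> = a \<odot>\<^bsub>M\<^esub> coord_map M V n b m x"
        unfolding e[OF x] using c[OF _ x] a by (intro M.smult_finsum_right[symmetric]) auto
      finally show "coord_map M V n b m (a \<odot>\<^bsub>F V\<^esub> x) = a \<odot>\<^bsub>M\<^esub> coord_map M V n b m x" by simp
    }
  qed (simp add: coord_map_def)
qed

text \<open>F V is a retract of a power of the regular module F T. The lift \<open>coord_map\<close>
  need not send the generator \<open>a i\<close> to the chosen \<open>m i\<close>, as the generators
  may be dependent, but after applying \<open>p\<close> the expansion of \<open>x\<close> over the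
  \<open>a i\<close> makes it agree with \<open>f\<close>.\<close>

lemma F_projective:
  assumes "V \<in> add_closure D T"
  shows "projective L (F V)"
  unfolding projective_def
proof (intro conjI ballI impI)
  have V: "V \<in> Obj D" using add_T_obj[OF assms] .
  show "F V \<in> Obj (mod_cat L)" using F_obj[OF V] .
  fix M N :: "('m, 'm) module" and p f
  assume M: "M \<in> Obj (mod_cat L)" and N: "N \<in> Obj (mod_cat L)"
    and p: "p \<in> lin_maps L M N" "p ` carrier M = carrier N" and f: "f \<in> lin_maps L (F V) N"
  have l: "left_module L M" "left_module L N" using M N A.mod_obj by blast+
  interpret p: lin_map L M N p using lin_mapI l p by blast
  interpret f: lin_map L "F V" N f using lin_mapI F_left_module[OF V] l f by blast
  obtain n a b where ab: "\<And>i. i < (n::nat) \<Longrightarrow> arr D (a i) T V" "\<And>i. i < n \<Longrightarrow> arr D (b i) V T"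
    "finsum (Hom D V V) (\<lambda>i. a i \<cdot> b i) {..<n} = Idn D V"
    by (rule add_closure_coords[OF assms]) (rule that)
  have "\<exists>m \<in> carrier M. p m = f (a i)" if "i < n" for i
  proof -
    have "f (a i) \<in> p ` carrier M" using f.f_closed[of "a i"] ab(1)[OF that] Tarr[OF V] p(2) by simp
    then show ?thesis by auto
  qed
  then obtain m where m: "\<And>i. i < n \<Longrightarrow> m i \<in> carrier M" "\<And>i. i < n \<Longrightarrow> p (m i) = f (a i)" by metis
  have h: "coord_map M V n b m \<in> lin_maps L (F V) M"
    by (rule coord_map_lin[OF l(1) V]) (use ab(2) m(1) in auto)
  have "p \<circ> coord_map M V n b m = f"
  proof (rule lin_maps_eqI[OF lin_maps_comp[OF h p(1) l] f])
    fix x assume "x \<in> carrier (F V)"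
    then have x: "arr D x T V" using Tarr[OF V] by simp
    have bx: "b i \<cdot> x \<in> carrier L" if "i < n" for i using arrD(3)[OF arr_cmp[OF x ab(2)[OF that]]]
      by simp
    have ai: "a i \<in> carrier (F V)" if "i < n" for i using ab(1)[OF that] Tarr[OF V] by simp
    have "(p \<circ> coord_map M V n b m) x = finsum N (\<lambda>i. p ((b i \<cdot> x) \<odot>\<^bsub>M\<^esub> m i)) {..<n}"
      using x Tarr[OF V] p.M.smult_closed[OF bx m(1)] by (simp add: coord_map_def Pi_def p.f_finsum)
    also have "\<dots> = finsum N (\<lambda>i. f ((b i \<cdot> x) \<odot>\<^bsub>F V\<^esub> a i)) {..<n}"
      using p.f_smult[OF bx m(1)] f.f_smult[OF bx ai] m(2) f.f_closed[OF f.M.smult_closed[OF bx ai]]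
      by (intro p.N.M.finsum_cong') (auto simp: Pi_def)
    also have "\<dots> = f (finsum (F V) (\<lambda>i. (b i \<cdot> x) \<odot>\<^bsub>F V\<^esub> a i) {..<n})"
      using f.M.smult_closed[OF bx ai] by (intro f.f_finsum[symmetric]) auto
    also have "finsum (F V) (\<lambda>i. (b i \<cdot> x) \<odot>\<^bsub>F V\<^esub> a i) {..<n} = x"
      using coords_expand[OF ab(1) ab(2) ab(3) x] by (simp add: finsum_F)
    finally show "(p \<circ> coord_map M V n b m) x = f x" .
  qed
  then show "\<exists>h \<in> lin_maps L (F V) M. p \<circ> h = f" using h by blast
qed

text \<open>\<open>S\<close> is a power of \<open>T\<close> with one copy per generator of
  \<open>X\<close>; the injection of the copy with index j, as an element of F S, is sent to
  \<open>m j\<close>.\<close>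

lemma free_cover:
  assumes "X \<in> Obj (mod_cat L)"
  obtains n S b m
    where "S \<in> add_closure D T" "\<And>i. i < (n::nat) \<Longrightarrow> arr D (b i) S T" "\<And>i. i < n \<Longrightarrow> m i \<in> carrier X"
    "coord_map X S n b m \<in> lin_maps L (F S) X" "coord_map X S n b m ` carrier (F S) = carrier X"
proof -
  have l: "left_module L X" and fg: "fin_gen L X" using assms A.mod_obj by blast+
  interpret X: left_module L X by fact
  obtain G where G: "finite G" "G \<subseteq> carrier X" "\<And>W. \<lbrakk>submodule W L X; G \<subseteq> W\<rbrakk> \<Longrightarrow> W = carrier X"
    using fg unfolding fin_gen_def by blast
  obtain xs where xs: "set xs = G" using finite_list[OF G(1)] by blast
  define n where "n = length xs"
  define m where "m i = xs ! i" for i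
  have m: "m i \<in> carrier X" if "i < n" for i using that xs G(2) nth_mem[of i xs]
    by (auto simp: n_def m_def)
  obtain S where S: "direct_sum D S (replicate n T)"
    using ex_direct_sum_list[of "replicate n T"] T_obj by fastforce
  obtain inc prj where d: "S \<in> Obj D" "\<And>i. i < n \<Longrightarrow> arr D (inc i) T S" "\<And>i. i < n \<Longrightarrow> arr D (prj i) S T"
    "\<And>i j. \<lbrakk>i < n; j < n\<rbrakk> \<Longrightarrow> prj j \<cdot> inc i = (if i = j then Idn D T else \<zero>\<^bsub>Hom D T T\<^esub>)"
    "finsum (Hom D S S) (\<lambda>i. inc i \<cdot> prj i) {..<n} = Idn D S"
    by (rule direct_sum_copiesE[OF S]) (rule that)
  obtain N where "zero_object D N" using ex_zero_object by blast
  then have Sadd: "S \<in> add_closure D T" using S summand_refl[OF d(1)] unfolding add_closure_def by blast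
  define h where "h = coord_map X S n prj m"
  have h: "h \<in> lin_maps L (F S) X" unfolding h_def
    by (rule coord_map_lin[OF l d(1)]) (use d(3) m in auto)
  interpret h: lin_map L "F S" X h using lin_mapI F_left_module[OF d(1)] l h by blast
  have "h (inc j) = m j" if j: "j < n" for j
  proof -
    have "h (inc j) = finsum X (\<lambda>i. (prj i \<cdot> inc j) \<odot>\<^bsub>X\<^esub> m i) {..<n}"
      using d(2)[OF j] Tarr[OF d(1)] by (simp add: h_def coord_map_def)
    also have "\<dots> = finsum X (\<lambda>i. if j = i then m i else \<zero>\<^bsub>X\<^esub>) {..<n}"
      using d(4)[OF j] m X.smult_one[OF m] X.smult_zero_left[OF m] by (intro X.M.finsum_cong') auto
    also have "\<dots> = m j" using X.M.finsum_singleton[of j "{..<n}" m] j m by auto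
    finally show ?thesis .
  qed
  then have "m j \<in> h ` carrier (F S)" if "j < n" for j using that d(2)[OF that] Tarr[OF d(1)]
    by (metis F_simps(1) image_eqI)
  then have "G \<subseteq> h ` carrier (F S)" using xs by (auto simp: in_set_conv_nth n_def m_def)
  then have "h ` carrier (F S) = carrier X" using G(3) h.image_submod[OF h.M.submod_carrier] by blast
  then show ?thesis using that[of S n prj m] Sadd d(3) m h by (simp add: h_def)
qed

lemma enough_projectives:
  fixes X :: "('m, 'm) module"
  assumes "X \<in> Obj (mod_cat L)"
  shows "\<exists>(P :: ('m, 'm) module) p. projective L P \<and> p \<in> lin_maps L P X \<and> p ` carrier P = carrier X"
proof -
  obtain n S b m
    where "S \<in> add_closure D T" "\<And>i. i < (n::nat) \<Longrightarrow> arr D (b i) S T" "\<And>i. i < n \<Longrightarrow> m i \<in> carrier X"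
    "coord_map X S n b m \<in> lin_maps L (F S) X" "coord_map X S n b m ` carrier (F S) = carrier X"
    by (rule free_cover[OF assms]) (rule that)
  then show ?thesis using F_projective by blast
qed

text \<open>The dual basis lemma: compose a section of a free cover with the coordinate functions of
  its source.\<close>

lemma projective_dual_basis:
  fixes P :: "('m, 'm) module"
  assumes "projective L P"
  shows "\<exists>n x \<xi>. dual_basis L P n x \<xi>"
proof -
  have P: "P \<in> Obj (mod_cat L)" using assms by (simp add: projective_def)
  have l: "left_module L P" using P A.mod_obj by blast
  obtain n S b m
    where S: "S \<in> add_closure D T" "\<And>i. i < (n::nat) \<Longrightarrow> arr D (b i) S T" "\<And>i. i < n \<Longrightarrow> m i \<in> carrier P"
    "coord_map P S n b m \<in> lin_maps L (F S) P" "coord_map P S n b m ` carrier (F S) = carrier P"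
    by (rule free_cover[OF P]) (rule that)
  have So: "S \<in> Obj D" using add_T_obj[OF S(1)] .
  obtain s where s: "s \<in> lin_maps L P (F S)" "coord_map P S n b m \<circ> s = id_map P"
    using A.projective_lift_surj[OF assms F_obj[OF So] P S(4,5) A.id_map_lin[OF l]] by blast
  interpret s: lin_map L P "F S" s using lin_mapI l F_left_module[OF So] s by blast
  have sa: "arr D (s y) T S" for y using lin_maps_range[OF s(1) F_left_module[OF So], of y] Tarr[OF So]
    by simp
  define \<xi> where "\<xi> i y = b i \<cdot> s y" for i y
  have "\<xi> i \<in> lin_maps L P (regular_module L)" if i: "i < n" for i
  proof (rule lin_mapsI)
    fix x assume x: "x \<in> carrier P"
    show "\<xi> i x \<in> carrier (regular_module L)" using arrD(3)[OF arr_cmp[OF sa S(2)[OF i]]]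
      by (simp add: \<xi>_def)
    show "\<xi> i (x \<oplus>\<^bsub>P\<^esub> y) = \<xi> i x \<oplus>\<^bsub>regular_module L\<^esub> \<xi> i y" if "y \<in> carrier P" for y
      using cmp_addr[OF sa sa S(2)[OF i]] s.f_add[OF x that] by (simp add: \<xi>_def)
    show "\<xi> i (a \<odot>\<^bsub>P\<^esub> x) = a \<odot>\<^bsub>regular_module L\<^esub> \<xi> i x" if "a \<in> carrier L" for a
      using assoc[OF _ sa S(2)[OF i], of a T] s.f_smult[OF that x] that Tarr[OF T_obj]
      by (simp add: \<xi>_def)
  next
    fix x assume "x \<notin> carrier P"
    then show "\<xi> i x = \<zero>\<^bsub>regular_module L\<^esub>" using s.f_out cmp_zeror[OF S(2)[OF i] T_obj]
      by (simp add: \<xi>_def)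
  qed
  moreover have "finsum P (\<lambda>i. \<xi> i y \<odot>\<^bsub>P\<^esub> m i) {..<n} = y" if y: "y \<in> carrier P" for y
  proof -
    have "coord_map P S n b m (s y) = y" using fun_cong[OF s(2), of y] y by (simp add: id_map_def)
    then show ?thesis using s.f_closed[OF y] by (simp add: coord_map_def \<xi>_def)
  qed
  ultimately have "dual_basis L P n m \<xi>" using S(3) by (simp add: dual_basis_def)
  then show ?thesis by blast
qed

section \<open>The torsion class of \<open>U\<^sub>\<Lambda>\<close> and Ext-projectivity\<close>

lemma tau_perp_F:
  assumes U: "U \<in> Obj D" and B: "B \<in> Obj D"
    and UL: "arr (mod_cat L) \<theta> (F U) UL" "arr (mod_cat L) \<theta>' UL (F U)"
    and inv: "\<And>x. x \<in> carrier (F U) \<Longrightarrow> \<theta>' (\<theta> x) = x" "\<And>x. x \<in> carrier UL \<Longrightarrow> \<theta> (\<theta>' x) = x"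
    and van: "\<And>V c x. \<lbrakk>V \<in> add_closure D T; arr D c U (Sh D V); arr D x (Sh D V) (Sh D B)\<rbrakk>
        \<Longrightarrow> x \<cdot> c = \<zero>\<^bsub>Hom D U (Sh D B)\<^esub>"
  shows "F B \<in> tau_perp K L UL"
proof -
  \<comment> \<open>F of this triangle is a projective presentation of F U, and \<open>van\<close>
    is the condition that nothing obstructs extending morphisms V -> B over S.\<close>
  obtain n V S k p c where t: "Tri D V S U k p c" and VT: "V \<in> add_closure D T"
    and S: "S \<in> add_closure D T"
    "\<And>t. arr D t T U \<Longrightarrow> \<exists>t'. arr D t' T S \<and> p \<cdot> t' = t" "direct_sum D S (replicate n T)"
    by (rule T_triangle[OF U]) (rule that)
  note a = triD[OF t]
  have o: "V \<in> Obj D" "S \<in> Obj D" using arrD(1,2)[OF a(1)] .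
  interpret th: lin_map L "F U" UL \<theta> using A.arr_mod_lin_map[OF UL(1)] .
  interpret th': lin_map L UL "F U" \<theta>' using A.arr_mod_lin_map[OF UL(2)] .
  have q0: "\<theta> \<circ> Fm S U p \<in> lin_maps L (F S) UL"
    using lin_maps_comp[OF Fm_lin[OF a(2)] th.f_lin th.M.left_module_axioms th.N.left_module_axioms] .
  have th0: "\<theta> x = \<zero>\<^bsub>UL\<^esub> \<longleftrightarrow> x = \<zero>\<^bsub>Hom D T U\<^esub>" if "arr D x T U" for x
    using inv(1)[of x] that Tarr[OF U] th'.f_zero th.f_zero by auto
  \<comment> \<open>The presentation is composed with \<open>\<theta>\<close> so that it ends in
    \<open>UL\<close> itself, the module that the torsion class refers to.\<close>
  have re: "right_exact L (F V) (F S) UL (Fm V S k) (\<theta> \<circ> Fm S U p)"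
    unfolding right_exact_def A.a_kernel_eq
  proof (intro conjI Fm_lin[OF a(1)] q0)
    show "Fm V S k ` carrier (F V) = {x \<in> carrier (F S). (\<theta> \<circ> Fm S U p) x = \<zero>\<^bsub>UL\<^esub>}"
    proof (intro equalityI subsetI)
      fix x assume "x \<in> Fm V S k ` carrier (F V)"
      then obtain z where z: "arr D z T V" "x = k \<cdot> z" using Fm_apply[of _ V S k] Tarr[OF o(1)] by auto
      have x: "arr D x T S" using z arr_cmp[OF z(1) a(1)] by simp
      have "p \<cdot> x = \<zero>\<^bsub>Hom D T U\<^esub>" using z assoc[OF z(1) a(1,2)] tri_comp1[OF t] cmp_zerol[OF z(1) U]
        by simp
      then show "x \<in> {x \<in> carrier (F S). (\<theta> \<circ> Fm S U p) x = \<zero>\<^bsub>UL\<^esub>}"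
        using x Tarr[OF o(2)] Fm_apply[OF x] th.f_zero by simp
    next
      fix x assume "x \<in> {x \<in> carrier (F S). (\<theta> \<circ> Fm S U p) x = \<zero>\<^bsub>UL\<^esub>}"
      then have x: "arr D x T S" "\<theta> (p \<cdot> x) = \<zero>\<^bsub>UL\<^esub>" using Tarr[OF o(2)] Fm_apply[of x] by auto
      then have "p \<cdot> x = \<zero>\<^bsub>Hom D T U\<^esub>" using th0[OF arr_cmp[OF x(1) a(2)]] by simp
      then obtain z where "arr D z T V" "k \<cdot> z = x" using tri_exact_cov[OF t x(1)] by blast
      then show "x \<in> Fm V S k ` carrier (F V)" using Fm_apply[of z V S k] Tarr[OF o(1)] by force
    qed
    show "(\<theta> \<circ> Fm S U p) ` carrier (F S) = carrier UL"
    proof (intro equalityI subsetI)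
      fix x assume "x \<in> (\<theta> \<circ> Fm S U p) ` carrier (F S)"
      then show "x \<in> carrier UL" using lin_mapsD(1)[OF q0] by blast
    next
      fix x assume x: "x \<in> carrier UL"
      then have "arr D (\<theta>' x) T U" using th'.f_closed Tarr[OF U] by simp
      then obtain y where y: "arr D y T S" "p \<cdot> y = \<theta>' x" using S(2) by blast
      then have "(\<theta> \<circ> Fm S U p) y = x" using Fm_apply[OF y(1)] inv(2)[OF x] by simp
      then show "x \<in> (\<theta> \<circ> Fm S U p) ` carrier (F S)" using y(1) Tarr[OF o(2)]
        by (metis F_simps(1) image_eqI)
    qed
  qed
  show ?thesis
  proof (rule A.tau_perpI[OF _ F_obj[OF B] enough_projectives projective_dual_basis F_projective[OF VT] F_projective[OF S(1)] re])
    show "UL \<in> Obj (mod_cat L)" using UL(1) by (simp add: A.arr_mod)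
    fix \<psi> assume "\<psi> \<in> lin_maps L (F V) (F B)"
    then obtain x where x: "arr D x V B" "Fm V B x = \<psi>" using F_full[OF o(1) B] by blast
    \<comment> \<open>A morphism \<open>x\<close> from \<open>V\<close> extends along
      \<open>k\<close> once its shift vanishes on the connecting morphism \<open>c\<close>. Its
      shift after \<open>c\<close> is a morphism from \<open>U\<close> to B[1] through V[1], as in
      \<open>van\<close>.\<close>
    have "ShM D x \<cdot> c = \<zero>\<^bsub>Hom D U (Sh D B)\<^esub>" using van[OF VT a(3) Sh_arr[OF x(1)]] .
    then obtain u where u: "arr D u (Sh D S) (Sh D B)" "u \<cdot> ShM D k = ShM D x"
      using tri_exact_con2[OF t Sh_arr[OF x(1)]] by blast
    obtain z where z: "arr D z S B" "ShM D z = u" using Sh_full[OF u(1) o(2) B] .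
    have "z \<cdot> k = x" using Sh_inj[OF arr_cmp[OF a(1) z(1)] x(1)] Sh_cmp[OF a(1) z(1)] u z by simp
    then have "\<psi> = Fm S B z \<circ> Fm V S k" using F.F_cmp[OF a(1) z(1)] x(2) by simp
    then show "\<exists>\<chi>\<in>lin_maps L (F S) (F B). \<psi> = \<chi> \<circ> Fm V S k" using Fm_lin[OF z(1)] by blast
  qed
qed

text \<open>
  \<open>B\<close> is the cocone of a right \<open>(add U)\<close>-approximation \<open>S \<rightarrow> T[1]\<close>, so that \<open>Hom(T, B)\<close> lies in
  the torsion class. A map \<open>w : X \<rightarrow> T[1]\<close> gives an extension of \<open>X\<close> by \<open>B\<close>; it splits because
  \<open>Hom(T, X)\<close> is Ext-projective, and then \<open>w\<close> lifts to \<open>S\<close>.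
\<close>

lemma bongartz_factor:
  assumes X: "X \<in> Obj D" and U: "U \<in> Obj D"
    and UL: "arr (mod_cat L) \<theta> (F U) UL" "arr (mod_cat L) \<theta>' UL (F U)"
      "\<And>x. x \<in> carrier (F U) \<Longrightarrow> \<theta>' (\<theta> x) = x" "\<And>x. x \<in> carrier UL \<Longrightarrow> \<theta> (\<theta>' x) = x"
    and XL: "arr (mod_cat L) \<eta> (F X) XL" "arr (mod_cat L) \<eta>' XL (F X)"
      "\<And>x. x \<in> carrier (F X) \<Longrightarrow> \<eta>' (\<eta> x) = x" "\<And>x. x \<in> carrier XL \<Longrightarrow> \<eta> (\<eta>' x) = x"
    and ext: "\<And>N. N \<in> tau_perp K L UL \<Longrightarrow> Ext1_vanishes L XL N"
    and rigid: "\<And>V a b. \<lbrakk>V \<in> add_closure D T; arr D a U (Sh D V); arr D b (Sh D V) (Sh D U)\<rbrakk>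
        \<Longrightarrow> b \<cdot> a = \<zero>\<^bsub>Hom D U (Sh D U)\<^esub>"
    and loc: "\<And>\<sigma>. \<lbrakk>arr D \<sigma> X X; ghost (Idn D X \<ominus>\<^bsub>Hom D X X\<^esub> \<sigma>) X X\<rbrakk>
        \<Longrightarrow> \<exists>\<tau>. arr D \<tau> X X \<and> \<sigma> \<cdot> \<tau> = Idn D X"
    and w: "arr D w X (Sh D T)"
  obtains S v w' where "S \<in> add_closure D U" "arr D w' X S" "arr D v S (Sh D T)" "v \<cdot> w' = w"
proof -
  obtain n S v where S: "direct_sum D S (replicate n U)" "S \<in> add_closure D U" "arr D v S (Sh D T)"
    "\<And>t. arr D t U (Sh D T) \<Longrightarrow> \<exists>t'. arr D t' U S \<and> v \<cdot> t' = t"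
    by (rule right_approximation[OF hf U Sh_obj[OF T_obj]]) (rule that)
  obtain B s \<beta> where tB: "Tri D T B S s \<beta> v" using extension_triangle[OF S(3) T_obj] .
  note aB = triD[OF tB]
  have B: "B \<in> Obj D" using arrD(2)[OF aB(1)] .
  \<comment> \<open>The class of the extension of \<open>X\<close> by \<open>B\<close> is the
    pushforward of \<open>w\<close> along T[1] -> B[1].\<close>
  define y where "y = ShM D s \<cdot> w"
  have y: "arr D y X (Sh D B)" unfolding y_def using arr_cmp[OF w Sh_arr[OF aB(1)]] .
  obtain E i e where tE: "Tri D B E X i e y" using extension_triangle[OF y B] .
  note aE = triD[OF tE]
  have E: "E \<in> Obj D" using arrD(2)[OF aE(1)] .
  have FB: "F B \<in> tau_perp K L UL"
  proof (rule tau_perp_F[OF U B UL])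
    fix V c x assume V: "V \<in> add_closure D T" and c: "arr D c U (Sh D V)"
      and x: "arr D x (Sh D V) (Sh D B)"
    note xc = arr_cmp[OF c x]
    \<comment> \<open>S[1] lies in add U[1], and into U[1] the composite vanishes by rigidity. So
      \<open>x \<cdot> c\<close> comes from a morphism U -> T[1]; that one lifts through the
      approximation \<open>v\<close>, and the shift of \<open>s\<close> kills
      \<open>v\<close>.\<close>
    have "ShM D \<beta> \<cdot> (x \<cdot> c) = \<zero>\<^bsub>Hom D U (Sh D S)\<^esub>"
    proof (rule add_closure_zero'[OF shift.F_add_closure[OF S(2)] arr_cmp[OF xc Sh_arr[OF aB(2)]]])
      fix t assume t: "arr D t (Sh D S) (Sh D U)"
      note bx = arr_cmp[OF x Sh_arr[OF aB(2)]]
      have "t \<cdot> (ShM D \<beta> \<cdot> (x \<cdot> c)) = (t \<cdot> (ShM D \<beta> \<cdot> x)) \<cdot> c"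
        using assoc[OF c x Sh_arr[OF aB(2)]] assoc[OF c bx t] by simp
      then show "t \<cdot> (ShM D \<beta> \<cdot> (x \<cdot> c)) = \<zero>\<^bsub>Hom D U (Sh D U)\<^esub>" using rigid[OF V c arr_cmp[OF bx t]]
        by simp
    qed
    then obtain z where z: "arr D z U (Sh D T)" "ShM D s \<cdot> z = x \<cdot> c" using tri_exact_cov3[OF tB xc]
      by blast
    obtain z' where z': "arr D z' U S" "v \<cdot> z' = z" using S(4)[OF z(1)] by blast
    have "x \<cdot> c = (ShM D s \<cdot> v) \<cdot> z'" using assoc[OF z'(1) aB(3) Sh_arr[OF aB(1)]] z z' by simp
    then show "x \<cdot> c = \<zero>\<^bsub>Hom D U (Sh D B)\<^esub>" using tri_comp3[OF tB] cmp_zerol[OF z'(1) Sh_obj[OF B]]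
      by simp
  qed
  \<comment> \<open>The class \<open>y\<close> is a ghost because T has no morphisms to T[1]; this
    is what makes F e surjective.\<close>
  have ygh: "y \<cdot> t = \<zero>\<^bsub>Hom D T (Sh D B)\<^esub>" if t: "arr D t T X" for t
  proof -
    have "w \<cdot> t = \<zero>\<^bsub>Hom D T (Sh D T)\<^esub>" using add_T_shift[OF T_add arr_cmp[OF t w]] .
    then show ?thesis
      unfolding y_def using assoc[OF t w Sh_arr[OF aB(1)]] cmp_zeror[OF Sh_arr[OF aB(1)] T_obj] by simp
  qed
  interpret i: lin_map L "F B" "F E" "Fm B E i"
    using lin_mapI[OF F_left_module[OF B] F_left_module[OF E] Fm_lin[OF aE(1)]] .
  interpret h: lin_map L "F X" XL \<eta> using A.arr_mod_lin_map[OF XL(1)] .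
  interpret h': lin_map L XL "F X" \<eta>' using A.arr_mod_lin_map[OF XL(2)] .
  \<comment> \<open>\<open>Ext1_vanishes\<close> is about short exact sequences, and F i may fail to
    be injective, so the image of F i serves as the kernel term.\<close>
  define H where "H = Fm B E i ` carrier (F B)"
  define N where "N = (F E)\<lparr>carrier := H\<rparr>"
  have H: "submodule H L (F E)" unfolding H_def using i.image_submod[OF i.M.submod_carrier] .
  have NO: "N \<in> Obj (mod_cat L)" unfolding N_def using A.submod_obj[OF F_obj[OF E] H] .
  have iN: "Fm B E i \<in> lin_maps L (F B) N"
    unfolding N_def by (rule lin_maps_restrict_codomain[OF i.f_lin]) (auto simp: H_def)
  have "N \<in> tau_perp K L UL"
    by (rule A.tau_perp_image[OF FB NO iN]) (simp add: N_def H_def)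
  then have E1: "Ext1_vanishes L XL N" by (rule ext)
  have hF: "\<eta> \<circ> Fm E X e \<in> lin_maps L (F E) XL"
    using lin_maps_comp[OF Fm_lin[OF aE(2)] h.f_lin h.M.left_module_axioms h.N.left_module_axioms] .
  have h0: "\<eta> x = \<zero>\<^bsub>XL\<^esub> \<longleftrightarrow> x = \<zero>\<^bsub>Hom D T X\<^esub>" if "arr D x T X" for x
    using XL(3)[of x] that Tarr[OF X] h'.f_zero h.f_zero by auto
  have re: "right_exact L N (F E) XL (inclusion (F E) H) (\<eta> \<circ> Fm E X e)"
    unfolding right_exact_def A.a_kernel_eq
  proof (intro conjI hF)
    show "inclusion (F E) H \<in> lin_maps L N (F E)" unfolding N_def
      using inclusion_lin[OF F_left_module[OF E] H] .
    have "inclusion (F E) H ` carrier N = H" by (auto simp: N_def inclusion_def image_iff)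
    also have "H = {x \<in> carrier (F E). (\<eta> \<circ> Fm E X e) x = \<zero>\<^bsub>XL\<^esub>}"
    proof (intro equalityI subsetI)
      fix x assume "x \<in> H"
      then obtain z where z: "arr D z T B" "x = i \<cdot> z" unfolding H_def
        using Fm_apply[of _ B E i] Tarr[OF B] by auto
      have x: "arr D x T E" using z arr_cmp[OF z(1) aE(1)] by simp
      have "e \<cdot> x = \<zero>\<^bsub>Hom D T X\<^esub>" using z assoc[OF z(1) aE(1,2)] tri_comp1[OF tE] cmp_zerol[OF z(1) X]
        by simp
      then show "x \<in> {x \<in> carrier (F E). (\<eta> \<circ> Fm E X e) x = \<zero>\<^bsub>XL\<^esub>}"
        using x Tarr[OF E] Fm_apply[OF x] h.f_zero by simp
    next
      fix x assume "x \<in> {x \<in> carrier (F E). (\<eta> \<circ> Fm E X e) x = \<zero>\<^bsub>XL\<^esub>}"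
      then have x: "arr D x T E" "\<eta> (e \<cdot> x) = \<zero>\<^bsub>XL\<^esub>" using Tarr[OF E] Fm_apply[of x] by auto
      then have "e \<cdot> x = \<zero>\<^bsub>Hom D T X\<^esub>" using h0[OF arr_cmp[OF x(1) aE(2)]] by simp
      then obtain z where "arr D z T B" "i \<cdot> z = x" using tri_exact_cov[OF tE x(1)] by blast
      then show "x \<in> H" unfolding H_def using Fm_apply[of z B E i] Tarr[OF B] by force
    qed
    finally show "inclusion (F E) H ` carrier N = {x \<in> carrier (F E). (\<eta> \<circ> Fm E X e) x = \<zero>\<^bsub>XL\<^esub>}" .
    show "(\<eta> \<circ> Fm E X e) ` carrier (F E) = carrier XL"
    proof (intro equalityI subsetI)
      fix x assume "x \<in> (\<eta> \<circ> Fm E X e) ` carrier (F E)"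
      then show "x \<in> carrier XL" using lin_mapsD(1)[OF hF] by blast
    next
      fix x assume x: "x \<in> carrier XL"
      then have hx: "arr D (\<eta>' x) T X" using h'.f_closed Tarr[OF X] by simp
      obtain z where z: "arr D z T E" "e \<cdot> z = \<eta>' x" using tri_exact_cov1[OF tE hx ygh[OF hx]] by blast
      then have "(\<eta> \<circ> Fm E X e) z = x" using Fm_apply[OF z(1)] XL(4)[OF x] by simp
      then show "x \<in> (\<eta> \<circ> Fm E X e) ` carrier (F E)" using z(1) Tarr[OF E]
        by (metis F_simps(1) image_eqI)
    qed
  qed
  have "inj_on (inclusion (F E) H) (carrier N)" by (auto simp: inj_on_def inclusion_def N_def)
  then obtain r where r: "r \<in> lin_maps L XL (F E)" "\<And>x. x \<in> carrier XL \<Longrightarrow> \<eta> (Fm E X e (r x)) = x"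
    using E1 re F_obj[OF E] unfolding Ext1_vanishes_def by (metis comp_apply)
  have "r \<circ> \<eta> \<in> lin_maps L (F X) (F E)"
    using lin_maps_comp[OF h.f_lin r(1) h.N.left_module_axioms F_left_module[OF E]] .
  \<comment> \<open>\<open>e \<cdot> \<sigma>\<close> acts as the identity on Hom(T,X) only, so it
    differs from the identity of \<open>X\<close> by a ghost; \<open>loc\<close> then gives it a
    right inverse.\<close>
  then obtain \<sigma> where \<sigma>: "arr D \<sigma> X E" "Fm X E \<sigma> = r \<circ> \<eta>" using F_full[OF X E] by blast
  note e\<sigma> = arr_cmp[OF \<sigma>(1) aE(2)]
  have id: "(e \<cdot> \<sigma>) \<cdot> t = t" if t: "arr D t T X" for t
  proof -
    have tc: "t \<in> carrier (F X)" using t Tarr[OF X] by simp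
    have "\<sigma> \<cdot> t = r (\<eta> t)" using Fm_apply[OF t, of E \<sigma>] \<sigma>(2) by simp
    then have "\<eta> (e \<cdot> (\<sigma> \<cdot> t)) = \<eta> t"
      using r(2)[OF h.f_closed[OF tc]] Fm_apply[OF arr_cmp[OF t \<sigma>(1)], of X e] by simp
    then have "e \<cdot> (\<sigma> \<cdot> t) = t"
      using XL(3)[of t] XL(3)[of "e \<cdot> (\<sigma> \<cdot> t)"] tc arr_cmp[OF arr_cmp[OF t \<sigma>(1)] aE(2)] Tarr[OF X]
      by simp
    then show ?thesis using assoc[OF t \<sigma>(1) aE(2)] by simp
  qed
  have "ghost (Idn D X \<ominus>\<^bsub>Hom D X X\<^esub> (e \<cdot> \<sigma>)) X X"
    unfolding ghost_def
  proof (intro conjI allI impI)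
    show "arr D (Idn D X \<ominus>\<^bsub>Hom D X X\<^esub> (e \<cdot> \<sigma>)) X X" using arr_minus[OF arr_idn[OF X] e\<sigma>] .
    fix t assume t: "arr D t T X"
    show "(Idn D X \<ominus>\<^bsub>Hom D X X\<^esub> (e \<cdot> \<sigma>)) \<cdot> t = \<zero>\<^bsub>Hom D T X\<^esub>"
      using cmp_minusl[OF t arr_idn[OF X] e\<sigma>] id[OF t] idl[OF t] minus_eq_zero_iff[OF t t] by simp
  qed
  then obtain \<tau> where \<tau>: "arr D \<tau> X X" "(e \<cdot> \<sigma>) \<cdot> \<tau> = Idn D X" using loc[OF e\<sigma>] by blast
  \<comment> \<open>\<open>\<sigma> \<cdot> \<tau>\<close> is a section of \<open>e\<close>, and a
    split extension has class zero.\<close>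
  have "y = y \<cdot> ((e \<cdot> \<sigma>) \<cdot> \<tau>)" using \<tau>(2) idr[OF y] by simp
  also have "\<dots> = ((y \<cdot> e) \<cdot> \<sigma>) \<cdot> \<tau>"
    using assoc[OF \<tau>(1) e\<sigma> y] assoc[OF \<sigma>(1) aE(2) y] by simp
  also have "\<dots> = \<zero>\<^bsub>Hom D X (Sh D B)\<^esub>"
    using tri_comp2[OF tE] cmp_zerol[OF \<sigma>(1) Sh_obj[OF B]] cmp_zerol[OF \<tau>(1) Sh_obj[OF B]] by simp
  finally have "ShM D s \<cdot> w = \<zero>\<^bsub>Hom D X (Sh D B)\<^esub>" by (simp add: y_def)
  then obtain w' where "arr D w' X S" "v \<cdot> w' = w" using tri_exact_cov2[OF tB w] by blast
  then show ?thesis using that S(2,3) by blast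
qed

section \<open>Locality of End X, and the Ext-projective module F X\<close>

lemma F_zero_object_add:
  assumes "Z \<in> Obj D" "zero_object (mod_cat L) (F Z)"
  shows "Z \<in> add_closure D (Sh D T)"
proof -
  have z: "t = \<zero>\<^bsub>Hom D T Z\<^esub>" if "arr D t T Z" for t
    using assms(2) that Tarr[OF assms(1)] unfolding A.zero_object_mod[OF F_obj[OF assms(1)]] by simp
  obtain V e e' where V: "V \<in> Obj D" "arr D e (Sh D V) Z" "arr D e' Z (Sh D V)"
    "e' \<cdot> e = Idn D (Sh D V)" "e \<cdot> e' = Idn D Z" using Sh_ess[OF assms(1)] .
  have "t = \<zero>\<^bsub>Hom D T (Sh D V)\<^esub>" if t: "arr D t T (Sh D V)" for t
    using z[OF arr_cmp[OF t V(2)]] assoc[OF t V(2,3)] V(4) idl[OF t] cmp_zeror[OF V(3) T_obj] by simp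
  then have "V \<in> add_closure D T" using V(1) by (simp add: add_T_iff)
  then have "Sh D V \<in> add_closure D (Sh D T)" by (rule shift.F_add_closure)
  then show ?thesis by (rule add_closure_iso[OF _ V(2-5)])
qed

text \<open>Some Krull-Schmidt summand \<open>Y\<close> of \<open>X\<close> survives under F. As F X
  is indecomposable, F kills the complement of \<open>Y\<close>, which therefore lies in add T[1]
  and is zero by \<open>noT\<close>. So \<open>X\<close> is isomorphic to \<open>Y\<close>, whose
  endomorphism ring is local.\<close>

lemma local_End:
  assumes ks: "krull_schmidt D" and X: "X \<in> Obj D" and ind: "indecomposable (mod_cat L) (F X)"
    and noT: "\<And>Z i p. \<lbrakk>arr D i Z X; arr D p X Z; p \<cdot> i = Idn D Z; Z \<in> add_closure D (Sh D T)\<rbrakk> \<Longrightarrow> zero_object D Z"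
    and a: "arr D a X X" and b: "arr D b X X" and ab: "iso_arrow D X X (a \<oplus>\<^bsub>Hom D X X\<^esub> b)"
  shows "iso_arrow D X X a \<or> iso_arrow D X X b"
proof -
  obtain Ys where Ys: "direct_sum D X Ys" "\<forall>Y \<in> set Ys. local_ring (endo_ring D Y)"
    using ks X unfolding krull_schmidt_def by blast
  obtain inc prj where d: "X \<in> Obj D" "set Ys \<subseteq> Obj D"
    "\<And>i. i < length Ys \<Longrightarrow> arr D (inc i) (Ys ! i) X"
    "\<And>i. i < length Ys \<Longrightarrow> arr D (prj i) X (Ys ! i)"
    "\<And>i j. \<lbrakk>i < length Ys; j < length Ys\<rbrakk> \<Longrightarrow>
       prj j \<cdot> inc i = (if i = j then Idn D (Ys ! i) else \<zero>\<^bsub>Hom D (Ys ! i) (Ys ! j)\<^esub>)"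
    "finsum (Hom D X X) (\<lambda>i. inc i \<cdot> prj i) {..<length Ys} = Idn D X"
    by (rule direct_sumE[OF Ys(1)]) (rule that)
  have Yo: "Ys ! i \<in> Obj D" if "i < length Ys" for i using d(2) that by auto
  have FX: "\<not> zero_object (mod_cat L) (F X)" using ind by (simp add: indecomposable_def)
  \<comment> \<open>If F killed all summands, every morphism T -> X would vanish, since it is the
    sum of its components.\<close>
  have "\<exists>j < length Ys. \<not> zero_object (mod_cat L) (F (Ys ! j))"
  proof (rule ccontr)
    assume "\<not> ?thesis"
    then have z: "t = \<zero>\<^bsub>Hom D T (Ys ! j)\<^esub>" if "j < length Ys" "arr D t T (Ys ! j)" for j t
      using that Tarr[OF Yo[OF that(1)]] A.zero_object_mod[OF F_obj[OF Yo[OF that(1)]]] by simp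
    have "t = \<zero>\<^bsub>Hom D T X\<^esub>" if t: "arr D t T X" for t
    proof -
      have "t = finsum (Hom D X X) (\<lambda>i. inc i \<cdot> prj i) {..<length Ys} \<cdot> t" using d(6) idl[OF t] by simp
      also have "\<dots> = finsum (Hom D T X) (\<lambda>i. (inc i \<cdot> prj i) \<cdot> t) {..<length Ys}"
        using arr_cmp[OF d(4) d(3)] X by (intro cmp_finsuml[OF _ _ t]) auto
      also have "\<dots> = \<zero>\<^bsub>Hom D T X\<^esub>"
        using assoc[OF t d(4) d(3)] z[OF _ arr_cmp[OF t d(4)]] cmp_zeror[OF d(3) T_obj] T_obj X
        by (intro finsum_arr_zero) auto
      finally show ?thesis .
    qed
    then show False using FX Tarr[OF X] A.zero_object_mod[OF F_obj[OF X]] by simp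
  qed
  then obtain j where j: "j < length Ys" "\<not> zero_object (mod_cat L) (F (Ys ! j))" by blast
  define Y where "Y = Ys ! j"
  obtain Z where Z: "direct_sum D X [Y, Z]"
    using retract_direct_sum[OF d(3)[OF j(1)] d(4)[OF j(1)]] d(5)[OF j(1) j(1)] by (auto simp: Y_def)
  obtain i p k q where s: "arr D i Y X" "arr D p X Y" "arr D k Z X" "arr D q X Z"
    "p \<cdot> i = Idn D Y" "q \<cdot> k = Idn D Z" "q \<cdot> i = \<zero>\<^bsub>Hom D Y Z\<^esub>" "p \<cdot> k = \<zero>\<^bsub>Hom D Z Y\<^esub>"
    "(i \<cdot> p) \<oplus>\<^bsub>Hom D X X\<^esub> (k \<cdot> q) = Idn D X" by (rule direct_sum2E[OF Z]) (rule that)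
  have "direct_sum (mod_cat L) (F X) [F Y, F Z]" using F.F_direct_sum[OF Z] by simp
  then have "zero_object (mod_cat L) (F Z)" using ind j(2) unfolding indecomposable_def Y_def by blast
  then have "zero_object D Z" using noT[OF s(3,4,6)] F_zero_object_add[OF arrD(1)[OF s(3)]] by blast
  then have "k = \<zero>\<^bsub>Hom D Z X\<^esub>" using zero_object_arr s(3) by blast
  then have kq: "k \<cdot> q = \<zero>\<^bsub>Hom D X X\<^esub>" using cmp_zerol[OF s(4) X] by simp
  interpret XX: abelian_group "Hom D X X" using hom_ab[OF X X] .
  have ip: "i \<cdot> p = Idn D X" using s(9) kq arrD(3)[OF arr_cmp[OF s(2,1)]] by simp
  have lr: "local_ring (endo_ring D Y)" using Ys(2) j(1) by (simp add: Y_def)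
  have Yo': "Y \<in> Obj D" using arrD(1)[OF s(1)] .
  have Ucar: "carrier (endo_ring D Y) = carrier (Hom D Y Y)" by (simp add: endo_ring_def)
  have U1: "iso_arrow D Y Y u \<longleftrightarrow> u \<in> Units (endo_ring D Y)" for u
    by (auto simp: iso_arrow_def Units_def endo_ring_def)
  \<comment> \<open>Now \<open>i\<close> and \<open>p\<close> are inverse to each other, so sending
    \<open>u\<close> to \<open>p \<cdot> (u \<cdot> i)\<close> is a ring isomorphism from End X to
    End Y, and invertibility can be tested on either side.\<close>
  have conj_arr: "arr D (p \<cdot> (u \<cdot> i)) Y Y" if "arr D u X X" for u
    using arr_cmp[OF arr_cmp[OF s(1) that] s(2)] .
  have conj_back: "i \<cdot> ((p \<cdot> (u \<cdot> i)) \<cdot> p) = u" if u: "arr D u X X" for u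
  proof -
    have "(p \<cdot> (u \<cdot> i)) \<cdot> p = p \<cdot> u"
      using assoc[OF s(2) arr_cmp[OF s(1) u] s(2)] assoc[OF s(2,1) u] ip idr[OF u] by simp
    then show ?thesis using assoc[OF u s(2,1)] ip idl[OF u] by simp
  qed
  have conj_cmp: "(p \<cdot> (u \<cdot> i)) \<cdot> (p \<cdot> (v \<cdot> i)) = p \<cdot> ((u \<cdot> v) \<cdot> i)"
    if u: "arr D u X X" and v: "arr D v X X" for u v
  proof -
    have "(u \<cdot> i) \<cdot> (p \<cdot> (v \<cdot> i)) = u \<cdot> (v \<cdot> i)"
      using assoc4[OF arr_cmp[OF s(1) v] s(2,1) u] ip idl[OF arr_cmp[OF s(1) v]] by simp
    then show ?thesis
      using assoc[OF conj_arr[OF v] arr_cmp[OF s(1) u] s(2)] assoc[OF s(1) v u] by simp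
  qed
  have conj_id: "p \<cdot> (Idn D X \<cdot> i) = Idn D Y" using idl[OF s(1)] s(5) by simp
  have to_Y: "iso_arrow D Y Y (p \<cdot> (u \<cdot> i))" if u: "arr D u X X" "iso_arrow D X X u" for u
  proof -
    obtain v where v: "arr D v X X" "v \<cdot> u = Idn D X" "u \<cdot> v = Idn D X"
      by (rule iso_arrowD[OF u(2) X X]) (rule that)
    show ?thesis
      using iso_arrowI[OF conj_arr[OF u(1)] conj_arr[OF v(1)]] conj_cmp[OF u(1) v(1)] conj_cmp[OF v(1) u(1)] v conj_id
      by simp
  qed
  have from_Y: "iso_arrow D X X u" if u: "arr D u X X" "iso_arrow D Y Y (p \<cdot> (u \<cdot> i))" for u
  proof -
    obtain v where v: "arr D v Y Y" "v \<cdot> (p \<cdot> (u \<cdot> i)) = Idn D Y" "(p \<cdot> (u \<cdot> i)) \<cdot> v = Idn D Y"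
      by (rule iso_arrowD[OF u(2) Yo' Yo']) (rule that)
    define v' where "v' = i \<cdot> (v \<cdot> p)"
    have v': "arr D v' X X" unfolding v'_def using arr_cmp[OF arr_cmp[OF s(2) v(1)] s(1)] .
    have cv: "p \<cdot> (v' \<cdot> i) = v"
    proof -
      have "v' \<cdot> i = i \<cdot> v"
        unfolding v'_def
        using assoc[OF s(1) arr_cmp[OF s(2) v(1)] s(1)] assoc[OF s(1,2) v(1)] s(5) idr[OF v(1)] by simp
      then show ?thesis using assoc[OF v(1) s(1,2)] s(5) idl[OF v(1)] by simp
    qed
    have "v' \<cdot> u = i \<cdot> ((p \<cdot> ((v' \<cdot> u) \<cdot> i)) \<cdot> p)" using conj_back[OF arr_cmp[OF u(1) v']] by simp
    also have "\<dots> = Idn D X" using conj_cmp[OF v' u(1)] cv v(2) idl[OF s(2)] ip by simp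
    finally have 1: "v' \<cdot> u = Idn D X" .
    have "u \<cdot> v' = i \<cdot> ((p \<cdot> ((u \<cdot> v') \<cdot> i)) \<cdot> p)" using conj_back[OF arr_cmp[OF v' u(1)]] by simp
    also have "\<dots> = Idn D X" using conj_cmp[OF u(1) v'] cv v(3) idl[OF s(2)] ip by simp
    finally show ?thesis using iso_arrowI[OF u(1) v' 1] by simp
  qed
  have "iso_arrow D Y Y (p \<cdot> ((a \<oplus>\<^bsub>Hom D X X\<^esub> b) \<cdot> i))" using to_Y[OF arr_add[OF a b] ab] .
  moreover have "p \<cdot> ((a \<oplus>\<^bsub>Hom D X X\<^esub> b) \<cdot> i) = (p \<cdot> (a \<cdot> i)) \<oplus>\<^bsub>Hom D Y Y\<^esub> (p \<cdot> (b \<cdot> i))"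
    using cmp_addl[OF s(1) a b] cmp_addr[OF arr_cmp[OF s(1) a] arr_cmp[OF s(1) b] s(2)] by simp
  ultimately have "(p \<cdot> (a \<cdot> i)) \<oplus>\<^bsub>endo_ring D Y\<^esub> (p \<cdot> (b \<cdot> i)) \<in> Units (endo_ring D Y)"
    using U1 by (simp add: endo_ring_def)
  then have "p \<cdot> (a \<cdot> i) \<in> Units (endo_ring D Y) \<or> p \<cdot> (b \<cdot> i) \<in> Units (endo_ring D Y)"
    using lr arrD(3)[OF conj_arr[OF a]] arrD(3)[OF conj_arr[OF b]] unfolding local_ring_def Ucar by blast
  then show ?thesis using from_Y a b U1 by blast
qed

lemma ghost_not_iso:
  assumes "X \<in> Obj D" "\<not> zero_object (mod_cat L) (F X)" "ghost \<rho> X X"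
  shows "\<not> iso_arrow D X X \<rho>"
proof
  assume "iso_arrow D X X \<rho>"
  then obtain \<tau> where \<tau>: "arr D \<rho> X X" "arr D \<tau> X X" "\<rho> \<cdot> \<tau> = Idn D X"
    by (rule iso_arrowD[OF _ assms(1,1)]) (rule that)
  have "t = \<zero>\<^bsub>Hom D T X\<^esub>" if t: "arr D t T X" for t
  proof -
    have "t = \<rho> \<cdot> (\<tau> \<cdot> t)" using assoc[OF t \<tau>(2,1)] \<tau>(3) idl[OF t] by simp
    then show ?thesis using assms(3) arr_cmp[OF t \<tau>(2)] by (simp add: ghost_def)
  qed
  then show False using assms(2) Tarr[OF assms(1)] A.zero_object_mod[OF F_obj[OF assms(1)]] by simp
qed

text \<open>A cancellation argument in the style of Krull-Schmidt, run in End X, where locality is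
  available. The identity of F X is the sum of the endomorphisms through the summands
  \<open>Xs ! j\<close>; lifted to \<open>X\<close>, one of them must be invertible. Then F X is a
  nonzero retract of an indecomposable summand, hence isomorphic to it. The isomorphic copy
  \<open>XL\<close> is returned because it is the module for which Ext-vanishing is known.\<close>

lemma ext_projective_summand:
  assumes X: "X \<in> Obj D" and FX: "\<not> zero_object (mod_cat L) (F X)"
    and loc: "\<And>a b. \<lbrakk>arr D a X X; arr D b X X; iso_arrow D X X (a \<oplus>\<^bsub>Hom D X X\<^esub> b)\<rbrakk>
        \<Longrightarrow> iso_arrow D X X a \<or> iso_arrow D X X b"
    and P: "is_P L TT M" and s: "arr (mod_cat L) s (F X) M" and r: "arr (mod_cat L) r M (F X)"
    and rs: "\<And>x. x \<in> carrier (F X) \<Longrightarrow> r (s x) = x"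
  obtains XL \<eta> \<eta>' where "arr (mod_cat L) \<eta> (F X) XL" "arr (mod_cat L) \<eta>' XL (F X)"
      "\<And>x. x \<in> carrier (F X) \<Longrightarrow> \<eta>' (\<eta> x) = x" "\<And>x. x \<in> carrier XL \<Longrightarrow> \<eta> (\<eta>' x) = x"
      "\<And>N. N \<in> TT \<Longrightarrow> Ext1_vanishes L XL N"
proof -
  obtain Xs where Xs: "direct_sum (mod_cat L) M Xs" "\<forall>X \<in> set Xs. indec_ext_projective L TT X"
    using P unfolding is_P_def by blast
  obtain inc prj where d: "M \<in> Obj (mod_cat L)" "set Xs \<subseteq> Obj (mod_cat L)"
    "\<And>i. i < length Xs \<Longrightarrow> arr (mod_cat L) (inc i) (Xs ! i) M"
    "\<And>i. i < length Xs \<Longrightarrow> arr (mod_cat L) (prj i) M (Xs ! i)"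
    "\<And>i j. \<lbrakk>i < length Xs; j < length Xs\<rbrakk> \<Longrightarrow>
       prj j \<cdot>\<^bsub>mod_cat L\<^esub> inc i = (if i = j then Idn (mod_cat L) (Xs ! i) else \<zero>\<^bsub>Hom (mod_cat L) (Xs ! i) (Xs ! j)\<^esub>)"
    "finsum (Hom (mod_cat L) M M) (\<lambda>i. inc i \<cdot>\<^bsub>mod_cat L\<^esub> prj i) {..<length Xs} = Idn (mod_cat L) M"
    by (rule F.C'.direct_sumE[OF Xs(1)]) (rule that)
  define n where "n = length Xs"
  define u where "u j = prj j \<cdot>\<^bsub>mod_cat L\<^esub> s" for j
  define v where "v j = r \<cdot>\<^bsub>mod_cat L\<^esub> inc j" for j
  have u: "arr (mod_cat L) (u j) (F X) (Xs ! j)" and v: "arr (mod_cat L) (v j) (Xs ! j) (F X)"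
    if "j < n" for j
    unfolding u_def v_def using F.C'.arr_cmp[OF s d(4)] F.C'.arr_cmp[OF d(3) r] that
    by (auto simp: n_def simp del: A.mod_cat_simps)
  have vu: "arr (mod_cat L) (v j \<cdot>\<^bsub>mod_cat L\<^esub> u j) (F X) (F X)" if "j < n" for j
    using F.C'.arr_cmp[OF u[OF that] v[OF that]] .
  have "\<exists>\<rho>. arr D \<rho> X X \<and> Fm X X \<rho> = v j \<cdot>\<^bsub>mod_cat L\<^esub> u j" if "j < n" for j
    using F_full[OF X X] vu[OF that] unfolding A.arr_mod by metis
  then obtain \<rho> where \<rho>: "\<And>j. j < n \<Longrightarrow> arr D (\<rho> j) X X" "\<And>j. j < n \<Longrightarrow> Fm X X (\<rho> j) = v j \<cdot>\<^bsub>mod_cat L\<^esub> u j"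
    by metis
  define R where "R = finsum (Hom D X X) \<rho> {..<n}"
  have R: "arr D R X X" unfolding R_def using \<rho>(1) X by (intro arr_finsum) auto
  interpret XX: abelian_group "Hom D X X" using hom_ab[OF X X] .
  \<comment> \<open>The sum of the \<open>inc j\<close> composed with \<open>prj j\<close> is the
    identity of \<open>M\<close>, so the whole sum collapses to \<open>r \<circ> s\<close>.\<close>
  have "Fm X X R = finsum (Hom (mod_cat L) (F X) (F X)) (\<lambda>j. v j \<cdot>\<^bsub>mod_cat L\<^esub> u j) {..<n}"
    unfolding R_def using F.F_finsum[of "{..<n}" \<rho> X X] \<rho> X vu F_obj[OF X]
      F.C'.finsum_arr_cong[of "{..<n}" "\<lambda>j. Fm X X (\<rho> j)" "\<lambda>j. v j \<cdot>\<^bsub>mod_cat L\<^esub> u j" "F X" "F X"]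
        by (simp del: A.mod_cat_simps)
  also have "\<dots> = finsum (Hom (mod_cat L) (F X) (F X)) (\<lambda>j. r \<cdot>\<^bsub>mod_cat L\<^esub> (inc j \<cdot>\<^bsub>mod_cat L\<^esub> (prj j \<cdot>\<^bsub>mod_cat L\<^esub> s))) {..<n}"
    using vu F_obj[OF X] by (intro F.C'.finsum_arr_cong) (auto simp: u_def v_def o_assoc)
  also have "\<dots> = r \<cdot>\<^bsub>mod_cat L\<^esub> finsum (Hom (mod_cat L) (F X) M) (\<lambda>j. inc j \<cdot>\<^bsub>mod_cat L\<^esub> (prj j \<cdot>\<^bsub>mod_cat L\<^esub> s)) {..<n}"
    using F.C'.arr_cmp[OF F.C'.arr_cmp[OF s d(4)] d(3)] F_obj[OF X]
    by (intro F.C'.cmp_finsumr[symmetric, OF _ _ r]) (auto simp: n_def simp del: A.mod_cat_simps)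
  also have "finsum (Hom (mod_cat L) (F X) M) (\<lambda>j. inc j \<cdot>\<^bsub>mod_cat L\<^esub> (prj j \<cdot>\<^bsub>mod_cat L\<^esub> s)) {..<n} = s"
  proof -
    have "finsum (Hom (mod_cat L) (F X) M) (\<lambda>j. inc j \<cdot>\<^bsub>mod_cat L\<^esub> (prj j \<cdot>\<^bsub>mod_cat L\<^esub> s)) {..<n}
      = finsum (Hom (mod_cat L) (F X) M) (\<lambda>j. (inc j \<cdot>\<^bsub>mod_cat L\<^esub> prj j) \<cdot>\<^bsub>mod_cat L\<^esub> s) {..<n}"
      using F.C'.arr_cmp[OF s F.C'.arr_cmp[OF d(4) d(3)]] F_obj[OF X] d(1)
      by (intro F.C'.finsum_arr_cong) (auto simp: n_def o_assoc)
    also have "\<dots> = finsum (Hom (mod_cat L) M M) (\<lambda>j. inc j \<cdot>\<^bsub>mod_cat L\<^esub> prj j) {..<n} \<cdot>\<^bsub>mod_cat L\<^esub> s"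
      using F.C'.arr_cmp[OF d(4) d(3)] d(1)
      by (intro F.C'.cmp_finsuml[symmetric, OF _ _ s]) (auto simp: n_def simp del: A.mod_cat_simps)
    also have "\<dots> = s" using d(6) F.C'.idl[OF s] by (simp add: n_def del: A.mod_cat_simps)
    finally show ?thesis .
  qed
  finally have FR: "Fm X X R = r \<circ> s" by (simp add: comp_def)
  have Rt: "R \<cdot> t = t" if t: "arr D t T X" for t
    using Fm_apply[OF t, of X R] FR rs[of t] Tarr[OF X] t by simp
  have gh: "ghost (Idn D X \<ominus>\<^bsub>Hom D X X\<^esub> R) X X"
    unfolding ghost_def
  proof (intro conjI allI impI)
    show "arr D (Idn D X \<ominus>\<^bsub>Hom D X X\<^esub> R) X X" using arr_minus[OF arr_idn[OF X] R] .
    fix t assume t: "arr D t T X"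
    show "(Idn D X \<ominus>\<^bsub>Hom D X X\<^esub> R) \<cdot> t = \<zero>\<^bsub>Hom D T X\<^esub>"
      using cmp_minusl[OF t arr_idn[OF X] R] Rt[OF t] idl[OF t] minus_eq_zero_iff[OF t t] by simp
  qed
  \<comment> \<open>\<open>R\<close> and a ghost add up to the identity; by locality one of the two
    is invertible, and the ghost is not.\<close>
  have "R \<oplus>\<^bsub>Hom D X X\<^esub> (Idn D X \<ominus>\<^bsub>Hom D X X\<^esub> R) = Idn D X"
    using XX.add_minus_cancel[OF arrD(3)[OF R] arrD(3)[OF arr_idn[OF X]]] by (simp add: a_minus_def)
  then have "iso_arrow D X X (R \<oplus>\<^bsub>Hom D X X\<^esub> (Idn D X \<ominus>\<^bsub>Hom D X X\<^esub> R))"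
    using iso_arrowI[OF arr_idn[OF X] arr_idn[OF X]] idl[OF arr_idn[OF X]] by simp
  then have "iso_arrow D X X R" using loc[OF R arr_minus[OF arr_idn[OF X] R]] ghost_not_iso[OF X FX gh]
    by blast
  \<comment> \<open>Locality passes from two summands to n of them. The empty sum is zero, which is
    a ghost and hence not invertible.\<close>
  then have "\<exists>j < n. iso_arrow D X X (\<rho> j)"
    using \<rho>(1) unfolding R_def
  proof (induction n)
    case 0
    then have "iso_arrow D X X \<zero>\<^bsub>Hom D X X\<^esub>" by simp
    moreover have "ghost \<zero>\<^bsub>Hom D X X\<^esub> X X" unfolding ghost_def using arr_zero[OF X X] cmp_zerol X
      by blast
    ultimately show ?case using ghost_not_iso[OF X FX] by blast
  next
    case (Suc n)
    have c: "\<rho> \<in> {..<n} \<rightarrow> carrier (Hom D X X)" "\<rho> n \<in> carrier (Hom D X X)" using arrD(3)[OF Suc.prems(2)]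
      by auto
    have "finsum (Hom D X X) \<rho> {..<Suc n} = \<rho> n \<oplus>\<^bsub>Hom D X X\<^esub> finsum (Hom D X X) \<rho> {..<n}"
      using c by (subst lessThan_Suc) (auto intro!: XX.finsum_insert)
    then have "iso_arrow D X X (\<rho> n) \<or> iso_arrow D X X (finsum (Hom D X X) \<rho> {..<n})"
      using Suc.prems by (intro loc) (auto intro!: arr_finsum X)
    then show ?case using Suc.IH Suc.prems(2) less_Suc_eq by (metis (no_types, lifting))
  qed
  then obtain j where j: "j < n" "iso_arrow D X X (\<rho> j)" by blast
  obtain \<tau> where \<tau>: "arr D \<tau> X X" "\<tau> \<cdot> \<rho> j = Idn D X" by (rule iso_arrowD[OF j(2) X X]) (rule that)
  define XL where "XL = Xs ! j"
  define \<eta>' where "\<eta>' = Fm X X \<tau> \<cdot>\<^bsub>mod_cat L\<^esub> v j"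
  have \<eta>: "arr (mod_cat L) (u j) (F X) XL" using u[OF j(1)] by (simp add: XL_def)
  have \<eta>': "arr (mod_cat L) \<eta>' XL (F X)" unfolding \<eta>'_def XL_def
    using F.C'.arr_cmp[OF v[OF j(1)] F.F_arr[OF \<tau>(1)]] .
  have "Fm X X \<tau> \<circ> (v j \<circ> u j) = id_map (F X)"
    using F.F_cmp[OF \<rho>(1)[OF j(1)] \<tau>(1)] \<tau>(2) \<rho>(2)[OF j(1)] F.F_idn[OF X] by simp
  then have "(Fm X X \<tau> \<circ> (v j \<circ> u j)) x = id_map (F X) x" for x by simp
  then have e1: "\<eta>' (u j x) = x" if "x \<in> carrier (F X)" for x
    using that by (simp add: \<eta>'_def id_map_def)
  have iXL: "indec_ext_projective L TT XL" using Xs(2) j(1) by (simp add: XL_def n_def)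
  obtain Z where Z: "direct_sum (mod_cat L) XL [F X, Z]"
    "\<And>x. \<lbrakk>zero_object (mod_cat L) Z; x \<in> carrier XL\<rbrakk> \<Longrightarrow> u j (\<eta>' x) = x"
    by (rule A.mod_retract[OF \<eta> \<eta>' e1]) (assumption, rule that)
  have "zero_object (mod_cat L) Z"
    using iXL Z(1) FX unfolding indec_ext_projective_def indecomposable_def by blast
  then show ?thesis using that[OF \<eta> \<eta>' e1] Z(2) iXL unfolding indec_ext_projective_def by blast
qed

text \<open>By Serre duality \<open>Hom(T, X[1])\<close> is dual to \<open>Hom(X[1], \<S> T)\<close>, and \<open>\<S> T = V[2]\<close> with \<open>V \<in> add T\<close>.\<close>

lemma connecting_map_ghost:
  assumes tri: "Tri D X U\<^sub>2 Y g f h" and serre: "serre_functor K D S Sm"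
    and fac: "\<And>V w. \<lbrakk>V \<in> add_closure D T; arr D w X (Sh D V)\<rbrakk> \<Longrightarrow> \<exists>w'. arr D w' U\<^sub>2 (Sh D V) \<and> w' \<cdot> g = w"
    and t: "arr D t T Y"
  shows "h \<cdot> t = \<zero>\<^bsub>Hom D T (Sh D X)\<^esub>"
proof -
  note a = triD[OF tri]
  have O: "X \<in> Obj D" "U\<^sub>2 \<in> Obj D" using arrD(1,2)[OF a(1)] .
  have lf: "linear_functor D D (carrier K) S Sm" using serre
    by (simp add: serre_functor_def linear_equivalence_def)
  have ST: "S T \<in> Obj D" "Sm (Idn D T) = Idn D (S T)" using lf T_obj by (auto simp: linear_functor_def)
  from serre obtain \<eta> where \<eta>0: "\<forall>A \<in> Obj D. \<forall>B \<in> Obj D.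
          \<eta> A B \<in> lin_maps K (Hom D A B) (dual_space K (Hom D B (S A))) \<and>
          bij_betw (\<eta> A B) (carrier (Hom D A B)) (carrier (dual_space K (Hom D B (S A))))"
    and nat0: "\<forall>A \<in> Obj D. \<forall>A' \<in> Obj D. \<forall>B \<in> Obj D. \<forall>B' \<in> Obj D.
          \<forall>a \<in> carrier (Hom D A' A). \<forall>f \<in> carrier (Hom D A B). \<forall>b \<in> carrier (Hom D B B').
          \<forall>u \<in> carrier (Hom D B' (S A')).
            \<eta> A' B' (b \<cdot> f \<cdot> a) u = \<eta> A B f (Sm a \<cdot> u \<cdot> b)"
    unfolding serre_functor_def by blast
  have \<eta>: "\<And>A B. \<lbrakk>A \<in> Obj D; B \<in> Obj D\<rbrakk> \<Longrightarrow>
          bij_betw (\<eta> A B) (carrier (Hom D A B)) (carrier (dual_space K (Hom D B (S A))))"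
    and nat: "\<And>A A' B B' a f b u. \<lbrakk>A \<in> Obj D; A' \<in> Obj D; B \<in> Obj D; B' \<in> Obj D; a \<in> carrier (Hom D A' A);
          f \<in> carrier (Hom D A B); b \<in> carrier (Hom D B B'); u \<in> carrier (Hom D B' (S A'))\<rbrakk> \<Longrightarrow>
            \<eta> A' B' (b \<cdot> f \<cdot> a) u = \<eta> A B f (Sm a \<cdot> u \<cdot> b)"
    using \<eta>0 nat0 by blast+
  have dual: "carrier (dual_space K V) = lin_maps K V (regular_module K)" for V :: "('k, 'm) module"
    by (simp add: dual_space_def)
  obtain W e1 e1' where W: "W \<in> Obj D" "arr D e1 (Sh D W) (S T)" "arr D e1' (S T) (Sh D W)"
    "e1' \<cdot> e1 = Idn D (Sh D W)" "e1 \<cdot> e1' = Idn D (S T)" using Sh_ess[OF ST(1)] .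
  obtain V e2 e2' where V: "V \<in> Obj D" "arr D e2 (Sh D V) W" "arr D e2' W (Sh D V)"
    "e2' \<cdot> e2 = Idn D (Sh D V)" "e2 \<cdot> e2' = Idn D W" using Sh_ess[OF W(1)] .
  \<comment> \<open>The shift is only an autoequivalence, so the two desuspensions of
    \<open>S T\<close> come with isomorphisms; \<open>e\<close> combines them into one from V[2] to
    \<open>S T\<close>.\<close>
  define e where "e = e1 \<cdot> ShM D e2"
  define e' where "e' = ShM D e2' \<cdot> e1'"
  have e: "arr D e (Sh D (Sh D V)) (S T)" "arr D e' (S T) (Sh D (Sh D V))"
    unfolding e_def e'_def using arr_cmp Sh_arr V W by blast+
  have ee: "e' \<cdot> e = Idn D (Sh D (Sh D V))"
    unfolding e_def e'_def assoc4[OF Sh_arr[OF V(2)] W(2,3) Sh_arr[OF V(3)]] W(4)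
    using idl[OF Sh_arr[OF V(2)]] Sh_cmp[OF V(2,3)] V(4) Sh_idn[OF Sh_obj[OF V(1)]] by simp
  have ee': "e \<cdot> e' = Idn D (S T)"
    unfolding e_def e'_def assoc4[OF W(3) Sh_arr[OF V(3)] Sh_arr[OF V(2)] W(2)]
    using idl[OF W(3)] Sh_cmp[OF V(3,2)] V(5) Sh_idn[OF W(1)] W(5) by simp
  have "q = \<zero>\<^bsub>Hom D T (Sh D V)\<^esub>" if q: "arr D q T (Sh D V)" for q
  proof -
    note TT = Sh_obj[OF T_obj]
    define z where "z = e \<cdot> ShM D q"
    have z: "arr D z (Sh D T) (S T)" unfolding z_def using arr_cmp[OF Sh_arr[OF q] e(1)] .
    \<comment> \<open>Hom(T[1], S T) is dual to Hom(T, T[1]), which is zero. So every functional on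
      it is the image of the zero morphism, whereas a nonzero \<open>z\<close> would be detected by
      some functional.\<close>
    have "z = \<zero>\<^bsub>Hom D (Sh D T) (S T)\<^esub>"
    proof (rule ccontr)
      assume nz: "z \<noteq> \<zero>\<^bsub>Hom D (Sh D T) (S T)\<^esub>"
      have "fin_gen K (Hom D (Sh D T) (S T))" using hf TT ST(1) by (simp add: hom_finite_def)
      then obtain \<phi> where \<phi>: "\<phi> \<in> lin_maps K (Hom D (Sh D T) (S T)) (regular_module K)" "\<phi> z \<noteq> \<zero>\<^bsub>K\<^esub>"
        by (rule separating_functional[OF field_K hom_module[OF TT ST(1)] _ arrD(3)[OF z] nz])
      have im: "\<eta> T (Sh D T) ` carrier (Hom D T (Sh D T)) = lin_maps K (Hom D (Sh D T) (S T)) (regular_module K)"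
        using \<eta>[OF T_obj TT] by (simp add: bij_betw_def dual)
      have c: "carrier (Hom D T (Sh D T)) \<subseteq> {\<zero>\<^bsub>Hom D T (Sh D T)\<^esub>}"
        using add_T_shift[OF T_add] Tarr[OF TT] by blast
      have zl: "(\<lambda>_. \<zero>\<^bsub>K\<^esub>) \<in> lin_maps K (Hom D (Sh D T) (S T)) (regular_module K)"
        by (auto intro!: lin_mapsI)
      have all: "\<psi> = \<eta> T (Sh D T) \<zero>\<^bsub>Hom D T (Sh D T)\<^esub>"
        if \<psi>: "\<psi> \<in> lin_maps K (Hom D (Sh D T) (S T)) (regular_module K)" for \<psi>
      proof -
        have "\<psi> \<in> \<eta> T (Sh D T) ` carrier (Hom D T (Sh D T))" using \<psi> im by simp
        then obtain q where "q \<in> carrier (Hom D T (Sh D T))" "\<psi> = \<eta> T (Sh D T) q" by (rule imageE)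
        then show ?thesis using subsetD[OF c, of q] by simp
      qed
      have "\<phi> = (\<lambda>_. \<zero>\<^bsub>K\<^esub>)" using all[OF \<phi>(1)] all[OF zl] by simp
      then show False using \<phi>(2) by simp
    qed
    then have "ShM D q = \<zero>\<^bsub>Hom D (Sh D T) (Sh D (Sh D V))\<^esub>"
      using assoc[OF Sh_arr[OF q] e] ee idl[OF Sh_arr[OF q]] cmp_zeror[OF e(2) TT] by (simp add: z_def)
    then show ?thesis
      using Sh_inj[OF q arr_zero[OF T_obj Sh_obj[OF V(1)]]] Sh_zero[OF T_obj Sh_obj[OF V(1)]] by simp
  qed
  then have VT: "V \<in> add_closure D T" using V(1) by (simp add: add_T_iff)
  define u where "u = h \<cdot> t"
  have u: "arr D u T (Sh D X)" unfolding u_def using arr_cmp[OF t a(3)] .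
  have gu: "ShM D g \<cdot> u = \<zero>\<^bsub>Hom D T (Sh D U\<^sub>2)\<^esub>"
    unfolding u_def
    using assoc[OF t a(3) Sh_arr[OF a(1)]] tri_comp3[OF tri] cmp_zerol[OF t Sh_obj[OF O(2)]] by simp
  have X1: "Sh D X \<in> Obj D" and U1: "Sh D U\<^sub>2 \<in> Obj D" using Sh_obj O by blast+
  have z0: "arr D \<zero>\<^bsub>Hom D T (Sh D X)\<^esub> T (Sh D X)" using arr_zero[OF T_obj X1] .
  have rg: "\<eta> T (Sh D X) q \<in> lin_maps K (Hom D (Sh D X) (S T)) (regular_module K)"
    if "arr D q T (Sh D X)" for q
    using bij_betw_apply[OF \<eta>[OF T_obj X1] arrD(3)[OF that]] by (simp add: dual)
  \<comment> \<open>The two functionals are compared at \<open>z\<close>. By \<open>fac\<close>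
    every such \<open>z\<close> factors through the shift of \<open>g\<close>, and naturality moves
    that factor over to the other argument, where it kills both \<open>u\<close> and zero.
    Injectivity of the duality then gives u = 0.\<close>
  have "\<eta> T (Sh D X) u = \<eta> T (Sh D X) \<zero>\<^bsub>Hom D T (Sh D X)\<^esub>"
  proof (rule lin_maps_eqI[OF rg[OF u] rg[OF z0]])
    fix z assume "z \<in> carrier (Hom D (Sh D X) (S T))"
    then have z: "arr D z (Sh D X) (S T)" using X1 ST(1) by (simp add: arr_def)
    obtain w where w: "arr D w X (Sh D V)" "ShM D w = e' \<cdot> z"
      using Sh_full[OF arr_cmp[OF z e(2)] O(1) Sh_obj[OF V(1)]] .
    obtain w' where w': "arr D w' U\<^sub>2 (Sh D V)" "w' \<cdot> g = w" using fac[OF VT w(1)] by blast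
    define z' where "z' = e \<cdot> ShM D w'"
    have z': "arr D z' (Sh D U\<^sub>2) (S T)" unfolding z'_def using arr_cmp[OF Sh_arr[OF w'(1)] e(1)] .
    have "z' \<cdot> ShM D g = e \<cdot> (e' \<cdot> z)"
      unfolding z'_def using assoc[OF Sh_arr[OF a(1)] Sh_arr[OF w'(1)] e(1)] Sh_cmp[OF a(1) w'(1)] w' w
      by simp
    also have "\<dots> = z" using assoc[OF z e(2,1)] ee' idl[OF z] by simp
    finally have zz: "z' \<cdot> ShM D g = z" .
    have key: "\<eta> T (Sh D X) q z = \<eta> T (Sh D U\<^sub>2) (ShM D g \<cdot> q) z'" if q: "arr D q T (Sh D X)" for q
      using nat[OF T_obj T_obj X1 U1 idn_closed[OF T_obj] arrD(3)[OF q] arrD(3)[OF Sh_arr[OF a(1)]] arrD(3)[OF z']]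
        idr[OF q] ST(2) zz idl[OF z] by simp
    show "\<eta> T (Sh D X) u z = \<eta> T (Sh D X) \<zero>\<^bsub>Hom D T (Sh D X)\<^esub> z"
      using key[OF u] key[OF z0] gu cmp_zeror[OF Sh_arr[OF a(1)] T_obj] by simp
  qed
  then show ?thesis
    using \<eta>[OF T_obj X1] arrD(3)[OF u] arrD(3)[OF z0] unfolding bij_betw_def inj_on_def u_def by blast
qed

text \<open>Exactness in the middle holds for every triangle; surjectivity is where
  \<open>gh\<close> enters, as it lets each morphism T -> Y lift to
  \<open>U\<^sub>2\<close>.\<close>

lemma triangle_right_exact:
  assumes tri: "Tri D X U\<^sub>2 Y g f h"
    and gh: "\<And>t. arr D t T Y \<Longrightarrow> h \<cdot> t = \<zero>\<^bsub>Hom D T (Sh D X)\<^esub>"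
  shows "right_exact L (F X) (F U\<^sub>2) (F Y) (Fm X U\<^sub>2 g) (Fm U\<^sub>2 Y f)"
  unfolding right_exact_def A.a_kernel_eq
proof (intro conjI)
  note a = triD[OF tri]
  have O: "X \<in> Obj D" "U\<^sub>2 \<in> Obj D" "Y \<in> Obj D" using arrD(1,2)[OF a(1)] arrD(2)[OF a(2)] .
  show "Fm X U\<^sub>2 g \<in> lin_maps L (F X) (F U\<^sub>2)" "Fm U\<^sub>2 Y f \<in> lin_maps L (F U\<^sub>2) (F Y)"
    using Fm_lin a by blast+
  show "Fm X U\<^sub>2 g ` carrier (F X) = {x \<in> carrier (F U\<^sub>2). Fm U\<^sub>2 Y f x = \<zero>\<^bsub>F Y\<^esub>}"
  proof (intro equalityI subsetI)
    fix x assume "x \<in> Fm X U\<^sub>2 g ` carrier (F X)"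
    then obtain z where z: "arr D z T X" "x = g \<cdot> z" using Fm_apply[of _ X U\<^sub>2 g] Tarr[OF O(1)] by auto
    have x: "arr D x T U\<^sub>2" using z arr_cmp[OF z(1) a(1)] by simp
    have "f \<cdot> x = \<zero>\<^bsub>Hom D T Y\<^esub>" using z assoc[OF z(1) a(1,2)] tri_comp1[OF tri] cmp_zerol[OF z(1) O(3)]
      by simp
    then show "x \<in> {x \<in> carrier (F U\<^sub>2). Fm U\<^sub>2 Y f x = \<zero>\<^bsub>F Y\<^esub>}"
      using x Tarr[OF O(2)] Fm_apply[OF x] by simp
  next
    fix x assume "x \<in> {x \<in> carrier (F U\<^sub>2). Fm U\<^sub>2 Y f x = \<zero>\<^bsub>F Y\<^esub>}"
    then have x: "arr D x T U\<^sub>2" "f \<cdot> x = \<zero>\<^bsub>Hom D T Y\<^esub>" using Tarr[OF O(2)] Fm_apply[of x] by auto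
    obtain z where "arr D z T X" "g \<cdot> z = x" using tri_exact_cov[OF tri x] by blast
    then show "x \<in> Fm X U\<^sub>2 g ` carrier (F X)" using Fm_apply[of z X U\<^sub>2 g] Tarr[OF O(1)] by force
  qed
  show "Fm U\<^sub>2 Y f ` carrier (F U\<^sub>2) = carrier (F Y)"
  proof (intro equalityI subsetI)
    fix x assume "x \<in> Fm U\<^sub>2 Y f ` carrier (F U\<^sub>2)"
    then show "x \<in> carrier (F Y)" using lin_mapsD(1)[OF Fm_lin[OF a(2)]] by blast
  next
    fix x assume "x \<in> carrier (F Y)"
    then have x: "arr D x T Y" using Tarr[OF O(3)] by simp
    obtain z where "arr D z T U\<^sub>2" "f \<cdot> z = x" using tri_exact_cov1[OF tri x gh[OF x]] by blast
    then show "x \<in> Fm U\<^sub>2 Y f ` carrier (F U\<^sub>2)" using Fm_apply[of z U\<^sub>2 Y f] Tarr[OF O(2)] by force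
  qed
qed

text \<open>An endomorphism fixing \<open>Hom(T, g)\<close> lifts to \<open>\<alpha>\<close> with \<open>\<alpha> g - g\<close> a ghost; ghosts out of \<open>X\<close>
  factor through \<open>g\<close>, so \<open>\<alpha>\<close> can be corrected by a ghost to an endomorphism fixing \<open>g\<close>.\<close>

lemma F_left_minimal:
  assumes g: "arr D g X U\<^sub>2"
    and min: "\<And>\<phi>. \<lbrakk>arr D \<phi> U\<^sub>2 U\<^sub>2; \<phi> \<cdot> g = g\<rbrakk> \<Longrightarrow> iso_arrow D U\<^sub>2 U\<^sub>2 \<phi>"
    and fac: "\<And>V w. \<lbrakk>V \<in> add_closure D T; arr D w X (Sh D V)\<rbrakk> \<Longrightarrow> \<exists>w'. arr D w' U\<^sub>2 (Sh D V) \<and> w' \<cdot> g = w"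
    and \<phi>: "arr (mod_cat L) \<phi> (F U\<^sub>2) (F U\<^sub>2)" "\<phi> \<circ> Fm X U\<^sub>2 g = Fm X U\<^sub>2 g"
  shows "iso_arrow (mod_cat L) (F U\<^sub>2) (F U\<^sub>2) \<phi>"
proof -
  note O = arrD(1,2)[OF g]
  have "\<phi> \<in> lin_maps L (F U\<^sub>2) (F U\<^sub>2)" using \<phi>(1) by (simp add: A.arr_mod)
  then obtain \<alpha> where \<alpha>: "arr D \<alpha> U\<^sub>2 U\<^sub>2" "Fm U\<^sub>2 U\<^sub>2 \<alpha> = \<phi>" using F_full[OF O(2,2)] by blast
  note \<alpha>g = arr_cmp[OF g \<alpha>(1)]
  have e: "(\<alpha> \<cdot> g) \<cdot> t = g \<cdot> t" if t: "arr D t T X" for t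
    using fun_cong[OF \<phi>(2), of t] Fm_apply[OF t] Fm_apply[OF arr_cmp[OF t g]] \<alpha>(2) assoc[OF t g \<alpha>(1)]
    by auto
  have "ghost ((\<alpha> \<cdot> g) \<ominus>\<^bsub>Hom D X U\<^sub>2\<^esub> g) X U\<^sub>2"
    unfolding ghost_def
  proof (intro conjI allI impI)
    show "arr D ((\<alpha> \<cdot> g) \<ominus>\<^bsub>Hom D X U\<^sub>2\<^esub> g) X U\<^sub>2" using arr_minus[OF \<alpha>g g] .
    fix t assume t: "arr D t T X"
    show "((\<alpha> \<cdot> g) \<ominus>\<^bsub>Hom D X U\<^sub>2\<^esub> g) \<cdot> t = \<zero>\<^bsub>Hom D T U\<^sub>2\<^esub>"
      using cmp_minusl[OF t \<alpha>g g] e[OF t] minus_eq_zero_iff[OF arr_cmp[OF t g] arr_cmp[OF t g]] by simp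
  qed
  then obtain V a b where V: "V \<in> add_closure D T" "arr D a X (Sh D V)" "arr D b (Sh D V) U\<^sub>2"
    "(\<alpha> \<cdot> g) \<ominus>\<^bsub>Hom D X U\<^sub>2\<^esub> g = b \<cdot> a" by (rule ghost_factor) (rule that)
  obtain a' where a': "arr D a' U\<^sub>2 (Sh D V)" "a' \<cdot> g = a" using fac[OF V(1,2)] by blast
  \<comment> \<open>A ghost endomorphism that accounts for the whole difference between
    \<open>\<alpha> \<cdot> g\<close> and \<open>g\<close>; subtracting it from
    \<open>\<alpha>\<close> gives a morphism fixing \<open>g\<close>.\<close>
  define \<beta> where "\<beta> = b \<cdot> a'"
  have \<beta>: "ghost \<beta> U\<^sub>2 U\<^sub>2" unfolding \<beta>_def using factor_ghost[OF V(1) a'(1) V(3)] .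
  then have \<beta>a: "arr D \<beta> U\<^sub>2 U\<^sub>2" by (simp add: ghost_def)
  define \<gamma> where "\<gamma> = \<alpha> \<ominus>\<^bsub>Hom D U\<^sub>2 U\<^sub>2\<^esub> \<beta>"
  have \<gamma>: "arr D \<gamma> U\<^sub>2 U\<^sub>2" unfolding \<gamma>_def using arr_minus[OF \<alpha>(1) \<beta>a] .
  interpret XU: abelian_group "Hom D X U\<^sub>2" using hom_ab[OF O] .
  have "\<beta> \<cdot> g = (\<alpha> \<cdot> g) \<ominus>\<^bsub>Hom D X U\<^sub>2\<^esub> g" unfolding \<beta>_def using assoc[OF g a'(1) V(3)] a'(2) V(4) by simp
  then have "\<gamma> \<cdot> g = (\<alpha> \<cdot> g) \<ominus>\<^bsub>Hom D X U\<^sub>2\<^esub> ((\<alpha> \<cdot> g) \<ominus>\<^bsub>Hom D X U\<^sub>2\<^esub> g)"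
    unfolding \<gamma>_def using cmp_minusl[OF g \<alpha>(1) \<beta>a] by simp
  also have "\<dots> = g"
    using arrD(3)[OF \<alpha>g] arrD(3)[OF g] by (simp add: a_minus_def XU.minus_add XU.r_neg1 XU.r_neg2)
  finally have "iso_arrow D U\<^sub>2 U\<^sub>2 \<gamma>" using min[OF \<gamma>] by simp
  then obtain \<tau> where \<tau>: "arr D \<tau> U\<^sub>2 U\<^sub>2" "\<tau> \<cdot> \<gamma> = Idn D U\<^sub>2" "\<gamma> \<cdot> \<tau> = Idn D U\<^sub>2"
    by (rule iso_arrowD[OF _ O(2,2)]) (rule that)
  \<comment> \<open>F does not see the correction, so inverting \<open>\<gamma>\<close> inverts
    \<open>\<phi>\<close>.\<close>
  have F\<gamma>: "Fm U\<^sub>2 U\<^sub>2 \<gamma> = \<phi>"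
  proof (rule lin_maps_eqI[OF Fm_lin[OF \<gamma>]])
    show "\<phi> \<in> lin_maps L (F U\<^sub>2) (F U\<^sub>2)" using \<phi>(1) by (simp add: A.arr_mod)
    fix x assume "x \<in> carrier (F U\<^sub>2)"
    then have x: "arr D x T U\<^sub>2" using Tarr[OF O(2)] by simp
    interpret TU: abelian_group "Hom D T U\<^sub>2" using hom_ab[OF T_obj O(2)] .
    have "\<gamma> \<cdot> x = (\<alpha> \<cdot> x) \<ominus>\<^bsub>Hom D T U\<^sub>2\<^esub> (\<beta> \<cdot> x)" unfolding \<gamma>_def by (rule cmp_minusl[OF x \<alpha>(1) \<beta>a])
    also have "\<dots> = \<alpha> \<cdot> x" using \<beta> x arrD(3)[OF arr_cmp[OF x \<alpha>(1)]]
      by (simp add: ghost_def a_minus_def TU.neg_zero)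
    finally show "Fm U\<^sub>2 U\<^sub>2 \<gamma> x = \<phi> x" using Fm_apply[OF x] \<alpha>(2) by metis
  qed
  have "Fm U\<^sub>2 U\<^sub>2 \<tau> \<cdot>\<^bsub>mod_cat L\<^esub> Fm U\<^sub>2 U\<^sub>2 \<gamma> = Idn (mod_cat L) (F U\<^sub>2)"
    "Fm U\<^sub>2 U\<^sub>2 \<gamma> \<cdot>\<^bsub>mod_cat L\<^esub> Fm U\<^sub>2 U\<^sub>2 \<tau> = Idn (mod_cat L) (F U\<^sub>2)"
    using F.F_cmp[OF \<gamma> \<tau>(1)] F.F_cmp[OF \<tau>(1) \<gamma>] \<tau> F.F_idn[OF O(2)] by metis+
  then show ?thesis using F.C'.iso_arrowI[OF \<phi>(1) F.F_arr[OF \<tau>(1)]] F\<gamma> by simp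
qed

end

theorem theorem4p19:
  fixes K :: "'k ring"
    and D :: "('o, 'm, 'k) tricat"
    and T X\<^sub>D U\<^sub>D M\<^sub>D U\<^sub>2 Y\<^sub>D :: 'o
    and g f h :: 'm
    and \<Lambda> :: "('k, 'm) module"
    and X\<^sub>\<Lambda> U\<^sub>\<Lambda> M\<^sub>\<Lambda> U'\<^sub>\<Lambda> Y\<^sub>\<Lambda> :: "('m, 'm) module"
    and g\<^sub>\<Lambda> f\<^sub>\<Lambda> :: "'m \<Rightarrow> 'm"
  assumes "algebraically_closed K"
    and "triangulated_category K D"
    and "hom_finite K D"
    and "krull_schmidt D"
    and "cluster_tilting D T"
    and "\<exists>S Sm. serre_functor K D S Sm"
    and "\<Lambda> = endo_op_algebra D T"
    and "direct_sum (mod_cat \<Lambda>) M\<^sub>\<Lambda> [X\<^sub>\<Lambda>, U\<^sub>\<Lambda>]"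
    and "basic (mod_cat \<Lambda>) M\<^sub>\<Lambda>"
    and "tau_tilting K \<Lambda> M\<^sub>\<Lambda>"
    and "bongartz_completion K \<Lambda> U\<^sub>\<Lambda> M\<^sub>\<Lambda>"
    and "indecomposable (mod_cat \<Lambda>) X\<^sub>\<Lambda>"
    and "Y\<^sub>\<Lambda> \<in> Obj (mod_cat \<Lambda>)"
    and "right_exact \<Lambda> X\<^sub>\<Lambda> U'\<^sub>\<Lambda> Y\<^sub>\<Lambda> g\<^sub>\<Lambda> f\<^sub>\<Lambda>"
    and "minimal_left_approx (mod_cat \<Lambda>) U\<^sub>\<Lambda> X\<^sub>\<Lambda> U'\<^sub>\<Lambda> g\<^sub>\<Lambda>"
    and "direct_sum D M\<^sub>D [X\<^sub>D, U\<^sub>D]"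
    and "basic D M\<^sub>D"
    and "rel_cluster_tilting D T M\<^sub>D"
    and "\<And>Z. summand D Z M\<^sub>D \<Longrightarrow> Z \<in> add_closure D (Sh D T) \<Longrightarrow> zero_object D Z"
    and "isomorphic (mod_cat \<Lambda>) (hom_functor D T X\<^sub>D) X\<^sub>\<Lambda>"
    and "isomorphic (mod_cat \<Lambda>) (hom_functor D T U\<^sub>D) U\<^sub>\<Lambda>"
    and "Tri D X\<^sub>D U\<^sub>2 Y\<^sub>D g f h"
    and "minimal_left_approx D U\<^sub>D X\<^sub>D U\<^sub>2 g"
  shows "right_exact \<Lambda> (hom_functor D T X\<^sub>D) (hom_functor D T U\<^sub>2) (hom_functor D T Y\<^sub>D)
           (hom_functor_map D T X\<^sub>D U\<^sub>2 g) (hom_functor_map D T U\<^sub>2 Y\<^sub>D f) \<and>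
         (\<exists>a b c.
           iso_arrow (mod_cat \<Lambda>) (hom_functor D T X\<^sub>D) X\<^sub>\<Lambda> a \<and>
           iso_arrow (mod_cat \<Lambda>) (hom_functor D T U\<^sub>2) U'\<^sub>\<Lambda> b \<and>
           iso_arrow (mod_cat \<Lambda>) (hom_functor D T Y\<^sub>D) Y\<^sub>\<Lambda> c \<and>
           b \<circ> hom_functor_map D T X\<^sub>D U\<^sub>2 g = g\<^sub>\<Lambda> \<circ> a \<and>
           c \<circ> hom_functor_map D T U\<^sub>2 Y\<^sub>D f = f\<^sub>\<Lambda> \<circ> b)"
proof -
  interpret triangulated_category K D by fact
  interpret cluster_tilted K D T
    by (intro cluster_tilted.intro cluster_tilted_axioms.intro assms)
  note tri = assms(22)
  have \<Lambda>: "\<Lambda> = L" by (rule assms(7))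
  note sumM = assms(8)[unfolded \<Lambda>] and bong = assms(11)[unfolded \<Lambda>] and indX = assms(12)[unfolded \<Lambda>]
    and YO = assms(13)[unfolded \<Lambda>] and re\<Lambda> = assms(14)[unfolded \<Lambda>] and min\<Lambda> = assms(15)[unfolded \<Lambda>]
    and isoX = assms(20)[unfolded \<Lambda>] and isoU = assms(21)[unfolded \<Lambda>]
  let ?C = "mod_cat L :: (('m, 'm) module, 'm \<Rightarrow> 'm, 'k) lincat"
  note ta = triD[OF tri]
  obtain iX pX iU pU
    where sD: "arr D iX X\<^sub>D M\<^sub>D" "arr D pX M\<^sub>D X\<^sub>D" "arr D iU U\<^sub>D M\<^sub>D" "arr D pU M\<^sub>D U\<^sub>D"
    "pX \<cdot>\<^bsub>D\<^esub> iX = Idn D X\<^sub>D" "pU \<cdot>\<^bsub>D\<^esub> iU = Idn D U\<^sub>D" "pU \<cdot>\<^bsub>D\<^esub> iX = \<zero>\<^bsub>Hom D X\<^sub>D U\<^sub>D\<^esub>" "pX \<cdot>\<^bsub>D\<^esub> iU = \<zero>\<^bsub>Hom D U\<^sub>D X\<^sub>D\<^esub>"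
    "(iX \<cdot>\<^bsub>D\<^esub> pX) \<oplus>\<^bsub>Hom D M\<^sub>D M\<^sub>D\<^esub> (iU \<cdot>\<^bsub>D\<^esub> pU) = Idn D M\<^sub>D"
      by (rule direct_sum2E[OF assms(16)]) (rule that)
  have O: "X\<^sub>D \<in> Obj D" "U\<^sub>D \<in> Obj D" "M\<^sub>D \<in> Obj D" "U\<^sub>2 \<in> Obj D" "Y\<^sub>D \<in> Obj D"
    using arrD(1,2)[OF sD(1)] arrD(1)[OF sD(3)] arrD(1,2)[OF ta(2)] by auto
  obtain i p j q where sL: "arr ?C i X\<^sub>\<Lambda> M\<^sub>\<Lambda>" "arr ?C p M\<^sub>\<Lambda> X\<^sub>\<Lambda>" "arr ?C j U\<^sub>\<Lambda> M\<^sub>\<Lambda>" "arr ?C q M\<^sub>\<Lambda> U\<^sub>\<Lambda>"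
    "p \<cdot>\<^bsub>?C\<^esub> i = Idn ?C X\<^sub>\<Lambda>" by (rule F.C'.direct_sum2E[OF sumM]) (rule that)
  have OL: "X\<^sub>\<Lambda> \<in> Obj ?C" "U\<^sub>\<Lambda> \<in> Obj ?C" using arrD(1)[OF sL(1)] arrD(1)[OF sL(3)] .
  obtain a where a0: "iso_arrow ?C (F X\<^sub>D) X\<^sub>\<Lambda> a" using isoX by (auto simp: isomorphic_def)
  obtain a' where a: "arr ?C a (F X\<^sub>D) X\<^sub>\<Lambda>" "arr ?C a' X\<^sub>\<Lambda> (F X\<^sub>D)"
    "\<And>x. x \<in> carrier (F X\<^sub>D) \<Longrightarrow> a' (a x) = x" "\<And>x. x \<in> carrier X\<^sub>\<Lambda> \<Longrightarrow> a (a' x) = x"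
    by (rule A.mod_iso_arrowE[OF a0 F_obj[OF O(1)] OL(1)]) (rule that)
  obtain \<theta>0 where \<theta>0: "iso_arrow ?C (F U\<^sub>D) U\<^sub>\<Lambda> \<theta>0" using isoU by (auto simp: isomorphic_def)
  obtain \<theta> \<theta>' where \<theta>: "arr ?C \<theta> (F U\<^sub>D) U\<^sub>\<Lambda>" "arr ?C \<theta>' U\<^sub>\<Lambda> (F U\<^sub>D)"
    "\<And>x. x \<in> carrier (F U\<^sub>D) \<Longrightarrow> \<theta>' (\<theta> x) = x" "\<And>x. x \<in> carrier U\<^sub>\<Lambda> \<Longrightarrow> \<theta> (\<theta>' x) = x"
    by (rule A.mod_iso_arrowE[OF \<theta>0 F_obj[OF O(2)] OL(2)]) (rule that)
  interpret a: lin_map L "F X\<^sub>D" X\<^sub>\<Lambda> a using A.arr_mod_lin_map[OF a(1)] .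
  interpret a': lin_map L X\<^sub>\<Lambda> "F X\<^sub>D" a' using A.arr_mod_lin_map[OF a(2)] .
  interpret \<theta>: lin_map L "F U\<^sub>D" U\<^sub>\<Lambda> \<theta> using A.arr_mod_lin_map[OF \<theta>(1)] .
  interpret \<theta>': lin_map L U\<^sub>\<Lambda> "F U\<^sub>D" \<theta>' using A.arr_mod_lin_map[OF \<theta>(2)] .
  have aa: "a' \<cdot>\<^bsub>?C\<^esub> a = Idn ?C (F X\<^sub>D)" "a \<cdot>\<^bsub>?C\<^esub> a' = Idn ?C X\<^sub>\<Lambda>"
    using a(3,4)
    by (auto simp: fun_eq_iff id_map_def a.f_out a'.f_out a.f_zero[unfolded F_simps] a'.f_zero)
  have tt: "\<theta>' \<cdot>\<^bsub>?C\<^esub> \<theta> = Idn ?C (F U\<^sub>D)" "\<theta> \<cdot>\<^bsub>?C\<^esub> \<theta>' = Idn ?C U\<^sub>\<Lambda>"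
    using \<theta>(3,4)
    by (auto simp: fun_eq_iff id_map_def \<theta>.f_out \<theta>'.f_out \<theta>.f_zero[unfolded F_simps] \<theta>'.f_zero)
  have indF: "indecomposable ?C (F X\<^sub>D)"
    unfolding indecomposable_def
  proof (intro conjI allI impI)
    show "F X\<^sub>D \<in> Obj ?C" using F_obj[OF O(1)] .
    show "\<not> zero_object ?C (F X\<^sub>D)"
      using indX F.C'.zero_object_iso[OF _ a(1,2) aa(2)] unfolding indecomposable_def by blast
    fix A B assume "direct_sum ?C (F X\<^sub>D) [A, B]"
    then have "direct_sum ?C X\<^sub>\<Lambda> [A, B]" by (rule F.C'.direct_sum_iso[OF _ a(1,2) aa])
    then show "zero_object ?C A \<or> zero_object ?C B" using indX unfolding indecomposable_def by blast
  qed
  then have nz: "\<not> zero_object ?C (F X\<^sub>D)" by (simp add: indecomposable_def)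
  \<comment> \<open>A retract of \<open>X\<^sub>D\<close> is one of \<open>M\<^sub>D\<close>;
    splitting it off as a summand brings it under the hypothesis on
    \<open>M\<^sub>D\<close>.\<close>
  have noT: "zero_object D Z"
    if r: "arr D u Z X\<^sub>D" "arr D v X\<^sub>D Z" "v \<cdot>\<^bsub>D\<^esub> u = Idn D Z" "Z \<in> add_closure D (Sh D T)" for Z u v
  proof -
    have "(v \<cdot>\<^bsub>D\<^esub> pX) \<cdot>\<^bsub>D\<^esub> (iX \<cdot>\<^bsub>D\<^esub> u) = Idn D Z"
      using assoc4[OF r(1) sD(1,2) r(2)] sD(5) idl[OF r(1)] r(3) by simp
    then obtain W where "direct_sum D M\<^sub>D [Z, W]"
      using retract_direct_sum[OF arr_cmp[OF r(1) sD(1)] arr_cmp[OF sD(2) r(2)]] by blast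
    then show ?thesis using assms(19)[OF _ r(4)] unfolding summand_def by blast
  qed
  have loc: "iso_arrow D X\<^sub>D X\<^sub>D u \<or> iso_arrow D X\<^sub>D X\<^sub>D v"
    if "arr D u X\<^sub>D X\<^sub>D" "arr D v X\<^sub>D X\<^sub>D" "iso_arrow D X\<^sub>D X\<^sub>D (u \<oplus>\<^bsub>Hom D X\<^sub>D X\<^sub>D\<^esub> v)" for u v
    by (rule local_End[OF assms(4) O(1) indF noT that])
  have P: "is_P L (tau_perp K L U\<^sub>\<Lambda>) M\<^sub>\<Lambda>" using bong by (simp add: bongartz_completion_def)
  \<comment> \<open>F of \<open>X\<^sub>D\<close> is a retract of \<open>M\<^sub>\<Lambda>\<close>,
    which is the sum of all indecomposable Ext-projectives of the torsion class.\<close>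
  have sa: "arr ?C (i \<cdot>\<^bsub>?C\<^esub> a) (F X\<^sub>D) M\<^sub>\<Lambda>" "arr ?C (a' \<cdot>\<^bsub>?C\<^esub> p) M\<^sub>\<Lambda> (F X\<^sub>D)"
    using F.C'.arr_cmp[OF a(1) sL(1)] F.C'.arr_cmp[OF sL(2) a(2)] .
  have rs: "(a' \<cdot>\<^bsub>?C\<^esub> p) ((i \<cdot>\<^bsub>?C\<^esub> a) x) = x" if "x \<in> carrier (F X\<^sub>D)" for x
    using fun_cong[OF sL(5), of "a x"] a(3)[OF that] a.f_closed[OF that] by (simp add: id_map_def)
  obtain XL \<eta> \<eta>' where XL: "arr ?C \<eta> (F X\<^sub>D) XL" "arr ?C \<eta>' XL (F X\<^sub>D)"
      "\<And>x. x \<in> carrier (F X\<^sub>D) \<Longrightarrow> \<eta>' (\<eta> x) = x" "\<And>x. x \<in> carrier XL \<Longrightarrow> \<eta> (\<eta>' x) = x"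
      "\<And>N. N \<in> tau_perp K L U\<^sub>\<Lambda> \<Longrightarrow> Ext1_vanishes L XL N"
    by (rule ext_projective_summand[OF O(1) nz loc P sa rs]) (assumption+, rule that)
  \<comment> \<open>Rigidity is given for \<open>M\<^sub>D\<close>; padding with the projection to
    \<open>U\<^sub>D\<close> and the shifted inclusion of \<open>U\<^sub>D\<close> transfers it to
    the summand.\<close>
  have rigid: "v \<cdot>\<^bsub>D\<^esub> u = \<zero>\<^bsub>Hom D U\<^sub>D (Sh D U\<^sub>D)\<^esub>"
    if V: "V \<in> add_closure D T" and u: "arr D u U\<^sub>D (Sh D V)" and v: "arr D v (Sh D V) (Sh D U\<^sub>D)"
    for V u v
  proof -
    have up: "arr D (u \<cdot>\<^bsub>D\<^esub> pU) M\<^sub>D (Sh D V)" using arr_cmp[OF sD(4) u] .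
    have iv: "arr D (ShM D iU \<cdot>\<^bsub>D\<^esub> v) (Sh D V) (Sh D M\<^sub>D)" using arr_cmp[OF v Sh_arr[OF sD(3)]] .
    have "(ShM D iU \<cdot>\<^bsub>D\<^esub> v) \<cdot>\<^bsub>D\<^esub> (u \<cdot>\<^bsub>D\<^esub> pU) \<in> factor_ideal D (Sh D T) M\<^sub>D (Sh D M\<^sub>D)"
      unfolding factor_ideal_def using shift.F_add_closure[OF V] arrD(3)[OF up] arrD(3)[OF iv] by blast
    then have z: "(ShM D iU \<cdot>\<^bsub>D\<^esub> v) \<cdot>\<^bsub>D\<^esub> (u \<cdot>\<^bsub>D\<^esub> pU) = \<zero>\<^bsub>Hom D M\<^sub>D (Sh D M\<^sub>D)\<^esub>"
      using assms(18) by (simp add: rel_cluster_tilting_def rel_rigid_def)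
    have 1: "ShM D pU \<cdot>\<^bsub>D\<^esub> (ShM D iU \<cdot>\<^bsub>D\<^esub> v) = v"
      using assoc[OF v Sh_arr[OF sD(3)] Sh_arr[OF sD(4)]] Sh_cmp[OF sD(3,4)] sD(6) Sh_idn[OF O(2)] idl[OF v]
      by simp
    have 2: "(u \<cdot>\<^bsub>D\<^esub> pU) \<cdot>\<^bsub>D\<^esub> iU = u" using assoc[OF sD(3,4) u] sD(6) idr[OF u] by simp
    have "v \<cdot>\<^bsub>D\<^esub> u = (ShM D pU \<cdot>\<^bsub>D\<^esub> (ShM D iU \<cdot>\<^bsub>D\<^esub> v)) \<cdot>\<^bsub>D\<^esub> ((u \<cdot>\<^bsub>D\<^esub> pU) \<cdot>\<^bsub>D\<^esub> iU)" using 1 2 by simp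
    also have "\<dots> = ShM D pU \<cdot>\<^bsub>D\<^esub> (((ShM D iU \<cdot>\<^bsub>D\<^esub> v) \<cdot>\<^bsub>D\<^esub> (u \<cdot>\<^bsub>D\<^esub> pU)) \<cdot>\<^bsub>D\<^esub> iU)"
      by (rule assoc4[OF sD(3) up iv Sh_arr[OF sD(4)]])
    also have "\<dots> = \<zero>\<^bsub>Hom D U\<^sub>D (Sh D U\<^sub>D)\<^esub>"
      unfolding z using cmp_zerol[OF sD(3) Sh_obj[OF O(3)]] cmp_zeror[OF Sh_arr[OF sD(4)] O(2)] by simp
    finally show ?thesis .
  qed
  interpret XX: abelian_group "Hom D X\<^sub>D X\<^sub>D" using hom_ab[OF O(1,1)] .
  have loc': "\<exists>\<tau>. arr D \<tau> X\<^sub>D X\<^sub>D \<and> \<sigma> \<cdot>\<^bsub>D\<^esub> \<tau> = Idn D X\<^sub>D"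
    if \<sigma>: "arr D \<sigma> X\<^sub>D X\<^sub>D" "ghost (Idn D X\<^sub>D \<ominus>\<^bsub>Hom D X\<^sub>D X\<^sub>D\<^esub> \<sigma>) X\<^sub>D X\<^sub>D" for \<sigma>
  proof -
    have "\<sigma> \<oplus>\<^bsub>Hom D X\<^sub>D X\<^sub>D\<^esub> (Idn D X\<^sub>D \<ominus>\<^bsub>Hom D X\<^sub>D X\<^sub>D\<^esub> \<sigma>) = Idn D X\<^sub>D"
      using XX.add_minus_cancel[OF arrD(3)[OF \<sigma>(1)] arrD(3)[OF arr_idn[OF O(1)]]]
      by (simp add: a_minus_def)
    then have "iso_arrow D X\<^sub>D X\<^sub>D (\<sigma> \<oplus>\<^bsub>Hom D X\<^sub>D X\<^sub>D\<^esub> (Idn D X\<^sub>D \<ominus>\<^bsub>Hom D X\<^sub>D X\<^sub>D\<^esub> \<sigma>))"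
      using iso_arrowI[OF arr_idn[OF O(1)] arr_idn[OF O(1)]] idl[OF arr_idn[OF O(1)]] by simp
    then have "iso_arrow D X\<^sub>D X\<^sub>D \<sigma>"
      using loc[OF \<sigma>(1) arr_minus[OF arr_idn[OF O(1)] \<sigma>(1)]] ghost_not_iso[OF O(1) nz \<sigma>(2)] by blast
    then show ?thesis by (rule iso_arrowD[OF _ O(1,1)]) blast
  qed
  have la: "arr D g X\<^sub>D U\<^sub>2" "U\<^sub>2 \<in> add_closure D U\<^sub>D"
    "\<And>V t. \<lbrakk>V \<in> add_closure D U\<^sub>D; arr D t X\<^sub>D V\<rbrakk> \<Longrightarrow> \<exists>s. arr D s U\<^sub>2 V \<and> s \<cdot>\<^bsub>D\<^esub> g = t"
    "\<And>\<phi>. \<lbrakk>arr D \<phi> U\<^sub>2 U\<^sub>2; \<phi> \<cdot>\<^bsub>D\<^esub> g = g\<rbrakk> \<Longrightarrow> iso_arrow D U\<^sub>2 U\<^sub>2 \<phi>"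
  proof -
    show "arr D g X\<^sub>D U\<^sub>2" by (rule ta(1))
    show "U\<^sub>2 \<in> add_closure D U\<^sub>D" using assms(23) by (simp add: minimal_left_approx_def left_approx_def)
    show "\<exists>s. arr D s U\<^sub>2 V \<and> s \<cdot>\<^bsub>D\<^esub> g = t" if Vt: "V \<in> add_closure D U\<^sub>D" "arr D t X\<^sub>D V" for V t
    proof -
      obtain s where "s \<in> carrier (Hom D U\<^sub>2 V)" "t = s \<cdot>\<^bsub>D\<^esub> g"
        using assms(23) Vt(1) arrD(3)[OF Vt(2)] unfolding minimal_left_approx_def left_approx_def
        by blast
      then show ?thesis using O(4) arrD(2)[OF Vt(2)] by (auto simp: arr_def)
    qed
    show "iso_arrow D U\<^sub>2 U\<^sub>2 \<phi>" if "arr D \<phi> U\<^sub>2 U\<^sub>2" "\<phi> \<cdot>\<^bsub>D\<^esub> g = g" for \<phi>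
      using assms(23) that(2) arrD(3)[OF that(1)] by (simp add: minimal_left_approx_def)
  qed
  \<comment> \<open>The morphism to T[1] passes through an object of add U, and there
    \<open>g\<close> is a left approximation.\<close>
  have facT: "\<exists>s. arr D s U\<^sub>2 (Sh D T) \<and> s \<cdot>\<^bsub>D\<^esub> g = w" if w: "arr D w X\<^sub>D (Sh D T)" for w
  proof -
    obtain S v w' where S: "S \<in> add_closure D U\<^sub>D" "arr D w' X\<^sub>D S" "arr D v S (Sh D T)" "v \<cdot>\<^bsub>D\<^esub> w' = w"
      by (rule bongartz_factor[OF O(1,2) \<theta> XL rigid loc' w]) blast+
    obtain s where s: "arr D s U\<^sub>2 S" "s \<cdot>\<^bsub>D\<^esub> g = w'" using la(3)[OF S(1,2)] by blast
    have "(v \<cdot>\<^bsub>D\<^esub> s) \<cdot>\<^bsub>D\<^esub> g = w" using assoc[OF la(1) s(1) S(3)] s S by simp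
    then show ?thesis using arr_cmp[OF s(1) S(3)] by blast
  qed
  have fac: "\<exists>s. arr D s U\<^sub>2 (Sh D V) \<and> s \<cdot>\<^bsub>D\<^esub> g = w"
    if "V \<in> add_closure D T" "arr D w X\<^sub>D (Sh D V)" for V w
    using approx_lift[OF shift.F_add_closure[OF that(1)] la(1) facT that(2)] by blast
  obtain S Sm where serre: "serre_functor K D S Sm" using assms(6) by blast
  have re: "right_exact L (F X\<^sub>D) (F U\<^sub>2) (F Y\<^sub>D) (Fm X\<^sub>D U\<^sub>2 g) (Fm U\<^sub>2 Y\<^sub>D f)"
    by (rule triangle_right_exact[OF tri connecting_map_ghost[OF tri serre fac]])
  have mla: "U'\<^sub>\<Lambda> \<in> add_closure ?C U\<^sub>\<Lambda>" "g\<^sub>\<Lambda> \<in> lin_maps L X\<^sub>\<Lambda> U'\<^sub>\<Lambda>"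
    "\<forall>V \<in> add_closure ?C U\<^sub>\<Lambda>. \<forall>t \<in> carrier (Hom ?C X\<^sub>\<Lambda> V). \<exists>s \<in> carrier (Hom ?C U'\<^sub>\<Lambda> V). t = s \<cdot>\<^bsub>?C\<^esub> g\<^sub>\<Lambda>"
    "\<forall>\<phi> \<in> carrier (Hom ?C U'\<^sub>\<Lambda> U'\<^sub>\<Lambda>). \<phi> \<cdot>\<^bsub>?C\<^esub> g\<^sub>\<Lambda> = g\<^sub>\<Lambda> \<longrightarrow> iso_arrow ?C U'\<^sub>\<Lambda> U'\<^sub>\<Lambda> \<phi>"
    using min\<Lambda> unfolding minimal_left_approx_def left_approx_def by (auto simp del: A.mod_cat_simps(2))
  have OU: "U'\<^sub>\<Lambda> \<in> Obj ?C" by (rule F.C'.add_closure_coords[OF mla(1)])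
  have gL: "arr ?C g\<^sub>\<Lambda> X\<^sub>\<Lambda> U'\<^sub>\<Lambda>" using mla(2) OL(1) OU by (simp add: A.arr_mod)
  \<comment> \<open>\<open>summand\<close> asks for a complement, so a module belongs to its own
    additive closure by way of a zero module; F of a zero object is one.\<close>
  obtain N where N: "zero_object D N" using ex_zero_object by blast
  have NO: "N \<in> Obj D" using N by (simp add: zero_object_def)
  have "zero_object ?C (F N)"
    using N F.F_idn[OF NO] F.F_zero[OF NO NO] F_obj[OF NO] unfolding zero_object_def by simp
  then have UU: "U\<^sub>\<Lambda> \<in> add_closure ?C U\<^sub>\<Lambda>" by (rule F.C'.add_closure_refl[OF OL(2)])
  have UUD: "U\<^sub>D \<in> add_closure D U\<^sub>D" by (rule add_closure_refl[OF O(2) N])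
  have Fg: "arr ?C (Fm X\<^sub>D U\<^sub>2 g) (F X\<^sub>D) (F U\<^sub>2)" using F.F_arr[OF la(1)] .
  \<comment> \<open>F g inherits the approximation property from \<open>g\<close> because F is
    full.\<close>
  have lift1: "\<exists>s. arr ?C s (F U\<^sub>2) U\<^sub>\<Lambda> \<and> s \<cdot>\<^bsub>?C\<^esub> Fm X\<^sub>D U\<^sub>2 g = t" if t: "arr ?C t (F X\<^sub>D) U\<^sub>\<Lambda>" for t
  proof -
    have "\<theta>' \<cdot>\<^bsub>?C\<^esub> t \<in> lin_maps L (F X\<^sub>D) (F U\<^sub>D)" using F.C'.arr_cmp[OF t \<theta>(2)] unfolding A.arr_mod
      by blast
    then obtain x where x: "arr D x X\<^sub>D U\<^sub>D" "Fm X\<^sub>D U\<^sub>D x = \<theta>' \<cdot>\<^bsub>?C\<^esub> t" using F_full[OF O(1,2)] by blast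
    obtain y where y: "arr D y U\<^sub>2 U\<^sub>D" "y \<cdot>\<^bsub>D\<^esub> g = x" using la(3)[OF UUD x(1)] by blast
    have Fy: "arr ?C (Fm U\<^sub>2 U\<^sub>D y) (F U\<^sub>2) (F U\<^sub>D)" using F.F_arr[OF y(1)] .
    have "(\<theta> \<cdot>\<^bsub>?C\<^esub> Fm U\<^sub>2 U\<^sub>D y) \<cdot>\<^bsub>?C\<^esub> Fm X\<^sub>D U\<^sub>2 g = \<theta> \<cdot>\<^bsub>?C\<^esub> (\<theta>' \<cdot>\<^bsub>?C\<^esub> t)"
      using F.C'.assoc[OF Fg Fy \<theta>(1)] F.F_cmp[OF la(1) y(1)] y(2) x(2) by simp
    also have "\<dots> = t" using F.C'.assoc[OF t \<theta>(2,1)] tt(2) F.C'.idl[OF t] by simp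
    finally show ?thesis using F.C'.arr_cmp[OF Fy \<theta>(1)] by blast
  qed
  \<comment> \<open>Both F g and \<open>g\<^sub>\<Lambda>\<close> are left approximations of the
    same module up to \<open>a\<close>, so each factors through the other, by \<open>b\<close> and
    \<open>b'\<close>.\<close>
  obtain b where b: "arr ?C b (F U\<^sub>2) U'\<^sub>\<Lambda>" "b \<cdot>\<^bsub>?C\<^esub> Fm X\<^sub>D U\<^sub>2 g = g\<^sub>\<Lambda> \<cdot>\<^bsub>?C\<^esub> a"
    by (rule F.C'.approx_lift[OF mla(1) Fg lift1 F.C'.arr_cmp[OF a(1) gL]]) (assumption, rule that)
  have lift2: "\<exists>s. arr ?C s U'\<^sub>\<Lambda> (F U\<^sub>D) \<and> s \<cdot>\<^bsub>?C\<^esub> g\<^sub>\<Lambda> = t" if t: "arr ?C t X\<^sub>\<Lambda> (F U\<^sub>D)" for t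
  proof -
    have \<theta>t: "arr ?C (\<theta> \<cdot>\<^bsub>?C\<^esub> t) X\<^sub>\<Lambda> U\<^sub>\<Lambda>" using F.C'.arr_cmp[OF t \<theta>(1)] .
    obtain s where s: "s \<in> carrier (Hom ?C U'\<^sub>\<Lambda> U\<^sub>\<Lambda>)" "\<theta> \<cdot>\<^bsub>?C\<^esub> t = s \<cdot>\<^bsub>?C\<^esub> g\<^sub>\<Lambda>"
      using mla(3) UU arrD(3)[OF \<theta>t] by blast
    have sa: "arr ?C s U'\<^sub>\<Lambda> U\<^sub>\<Lambda>" using s(1) OU OL(2) by (simp add: arr_def)
    have "(\<theta>' \<cdot>\<^bsub>?C\<^esub> s) \<cdot>\<^bsub>?C\<^esub> g\<^sub>\<Lambda> = \<theta>' \<cdot>\<^bsub>?C\<^esub> (\<theta> \<cdot>\<^bsub>?C\<^esub> t)"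
      unfolding s(2) by (rule F.C'.assoc[OF gL sa \<theta>(2), symmetric])
    also have "\<dots> = t" using F.C'.assoc[OF t \<theta>(1,2)] tt(1) F.C'.idl[OF t] by simp
    finally show ?thesis using F.C'.arr_cmp[OF sa \<theta>(2)] by blast
  qed
  obtain b' where b': "arr ?C b' U'\<^sub>\<Lambda> (F U\<^sub>2)" "b' \<cdot>\<^bsub>?C\<^esub> g\<^sub>\<Lambda> = Fm X\<^sub>D U\<^sub>2 g \<cdot>\<^bsub>?C\<^esub> a'"
    by (rule F.C'.approx_lift[OF F.F_add_closure[OF la(2)] gL lift2 F.C'.arr_cmp[OF a(2) Fg]]) (assumption, rule that)
  have bb: "(b' \<cdot>\<^bsub>?C\<^esub> b) \<circ> Fm X\<^sub>D U\<^sub>2 g = Fm X\<^sub>D U\<^sub>2 g"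
  proof -
    have "(b' \<cdot>\<^bsub>?C\<^esub> b) \<circ> Fm X\<^sub>D U\<^sub>2 g = (b' \<cdot>\<^bsub>?C\<^esub> g\<^sub>\<Lambda>) \<cdot>\<^bsub>?C\<^esub> a" using b(2)
      by (simp add: o_assoc[symmetric])
    also have "\<dots> = Fm X\<^sub>D U\<^sub>2 g \<cdot>\<^bsub>?C\<^esub> (a' \<cdot>\<^bsub>?C\<^esub> a)" unfolding b'(2) by (simp add: o_assoc)
    also have "\<dots> = Fm X\<^sub>D U\<^sub>2 g" unfolding aa(1) by (rule F.C'.idr[OF Fg])
    finally show ?thesis .
  qed
  have bb': "(b \<cdot>\<^bsub>?C\<^esub> b') \<cdot>\<^bsub>?C\<^esub> g\<^sub>\<Lambda> = g\<^sub>\<Lambda>"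
  proof -
    have "(b \<cdot>\<^bsub>?C\<^esub> b') \<cdot>\<^bsub>?C\<^esub> g\<^sub>\<Lambda> = (b \<cdot>\<^bsub>?C\<^esub> Fm X\<^sub>D U\<^sub>2 g) \<cdot>\<^bsub>?C\<^esub> a'" using b'(2)
      by (simp add: o_assoc[symmetric])
    also have "\<dots> = g\<^sub>\<Lambda> \<cdot>\<^bsub>?C\<^esub> (a \<cdot>\<^bsub>?C\<^esub> a')" unfolding b(2) by (simp add: o_assoc)
    also have "\<dots> = g\<^sub>\<Lambda>" unfolding aa(2) by (rule F.C'.idr[OF gL])
    finally show ?thesis .
  qed
  \<comment> \<open>The two composites of \<open>b\<close> and \<open>b'\<close> fix F g and
    \<open>g\<^sub>\<Lambda>\<close>, so minimality on each side makes them invertible.\<close>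
  have i1: "iso_arrow ?C (F U\<^sub>2) (F U\<^sub>2) (b' \<cdot>\<^bsub>?C\<^esub> b)"
    by (rule F_left_minimal[OF la(1) la(4) fac F.C'.arr_cmp[OF b(1) b'(1)] bb])
  have i2: "iso_arrow ?C U'\<^sub>\<Lambda> U'\<^sub>\<Lambda> (b \<cdot>\<^bsub>?C\<^esub> b')"
    using mla(4) arrD(3)[OF F.C'.arr_cmp[OF b'(1) b(1)]] bb' by blast
  have isob: "iso_arrow ?C (F U\<^sub>2) U'\<^sub>\<Lambda> b" by (rule F.C'.iso_arrow_two_sided[OF b(1) b'(1) i1 i2])
  obtain d where d: "arr ?C d U'\<^sub>\<Lambda> (F U\<^sub>2)" "\<And>x. x \<in> carrier (F U\<^sub>2) \<Longrightarrow> d (b x) = x" "\<And>x. x \<in> carrier U'\<^sub>\<Lambda> \<Longrightarrow> b (d x) = x"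
    by (rule A.mod_iso_arrowE[OF isob F_obj[OF O(4)] OU]) (rule that)
  have l: "left_module L (F U\<^sub>2)" "left_module L (F Y\<^sub>D)" "left_module L U'\<^sub>\<Lambda>" "left_module L Y\<^sub>\<Lambda>"
    using F_left_module O(4,5) OU YO A.mod_obj by blast+
  have bl: "b \<in> lin_maps L (F U\<^sub>2) U'\<^sub>\<Lambda>" "d \<in> lin_maps L U'\<^sub>\<Lambda> (F U\<^sub>2)" using b(1) d(1)
    by (simp_all add: A.arr_mod)
  have bg: "b (Fm X\<^sub>D U\<^sub>2 g x) = g\<^sub>\<Lambda> (a x)" for x using fun_cong[OF b(2), of x] by simp
  obtain c where c: "c \<in> lin_maps L (F Y\<^sub>D) Y\<^sub>\<Lambda>" "c \<circ> Fm U\<^sub>2 Y\<^sub>D f = f\<^sub>\<Lambda> \<circ> b"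
    by (rule A.cokernel_map[OF l re re\<Lambda> bl(1)]) (use bg a.f_closed in \<open>auto intro: that\<close>)
  have dg: "d (g\<^sub>\<Lambda> x) \<in> Fm X\<^sub>D U\<^sub>2 g ` carrier (F X\<^sub>D)" if x: "x \<in> carrier X\<^sub>\<Lambda>" for x
  proof -
    have ax: "a' x \<in> carrier (F X\<^sub>D)" using a'.f_closed[OF x] .
    have "d (g\<^sub>\<Lambda> x) = Fm X\<^sub>D U\<^sub>2 g (a' x)"
      using bg[of "a' x"] a(4)[OF x] d(2)[OF lin_mapsD(1)[OF Fm_lin[OF la(1)] ax]] by simp
    then show ?thesis using ax by blast
  qed
  obtain c' where c': "c' \<in> lin_maps L Y\<^sub>\<Lambda> (F Y\<^sub>D)" "c' \<circ> f\<^sub>\<Lambda> = Fm U\<^sub>2 Y\<^sub>D f \<circ> d"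
    by (rule A.cokernel_map[OF l(3,4,1,2) re\<Lambda> re bl(2) dg]) (assumption, rule that)
  have im: "Fm U\<^sub>2 Y\<^sub>D f ` carrier (F U\<^sub>2) = carrier (F Y\<^sub>D)" "f\<^sub>\<Lambda> ` carrier U'\<^sub>\<Lambda> = carrier Y\<^sub>\<Lambda>"
    using re re\<Lambda> unfolding right_exact_def by blast+
  \<comment> \<open>\<open>c\<close> and \<open>c'\<close> are induced on cokernels by inverse maps;
    they are compared on images of the two surjections.\<close>
  have isoc: "iso_arrow ?C (F Y\<^sub>D) Y\<^sub>\<Lambda> c"
  proof (rule A.mod_iso_arrowI)
    show "arr ?C c (F Y\<^sub>D) Y\<^sub>\<Lambda>" "arr ?C c' Y\<^sub>\<Lambda> (F Y\<^sub>D)" using c(1) c'(1) F_obj[OF O(5)] YO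
      by (simp_all add: A.arr_mod)
    fix y assume "y \<in> carrier (F Y\<^sub>D)"
    then obtain x where x: "x \<in> carrier (F U\<^sub>2)" "y = Fm U\<^sub>2 Y\<^sub>D f x" using im(1) by blast
    show "c' (c y) = y"
      using fun_cong[OF c(2), of x] fun_cong[OF c'(2), of "b x"] d(2)[OF x(1)] x(2) by simp
  next
    fix y assume "y \<in> carrier Y\<^sub>\<Lambda>"
    then obtain x where x: "x \<in> carrier U'\<^sub>\<Lambda>" "y = f\<^sub>\<Lambda> x" using im(2) by blast
    show "c (c' y) = y"
      using fun_cong[OF c'(2), of x] fun_cong[OF c(2), of "d x"] d(3)[OF x(1)] x(2) by simp
  qed
  show ?thesis
    unfolding \<Lambda> using re a0 isob isoc b(2) c(2) by auto
qed

end
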